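(* Let $n\ge1$, fix a compact subset $\mathcal{K}\subset\mathbb{R}_{>0}^n$, and let $\psi:[0,\infty)\to[1,\infty)$ be an increasing function such that $\sum_{k\ge 0}\psi(k)^{-(2n+2)}$ (over integers $k\ge0$) converges. Then there exists a subset $\mathcal{X}(\psi)\subset\mathbb{R}^{n\times n}_{\mathrm{sym}}$ of full Lebesgue measure such that for every $X\in\mathcal{X}(\psi)$ there is a constant $c=c(X)$ with $$|\theta_{\mathcal{B}}(M,X,\bm{x},\bm{y})|\le c\,M^{\frac n2}\,\psi(\log M)$$ for all $M\ge1$, all $\bm{b}=(b_1,\dots,b_n)\in\mathcal{K}$ and all $\bm{x},\bm{y}\in\mathbb{R}^n$, where $\mathcal{B}=(0,b_1)\times\cdots\times(0,b_n)$. The constant is independent of $M$, $\bm{b}$, $\bm{x}$, $\bm{y}$.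
   Context: $\mathbb{R}^{n\times n}_{\mathrm{sym}}$ denotes the real symmetric $n\times n$ matrices and $\mathrm{e}(z)=e^{2\pi iz}$; vectors are row vectors. For a bounded set $\mathcal{B}\subset\mathbb{R}^n$, $M>0$, $X\in\mathbb{R}^{n\times n}_{\mathrm{sym}}$ and $\bm{x},\bm{y}\in\mathbb{R}^n$, $$\theta_{\mathcal{B}}(M,X,\bm{x},\bm{y})=\sum_{\bm{m}\in\mathbb{Z}^n\cap(M\mathcal{B}-\bm{x})}\mathrm{e}\big(\tfrac12\bm{m}X{}^t\bm{m}+\bm{m}\,{}^t\bm{y}\big),$$ i.e. the sum over $\bm m\in\mathbb{Z}^n$ with $M^{-1}(\bm m+\bm x)\in\mathcal{B}$. *)

theory Defs
  imports "HOL-Analysis.Analysis"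
begin

definition e_char :: "complex \<Rightarrow> complex" where
  "e_char z = exp (2 * of_real pi * \<i> * z)"

definition integer_lattice :: "(real ^ 'n) set" where
  "integer_lattice = {m. \<forall>i. m $ i \<in> \<int>}"

text \<open>Only meaningful for bounded \<open>B\<close>: the index set is then finite, whereas a sum over an
  infinite set is \<open>0\<close> by convention.\<close>

definition theta_sum ::
  "(real ^ 'n) set \<Rightarrow> real \<Rightarrow> real ^ 'n ^ 'n \<Rightarrow> real ^ 'n \<Rightarrow> real ^ 'n \<Rightarrow> complex" where
  "theta_sum B M X x y =
     (\<Sum>m \<in> integer_lattice \<inter> (\<lambda>v. M *\<^sub>R v - x) ` B.
        e_char (of_real (1/2 * ((m v* X) \<bullet> m) + m \<bullet> y)))"

definition sym_matrices :: "(real ^ 'n ^ 'n) set" where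
  "sym_matrices = {X. transpose X = X}"

text \<open>Lebesgue measure on the space of symmetric matrices, of dimension \<open>n (n + 1) / 2\<close>, is
  the product measure in the independent entries. These are indexed by the unordered pairs
  \<open>{i, j}\<close> (singletons for the diagonal), so that no order on the index type is needed.\<close>

definition sym_index :: "'n set set" where
  "sym_index = {{i, j} | i j. True}"

definition sym_of_entries :: "('n set \<Rightarrow> real) \<Rightarrow> real ^ 'n ^ 'n" where
  "sym_of_entries f = (\<chi> i j. f {i, j})"

definition lborel_sym :: "(real ^ 'n ^ 'n) measure" where
  "lborel_sym = distr (Pi\<^sub>M sym_index (\<lambda>_. lborel)) (restrict_space borel sym_matrices) sym_of_entries"

definition lebesgue_sym :: "(real ^ 'n ^ 'n) measure" where
  "lebesgue_sym = completion lborel_sym"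

text \<open>As \<open>distr\<close> is only meaningful along measurable maps, measurability is checked here.\<close>

lemma sym_of_entries_measurable:
  "(sym_of_entries :: ('n::finite set \<Rightarrow> real) \<Rightarrow> _)
     \<in> measurable (Pi\<^sub>M sym_index (\<lambda>_. lborel)) (restrict_space borel sym_matrices)"
proof (rule measurable_restrict_space2)
  show "sym_of_entries \<in> space (Pi\<^sub>M sym_index (\<lambda>_. lborel)) \<rightarrow> (sym_matrices :: (real ^ 'n ^ 'n) set)"
    by (auto simp: sym_of_entries_def sym_matrices_def transpose_def insert_commute vec_eq_iff)
  have entry: "(\<lambda>f. f {i, j}) \<in> borel_measurable (Pi\<^sub>M sym_index (\<lambda>_. lborel :: real measure))"
    for i j :: 'n
  proof -
    have "{i, j} \<in> sym_index" by (auto simp: sym_index_def)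
    from measurable_component_singleton[OF this, of "\<lambda>_. lborel :: real measure"]
    show ?thesis by simp
  qed
  show "(sym_of_entries :: ('n set \<Rightarrow> real) \<Rightarrow> _) \<in> borel_measurable (Pi\<^sub>M sym_index (\<lambda>_. lborel))"
  proof (subst borel_measurable_euclidean_space, intro ballI)
    fix b :: "real ^ 'n ^ 'n" assume "b \<in> Basis"
    then obtain i j where "b = axis i (axis j 1)"
      by (auto simp: Basis_vec_def)
    then have "(\<lambda>f. sym_of_entries f \<bullet> b) = (\<lambda>f. f {i, j})"
      by (simp add: sym_of_entries_def inner_axis)
    then show "(\<lambda>f. sym_of_entries f \<bullet> b) \<in> borel_measurable (Pi\<^sub>M sym_index (\<lambda>_. lborel))"
      using entry by simp
  qed
qed

lemma sym_of_entries_bij: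
  "bij_betw sym_of_entries (space (Pi\<^sub>M sym_index (\<lambda>_. lborel)))
     (sym_matrices :: (real ^ 'n::finite ^ 'n) set)"
proof -
  have *: "X $ i $ j = X $ j $ i" if "X \<in> sym_matrices" for X :: "real ^ 'n ^ 'n" and i j
    using that by (auto simp: sym_matrices_def transpose_def vec_eq_iff)
  have "inj_on sym_of_entries (space (Pi\<^sub>M (sym_index :: 'n set set) (\<lambda>_. lborel :: real measure)))"
  proof (rule inj_onI)
    fix f g :: "'n set \<Rightarrow> real"
    assume f: "f \<in> space (Pi\<^sub>M sym_index (\<lambda>_. lborel))" and g: "g \<in> space (Pi\<^sub>M sym_index (\<lambda>_. lborel))"
      and eq: "sym_of_entries f = sym_of_entries g"
    have "f s = g s" if "s \<in> sym_index" for s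
      using that eq by (auto simp: sym_index_def sym_of_entries_def vec_eq_iff)
    then show "f = g"
      using f g by (auto simp: space_PiM intro: PiE_ext)
  qed
  moreover have "X \<in> sym_of_entries ` space (Pi\<^sub>M (sym_index :: 'n set set) (\<lambda>_. lborel :: real measure))"
    if X: "X \<in> sym_matrices" for X :: "real ^ 'n ^ 'n"
  proof -
    define f where
      "f = restrict (\<lambda>s. THE t. \<exists>i j. s = {i, j} \<and> t = X $ i $ j) sym_index"
    have "f {i, j} = X $ i $ j" for i j
    proof -
      have "(THE t. \<exists>k l. {i, j} = {k, l} \<and> t = X $ k $ l) = X $ i $ j"
        by (rule the_equality) (use *[OF X] in \<open>auto simp: doubleton_eq_iff\<close>)
      then show ?thesis
        by (auto simp: f_def sym_index_def)
    qed
    then have "X = sym_of_entries f"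
      by (simp add: sym_of_entries_def vec_eq_iff)
    moreover have "f \<in> space (Pi\<^sub>M sym_index (\<lambda>_. lborel))"
      by (simp add: space_PiM f_def)
    ultimately show ?thesis by blast
  qed
  ultimately show ?thesis
    using measurable_space[OF sym_of_entries_measurable]
    by (fastforce simp: bij_betw_def space_restrict_space)
qed

lemma space_lebesgue_sym [simp]: "space lebesgue_sym = sym_matrices"
  by (simp add: lebesgue_sym_def lborel_sym_def space_restrict_space)

text \<open>A subset of the symmetric matrices has full measure if its complement there is a null set.\<close>

definition full_measure_sym :: "(real ^ 'n ^ 'n) set \<Rightarrow> bool" where
  "full_measure_sym S \<longleftrightarrow> S \<subseteq> sym_matrices \<and> sym_matrices - S \<in> null_sets lebesgue_sym"

end

theory Submission
  imports Defs
begin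

text \<open>
  Split the box into dyadic boxes with smooth weights. Weyl differencing bounds the sum over a box with
  sides \<open>M\<^sub>i = 2 ^ a\<^sub>i\<close> by the square root of \<open>\<Prod>i. M\<^sub>i\<close> times the number of lattice points \<open>(h, k)\<close> with
  \<open>h\<^sub>i\<close> of size \<open>M\<^sub>i\<close> and \<open>(h X + k)\<^sub>i\<close> of size \<open>1 / M\<^sub>i\<close>. By reduction theory, \<open>N\<close> such points force a Lagrangian
  sublattice of covolume \<open>O(1 / N)\<close> in the symplectic lattice attached to \<open>X\<close> and \<open>M\<close>. If the sides are
  comparable, the expected number of Lagrangian sublattices of covolume at most \<open>x\<close> is \<open>O(x ^ (n + 1))\<close>, by
  induction on the coordinates; this is the source of the exponent \<open>2 n + 2\<close>. If the sides are not
  comparable, the first moment of the lattice point count already suffices, since the trivial bound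
  gains a power of \<open>2 ^ t\<close>. The Borel--Cantelli lemma over dyadic scales finishes the proof.
\<close>

section \<open>Averages over the unit cube\<close>

text \<open>The theta sum exceeds M^(n/2) \<psi> only if a lattice point count exceeds \<psi>^2, so
  a tail x^-(n + 1) at x = \<psi>^2 is exactly what the hypothesis on \<psi> can absorb; a first
  moment would only give 1 / x. The obstacle is the number of dyadic boxes, about t^n at scale 2^t,
  which must not cost a logarithm. A box with sides 2^(a i) carries the factor Q = q^(sum of t - a
  i) with q^4 = 1/2. Its trivial gain is Q^2, and the threshold for its count is raised to (\<psi> /
  Q)^2: the gain that is left, Q, makes the bounds summable over the boxes, and the raised threshold
  makes the probabilities summable. Uniformity in x and y is automatic: after differencing, y sits
  in a factor of modulus 1, and x only moves the weights, whose bounds are translation invariant. No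
  equidistribution theorem on a space of symplectic lattices enters. Integral shifts of X permute
  the lattice data, so all means are taken over a unit cube, one row of X at a time.\<close>

lemma nn_integral_translate:
  fixes g :: "'a::euclidean_space \<Rightarrow> ennreal"
  assumes [measurable]: "g \<in> borel_measurable borel"
  shows "(\<integral>\<^sup>+y. g (y + c) \<partial>lborel) = (\<integral>\<^sup>+y. g y \<partial>lborel)"
proof -
  have "(\<integral>\<^sup>+y. g y \<partial>lborel) = (\<integral>\<^sup>+y. g y \<partial>distr lborel borel ((+) c))"
    by (simp add: lborel_distr_plus)
  also have "\<dots> = (\<integral>\<^sup>+y. g (c + y) \<partial>lborel)"
    by (subst nn_integral_distr) auto
  finally show ?thesis by (simp add: add.commute)
qed

lemma nn_integral_count_indicator_unique:
  assumes "\<exists>!k. k \<in> A \<and> P k"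
  shows "(\<integral>\<^sup>+k. indicator {k. P k} k \<partial>count_space A) = (1::ennreal)"
proof -
  obtain k0 where k0: "k0 \<in> A" "P k0" and u: "\<And>k. k \<in> A \<Longrightarrow> P k \<Longrightarrow> k = k0"
    using assms by blast
  have "(\<integral>\<^sup>+k. indicator {k. P k} k \<partial>count_space A) = (\<integral>\<^sup>+k. indicator {k0} k \<partial>count_space A)"
  proof (rule nn_integral_cong)
    fix k assume "k \<in> space (count_space A)"
    then have "P k \<longleftrightarrow> k = k0" using k0(2) u[of k] by (metis space_count_space)
    then show "indicator {k. P k} k = (indicator {k0} k :: ennreal)" by (simp add: indicator_def)
  qed
  also have "\<dots> = emeasure (count_space A) {k0}" using k0 by simp
  also have "\<dots> = 1" using k0 by simp
  finally show ?thesis .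
qed

lemma borel_measurable_count_sum [measurable (raw)]:
  fixes f :: "'i \<Rightarrow> 'a \<Rightarrow> ennreal"
  assumes "countable I" "\<And>i. i \<in> I \<Longrightarrow> f i \<in> borel_measurable M"
  shows "(\<lambda>x. \<integral>\<^sup>+i. f i x \<partial>count_space I) \<in> borel_measurable M"
proof (cases "finite I")
  case True
  then show ?thesis using assms by (simp add: nn_integral_count_space_finite)
next
  case False
  have "(\<lambda>x. \<integral>\<^sup>+i. f i x \<partial>count_space I) = (\<lambda>x. \<Sum>k. f (from_nat_into I k) x)"
  proof
    fix x
    have "(\<integral>\<^sup>+i. f i x \<partial>count_space I) = (\<integral>\<^sup>+k. f (from_nat_into I k) x \<partial>count_space UNIV)"
      using bij_betw_from_nat_into[OF assms(1) False] by (rule nn_integral_bij_count_space[symmetric])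
    then show "(\<integral>\<^sup>+i. f i x \<partial>count_space I) = (\<Sum>k. f (from_nat_into I k) x)"
      by (simp add: nn_integral_count_space_nat)
  qed
  moreover have "from_nat_into I k \<in> I" for k
    using False by (metis finite.emptyI from_nat_into)
  ultimately show ?thesis using assms(2) by (auto intro!: borel_measurable_suminf_order)
qed

text \<open>The translates of \<open>Q\<close> by \<open>Z\<close> tile the space, so every y lies
  in exactly one of them; Tonelli moves the sum inside.\<close>

lemma nn_integral_unfold:
  fixes Q Z :: "'a::euclidean_space set"
  assumes Z: "countable Z" and Q [measurable]: "Q \<in> sets borel"
    and tile: "\<And>y. \<exists>!\<alpha>. \<alpha> \<in> Z \<and> y - \<alpha> \<in> Q"
    and g [measurable]: "g \<in> borel_measurable borel"
  shows "(\<integral>\<^sup>+\<alpha>. \<integral>\<^sup>+y. indicator Q y * g (y + \<alpha>) \<partial>lborel \<partial>count_space Z) = (\<integral>\<^sup>+y. g y \<partial>lborel)"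
proof -
  have "(\<integral>\<^sup>+y. indicator Q y * g (y + \<alpha>) \<partial>lborel) = (\<integral>\<^sup>+y. indicator Q (y - \<alpha>) * g y \<partial>lborel)" for \<alpha>
    using nn_integral_translate[of "\<lambda>y. indicator Q (y - \<alpha>) * g y" \<alpha>] by simp
  then have "(\<integral>\<^sup>+\<alpha>. \<integral>\<^sup>+y. indicator Q y * g (y + \<alpha>) \<partial>lborel \<partial>count_space Z)
      = (\<integral>\<^sup>+\<alpha>. \<integral>\<^sup>+y. indicator Q (y - \<alpha>) * g y \<partial>lborel \<partial>count_space Z)" by simp
  also have "\<dots> = (\<integral>\<^sup>+y. \<integral>\<^sup>+\<alpha>. indicator Q (y - \<alpha>) * g y \<partial>count_space Z \<partial>lborel)"
    by (rule nn_integral_count_space_nn_integral[symmetric, OF Z]) simp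
  also have "\<dots> = (\<integral>\<^sup>+y. g y \<partial>lborel)"
  proof (rule nn_integral_cong)
    fix y
    have "(\<integral>\<^sup>+\<alpha>. indicator Q (y - \<alpha>) * g y \<partial>count_space Z)
        = (\<integral>\<^sup>+\<alpha>. indicator Q (y - \<alpha>) \<partial>count_space Z) * g y"
      by (rule nn_integral_multc) simp
    also have "(\<integral>\<^sup>+\<alpha>. indicator Q (y - \<alpha>) \<partial>count_space Z)
        = (\<integral>\<^sup>+\<alpha>. indicator {\<alpha>. y - \<alpha> \<in> Q} \<alpha> \<partial>count_space Z)"
      by (rule nn_integral_cong) (simp add: indicator_def)
    also have "\<dots> = 1" by (rule nn_integral_count_indicator_unique[OF tile])
    finally show "(\<integral>\<^sup>+\<alpha>. indicator Q (y - \<alpha>) * g y \<partial>count_space Z) = g y" by simp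
  qed
  finally show ?thesis .
qed

text \<open>A cube tiles only a slab under the multiples of a single vector; \<open>S\<close> is
  that slab in the application, stable under real multiples of \<open>u\<close>. Both
  \<open>Q\<close> and its shift are fundamental domains of \<open>S\<close> modulo
  \<open>u\<close>, and a periodic function has the same integral over each.\<close>

lemma nn_integral_periodic_shift:
  fixes Q S :: "'a::euclidean_space set" and u :: 'a
  assumes Q [measurable]: "Q \<in> sets borel"
    and tile: "\<And>y. y \<in> S \<Longrightarrow> \<exists>!k::int. y - of_int k *\<^sub>R u \<in> Q"
    and QS: "Q \<subseteq> S" and S: "\<And>y c. y \<in> S \<Longrightarrow> y + c *\<^sub>R u \<in> S"
    and f [measurable]: "f \<in> borel_measurable borel" and per: "\<And>y. f (y + u) = f y"
  shows "(\<integral>\<^sup>+y. indicator Q y * f (y + c *\<^sub>R u) \<partial>lborel) = (\<integral>\<^sup>+y. indicator Q y * f y \<partial>lborel)"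
proof -
  have pern: "f (y + real n *\<^sub>R u) = f y" for y n
  proof (induction n)
    case (Suc n)
    have "f (y + real (Suc n) *\<^sub>R u) = f ((y + real n *\<^sub>R u) + u)" by (simp add: algebra_simps)
    then show ?case using per Suc by simp
  qed simp
  have perz: "f (y + of_int k *\<^sub>R u) = f y" for y k
  proof (cases "k \<ge> 0")
    case True
    then show ?thesis using pern[of y "nat k"] by simp
  next
    case False
    then show ?thesis using pern[of "y + of_int k *\<^sub>R u" "nat (-k)"] by (simp add: algebra_simps)
  qed
  have one: "(\<integral>\<^sup>+k. indicator Q (y - of_int k *\<^sub>R u) \<partial>count_space (UNIV::int set)) = (1::ennreal)" if "y \<in> S" for y
  proof -
    have "(\<integral>\<^sup>+k. indicator Q (y - of_int k *\<^sub>R u) \<partial>count_space (UNIV::int set))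
        = (\<integral>\<^sup>+k. indicator {k. y - of_int k *\<^sub>R u \<in> Q} k \<partial>count_space (UNIV::int set))"
      by (rule nn_integral_cong) (simp add: indicator_def)
    also have "\<dots> = (1::ennreal)" by (rule nn_integral_count_indicator_unique) (use tile[OF that] in simp)
    finally show ?thesis .
  qed
  have "(\<integral>\<^sup>+y. indicator Q y * f (y + c *\<^sub>R u) \<partial>lborel) = (\<integral>\<^sup>+y. indicator Q (y - c *\<^sub>R u) * f y \<partial>lborel)"
    using nn_integral_translate[of "\<lambda>y. indicator Q (y - c *\<^sub>R u) * f y" "c *\<^sub>R u"] by simp
  \<comment> \<open>The inserted sum over k equals 1 and cuts the shifted domain into pieces; each
    piece is then moved back by a multiple of \<open>u\<close>, which \<open>f\<close> does not
    see.\<close>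
  also have "\<dots> = (\<integral>\<^sup>+y. \<integral>\<^sup>+k. indicator Q (y - c *\<^sub>R u) * f y * indicator Q (y - of_int k *\<^sub>R u) \<partial>count_space (UNIV::int set) \<partial>lborel)"
  proof (rule nn_integral_cong)
    fix y
    show "indicator Q (y - c *\<^sub>R u) * f y =
      (\<integral>\<^sup>+k. indicator Q (y - c *\<^sub>R u) * f y * indicator Q (y - of_int k *\<^sub>R u) \<partial>count_space (UNIV::int set))"
    proof (cases "y - c *\<^sub>R u \<in> Q")
      case True
      then have "(y - c *\<^sub>R u) + c *\<^sub>R u \<in> S" using QS S by blast
      then have "y \<in> S" by simp
      then show ?thesis by (simp add: nn_integral_cmult one)
    qed simp
  qed
  also have "\<dots> = (\<integral>\<^sup>+k. \<integral>\<^sup>+y. indicator Q (y - c *\<^sub>R u) * f y * indicator Q (y - of_int k *\<^sub>R u) \<partial>lborel \<partial>count_space (UNIV::int set))"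
    by (rule nn_integral_count_space_nn_integral) auto
  also have "\<dots> = (\<integral>\<^sup>+k. \<integral>\<^sup>+y. indicator Q y * f y * indicator Q ((y - c *\<^sub>R u) - of_int (-k) *\<^sub>R u) \<partial>lborel \<partial>count_space (UNIV::int set))"
  proof (rule nn_integral_cong)
    fix k :: int
    have "(\<integral>\<^sup>+y. indicator Q (y - c *\<^sub>R u) * f y * indicator Q (y - of_int k *\<^sub>R u) \<partial>lborel)
      = (\<integral>\<^sup>+y. indicator Q (y + of_int k *\<^sub>R u - c *\<^sub>R u) * f (y + of_int k *\<^sub>R u) * indicator Q y \<partial>lborel)"
      using nn_integral_translate[of "\<lambda>y. indicator Q (y - c *\<^sub>R u) * f y * indicator Q (y - of_int k *\<^sub>R u)" "of_int k *\<^sub>R u"]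
      by simp
    then show "(\<integral>\<^sup>+y. indicator Q (y - c *\<^sub>R u) * f y * indicator Q (y - of_int k *\<^sub>R u) \<partial>lborel)
      = (\<integral>\<^sup>+y. indicator Q y * f y * indicator Q ((y - c *\<^sub>R u) - of_int (-k) *\<^sub>R u) \<partial>lborel)"
      by (simp add: perz mult.assoc mult.commute mult.left_commute add_diff_eq diff_add_eq)
  qed
  also have "\<dots> = (\<integral>\<^sup>+y. \<integral>\<^sup>+k. indicator Q y * f y * indicator Q ((y - c *\<^sub>R u) - of_int (-k) *\<^sub>R u) \<partial>count_space (UNIV::int set) \<partial>lborel)"
    by (rule nn_integral_count_space_nn_integral[symmetric]) auto
  also have "\<dots> = (\<integral>\<^sup>+y. indicator Q y * f y \<partial>lborel)"
  proof (rule nn_integral_cong)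
    fix y
    have bij: "bij_betw uminus (UNIV::int set) UNIV"
      by (rule bij_betwI[of _ _ _ uminus]) auto
    have "(\<integral>\<^sup>+k. indicator Q ((y - c *\<^sub>R u) - of_int (-k) *\<^sub>R u) \<partial>count_space (UNIV::int set)) = (1::ennreal)"
      if "y \<in> Q"
    proof -
      have "y + (- c) *\<^sub>R u \<in> S" using QS S that by blast
      then have "y - c *\<^sub>R u \<in> S" by simp
      from one[OF this] show ?thesis
        using nn_integral_bij_count_space[OF bij, of "\<lambda>k. indicator Q ((y - c *\<^sub>R u) - of_int k *\<^sub>R u)"] by simp
    qed
    then show "(\<integral>\<^sup>+k. indicator Q y * f y * indicator Q ((y - c *\<^sub>R u) - of_int (-k) *\<^sub>R u) \<partial>count_space (UNIV::int set)) = indicator Q y * f y"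
      by (cases "y \<in> Q") (simp_all add: nn_integral_cmult)
  qed
  finally show ?thesis .
qed

text \<open>Half open, so that the integral translates are disjoint and cover everything.\<close>

definition unit_cube :: "(real ^ 'n) set" where
  "unit_cube = {y. \<forall>i. 0 \<le> y $ i \<and> y $ i < 1}"

lemma unit_cube_borel [measurable]: "unit_cube \<in> sets borel"
  unfolding unit_cube_def by measurable

lemma countable_integer_lattice: "countable (integer_lattice :: (real ^ 'n) set)"
proof -
  have "countable {v :: real ^ 'n. \<forall>i. v $ i \<in> \<int>}"
    by (rule countable_vector) (simp add: Ints_def)
  then show ?thesis by (simp add: integer_lattice_def)
qed

lemma floor_unique_Ints: "\<exists>!a. a \<in> \<int> \<and> 0 \<le> y - a \<and> y - a < (1::real)"
proof (rule ex1I[of _ "of_int \<lfloor>y\<rfloor>"])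
  show "of_int \<lfloor>y\<rfloor> \<in> \<int> \<and> 0 \<le> y - of_int \<lfloor>y\<rfloor> \<and> y - of_int \<lfloor>y\<rfloor> < 1"
    by (simp add: floor_correct) linarith
  fix a assume a: "a \<in> \<int> \<and> 0 \<le> y - a \<and> y - a < 1"
  then obtain k where "a = of_int k" by (auto elim: Ints_cases)
  with a show "a = of_int \<lfloor>y\<rfloor>" by simp linarith
qed

lemma tile_unit_cube: "\<exists>!\<alpha>. \<alpha> \<in> integer_lattice \<and> (y :: real ^ 'n) - \<alpha> \<in> unit_cube"
proof (rule ex1I[of _ "\<chi> i. of_int \<lfloor>y $ i\<rfloor>"])
  show "(\<chi> i. of_int \<lfloor>y $ i\<rfloor>) \<in> integer_lattice \<and> y - (\<chi> i. of_int \<lfloor>y $ i\<rfloor>) \<in> unit_cube"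
    by (auto simp: integer_lattice_def unit_cube_def) linarith
  fix \<alpha> assume a: "\<alpha> \<in> integer_lattice \<and> y - \<alpha> \<in> unit_cube"
  have "\<alpha> $ i = of_int \<lfloor>y $ i\<rfloor>" for i
  proof -
    have "\<alpha> $ i \<in> \<int>" "0 \<le> y $ i - \<alpha> $ i" "y $ i - \<alpha> $ i < 1" using a by (auto simp: integer_lattice_def unit_cube_def)
    then show ?thesis by (auto elim!: Ints_cases simp: floor_unique)
  qed
  then show "\<alpha> = (\<chi> i. of_int \<lfloor>y $ i\<rfloor>)" by (simp add: vec_eq_iff)
qed

lemma nn_integral_unfold_cube:
  fixes g :: "real ^ 'n \<Rightarrow> ennreal"
  assumes "g \<in> borel_measurable borel"
  shows "(\<integral>\<^sup>+\<alpha>. \<integral>\<^sup>+y. indicator unit_cube y * g (y + \<alpha>) \<partial>lborel \<partial>count_space integer_lattice) = (\<integral>\<^sup>+y. g y \<partial>lborel)"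
  by (rule nn_integral_unfold[OF countable_integer_lattice unit_cube_borel tile_unit_cube assms])

lemma nn_integral_cube_shift_axis:
  fixes f :: "real ^ 'n \<Rightarrow> ennreal"
  assumes f: "f \<in> borel_measurable borel" and per: "\<And>y. f (y + axis a 1) = f y"
  shows "(\<integral>\<^sup>+y. indicator unit_cube y * f (y + c *\<^sub>R axis a 1) \<partial>lborel) = (\<integral>\<^sup>+y. indicator unit_cube y * f y \<partial>lborel)"
proof (rule nn_integral_periodic_shift[where S = "{y. \<forall>i. i \<noteq> a \<longrightarrow> 0 \<le> y $ i \<and> y $ i < 1}"])
  fix y :: "real ^ 'n" assume y: "y \<in> {y. \<forall>i. i \<noteq> a \<longrightarrow> 0 \<le> y $ i \<and> y $ i < 1}"
  have *: "y - of_int k *\<^sub>R axis a 1 \<in> unit_cube \<longleftrightarrow> 0 \<le> y $ a - of_int k \<and> y $ a - of_int k < 1" for k :: int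
    using y by (auto simp: unit_cube_def axis_def)
  have **: "0 \<le> y $ a - of_int k \<and> y $ a - of_int k < 1 \<longleftrightarrow> k = \<lfloor>y $ a\<rfloor>" for k :: int
    by linarith
  show "\<exists>!k::int. y - of_int k *\<^sub>R axis a 1 \<in> unit_cube"
    unfolding * ** by blast
next
  show "unit_cube \<subseteq> {y::real^'n. \<forall>i. i \<noteq> a \<longrightarrow> 0 \<le> y $ i \<and> y $ i < 1}" by (auto simp: unit_cube_def)
qed (use f per in \<open>auto simp: axis_def\<close>)

lemma nn_integral_cube_shift:
  fixes f :: "real ^ 'n \<Rightarrow> ennreal"
  assumes f [measurable]: "f \<in> borel_measurable borel" and per: "\<And>y a. f (y + axis a 1) = f y"
  shows "(\<integral>\<^sup>+y. indicator unit_cube y * f (y + v) \<partial>lborel) = (\<integral>\<^sup>+y. indicator unit_cube y * f y \<partial>lborel)"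
proof -
  have *: "(\<integral>\<^sup>+y. indicator unit_cube y * f (y + (\<Sum>a\<in>A. v $ a *\<^sub>R axis a 1)) \<partial>lborel) = (\<integral>\<^sup>+y. indicator unit_cube y * f y \<partial>lborel)"
    if "finite A" for A
    using that
  proof induction
    case (insert b A)
    have "(\<integral>\<^sup>+y. indicator unit_cube y * f (y + (\<Sum>a\<in>insert b A. v $ a *\<^sub>R axis a 1)) \<partial>lborel)
       = (\<integral>\<^sup>+y. indicator unit_cube y * f ((y + v $ b *\<^sub>R axis b 1) + (\<Sum>a\<in>A. v $ a *\<^sub>R axis a 1)) \<partial>lborel)"
      using insert by (simp add: add.assoc)
    also have "\<dots> = (\<integral>\<^sup>+y. indicator unit_cube y * f (y + (\<Sum>a\<in>A. v $ a *\<^sub>R axis a 1)) \<partial>lborel)"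
    proof (rule nn_integral_cube_shift_axis[where f = "\<lambda>y. f (y + (\<Sum>a\<in>A. v $ a *\<^sub>R axis a 1))"])
      show "f (y + axis b 1 + (\<Sum>a\<in>A. v $ a *\<^sub>R axis a 1)) = f (y + (\<Sum>a\<in>A. v $ a *\<^sub>R axis a 1))" for y
        using per[of "y + (\<Sum>a\<in>A. v $ a *\<^sub>R axis a 1)" b] by (simp add: add_ac)
    qed simp
    finally show ?case using insert by simp
  qed simp
  have "(\<Sum>a\<in>UNIV. v $ a *\<^sub>R axis a 1) = v"
    by (simp add: vec_eq_iff axis_def if_distrib cong: if_cong)
  then show ?thesis using *[of UNIV] by simp
qed

lemma nn_integral_unfold_interval:
  fixes g :: "real \<Rightarrow> ennreal"
  assumes [measurable]: "g \<in> borel_measurable borel"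
  shows "(\<integral>\<^sup>+k. \<integral>\<^sup>+v. indicator {0..<1} v * g (v + of_int k) \<partial>lborel \<partial>count_space (UNIV::int set)) = (\<integral>\<^sup>+v. g v \<partial>lborel)"
proof -
  have "(\<integral>\<^sup>+\<alpha>. \<integral>\<^sup>+v. indicator {0..<1} v * g (v + \<alpha>) \<partial>lborel \<partial>count_space \<int>) = (\<integral>\<^sup>+v. g v \<partial>lborel)"
  proof (rule nn_integral_unfold)
    show "\<exists>!\<alpha>. \<alpha> \<in> \<int> \<and> y - \<alpha> \<in> {0..<1}" for y :: real
      using floor_unique_Ints[of y] by simp
  qed (auto simp: Ints_def)
  moreover have "bij_betw of_int (UNIV::int set) (\<int>::real set)"
    by (auto simp: bij_betw_def inj_on_def Ints_def)
  ultimately show ?thesis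
    by (simp add: nn_integral_bij_count_space[symmetric])
qed

lemma emeasure_unit_cube: "emeasure lborel (unit_cube :: (real^'n) set) = 1"
proof -
  have [simp]: "(One :: real ^ 'n) $ i = 1" for i
    using inner_sum_left_Basis[of "axis i (1::real)" "\<lambda>_. 1"] by (simp add: cart_eq_inner_axis)
  have "emeasure lborel (box 0 (One :: real ^ 'n)) \<le> emeasure lborel (unit_cube :: (real^'n) set)"
    by (rule emeasure_mono) (auto simp: unit_cube_def mem_box_cart less_imp_le simp del: sum_component)
  moreover have "emeasure lborel (unit_cube :: (real^'n) set) \<le> emeasure lborel (cbox 0 (One :: real ^ 'n))"
    by (rule emeasure_mono) (auto simp: unit_cube_def mem_box_cart less_imp_le simp del: sum_component)
  moreover have "emeasure lborel (box 0 (One :: real ^ 'n)) = 1" "emeasure lborel (cbox 0 (One :: real ^ 'n)) = 1"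
    by (simp_all add: emeasure_lborel_box_eq emeasure_lborel_cbox_eq)
  ultimately show ?thesis by simp
qed

section \<open>The symplectic form and Lagrangian sublattices of the Gaussian integers\<close>

definition om :: "complex ^ 'n \<Rightarrow> complex ^ 'n \<Rightarrow> real" where
  "om p q = (\<Sum>i\<in>UNIV. Im (cnj (p $ i) * q $ i))"

lemma om_add_left: "om (p + q) r = om p r + om q r"
  and om_add_right: "om r (p + q) = om r p + om r q"
  and om_diff_left: "om (p - q) r = om p r - om q r"
  and om_diff_right: "om r (p - q) = om r p - om r q"
  and om_minus_left: "om (- p) r = - om p r"
  and om_minus_right: "om r (- p) = - om r p"
  and om_scaleR_left: "om (c *\<^sub>R p) r = c * om p r"
  and om_scaleR_right: "om r (c *\<^sub>R p) = c * om r p"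
  and om_zero_left: "om 0 r = 0" and om_zero_right: "om r 0 = 0"
  by (auto simp: om_def algebra_simps sum.distrib sum_subtractf sum_negf sum_distrib_left)

lemma om_self: "om p p = 0"
  by (simp add: om_def)

lemma om_commute: "om p q = - om q p"
  by (simp add: om_def sum_negf[symmetric] algebra_simps)

lemma om_sum_left: "om (\<Sum>a\<in>A. f a) r = (\<Sum>a\<in>A. om (f a) r)"
  by (induction A rule: infinite_finite_induct) (auto simp: om_add_left om_zero_left)

lemma om_sum_right: "om r (\<Sum>a\<in>A. f a) = (\<Sum>a\<in>A. om r (f a))"
  by (induction A rule: infinite_finite_induct) (auto simp: om_add_right om_zero_right)

lemmas om_simps = om_add_left om_add_right om_diff_left om_diff_right om_minus_left om_minus_right
  om_scaleR_left om_scaleR_right om_zero_left om_zero_right om_sum_left om_sum_right om_self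

lemma om_inner: "om p q = (\<i> *s p) \<bullet> q"
  by (simp add: om_def inner_vec_def inner_complex_def algebra_simps)

lemma norm_i_scale: "norm (\<i> *s (p :: complex ^ 'n)) = norm p"
  by (simp add: norm_vec_def norm_mult)

lemma abs_om_le: "\<bar>om p q\<bar> \<le> norm p * norm q"
  unfolding om_inner using Cauchy_Schwarz_ineq2[of "\<i> *s p" q] by (simp add: norm_i_scale)

definition cvec :: "real ^ 'n \<Rightarrow> complex ^ 'n" where
  "cvec v = (\<chi> i. of_real (v $ i))"

definition comb :: "complex ^ 'n ^ 'n \<Rightarrow> real ^ 'n \<Rightarrow> complex ^ 'n" where
  "comb W t = (\<Sum>i\<in>UNIV. t $ i *\<^sub>R W $ i)"

text \<open>Bilinear, without conjugation: the pairing of a row with a column that occurs in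
  \<open>W *v x\<close>.\<close>

definition bdot :: "complex ^ 'n \<Rightarrow> complex ^ 'n \<Rightarrow> complex" where
  "bdot r x = (\<Sum>j\<in>UNIV. r $ j * x $ j)"

definition isotr :: "complex ^ 'n ^ 'n \<Rightarrow> bool" where
  "isotr W \<longleftrightarrow> (\<forall>i j. om (W $ i) (W $ j) = 0)"

lemma comb_nth: "comb W t $ j = (\<Sum>i\<in>UNIV. of_real (t $ i) * W $ i $ j)"
  unfolding comb_def by (simp add: scaleR_conv_of_real[where 'a=complex])

lemma comb_eq: "comb W t = cvec t v* W"
  by (simp add: vec_eq_iff comb_nth vector_matrix_mult_def cvec_def mult.commute)

lemma comb_add: "comb W (s + t) = comb W s + comb W t"
  and comb_diff: "comb W (s - t) = comb W s - comb W t"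
  and comb_scaleR: "comb W (c *\<^sub>R t) = c *\<^sub>R comb W t"
  and comb_0: "comb W 0 = 0"
  by (auto simp: comb_def algebra_simps sum.distrib sum_subtractf scaleR_sum_right)

lemma om_comb_right: "om p (comb W t) = (\<Sum>i\<in>UNIV. t $ i * om p (W $ i))"
  by (simp add: comb_def om_simps)

lemma om_comb_left: "om (comb W t) p = (\<Sum>i\<in>UNIV. t $ i * om (W $ i) p)"
  by (simp add: comb_def om_simps)

lemma isotr_comb: "isotr W \<Longrightarrow> om (comb W s) (comb W t) = 0"
  by (simp add: om_comb_right om_comb_left isotr_def)

section \<open>Isotropic frames and complex linear algebra\<close>

lemma det_zero_left_ker:
  fixes A :: "'a::field ^ 'n ^ 'n"
  assumes "det A = 0" shows "\<exists>c. c \<noteq> 0 \<and> c v* A = 0"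
proof -
  have "det (transpose A) = 0" using assms by simp
  then have "\<not> invertible (transpose A)" using invertible_det_nz by blast
  then show ?thesis
    using matrix_left_invertible_ker[of "transpose A"] invertible_left_inverse[of "transpose A"] by auto
qed

lemma det_nz_left_ker:
  fixes A :: "'a::field ^ 'n ^ 'n"
  assumes "det A \<noteq> 0" "c v* A = 0" shows "c = 0"
proof -
  have "invertible (transpose A)" using assms(1) by (simp add: invertible_det_nz)
  then show ?thesis
    using matrix_left_invertible_ker[of "transpose A"] invertible_left_inverse[of "transpose A"] assms(2) by auto
qed

lemma det_nz_ker:
  fixes A :: "'a::field ^ 'n ^ 'n"
  assumes "det A \<noteq> 0" "A *v c = 0" shows "c = 0"
  using det_nz_left_ker[of "transpose A" c] assms by simp

lemma det_nz_solve:
  fixes A :: "'a::field ^ 'n ^ 'n"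
  assumes "det A \<noteq> 0" obtains x where "A *v x = b"
proof -
  obtain B where "A ** B = mat 1"
    using assms invertible_det_nz[of A] unfolding invertible_def by blast
  then have "A *v (B *v b) = b" by (simp add: matrix_vector_mul_assoc)
  then show thesis using that by blast
qed

lemma det_nz_solve_left:
  fixes A :: "'a::field ^ 'n ^ 'n"
  assumes "det A \<noteq> 0" obtains x where "x v* A = b"
  using det_nz_solve[of "transpose A" b] assms by (metis det_transpose transpose_matrix_vector)

text \<open>Multiplication by \<i> is a complex structure compatible with \<open>om\<close>. If a +
  \<i> b = 0 for real combinations a, b of the rows, isotropy makes \<open>om\<close> of b and \<i>
  b vanish, and that value is |b|^2. So real independence of an isotropic family is already complex
  independence, and a complex determinant detects it.\<close>

lemma isotr_indep_det_nz:
  assumes W: "isotr W" and ind: "\<And>t. comb W t = 0 \<Longrightarrow> t = 0"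
  shows "det W \<noteq> 0"
proof
  assume "det W = 0"
  then obtain c where c: "c \<noteq> 0" "c v* W = 0" using det_zero_left_ker by blast
  define a where "a = (\<chi> i. Re (c $ i))"
  define b where "b = (\<chi> i. Im (c $ i))"
  have "comb W a + \<i> *s comb W b = c v* W"
    by (simp add: vec_eq_iff comb_nth vector_matrix_mult_def a_def b_def sum_distrib_left sum.distrib[symmetric])
       (intro allI sum.cong refl, metis (no_types, lifting) complex_eq distrib_left mult.assoc mult.commute)
  then have eq: "comb W a = - (\<i> *s comb W b)" using c(2) by (simp add: eq_neg_iff_add_eq_0)
  have "om (comb W b) (comb W a) = 0" by (rule isotr_comb[OF W])
  then have "om (comb W b) (\<i> *s comb W b) = 0" unfolding eq by (simp add: om_simps)
  then have "(\<i> *s comb W b) \<bullet> (\<i> *s comb W b) = 0" by (simp add: om_inner)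
  then have "norm (comb W b) = 0" by (metis inner_eq_zero_iff norm_i_scale norm_zero)
  then have 1: "comb W b = 0" by simp
  then have 2: "comb W a = 0" unfolding eq by simp
  have "a = 0" "b = 0" using ind 1 2 by blast+
  then have "c = 0" by (simp add: vec_eq_iff a_def b_def complex_eq_iff)
  then show False using c by simp
qed

lemma comb_inj:
  assumes "det W \<noteq> 0" "comb W s = comb W t" shows "s = t"
proof -
  have "comb W (s - t) = 0" using assms by (simp add: comb_diff)
  then have "cvec (s - t) = 0" using det_nz_left_ker[OF assms(1)] by (simp add: comb_eq)
  then show ?thesis by (simp add: vec_eq_iff cvec_def)
qed

definition herm :: "complex ^ 'n ^ 'n \<Rightarrow> complex ^ 'n ^ 'n" where
  "herm W = (\<chi> i j. cnj (W $ j $ i))"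

lemma det_herm: "det (herm W) = cnj (det W)"
proof -
  have "herm W = (\<chi> i j. cnj (transpose W $ i $ j))" by (simp add: herm_def transpose_def)
  also have "det \<dots> = cnj (det (transpose W))"
    by (simp add: det_def cnj_sum cnj_prod)
  finally show ?thesis by simp
qed

text \<open>The imaginary parts of the Hermitian Gram matrix are the values of \<open>om\<close>.
  Because this matrix is real, linear systems for the frame with real data have solutions with real
  coefficients.\<close>

lemma isotr_gram_real:
  assumes "isotr W" shows "Im ((W ** herm W) $ i $ k) = 0"
proof -
  have "(W ** herm W) $ i $ k = (\<Sum>j\<in>UNIV. W $ i $ j * cnj (W $ k $ j))"
    by (simp add: matrix_matrix_mult_def herm_def)
  moreover have "Im \<dots> = om (W $ k) (W $ i)" by (simp add: om_def algebra_simps)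
  ultimately show ?thesis using assms by (simp add: isotr_def)
qed

lemma real_matrix_im:
  fixes H :: "complex ^ 'n ^ 'n"
  assumes "\<And>i k. Im (H $ i $ k) = 0" "det H \<noteq> 0" "\<And>i. Im ((H *v g) $ i) = 0"
  shows "\<exists>r. g = cvec r"
proof -
  define h where "h = cvec (\<chi> i. Im (g $ i))"
  have "(H *v h) $ i = 0" for i
  proof -
    have "Im ((H *v g) $ i) = (\<Sum>j\<in>UNIV. Re (H $ i $ j) * Im (g $ j))"
      by (simp add: matrix_vector_mult_def assms(1))
    moreover have "(H *v h) $ i = of_real (\<Sum>j\<in>UNIV. Re (H $ i $ j) * Im (g $ j))"
      by (simp add: matrix_vector_mult_def h_def cvec_def complex_eq_iff assms(1))
    ultimately show ?thesis using assms(3)[of i] by simp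
  qed
  then have "H *v h = 0" by (simp add: vec_eq_iff)
  then have "h = 0" using det_nz_ker[OF assms(2)] by blast
  then have "Im (g $ i) = 0" for i by (simp add: h_def cvec_def vec_eq_iff)
  then have "g = cvec (\<chi> i. Re (g $ i))" by (simp add: cvec_def vec_eq_iff complex_eq_iff)
  then show ?thesis by blast
qed

lemma isotr_solution:
  assumes W: "isotr W" "det W \<noteq> 0" and x: "W *v x = cvec \<alpha>"
  obtains g where "x = herm W *v cvec g"
proof -
  have d: "det (herm W) \<noteq> 0" using W by (simp add: det_herm)
  obtain g where g: "herm W *v g = x" using det_nz_solve[OF d] by blast
  have "(W ** herm W) *v g = cvec \<alpha>" using g x by (simp flip: matrix_vector_mul_assoc)
  then have "Im (((W ** herm W) *v g) $ i) = 0" for i by (simp add: cvec_def)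
  moreover have "det (W ** herm W) \<noteq> 0" using d W by (simp add: det_mul)
  ultimately obtain r where "g = cvec r"
    using real_matrix_im[of "W ** herm W" g] isotr_gram_real[OF W(1)] by blast
  then show thesis using that g by blast
qed

lemma herm_mult_nth: "(herm W *v cvec g) $ j = (\<Sum>i\<in>UNIV. of_real (g $ i) * cnj (W $ i $ j))"
  by (simp add: matrix_vector_mult_def herm_def cvec_def mult.commute)

lemma norm_sq_solution:
  assumes x: "W *v x = cvec \<alpha>" and g: "x = herm W *v cvec g"
  shows "(norm x)\<^sup>2 = g \<bullet> \<alpha>"
proof -
  have "complex_of_real ((norm x)\<^sup>2) = (\<Sum>j\<in>UNIV. cnj (x $ j) * x $ j)"
    by (simp add: norm_vec_def L2_set_def sum_nonneg complex_norm_square mult.commute del: of_real_power)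
  also have "\<dots> = (\<Sum>j\<in>UNIV. \<Sum>i\<in>UNIV. of_real (g $ i) * W $ i $ j * x $ j)"
    unfolding g[THEN arg_cong[where f="\<lambda>v. cnj (v $ _)"]]
    by (simp add: herm_mult_nth cnj_sum sum_distrib_right)
  also have "\<dots> = (\<Sum>i\<in>UNIV. of_real (g $ i) * (\<Sum>j\<in>UNIV. W $ i $ j * x $ j))"
    by (subst sum.swap) (simp add: sum_distrib_left mult.assoc)
  also have "\<dots> = (\<Sum>i\<in>UNIV. of_real (g $ i) * cvec \<alpha> $ i)"
    by (simp add: x[symmetric] matrix_vector_mult_def)
  also have "\<dots> = of_real (g \<bullet> \<alpha>)" by (simp add: cvec_def inner_vec_def)
  finally show ?thesis using of_real_eq_iff by blast
qed

lemma Im_bdot_solution: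
  assumes g: "x = herm W *v cvec g"
  shows "Im (bdot r x) = (\<Sum>i\<in>UNIV. g $ i * om (W $ i) r)"
proof -
  have "bdot r x = (\<Sum>j\<in>UNIV. \<Sum>i\<in>UNIV. of_real (g $ i) * (cnj (W $ i $ j) * r $ j))"
    by (simp add: g bdot_def herm_mult_nth sum_distrib_left mult_ac)
  also have "\<dots> = (\<Sum>i\<in>UNIV. of_real (g $ i) * (\<Sum>j\<in>UNIV. cnj (W $ i $ j) * r $ j))"
    by (subst sum.swap) (simp add: sum_distrib_left)
  finally show ?thesis by (simp add: om_def sum_distrib_left)
qed

text \<open>Writing x through real coefficients g turns the imaginary part of its pairing with r
  into the pairing of g with the values of \<open>om\<close>, and |x|^2 into the pairing of g with
  \<alpha>. Applied to the extra generator of a child, it makes the imaginary part of the relative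
  covolume factor a multiple of |x|^2.\<close>

lemma Im_bdot_proportional:
  assumes "isotr W" "det W \<noteq> 0" "W *v x = cvec \<alpha>" "\<And>i. om (W $ i) r = \<gamma> * \<alpha> $ i"
  shows "Im (bdot r x) = \<gamma> * (norm x)\<^sup>2"
proof -
  obtain g where g: "x = herm W *v cvec g" using isotr_solution[OF assms(1-3)] by blast
  show ?thesis
    unfolding Im_bdot_solution[OF g] norm_sq_solution[OF assms(3) g] assms(4)
    by (simp add: inner_vec_def sum_distrib_left mult_ac)
qed

text \<open>With real coefficients for x, the quantity |x|^2 is minus the inner product of t with Im
  x, so Cauchy-Schwarz bounds |x| by |t|, whatever the frame.\<close>

lemma norm_solution_Im_le:
  assumes "isotr W" "det W \<noteq> 0" and x: "W *v x = cvec (\<chi> i. \<Sum>j\<in>UNIV. Im (W $ i $ j) * t $ j)"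
  shows "norm x \<le> norm t"
proof -
  obtain g where g: "x = herm W *v cvec g" using isotr_solution[OF assms] by blast
  have imx: "Im (x $ j) = - (\<Sum>i\<in>UNIV. g $ i * Im (W $ i $ j))" for j
    by (simp add: g herm_mult_nth sum_negf)
  have "(norm x)\<^sup>2 = (\<Sum>i\<in>UNIV. \<Sum>j\<in>UNIV. g $ i * Im (W $ i $ j) * t $ j)"
    unfolding norm_sq_solution[OF x g] by (simp add: inner_vec_def sum_distrib_left mult_ac)
  also have "\<dots> = (\<Sum>j\<in>UNIV. t $ j * (\<Sum>i\<in>UNIV. g $ i * Im (W $ i $ j)))"
    by (subst sum.swap) (simp add: sum_distrib_left mult_ac)
  also have "\<dots> = - (t \<bullet> (\<chi> j. Im (x $ j)))" by (simp add: inner_vec_def imx sum_negf)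
  also have "\<dots> \<le> norm t * norm (\<chi> j. Im (x $ j))"
    using Cauchy_Schwarz_ineq2[of t "\<chi> j. Im (x $ j)"] by linarith
  also have "\<dots> \<le> norm t * norm x"
    by (intro mult_left_mono norm_le_componentwise_cart) (auto simp: abs_Im_le_cmod)
  finally have "norm x * norm x \<le> norm t * norm x" by (simp add: power2_eq_square)
  then show ?thesis by (cases "norm x = 0") (auto simp: mult_le_cancel_right)
qed

text \<open>An isotropic frame of full rank spans a maximal isotropic space: the complex coordinates
  of a vector orthogonal to it solve a real nonsingular system and are therefore real.\<close>

lemma isotr_perp_comb:
  assumes W: "isotr W" "det W \<noteq> 0" and p: "\<And>i. om (W $ i) p = 0"
  obtains t where "p = comb W t"
proof -
  obtain c where c: "c v* W = p" using det_nz_solve_left[OF W(2)] by blast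
  let ?H = "W ** herm W"
  have "Im ((transpose ?H *v c) $ i) = om (W $ i) p" for i
  proof -
    have "(transpose ?H *v c) $ i = (\<Sum>k\<in>UNIV. c $ k * (\<Sum>j\<in>UNIV. W $ k $ j * cnj (W $ i $ j)))"
      by (simp add: vector_matrix_mult_def matrix_matrix_mult_def herm_def mult.commute)
    also have "\<dots> = (\<Sum>j\<in>UNIV. cnj (W $ i $ j) * p $ j)"
      by (simp add: c[symmetric] vector_matrix_mult_def sum_distrib_left)
         (subst sum.swap, simp add: mult_ac)
    finally show ?thesis by (simp add: om_def)
  qed
  moreover have "det (transpose ?H) \<noteq> 0" using W by (simp add: det_mul det_herm)
  moreover have "Im (transpose ?H $ i $ k) = 0" for i k
    using isotr_gram_real[OF W(1)] by (simp add: transpose_def)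
  ultimately obtain r where "c = cvec r" using real_matrix_im[of "transpose ?H" c] p by auto
  then show thesis using that c by (auto simp: comb_eq)
qed

section \<open>Gaussian integer frames and primitive Lagrangian sublattices\<close>

definition gints :: "complex set" where "gints = {z. Re z \<in> \<int> \<and> Im z \<in> \<int>}"

definition glat :: "(complex ^ 'n) set" where "glat = {p. \<forall>i. p $ i \<in> gints}"

lemma gints_closed [intro]:
  "0 \<in> gints" "1 \<in> gints" "x \<in> gints \<Longrightarrow> y \<in> gints \<Longrightarrow> x + y \<in> gints"
  "x \<in> gints \<Longrightarrow> y \<in> gints \<Longrightarrow> x - y \<in> gints" "x \<in> gints \<Longrightarrow> - x \<in> gints"
  "x \<in> gints \<Longrightarrow> y \<in> gints \<Longrightarrow> x * y \<in> gints" "of_int k \<in> gints"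
  by (auto simp: gints_def)

lemma gints_sum [intro]: "(\<And>a. a \<in> A \<Longrightarrow> f a \<in> gints) \<Longrightarrow> sum f A \<in> gints"
  by (induction A rule: infinite_finite_induct) auto

lemma gints_prod [intro]: "(\<And>a. a \<in> A \<Longrightarrow> f a \<in> gints) \<Longrightarrow> prod f A \<in> gints"
  by (induction A rule: infinite_finite_induct) auto

lemma det_gints: "(\<And>i. W $ i \<in> glat) \<Longrightarrow> det W \<in> gints"
  unfolding det_def glat_def by (intro gints_sum gints_closed gints_prod) auto

lemma glat_closed [intro]: "0 \<in> glat" "p \<in> glat \<Longrightarrow> q \<in> glat \<Longrightarrow> p + q \<in> glat"
  "p \<in> glat \<Longrightarrow> q \<in> glat \<Longrightarrow> p - q \<in> glat" "p \<in> glat \<Longrightarrow> - p \<in> glat"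
  "p \<in> glat \<Longrightarrow> c \<in> \<int> \<Longrightarrow> c *\<^sub>R p \<in> glat"
  by (auto simp: glat_def gints_def)

lemma om_glat: "p \<in> glat \<Longrightarrow> q \<in> glat \<Longrightarrow> om p q \<in> \<int>"
  by (auto simp: om_def glat_def gints_def intro!: Ints_sum)

lemma countable_glat: "countable (glat :: (complex ^ 'n) set)"
proof -
  have "gints \<subseteq> (\<lambda>(a, b). Complex (of_int a) (of_int b)) ` UNIV"
    by (auto simp: gints_def image_iff complex_eq_iff elim!: Ints_cases)
  then have "countable gints" by (rule countable_subset) simp
  then have "countable {p :: complex ^ 'n. \<forall>i. p $ i \<in> gints}" by (intro countable_vector)
  then show ?thesis by (simp add: glat_def)
qed

definition gframe :: "complex ^ 'n ^ 'n \<Rightarrow> bool" where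
  "gframe W \<longleftrightarrow> (\<forall>i. W $ i \<in> glat) \<and> isotr W \<and> det W \<noteq> 0"

definition lagof :: "complex ^ 'n ^ 'n \<Rightarrow> (complex ^ 'n) set" where
  "lagof W = {p \<in> glat. \<forall>i. om (W $ i) p = 0}"

text \<open>A vector of \<open>glat\<close> encodes \<open>(h, k)\<close> in $\mathbb{Z}^{2n}$ as \<open>h + \<i> k\<close>. Thus \<open>lag L\<close> says that
  \<open>L\<close> is a primitive Lagrangian sublattice of the standard symplectic lattice.\<close>

definition lag :: "(complex ^ 'n) set \<Rightarrow> bool" where
  "lag L \<longleftrightarrow> (\<exists>W. gframe W \<and> L = lagof W)"

lemma lagof_comb: "gframe W \<Longrightarrow> p \<in> lagof W \<Longrightarrow> \<exists>t. p = comb W t"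
  using isotr_perp_comb[of W p] by (auto simp: gframe_def lagof_def)

lemma lag_glat: "lag L \<Longrightarrow> p \<in> L \<Longrightarrow> p \<in> glat"
  by (auto simp: lag_def lagof_def)

lemma lag_iso: "lag L \<Longrightarrow> p \<in> L \<Longrightarrow> q \<in> L \<Longrightarrow> om p q = 0"
  unfolding lag_def using lagof_comb isotr_comb gframe_def by metis

lemma lag_max: assumes "lag L" "p \<in> glat" "\<And>q. q \<in> L \<Longrightarrow> om q p = 0" shows "p \<in> L"
proof -
  obtain W where W: "gframe W" "L = lagof W" using assms(1) lag_def by blast
  then have "W $ i \<in> L" for i by (auto simp: lagof_def gframe_def isotr_def)
  then show ?thesis using assms W by (auto simp: lagof_def)
qed

lemma lag_add: "lag L \<Longrightarrow> p \<in> L \<Longrightarrow> q \<in> L \<Longrightarrow> p + q \<in> L"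
  and lag_diff: "lag L \<Longrightarrow> p \<in> L \<Longrightarrow> q \<in> L \<Longrightarrow> p - q \<in> L"
  and lag_scale: "lag L \<Longrightarrow> p \<in> L \<Longrightarrow> c \<in> \<int> \<Longrightarrow> c *\<^sub>R p \<in> L"
  and lag_zero: "lag L \<Longrightarrow> 0 \<in> L"
  by (auto simp: lag_def lagof_def om_simps)

lemma lag_sum: "lag L \<Longrightarrow> (\<And>a. a \<in> A \<Longrightarrow> f a \<in> L) \<Longrightarrow> sum f A \<in> L"
  by (induction A rule: infinite_finite_induct) (auto simp: lag_zero lag_add)

lemma lag_comb: "lag L \<Longrightarrow> (\<And>i. W $ i \<in> L) \<Longrightarrow> t \<in> integer_lattice \<Longrightarrow> comb W t \<in> L"
  unfolding comb_def by (intro lag_sum lag_scale) (auto simp: integer_lattice_def)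

lemma det_comb_row:
  fixes W :: "complex ^ 'n ^ 'n"
  shows "det (\<chi> i. if i = k then comb W t else W $ i) = of_real (t $ k) * det W"
proof -
  have "comb W t = (\<Sum>i\<in>UNIV. cvec t $ i *s row i W)"
    by (simp add: vec_eq_iff comb_nth cvec_def row_def)
  then have "(\<chi> i. if i = k then comb W t else W $ i) = (\<chi> i. if i = k then (\<Sum>i\<in>UNIV. cvec t $ i *s row i W) else row i W)"
    by (simp add: vec_eq_iff row_def)
  then show ?thesis using cramer_lemma_transpose[of k "cvec t" W] by (simp add: cvec_def)
qed

text \<open>The squared modulus of the determinant of a Gaussian integer frame is a positive
  integer, so some frame in L has the least value. If a vector of L had a non-integral k-th
  coordinate, then reducing its coordinates modulo 1 and putting it into row k would multiply the
  determinant by a factor of modulus strictly between 0 and 1.\<close>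

lemma lag_basis:
  fixes L :: "(complex ^ 'n) set"
  assumes "lag L"
  shows "\<exists>W. gframe W \<and> (\<forall>i. W $ i \<in> L) \<and> L = comb W ` integer_lattice"
proof -
  define \<mu> where "\<mu> W = nat \<lfloor>(cmod (det W))\<^sup>2\<rfloor>" for W :: "complex ^ 'n ^ 'n"
  define P where "P W \<longleftrightarrow> gframe W \<and> (\<forall>i. W $ i \<in> L)" for W
  have \<mu>: "real (\<mu> W) = (cmod (det W))\<^sup>2" if "P W" for W
  proof -
    have "det W \<in> gints" using that by (intro det_gints) (auto simp: P_def gframe_def)
    then have "(cmod (det W))\<^sup>2 \<in> \<int>" by (auto simp: gints_def cmod_power2)
    then obtain k where "(cmod (det W))\<^sup>2 = of_int k" by (auto elim: Ints_cases)
    moreover from this have "k \<ge> 0" by (metis of_int_0_le_iff zero_le_power2)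
    ultimately show ?thesis by (simp add: \<mu>_def)
  qed
  obtain W0 where "gframe W0" "L = lagof W0" using assms lag_def by blast
  then have "P W0" by (auto simp: P_def lagof_def gframe_def isotr_def)
  then obtain W where PW: "P W" and min: "\<And>V. P V \<Longrightarrow> \<mu> W \<le> \<mu> V"
    using ex_has_least_nat[of P W0 \<mu>] by blast
  have W: "gframe W" "\<And>i. W $ i \<in> L" using PW by (auto simp: P_def)
  have "p \<in> comb W ` integer_lattice" if p: "p \<in> L" for p
  proof -
    have "om (W $ i) p = 0" for i using lag_iso[OF assms] W p by blast
    then obtain t where t: "p = comb W t"
      using isotr_perp_comb W(1) unfolding gframe_def by metis
    define s :: "real ^ 'n" where "s = (\<chi> i. of_int \<lfloor>t $ i\<rfloor>)"
    have s: "s \<in> integer_lattice" by (simp add: s_def integer_lattice_def)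
    have q: "comb W (t - s) \<in> L"
      using lag_diff[OF assms p lag_comb[OF assms W(2) s]] t by (simp add: comb_diff)
    have "t $ k = s $ k" for k
    proof (rule ccontr)
      assume ne: "t $ k \<noteq> s $ k"
      define V where "V = (\<chi> i. if i = k then comb W (t - s) else W $ i)"
      have detV: "det V = of_real (t $ k - s $ k) * det W" by (simp add: V_def det_comb_row)
      have r: "\<bar>t $ k - s $ k\<bar> < 1" by (simp add: s_def) linarith
      have "\<forall>i. V $ i \<in> L" using q W by (simp add: V_def)
      moreover have "gframe V"
        using calculation lag_iso[OF assms] lag_glat[OF assms] detV ne W(1)
        by (auto simp: gframe_def isotr_def)
      ultimately have PV: "P V" by (simp add: P_def)
      have "(cmod (det V))\<^sup>2 = (t $ k - s $ k)\<^sup>2 * (cmod (det W))\<^sup>2"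
        by (simp only: detV norm_mult norm_of_real power_mult_distrib power2_abs)
      moreover have "(t $ k - s $ k)\<^sup>2 < 1" using r by (simp add: abs_square_less_1)
      moreover have "(cmod (det W))\<^sup>2 > 0" using W(1) by (simp add: gframe_def)
      ultimately have "(cmod (det V))\<^sup>2 < (cmod (det W))\<^sup>2" using mult_strict_right_mono[of "(t $ k - s $ k)\<^sup>2" 1 "(cmod (det W))\<^sup>2"] by simp
      then show False using min[OF PV] \<mu>[OF PV] \<mu>[OF PW] by linarith
    qed
    then have "t = s" by (simp add: vec_eq_iff)
    then show ?thesis using t s by blast
  qed
  then show ?thesis using W lag_comb[OF assms W(2)] by blast
qed

definition bas :: "(complex ^ 'n) set \<Rightarrow> complex ^ 'n ^ 'n" where
  "bas L = (SOME W. gframe W \<and> (\<forall>i. W $ i \<in> L) \<and> L = comb W ` integer_lattice)"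

lemma bas:
  assumes "lag L"
  shows "gframe (bas L)" "bas L $ i \<in> L" "L = comb (bas L) ` integer_lattice"
  using someI_ex[OF lag_basis[OF assms]] unfolding bas_def by blast+

lemma countable_lag: "countable {L :: (complex ^ 'n) set. lag L}"
proof -
  have "inj_on bas {L :: (complex ^ 'n) set. lag L}"
    by (rule inj_onI) (metis bas(3) mem_Collect_eq)
  moreover have "bas ` {L :: (complex ^ 'n) set. lag L} \<subseteq> {W. \<forall>i. W $ i \<in> glat}"
    using bas(1) by (auto simp: gframe_def)
  moreover have "countable {W :: complex ^ 'n ^ 'n. \<forall>i. W $ i \<in> glat}"
    by (rule countable_vector) (rule countable_glat)
  ultimately show ?thesis by (meson countable_image_inj_on countable_subset)
qed

text \<open>The action of the symplectic matrix attached to \<open>X\<close> and the diagonal matrix \<open>M\<close>: \<open>(h, k)\<close> is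
  sent to \<open>(h M\<inverse>, (h X + k) M)\<close>.\<close>

definition rho :: "('n \<Rightarrow> real) \<Rightarrow> real ^ 'n ^ 'n \<Rightarrow> complex ^ 'n \<Rightarrow> complex ^ 'n" where
  "rho M X p = (\<chi> i. Complex (Re (p $ i) / M i) (M i * ((\<Sum>j\<in>UNIV. Re (p $ j) * X $ j $ i) + Im (p $ i))))"

definition rhom :: "('n \<Rightarrow> real) \<Rightarrow> real ^ 'n ^ 'n \<Rightarrow> complex ^ 'n ^ 'n \<Rightarrow> complex ^ 'n ^ 'n" where
  "rhom M X W = (\<chi> i. rho M X (W $ i))"

lemma rho_add: "rho M X (p + q) = rho M X p + rho M X q"
  and rho_diff: "rho M X (p - q) = rho M X p - rho M X q"
  and rho_scaleR: "rho M X (c *\<^sub>R p) = c *\<^sub>R rho M X p"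
  and rho_0: "rho M X 0 = 0"
  by (auto simp: rho_def vec_eq_iff complex_eq_iff algebra_simps add_divide_distrib diff_divide_distrib
      sum.distrib sum_subtractf sum_distrib_left)

lemma rho_sum: "rho M X (sum f A) = (\<Sum>a\<in>A. rho M X (f a))"
  by (induction A rule: infinite_finite_induct) (auto simp: rho_0 rho_add)

lemma rho_comb: "rho M X (comb W t) = comb (rhom M X W) t"
  by (simp add: comb_def rho_sum rho_scaleR rhom_def)

lemma om_rho:
  assumes X: "transpose X = X" and M: "\<And>i. M i > 0"
  shows "om (rho M X p) (rho M X q) = om p q"
proof -
  have sym: "X $ i $ j = X $ j $ i" for i j using X by (metis transpose_def vec_lambda_beta)
  let ?S = "\<lambda>p i. (\<Sum>j\<in>UNIV. Re (p $ j) * X $ j $ i)"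
  have "Im (cnj (rho M X p $ i) * rho M X q $ i) = Re (p $ i) * ?S q i - Re (q $ i) * ?S p i + Im (cnj (p $ i) * q $ i)" for i
    using M[of i] by (simp add: rho_def field_simps)
  then have "om (rho M X p) (rho M X q) = (\<Sum>i\<in>UNIV. Re (p $ i) * ?S q i) - (\<Sum>i\<in>UNIV. Re (q $ i) * ?S p i) + om p q"
    by (simp add: om_def sum.distrib sum_subtractf)
  moreover have "(\<Sum>i\<in>UNIV. Re (p $ i) * ?S q i) = (\<Sum>i\<in>UNIV. Re (q $ i) * ?S p i)"
  proof -
    have "(\<Sum>i\<in>UNIV. Re (p $ i) * ?S q i) = (\<Sum>i\<in>UNIV. \<Sum>j\<in>UNIV. Re (p $ i) * (Re (q $ j) * X $ j $ i))"
      by (simp add: sum_distrib_left)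
    also have "\<dots> = (\<Sum>j\<in>UNIV. \<Sum>i\<in>UNIV. Re (q $ j) * (Re (p $ i) * X $ i $ j))"
      by (subst sum.swap, intro sum.cong refl) (metis mult.left_commute sym)
    finally show ?thesis by (simp add: sum_distrib_left)
  qed
  ultimately show ?thesis by simp
qed

lemma rho_inj: assumes M: "\<And>i. M i > (0::real)" and "rho M X p = 0" shows "p = 0"
proof -
  have re: "Re (p $ i) = 0" for i
    using assms(2) M[of i] by (auto simp: rho_def vec_eq_iff complex_eq_iff)
  moreover have "Im (p $ i) = 0" for i
    using assms(2) M re by (auto simp: rho_def vec_eq_iff complex_eq_iff) (metis less_irrefl)
  ultimately show ?thesis by (simp add: vec_eq_iff complex_eq_iff)
qed

lemma isotr_rhom: "transpose X = X \<Longrightarrow> (\<And>i. M i > 0) \<Longrightarrow> isotr W \<Longrightarrow> isotr (rhom M X W)"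
  by (simp add: isotr_def rhom_def om_rho)

lemma det_rhom_nz:
  assumes "transpose X = X" "\<And>i. M i > 0" "isotr W" "det W \<noteq> 0"
  shows "det (rhom M X W) \<noteq> 0"
proof (rule isotr_indep_det_nz)
  show "isotr (rhom M X W)" using assms isotr_rhom by blast
  fix t assume "comb (rhom M X W) t = 0"
  then have "comb W t = 0" using rho_inj[OF assms(2)] by (simp flip: rho_comb)
  then show "t = 0" using comb_inj[OF assms(4), of t 0] by (simp add: comb_0)
qed

text \<open>The Gram matrix of an isotropic frame is real and its determinant is the squared modulus
  of the complex determinant. So this is the Euclidean covolume of the image of L as a lattice of
  rank n.\<close>

definition lvol :: "('n \<Rightarrow> real) \<Rightarrow> real ^ 'n ^ 'n \<Rightarrow> (complex ^ 'n) set \<Rightarrow> real" where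
  "lvol M X L = cmod (det (rhom M X (bas L)))"

lemma lvol_pos: "transpose X = X \<Longrightarrow> (\<And>i. M i > 0) \<Longrightarrow> lag L \<Longrightarrow> lvol M X L > 0"
  using det_rhom_nz[of X M "bas L"] bas(1)[of L] by (simp add: lvol_def gframe_def)

section \<open>Reducing a Lagrangian sublattice along a coordinate\<close>

definition outer :: "'a::comm_ring_1 ^ 'n \<Rightarrow> 'a ^ 'n \<Rightarrow> 'a ^ 'n ^ 'n" where
  "outer u w = (\<chi> i j. u $ i * w $ j)"

lemma det_rank_one_row:
  fixes u w :: "'a::field ^ 'n"
  assumes "finite S" "k \<notin> S"
  shows "det (\<chi> i. if i = k then w else if i \<in> S then axis i 1 + u $ i *s w else axis i 1) = w $ k"
  using assms
proof (induction S)
  case empty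
  have c: "det (\<chi> i. if i = k then (\<Sum>i\<in>UNIV. w $ i *s row i (mat 1)) else row i (mat 1 :: 'a ^ 'n ^ 'n)) = w $ k * det (mat 1 :: 'a ^ 'n ^ 'n)"
    by (rule cramer_lemma_transpose)
  have v: "(\<chi> i. if i = k then (\<Sum>i\<in>UNIV. w $ i *s row i (mat 1)) else row i (mat 1 :: 'a ^ 'n ^ 'n)) = (\<chi> i. if i = k then w else axis i 1)"
    by (simp add: vec_eq_iff row_def mat_def axis_def if_distrib cong: if_cong)
  show ?case using c unfolding v by (simp cong: if_cong)
next
  case (insert m S)
  let ?A = "\<chi> i. if i = k then w else if i \<in> S then axis i 1 + u $ i *s w else axis i 1"
  have "det (\<chi> i. if i = k then w else if i \<in> insert m S then axis i 1 + u $ i *s w else axis i 1)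
      = det (\<chi> i. if i = m then row m ?A + u $ m *s row k ?A else row i ?A)"
    by (rule arg_cong[where f = det]) (use insert in \<open>auto simp: vec_eq_iff row_def\<close>)
  also have "\<dots> = det ?A" by (rule det_row_operation) (use insert in auto)
  finally show ?case using insert by simp
qed

lemma det_rank_one_aux:
  fixes u w :: "'a::field ^ 'n"
  assumes "finite S"
  shows "det (\<chi> i. if i \<in> S then axis i 1 + u $ i *s w else axis i 1) = 1 + (\<Sum>i\<in>S. u $ i * w $ i)"
  using assms
proof (induction S)
  case empty
  have "(\<chi> i. axis i 1) = (mat 1 :: 'a ^ 'n ^ 'n)" by (auto simp: vec_eq_iff mat_def axis_def)
  then show ?case by simp
next
  case (insert k S)
  let ?c = "\<lambda>i. if i \<in> S then axis i 1 + u $ i *s w else axis i 1"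
  have "det (\<chi> i. if i \<in> insert k S then axis i 1 + u $ i *s w else axis i 1)
     = det (\<chi> i. if i = k then axis k 1 + u $ k *s w else ?c i)"
    by (rule arg_cong[where f = det]) (use insert in \<open>auto simp: vec_eq_iff\<close>)
  also have "\<dots> = det (\<chi> i. if i = k then axis k 1 else ?c i) + det (\<chi> i. if i = k then u $ k *s w else ?c i)"
    by (rule det_row_add)
  also have "det (\<chi> i. if i = k then u $ k *s w else ?c i) = u $ k * det (\<chi> i. if i = k then w else ?c i)"
    by (rule det_row_mul)
  also have "det (\<chi> i. if i = k then w else ?c i) = w $ k"
    using det_rank_one_row[of S k w u] insert by simp
  also have "(\<chi> i. if i = k then axis k 1 else ?c i) = (\<chi> i. ?c i)"
    using insert by (auto simp: vec_eq_iff)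
  finally show ?case using insert by simp
qed

text \<open>The matrix determinant lemma. The rows are switched on one at a time: expanding the new
  row splits off a determinant in which one row equals w, and that row clears the others.\<close>

lemma det_rank_one:
  fixes u w :: "'a::field ^ 'n"
  shows "det (mat 1 + outer u w) = 1 + (\<Sum>i\<in>UNIV. u $ i * w $ i)"
proof -
  have "mat 1 + outer u w = (\<chi> i. if i \<in> UNIV then axis i 1 + u $ i *s w else axis i 1)"
    by (auto simp: vec_eq_iff mat_def axis_def outer_def)
  then show ?thesis using det_rank_one_aux[of UNIV u w] by simp
qed

lemma subgroup_generator:
  fixes A :: "real set"
  assumes "A \<subseteq> \<int>" and diff: "\<And>x y t. x \<in> A \<Longrightarrow> y \<in> A \<Longrightarrow> t \<in> \<int> \<Longrightarrow> x - t * y \<in> A" and "x \<in> A" "x \<noteq> 0"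
  obtains g where "g \<in> A" "g > 0" "\<And>y. y \<in> A \<Longrightarrow> \<exists>t\<in>\<int>. y = t * g"
proof -
  define P where "P k \<longleftrightarrow> real k \<in> A \<and> k > 0" for k
  have "0 \<in> A" using diff[of x x 1] assms by simp
  then have "\<bar>x\<bar> \<in> A" using diff[of 0 x 1] assms(3) by (auto simp: abs_if)
  moreover obtain k where k: "x = of_int k" using assms by (meson Ints_cases subsetD)
  ultimately have "P (nat \<bar>k\<bar>)" using assms by (auto simp: P_def)
  then obtain k where k: "P k" and min: "\<And>l. P l \<Longrightarrow> k \<le> l"
    using ex_has_least_nat[of P _ "\<lambda>x. x"] by blast
  show thesis
  proof
    show "real k \<in> A" "real k > 0" using k by (auto simp: P_def)
    fix y assume y: "y \<in> A"
    then obtain l where l: "y = of_int l" using assms(1) by (meson Ints_cases subsetD)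
    define r where "r = l mod int k"
    have "of_int r = y - of_int (l div int k) * real k"
      by (simp add: r_def l minus_div_mult_eq_mod[symmetric])
    then have "of_int r \<in> A" using diff[OF y \<open>real k \<in> A\<close>] by simp
    moreover have "0 \<le> r" "r < int k" using k by (auto simp: r_def P_def)
    ultimately have rA: "real_of_int r \<in> A" "0 \<le> r" "r < int k" by auto
    have "r = 0"
    proof (rule ccontr)
      assume "r \<noteq> 0"
      then have "P (nat r)" using rA by (simp add: P_def)
      from min[OF this] show False using rA by linarith
    qed
    then have "l = (l div int k) * int k" using div_mult_mod_eq[of l "int k"] unfolding r_def by linarith
    then have "y = of_int (l div int k) * real k" unfolding l by (metis of_int_mult of_int_of_nat_eq)
    then show "\<exists>t\<in>\<int>. y = t * real k" by auto
  qed
qed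

text \<open>The vertical vector (0, e_a) of the symplectic lattice; pairing with it by
  \<open>om\<close> reads off a horizontal coordinate.\<close>

definition kv :: "'n::finite \<Rightarrow> complex ^ 'n" where "kv a = axis a \<i>"

lemma om_kv_right: "om p (kv a) = Re (p $ a)"
  by (simp add: om_def kv_def axis_def if_distrib cong: if_cong)

lemma om_kv_left: "om (kv a) p = - Re (p $ a)"
  by (metis om_commute om_kv_right)

lemma kv_glat: "kv a \<in> glat"
  by (auto simp: kv_def glat_def axis_def gints_def)

lemma Re_kv [simp]: "Re (kv a $ j) = 0"
  by (simp add: kv_def axis_def)

text \<open>The Lagrangian sublattices that come from the coordinates in \<open>I\<close>; \<open>LL UNIV\<close> is the set of all of
  them, and the induction on \<open>I\<close> adds one coordinate at a time by means of \<open>red\<close>.\<close>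

definition LL :: "'n::finite set \<Rightarrow> (complex ^ 'n) set set" where
  "LL I = {L. lag L \<and> (\<forall>j. j \<notin> I \<longrightarrow> kv j \<in> L)}"

lemma LL_Re: "L \<in> LL I \<Longrightarrow> p \<in> L \<Longrightarrow> j \<notin> I \<Longrightarrow> Re (p $ j) = 0"
  using lag_iso[of L p "kv j"] by (auto simp: LL_def om_kv_right)

text \<open>The symplectic reduction of L along \<open>kv a\<close>: up to finite index it is
  spanned by \<open>kv a\<close> and the vectors of L whose a-th horizontal coordinate vanishes.
  Taking a symplectic complement makes primitivity automatic.\<close>

definition red :: "'n::finite \<Rightarrow> (complex ^ 'n) set \<Rightarrow> (complex ^ 'n) set" where
  "red a L = {p \<in> glat. Re (p $ a) = 0 \<and> (\<forall>q\<in>L. Re (q $ a) = 0 \<longrightarrow> om p q = 0)}"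

lemma lag_red:
  assumes L: "lag L" and a: "kv a \<notin> L"
  shows "lag (red a L)"
proof -
  define W where "W = bas L"
  have W: "gframe W" "\<And>i. W $ i \<in> L" "L = comb W ` integer_lattice"
    using bas[OF L] by (auto simp: W_def)
  define g where "g i = Re (W $ i $ a)" for i
  have gint: "g i \<in> \<int>" for i
    using W(1) by (auto simp: g_def gframe_def glat_def gints_def)
  have "\<exists>i. g i \<noteq> 0"
  proof (rule ccontr)
    assume "\<not> (\<exists>i. g i \<noteq> 0)"
    then have "om q (kv a) = 0" if "q \<in> L" for q
    proof -
      obtain \<tau> where \<tau>: "q = comb W \<tau>" using \<open>q \<in> L\<close> W(3) by blast
      have "om (W $ i) (kv a) = 0" for i using \<open>\<not> (\<exists>i. g i \<noteq> 0)\<close> unfolding om_kv_right g_def by blast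
      then show ?thesis by (simp only: \<tau> om_comb_left) simp
    qed
    then show False using lag_max[OF L kv_glat] a by blast
  qed
  then obtain i0 where i0: "g i0 \<noteq> 0" by blast
  \<comment> \<open>The combinations cancel the a-th horizontal coordinate, and \<open>kv a\<close>
    takes the place of the row that is lost. This frame need not generate the reduction, but
    \<open>lagof\<close> depends only on its real span.\<close>
  define V where "V = (\<chi> i. if i = i0 then kv a else g i0 *\<^sub>R W $ i - g i *\<^sub>R W $ i0)"
  have WW: "om (W $ i) (W $ j) = 0" for i j using W(1) by (simp add: gframe_def isotr_def)
  have Wk: "om (W $ i) (kv a) = g i" for i by (simp add: om_kv_right g_def)
  have kW: "om (kv a) (W $ i) = - g i" for i by (simp add: om_kv_left g_def)
  have Viso: "isotr V"
    by (auto simp: isotr_def V_def om_simps WW Wk kW)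
  have Vglat: "V $ i \<in> glat" for i
    using W(1) gint kv_glat by (auto simp: V_def gframe_def intro!: glat_closed(3,5))
  have "det V \<noteq> 0"
  proof (rule isotr_indep_det_nz[OF Viso])
    fix t assume t: "comb V t = 0"
    have "om (W $ i0) (comb V t) = t $ i0 * g i0"
    proof -
      have "om (W $ i0) (comb V t) = (\<Sum>i\<in>UNIV. if i = i0 then t $ i0 * g i0 else 0)"
        unfolding om_comb_right by (intro sum.cong refl) (auto simp: V_def om_simps WW Wk)
      then show ?thesis by simp
    qed
    then have t0: "t $ i0 = 0" using t i0 by (simp add: om_simps)
    define s where "s = (\<chi> i. if i = i0 then - (\<Sum>k\<in>UNIV - {i0}. t $ k * g k) else t $ i * g i0)"
    have "comb V t = (\<Sum>i\<in>UNIV - {i0}. t $ i *\<^sub>R V $ i)"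
      unfolding comb_def by (subst sum.remove[of _ i0]) (auto simp: t0)
    also have "\<dots> = (\<Sum>i\<in>UNIV - {i0}. (t $ i * g i0) *\<^sub>R W $ i - (t $ i * g i) *\<^sub>R W $ i0)"
      by (intro sum.cong refl) (auto simp: V_def algebra_simps)
    also have "\<dots> = comb W s"
      unfolding comb_def by (subst (2) sum.remove[of _ i0])
        (auto simp: s_def sum_subtractf scaleR_sum_left[symmetric])
    finally have "comb W s = 0" using t by simp
    then have "s = 0" using comb_inj[of W s 0] W(1) by (simp add: comb_0 gframe_def)
    then have "t $ i = 0" for i
    proof (cases "i = i0")
      case False
      have "s $ i = 0" using \<open>s = 0\<close> by simp
      then show ?thesis using False i0 by (simp add: s_def)
    qed (simp add: t0)
    then show "t = 0" by (simp add: vec_eq_iff)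
  qed
  then have gV: "gframe V" using Viso Vglat by (simp add: gframe_def)
  have "red a L = lagof V"
  proof (intro set_eqI iffI)
    fix p assume p: "p \<in> red a L"
    have "om (V $ i) p = 0" for i
    proof (cases "i = i0")
      case True
      then show ?thesis using p by (simp add: V_def om_kv_left red_def)
    next
      case False
      then have "V $ i \<in> L" using lag_diff[OF L lag_scale[OF L W(2) gint] lag_scale[OF L W(2) gint]] by (simp add: V_def)
      moreover have "Re (V $ i $ a) = 0" using False by (simp add: V_def g_def)
      ultimately show ?thesis using p om_commute[of "V $ i" p] by (auto simp: red_def)
    qed
    then show "p \<in> lagof V" using p by (simp add: lagof_def red_def)
  next
    fix p assume p: "p \<in> lagof V"
    have "Re (p $ a) = 0"
      using p om_kv_left[of a p] by (auto simp: lagof_def V_def dest!: spec[of _ i0])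
    moreover have "om p q = 0" if q: "q \<in> L" "Re (q $ a) = 0" for q
    proof -
      obtain \<tau> where \<tau>: "q = comb W \<tau>" using q W(3) by blast
      have "(\<Sum>i\<in>UNIV. \<tau> $ i * g i) = 0" using q(2) \<tau> by (simp add: comb_def g_def)
      then have s0: "\<tau> $ i0 * g i0 + (\<Sum>i\<in>UNIV - {i0}. \<tau> $ i * g i) = 0"
        by (subst (asm) sum.remove[of _ i0]) auto
      have s1: "(\<Sum>i\<in>UNIV - {i0}. \<tau> $ i * g i) = - (\<tau> $ i0 * g i0)" using s0 by linarith
      have "g i0 * om p q = (\<Sum>i\<in>UNIV - {i0}. \<tau> $ i * om p (V $ i))"
      proof -
        have "(\<Sum>i\<in>UNIV - {i0}. \<tau> $ i * om p (V $ i)) = (\<Sum>i\<in>UNIV - {i0}. g i0 * (\<tau> $ i * om p (W $ i)) - (\<tau> $ i * g i) * om p (W $ i0))"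
          by (intro sum.cong refl) (auto simp: V_def om_simps algebra_simps)
        also have "\<dots> = g i0 * (\<Sum>i\<in>UNIV - {i0}. \<tau> $ i * om p (W $ i)) - (\<Sum>i\<in>UNIV - {i0}. \<tau> $ i * g i) * om p (W $ i0)"
          by (simp add: sum_subtractf sum_distrib_left sum_distrib_right)
        also have "\<dots> = g i0 * (\<Sum>i\<in>UNIV - {i0}. \<tau> $ i * om p (W $ i)) + (\<tau> $ i0 * g i0) * om p (W $ i0)"
          unfolding s1 by simp
        also have "\<dots> = g i0 * om p q"
          unfolding \<tau> om_comb_right by (subst (2) sum.remove[of _ i0]) (auto simp: algebra_simps)
        finally show ?thesis by simp
      qed
      moreover have "om p (V $ i) = 0" for i using p om_commute[of p "V $ i"] by (simp add: lagof_def)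
      ultimately show ?thesis using i0 by simp
    qed
    ultimately show "p \<in> red a L" using p by (simp add: red_def lagof_def)
  qed
  then show ?thesis using gV by (auto simp: lag_def)
qed

lemma kv_in_red: "kv a \<in> red a L" if "lag L"
  using that by (auto simp: red_def kv_glat om_kv_left)

lemma red_LL:
  assumes "L \<in> LL (insert a I)" "kv a \<notin> L"
  shows "red a L \<in> LL I"
proof -
  have "lag L" using assms by (simp add: LL_def)
  moreover have "kv j \<in> red a L" if "j \<notin> I" "j \<noteq> a" for j
  proof -
    have "kv j \<in> L" using assms that by (simp add: LL_def)
    then show ?thesis using lag_iso[OF \<open>lag L\<close>, of "kv j"] by (auto simp: red_def kv_glat)
  qed
  ultimately show ?thesis using lag_red assms(2) kv_in_red by (fastforce simp: LL_def)
qed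

section \<open>Varying a single row and column of the symmetric matrix\<close>

definition rep :: "complex ^ 'n \<Rightarrow> real ^ 'n" where "rep p = (\<chi> i. Re (p $ i))"

definition rowm :: "'n::finite \<Rightarrow> real ^ 'n \<Rightarrow> real ^ 'n ^ 'n" where
  "rowm a y = (\<chi> i j. if i = a then y $ j else if j = a then y $ i else 0)"

lemma transpose_rowm: "transpose (rowm a y) = rowm a y"
  by (simp add: rowm_def transpose_def vec_eq_iff)

lemma transpose_add: "transpose (A + B) = transpose A + transpose (B :: 'a::plus ^ 'n ^ 'm)"
  by (simp add: transpose_def vec_eq_iff)

lemma rho_kv: "rho M X (kv a) = axis a (Complex 0 (M a))"
  by (simp add: rho_def vec_eq_iff complex_eq_iff) (auto simp: kv_def axis_def)

lemma rho_rowm: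
  assumes "Re (p $ a) = 0"
  shows "rho M (X + rowm a y) p = rho M X p + (rep p \<bullet> y) *\<^sub>R rho M X (kv a)"
proof -
  have *: "Re (p $ j) * rowm a y $ j $ i = (if i = a then Re (p $ j) * y $ j else 0)" for i j
    using assms by (auto simp: rowm_def)
  have "(\<Sum>j\<in>UNIV. Re (p $ j) * (X + rowm a y) $ j $ i) = (\<Sum>j\<in>UNIV. Re (p $ j) * X $ j $ i) + (if i = a then rep p \<bullet> y else 0)" for i
    by (simp add: distrib_left sum.distrib * inner_vec_def rep_def)
  then show ?thesis
    by (simp add: vec_eq_iff rho_kv) (auto simp: rho_def axis_def complex_eq_iff algebra_simps)
qed

lemma rho_rowm_axis:
  "rho M (X + rowm a (y + z *\<^sub>R axis a 1)) p = rho M (X + rowm a y) p + (z * Re (p $ a)) *\<^sub>R rho M X (kv a)"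
proof -
  have *: "Re (p $ j) * rowm a (y + z *\<^sub>R axis a 1) $ j $ i = Re (p $ j) * rowm a y $ j $ i + (if i = a \<and> j = a then Re (p $ j) * z else 0)" for i j
    by (auto simp: rowm_def axis_def algebra_simps)
  have "(\<Sum>j\<in>UNIV. Re (p $ j) * (X + rowm a (y + z *\<^sub>R axis a 1)) $ j $ i)
      = (\<Sum>j\<in>UNIV. Re (p $ j) * (X + rowm a y) $ j $ i) + (if i = a then Re (p $ a) * z else 0)" for i
    by (simp add: distrib_left sum.distrib *)
  then show ?thesis
    by (simp add: vec_eq_iff rho_kv) (auto simp: rho_def axis_def complex_eq_iff algebra_simps)
qed

lemma comb_matrix: "(\<chi> i. comb W (T $ i)) = (\<chi> i j. of_real (T $ i $ j)) ** W"
  by (simp add: vec_eq_iff comb_nth matrix_matrix_mult_def)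

lemma matrix_add_rdistrib0: "(A + B) ** C = A ** C + B ** (C :: 'a::semiring_1 ^ 'n ^ 'n)"
  by (simp add: vec_eq_iff matrix_matrix_mult_def distrib_right sum.distrib)

lemma rhom_rowm:
  assumes "\<And>i. Re (W $ i $ a) = 0" "kv a = comb W \<kappa>"
  shows "rhom M (X + rowm a y) W = (mat 1 + outer (cvec (\<chi> i. rep (W $ i) \<bullet> y)) (cvec \<kappa>)) ** rhom M X W"
proof -
  have "rhom M (X + rowm a y) W $ i = rhom M X W $ i + (rep (W $ i) \<bullet> y) *\<^sub>R comb (rhom M X W) \<kappa>" for i
    using rho_rowm[OF assms(1)[of i]] by (simp add: rhom_def assms(2) rho_comb)
  moreover have "(outer (cvec (\<chi> i. rep (W $ i) \<bullet> y)) (cvec \<kappa>) ** rhom M X W) $ i = (rep (W $ i) \<bullet> y) *\<^sub>R comb (rhom M X W) \<kappa>" for i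
    by (simp add: vec_eq_iff matrix_matrix_mult_def outer_def cvec_def comb_nth scaleR_conv_of_real[where 'a=complex] sum_distrib_left mult.assoc)
  ultimately show ?thesis
    by (simp only: vec_eq_iff[of "rhom M (X + rowm a y) W"] matrix_add_rdistrib0 matrix_mul_lid vector_add_component) simp
qed

lemma kappa_rep: "kv a = comb W \<kappa> \<Longrightarrow> (\<Sum>i\<in>UNIV. (rep (W $ i) \<bullet> y) * \<kappa> $ i) = 0"
proof -
  assume k: "kv a = comb W \<kappa>"
  have "(\<Sum>i\<in>UNIV. \<kappa> $ i * Re (W $ i $ j)) = 0" for j
    using arg_cong[OF k, of "\<lambda>v. Re (v $ j)"] by (simp add: comb_nth)
  moreover have "(\<Sum>i\<in>UNIV. (rep (W $ i) \<bullet> y) * \<kappa> $ i) = (\<Sum>j\<in>UNIV. y $ j * (\<Sum>i\<in>UNIV. \<kappa> $ i * Re (W $ i $ j)))"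
    by (simp add: inner_vec_def rep_def sum_distrib_left sum_distrib_right, subst sum.swap) (simp add: mult_ac)
  ultimately show ?thesis by simp
qed

lemma det_rhom_rowm:
  assumes "\<And>i. Re (W $ i $ a) = 0" "kv a = comb W \<kappa>"
  shows "det (rhom M (X + rowm a y) W) = det (rhom M X W)"
proof -
  have "(\<Sum>i\<in>UNIV. cvec (\<chi> i. rep (W $ i) \<bullet> y) $ i * cvec \<kappa> $ i) = of_real (\<Sum>i\<in>UNIV. (rep (W $ i) \<bullet> y) * \<kappa> $ i)"
    by (simp add: cvec_def)
  then show ?thesis
    unfolding rhom_rowm[OF assms] det_mul det_rank_one using kappa_rep[OF assms(2), of y] by simp
qed

lemma lag_kv_comb:
  assumes "lag L" "kv a \<in> L"
  obtains \<kappa> where "\<kappa> \<in> integer_lattice" "kv a = comb (bas L) \<kappa>"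
  using bas(3)[OF assms(1)] assms(2) by blast

lemma lag_kv_Re: "lag L \<Longrightarrow> kv a \<in> L \<Longrightarrow> p \<in> L \<Longrightarrow> Re (p $ a) = 0"
  using lag_iso[of L p "kv a"] by (simp add: om_kv_right)

text \<open>On vectors with zero a-th horizontal coordinate a change of row a is a shear in the
  direction of \<open>kv a\<close>, which lies in L itself. So the whole row can be averaged over
  while the covolume of a parent stays fixed.\<close>

lemma lvol_rowm:
  assumes "lag L" "kv a \<in> L"
  shows "lvol M (X + rowm a y) L = lvol M X L"
proof -
  obtain \<kappa> where "kv a = comb (bas L) \<kappa>" using lag_kv_comb[OF assms] by blast
  moreover have "Re (bas L $ i $ a) = 0" for i using lag_kv_Re[OF assms bas(2)[OF assms(1)]] .
  ultimately show ?thesis by (simp add: lvol_def det_rhom_rowm)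
qed

text \<open>The vector that represents the functional \<alpha> on the image lattice: its pairing by
  \<open>bdot\<close> with row i is \<open>\<alpha> $ i\<close>. Its norm is the dual norm of
  \<alpha>, the factor by which passing to the kernel of a primitive \<alpha> multiplies the
  covolume.\<close>

definition xsol :: "('n::finite \<Rightarrow> real) \<Rightarrow> real ^ 'n ^ 'n \<Rightarrow> complex ^ 'n ^ 'n \<Rightarrow> real ^ 'n \<Rightarrow> complex ^ 'n" where
  "xsol M X W \<alpha> = (SOME x. rhom M X W *v x = cvec \<alpha>)"

lemma xsol:
  assumes "transpose X = X" "\<And>i. M i > 0" "gframe W"
  shows "rhom M X W *v xsol M X W \<alpha> = cvec \<alpha>"
    and "rhom M X W *v x = cvec \<alpha> \<Longrightarrow> x = xsol M X W \<alpha>"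
proof -
  have d: "det (rhom M X W) \<noteq> 0" using assms det_rhom_nz by (auto simp: gframe_def)
  show 1: "rhom M X W *v xsol M X W \<alpha> = cvec \<alpha>"
    unfolding xsol_def by (rule someI_ex) (meson d det_nz_solve)
  assume "rhom M X W *v x = cvec \<alpha>"
  then have "rhom M X W *v (x - xsol M X W \<alpha>) = 0" using 1 by (simp add: matrix_vector_mult_diff_distrib)
  then show "x = xsol M X W \<alpha>" using det_nz_ker[OF d] by fastforce
qed

text \<open>The horizontal part of \<open>kv a\<close> is zero, so \<kappa> is orthogonal to the
  displacement vector and the rank-one perturbation is inverted by changing its sign. Varying y thus
  translates \<alpha> by a real vector, which is how averaging over a row spreads out the lattice
  points \<alpha>.\<close>

lemma xsol_rowm:
  assumes X: "transpose X = X" and M: "\<And>i. M i > 0" and W: "gframe W"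
    and re: "\<And>i. Re (W $ i $ a) = 0" and k: "kv a = comb W \<kappa>"
  shows "xsol M (X + rowm a y) W \<alpha> = xsol M X W (\<alpha> - (\<kappa> \<bullet> \<alpha>) *\<^sub>R (\<chi> i. rep (W $ i) \<bullet> y))"
proof -
  let ?c = "\<chi> i. rep (W $ i) \<bullet> y" and ?\<beta> = "\<alpha> - (\<kappa> \<bullet> \<alpha>) *\<^sub>R (\<chi> i. rep (W $ i) \<bullet> y)"
  have "\<kappa> \<bullet> ?c = 0" using kappa_rep[OF k, of y] by (simp add: inner_vec_def mult.commute)
  then have kb: "\<kappa> \<bullet> ?\<beta> = \<kappa> \<bullet> \<alpha>" by (simp add: inner_diff_right)
  have "outer (cvec ?c) (cvec \<kappa>) *v cvec ?\<beta> = of_real (\<kappa> \<bullet> ?\<beta>) *s cvec ?c"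
    by (simp add: vec_eq_iff matrix_vector_mult_def outer_def cvec_def inner_vec_def sum_distrib_left sum_distrib_right mult_ac
        del: vector_minus_component vector_scaleR_component)
  then have "rhom M (X + rowm a y) W *v xsol M X W ?\<beta> = cvec ?\<beta> + of_real (\<kappa> \<bullet> \<alpha>) *s cvec ?c"
    unfolding rhom_rowm[OF re k] by (simp only: matrix_vector_mul_assoc[symmetric] xsol[OF X M W] kb matrix_vector_mult_add_rdistrib matrix_vector_mul_lid)
  also have "\<dots> = cvec \<alpha>" by (simp add: vec_eq_iff cvec_def)
  finally have "rhom M (X + rowm a y) W *v xsol M X W ?\<beta> = cvec \<alpha>" .
  moreover have "transpose (X + rowm a y) = X + rowm a y" by (simp add: transpose_add transpose_rowm X)
  ultimately show ?thesis using xsol(2) M W by metis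
qed

lemma bdot_comb: "bdot (comb N t) x = (\<Sum>i\<in>UNIV. of_real (t $ i) * (N *v x) $ i)"
  by (simp add: bdot_def comb_nth matrix_vector_mult_def sum_distrib_left sum_distrib_right, subst sum.swap) (simp add: mult_ac)

lemma bdot_add_left: "bdot (r + s) x = bdot r x + bdot s x"
  and bdot_scaleR_left: "bdot (c *\<^sub>R r) x = of_real c * bdot r x"
  by (simp_all add: bdot_def algebra_simps sum.distrib sum_distrib_left scaleR_conv_of_real[where 'a=complex])

lemma bdot_comb_sol: "N *v x = cvec \<alpha> \<Longrightarrow> bdot (comb N t) x = of_real (t \<bullet> \<alpha>)"
  by (simp add: bdot_comb cvec_def inner_vec_def)

section \<open>Lagrangian sublattices with a given reduction\<close>

lemma integer_lattice_closed [intro]: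
  "0 \<in> integer_lattice" "x \<in> integer_lattice \<Longrightarrow> y \<in> integer_lattice \<Longrightarrow> x + y \<in> integer_lattice"
  "x \<in> integer_lattice \<Longrightarrow> y \<in> integer_lattice \<Longrightarrow> x - y \<in> integer_lattice"
  "x \<in> integer_lattice \<Longrightarrow> c \<in> \<int> \<Longrightarrow> c *\<^sub>R x \<in> integer_lattice"
  by (auto simp: integer_lattice_def)

lemma integer_lattice_inner: "x \<in> integer_lattice \<Longrightarrow> y \<in> integer_lattice \<Longrightarrow> x \<bullet> y \<in> \<int>"
  by (auto simp: integer_lattice_def inner_vec_def)

lemma integer_lattice_axis: "axis k 1 \<in> integer_lattice"
  by (auto simp: integer_lattice_def axis_def)

text \<open>The inner products with \<beta> form a nonzero subgroup of the integers. Its generator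
  is the content g, and a vector attaining it is a Bezout vector for the primitive part.\<close>

lemma content_exists:
  fixes \<beta> :: "real ^ 'n"
  assumes "\<beta> \<in> integer_lattice" "\<beta> \<noteq> 0"
  obtains g :: nat and \<alpha> b where "g \<ge> 1" "\<alpha> \<in> integer_lattice" "b \<in> integer_lattice" "\<beta> = real g *\<^sub>R \<alpha>" "b \<bullet> \<alpha> = 1"
proof -
  let ?A = "(\<lambda>n. n \<bullet> \<beta>) ` integer_lattice"
  have "\<exists>k. \<beta> $ k \<noteq> 0" using assms by (auto simp: vec_eq_iff)
  then obtain k where k: "\<beta> $ k \<noteq> 0" by blast
  have ax: "axis k 1 \<bullet> \<beta> = \<beta> $ k" for k by (simp add: inner_axis')
  have sub: "?A \<subseteq> \<int>" using integer_lattice_inner assms by blast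
  have df: "x - t * y \<in> ?A" if xy: "x \<in> ?A" "y \<in> ?A" "t \<in> \<int>" for x y t
  proof -
    obtain p q where "x = p \<bullet> \<beta>" "y = q \<bullet> \<beta>" "p \<in> integer_lattice" "q \<in> integer_lattice" using xy by blast
    then have "x - t * y = (p - t *\<^sub>R q) \<bullet> \<beta>" "p - t *\<^sub>R q \<in> integer_lattice"
      using xy by (auto simp: inner_diff_left)
    then show ?thesis by blast
  qed
  have "\<beta> $ k \<in> ?A" using ax[of k] integer_lattice_axis[of k] by (metis image_eqI)
  from subgroup_generator[OF sub df this k]
  obtain g where g: "g \<in> ?A" "g > 0" "\<And>y. y \<in> ?A \<Longrightarrow> \<exists>t\<in>\<int>. y = t * g" by blast
  obtain b where b: "b \<in> integer_lattice" "g = b \<bullet> \<beta>" using g(1) by blast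
  have "\<beta> $ i \<in> ?A" for i using ax[of i] integer_lattice_axis[of i] by (metis image_eqI)
  then have "\<forall>i. \<exists>t\<in>\<int>. \<beta> $ i = t * g" using g(3) by blast
  then obtain t where t: "\<And>i. t i \<in> \<int>" "\<And>i. \<beta> $ i = t i * g" by metis
  obtain z where z: "g = of_int z" using g(1) sub by (meson Ints_cases subsetD)
  define \<alpha> where "\<alpha> = (\<chi> i. t i)"
  have ga: "\<beta> = g *\<^sub>R \<alpha>" by (simp add: vec_eq_iff \<alpha>_def t(2) mult.commute)
  show thesis
  proof (rule that[of "nat z" \<alpha> b])
    show "1 \<le> nat z" using z g by simp
    have gz: "real (nat z) = g" using z g by simp
    show "\<beta> = real (nat z) *\<^sub>R \<alpha>" using ga gz by simp
    have "g = g * (b \<bullet> \<alpha>)" using b(2) ga by simp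
    then show "b \<bullet> \<alpha> = 1" using g by simp
  qed (use b t in \<open>auto simp: \<alpha>_def integer_lattice_def\<close>)
qed

lemma gints_norm_ge_1: assumes "z \<in> gints" "z \<noteq> 0" shows "cmod z \<ge> 1"
proof -
  obtain a b where ab: "Re z = of_int a" "Im z = of_int b" using assms by (auto simp: gints_def elim!: Ints_cases)
  have "a \<noteq> 0 \<or> b \<noteq> 0" using assms ab by (auto simp: complex_eq_iff)
  then have "1 \<le> a\<^sup>2 + b\<^sup>2"
    by (metis add_nonneg_pos add_pos_nonneg int_one_le_iff_zero_less zero_le_power2 zero_less_power2)
  then have "1 \<le> (cmod z)\<^sup>2" using ab by (simp add: cmod_power2) (metis of_int_1_le_iff of_int_add of_int_power)
  then show ?thesis using power2_le_imp_le[of 1 "cmod z"] by simp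
qed

text \<open>In coordinates with respect to W, sending v to v P fixes the kernel of \<alpha> and
  takes b to the coordinates \<sigma> of u. The kernel and b together generate the integer lattice,
  so the frame B is an integral matrix A followed by P and then by W. The determinant of P is the
  pairing of u with x, and that of A is a nonzero Gaussian integer, of modulus at least 1.\<close>

lemma det_frame_lower:
  fixes W B :: "complex ^ 'n ^ 'n"
  assumes B: "\<And>i. B $ i = T i *\<^sub>R u + comb W (\<tau> i)"
    and T: "\<And>i. T i \<in> \<int>" and \<tau>: "\<And>i. \<tau> i \<in> integer_lattice" and orth: "\<And>i. \<tau> i \<bullet> \<alpha> = 0"
    and b: "b \<in> integer_lattice" "b \<bullet> \<alpha> = 1"
    and N: "det (rhom M X W) \<noteq> 0" and R: "det (rhom M X B) \<noteq> 0"
    and x: "rhom M X W *v x = cvec \<alpha>"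
  shows "cmod (det (rhom M X W)) * cmod (bdot (rho M X u) x) \<le> cmod (det (rhom M X B))"
proof -
  let ?N = "rhom M X W"
  obtain \<sigma> where \<sigma>: "\<sigma> v* ?N = rho M X u" using det_nz_solve_left[OF N] by blast
  define a where "a i = \<tau> i + T i *\<^sub>R b" for i
  define A where "A = (\<chi> i. cvec (a i))"
  define P where "P = mat 1 + outer (cvec \<alpha>) (\<sigma> - cvec b)"
  have aa: "a i \<bullet> \<alpha> = T i" for i by (simp add: a_def inner_add_left orth b)
  have sum_a: "(\<Sum>k\<in>UNIV. complex_of_real (a i $ k) * complex_of_real (\<alpha> $ k)) = of_real (T i)" for i
    using aa[of i] by (simp add: inner_vec_def flip: of_real_mult of_real_sum)
  have AP: "(A ** P) $ i = cvec (\<tau> i) + of_real (T i) *s \<sigma>" for i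
  proof -
    have "(A ** outer (cvec \<alpha>) (\<sigma> - cvec b)) $ i $ j = of_real (T i) * (\<sigma> - cvec b) $ j" for j
      unfolding sum_a[symmetric]
      by (simp add: matrix_matrix_mult_def A_def outer_def cvec_def sum_distrib_right mult.assoc)
    then have "(A ** P) $ i $ j = cvec (a i) $ j + of_real (T i) * (\<sigma> - cvec b) $ j" for j
      by (simp add: P_def matrix_add_ldistrib A_def)
    then show ?thesis by (simp add: vec_eq_iff a_def cvec_def algebra_simps)
  qed
  have "rhom M X B = A ** P ** ?N"
  proof -
    have "(A ** P ** ?N) $ i = (cvec (\<tau> i) + of_real (T i) *s \<sigma>) v* ?N" for i
      by (simp add: vec_eq_iff matrix_matrix_mult_def vector_matrix_mult_def[of _ ?N] mult.commute flip: AP)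
    also have "\<dots> i = comb ?N (\<tau> i) + T i *\<^sub>R rho M X u" for i
      by (simp add: vector_matrix_mult_add_rdistrib[of _ "_ *s _"] vector_matrix_left_distrib comb_eq \<sigma>[symmetric]
          vec_eq_iff vector_matrix_mult_def sum_distrib_left scaleR_conv_of_real[where 'a=complex] sum.distrib algebra_simps)
    finally have "(A ** P ** ?N) $ i = rhom M X B $ i" for i
      by (simp add: rhom_def[of M X B] B rho_add rho_scaleR rho_comb add.commute)
    then show ?thesis unfolding vec_eq_iff[of "rhom M X B"] by metis
  qed
  then have "det (rhom M X B) = det A * det P * det ?N" by (simp add: det_mul)
  moreover have "det P = bdot (rho M X u) x"
  proof -
    have "(\<Sum>i\<in>UNIV. cvec \<alpha> $ i * cvec b $ i) = of_real (b \<bullet> \<alpha>)"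
      by (simp add: cvec_def inner_vec_def mult.commute)
    then have "det P = (\<Sum>i\<in>UNIV. cvec \<alpha> $ i * \<sigma> $ i)"
      unfolding P_def det_rank_one by (simp add: algebra_simps sum_subtractf b)
    also have "\<dots> = (\<Sum>i\<in>UNIV. (?N *v x) $ i * \<sigma> $ i)" by (simp only: x)
    also have "\<dots> = bdot (\<sigma> v* ?N) x"
      by (simp add: bdot_def matrix_vector_mult_def vector_matrix_mult_def sum_distrib_left sum_distrib_right, subst sum.swap) (simp add: mult_ac)
    finally show ?thesis using \<sigma> by simp
  qed
  moreover have "cmod (det A) \<ge> 1"
  proof (rule gints_norm_ge_1)
    have "a i \<in> integer_lattice" for i using \<tau> T b by (auto simp: a_def)
    then show "det A \<in> gints" by (intro det_gints) (auto simp: A_def glat_def gints_def cvec_def integer_lattice_def)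
    show "det A \<noteq> 0" using R calculation by auto
  qed
  ultimately show ?thesis
    using mult_right_mono[of 1 "cmod (det A)" "cmod (det P) * cmod (det ?N)"] by (simp add: norm_mult mult_ac)
qed

definition children :: "'n::finite \<Rightarrow> 'n set \<Rightarrow> (complex ^ 'n) set \<Rightarrow> (complex ^ 'n) set set" where
  "children a I Lb = {L \<in> LL (insert a I). kv a \<notin> L \<and> red a L = Lb}"

lemma child_generator:
  assumes L: "lag L" and a: "kv a \<notin> L"
  obtains u where "u \<in> L" "Re (u $ a) \<noteq> 0" "\<And>l. l \<in> L \<Longrightarrow> \<exists>t\<in>\<int>. Re (l $ a) = t * Re (u $ a)"
proof -
  let ?A = "(\<lambda>l. Re (l $ a)) ` L"
  have sub: "?A \<subseteq> \<int>" using lag_glat[OF L] by (auto simp: glat_def gints_def)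
  have "\<exists>l\<in>L. Re (l $ a) \<noteq> 0"
    using lag_max[OF L kv_glat] a by (metis om_kv_right)
  then obtain l where l: "l \<in> L" "Re (l $ a) \<noteq> 0" by blast
  have df: "x - t * y \<in> ?A" if xy: "x \<in> ?A" "y \<in> ?A" "t \<in> \<int>" for x y t
  proof -
    obtain p q where "x = Re (p $ a)" "y = Re (q $ a)" "p \<in> L" "q \<in> L" using xy by blast
    then have "x - t * y = Re ((p - t *\<^sub>R q) $ a)" "p - t *\<^sub>R q \<in> L"
      using xy L by (auto intro: lag_diff lag_scale)
    then show ?thesis by blast
  qed
  have "Re (l $ a) \<in> ?A" using l by blast
  from subgroup_generator[OF sub df this l(2)]
  obtain g where "g \<in> ?A" "g > 0" "\<And>y. y \<in> ?A \<Longrightarrow> \<exists>t\<in>\<int>. y = t * g" by blast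
  then show thesis using that by fastforce
qed

text \<open>The complement of u and of the part of Lb orthogonal to u; as with \<open>red\<close>, a
  complement is saturated by construction.\<close>

definition child_of :: "(complex ^ 'n) set \<Rightarrow> complex ^ 'n \<Rightarrow> (complex ^ 'n) set" where
  "child_of Lb u = {p \<in> glat. om p u = 0 \<and> (\<forall>q\<in>Lb. om q u = 0 \<longrightarrow> om p q = 0)}"

lemma child_structure:
  assumes L: "lag L" and a: "kv a \<notin> L" and u: "u \<in> L" "Re (u $ a) \<noteq> 0" "\<And>l. l \<in> L \<Longrightarrow> \<exists>t\<in>\<int>. Re (l $ a) = t * Re (u $ a)"
    and l: "l \<in> L"
  shows "\<exists>t\<in>\<int>. \<exists>q\<in>red a L. l = t *\<^sub>R u + q \<and> om q u = 0"
proof -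
  obtain t where t: "t \<in> \<int>" "Re (l $ a) = t * Re (u $ a)" using u(3)[OF l] by blast
  have q: "l - t *\<^sub>R u \<in> L" using L u l t by (auto intro: lag_diff lag_scale)
  then have "l - t *\<^sub>R u \<in> red a L" using lag_iso[OF L q] lag_glat[OF L q] t by (auto simp: red_def)
  moreover have "om (l - t *\<^sub>R u) u = 0" using lag_iso[OF L q u(1)] .
  ultimately show ?thesis using t by (intro bexI[of _ t] bexI[of _ "l - t *\<^sub>R u"]) auto
qed

text \<open>Every element of L is an integral multiple of u plus an element of the parent orthogonal
  to u. Orthogonality to these is orthogonality to L, and L is maximal.\<close>

lemma child_of_eq:
  assumes L: "lag L" and a: "kv a \<notin> L" and u: "u \<in> L" "Re (u $ a) \<noteq> 0" "\<And>l. l \<in> L \<Longrightarrow> \<exists>t\<in>\<int>. Re (l $ a) = t * Re (u $ a)"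
  shows "L = child_of (red a L) u"
proof (intro set_eqI iffI)
  have Lb: "lag (red a L)" using lag_red L a by blast
  have mem: "q \<in> L" if q: "q \<in> red a L" "om q u = 0" for q
  proof (rule lag_max[OF L])
    show "q \<in> glat" using lag_glat[OF Lb] q by blast
    fix l assume "l \<in> L"
    then obtain t q' where "q' \<in> red a L" "l = t *\<^sub>R u + q'" using child_structure[OF L a u] by blast
    then show "om l q = 0" using q om_commute[of u q] lag_iso[OF Lb] by (simp add: om_simps)
  qed
  fix p
  show "p \<in> child_of (red a L) u" if "p \<in> L"
    using that lag_glat[OF L] lag_iso[OF L] u(1) mem by (auto simp: child_of_def)
  show "p \<in> L" if p: "p \<in> child_of (red a L) u"
  proof (rule lag_max[OF L])
    show "p \<in> glat" using p by (simp add: child_of_def)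
    fix l assume "l \<in> L"
    then obtain t q' where q': "q' \<in> red a L" "l = t *\<^sub>R u + q'" "om q' u = 0" using child_structure[OF L a u] by blast
    then have "om p q' = 0" "om p u = 0" using p by (auto simp: child_of_def)
    then show "om l p = 0" using q' om_commute[of u p] om_commute[of q' p] by (simp add: om_simps)
  qed
qed

text \<open>So u matters only modulo the kernel of its own functional on Lb: of a lattice correction
  n, only the integer obtained by pairing with the primitive functional \<alpha> survives.\<close>

lemma child_of_shift:
  assumes Lb: "lag Lb" and n: "n \<in> Lb" "om n u = 0"
  shows "child_of Lb (u - n) = child_of Lb u"
proof -
  have *: "om q (u - n) = om q u" if "q \<in> Lb" for q using lag_iso[OF Lb that n(1)] by (simp add: om_simps)
  have "om p (u - n) = 0 \<and> (\<forall>q\<in>Lb. om q (u - n) = 0 \<longrightarrow> om p q = 0)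
      \<longleftrightarrow> om p u = 0 \<and> (\<forall>q\<in>Lb. om q u = 0 \<longrightarrow> om p q = 0)" for p
  proof -
    have "(\<forall>q\<in>Lb. om q u = 0 \<longrightarrow> om p q = 0) \<Longrightarrow> om p (u - n) = om p u"
      using n by (simp add: om_diff_right)
    then show ?thesis using * by metis
  qed
  then show ?thesis unfolding child_of_def by blast
qed

definition kap :: "(complex ^ 'n) set \<Rightarrow> 'n::finite \<Rightarrow> real ^ 'n" where
  "kap L j = (SOME \<kappa>. \<kappa> \<in> integer_lattice \<and> kv j = comb (bas L) \<kappa>)"

lemma kap: assumes "lag L" "kv j \<in> L" shows "kap L j \<in> integer_lattice" "kv j = comb (bas L) (kap L j)"
  using someI_ex[of "\<lambda>\<kappa>. \<kappa> \<in> integer_lattice \<and> kv j = comb (bas L) \<kappa>"] lag_kv_comb[OF assms] unfolding kap_def by blast+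

text \<open>The functionals on the parent that can come from a child: the generator is orthogonal to
  the vertical vectors which the child still contains, and the value c on \<open>kv a\<close> is, up
  to sign and content, the a-th horizontal coordinate of the generator.\<close>

definition slice :: "'n::finite \<Rightarrow> 'n set \<Rightarrow> (complex ^ 'n) set \<Rightarrow> real \<Rightarrow> (real ^ 'n) set" where
  "slice a I Lb c = {\<alpha> \<in> integer_lattice. kap Lb a \<bullet> \<alpha> = c \<and> (\<forall>j. j \<notin> I \<and> j \<noteq> a \<longrightarrow> kap Lb j \<bullet> \<alpha> = 0)}"

definition paired :: "(complex ^ 'n) set \<Rightarrow> real ^ 'n \<Rightarrow> complex ^ 'n \<Rightarrow> bool" where
  "paired Lb \<beta> u \<longleftrightarrow> u \<in> glat \<and> (\<forall>i. om (bas Lb $ i) u = \<beta> $ i)"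

definition ufun :: "(complex ^ 'n) set \<Rightarrow> real ^ 'n \<Rightarrow> complex ^ 'n" where
  "ufun Lb \<beta> = (SOME u. paired Lb \<beta> u)"

lemma ufun: "paired Lb \<beta> u \<Longrightarrow> paired Lb \<beta> (ufun Lb \<beta>)"
  unfolding ufun_def by (rule someI)

lemma paired_comb: "paired Lb \<beta> u \<Longrightarrow> om (comb (bas Lb) t) u = t \<bullet> \<beta>"
  by (simp add: paired_def om_comb_left inner_vec_def)

text \<open>A child \<open>L\<close> of \<open>Lb\<close> is generated by a corank one sublattice of \<open>Lb\<close>, the kernel of the primitive
  functional \<open>\<alpha>\<close>, and one further vector, which is determined by \<open>g\<close> and \<open>\<nu>\<close> modulo that sublattice.\<close>

definition encodes :: "(complex ^ 'n) set \<Rightarrow> (complex ^ 'n) set \<Rightarrow> nat \<Rightarrow> real ^ 'n \<Rightarrow> int \<Rightarrow> bool" where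
  "encodes Lb L g \<alpha> \<nu> \<longleftrightarrow> (\<exists>n b. n \<in> integer_lattice \<and> b \<in> integer_lattice \<and> b \<bullet> \<alpha> = 1 \<and> of_int \<nu> = n \<bullet> \<alpha> \<and>
     paired Lb (real g *\<^sub>R \<alpha>) (ufun Lb (real g *\<^sub>R \<alpha>)) \<and>
     L = child_of Lb (ufun Lb (real g *\<^sub>R \<alpha>) + comb (bas Lb) n) \<and>
     (\<forall>l\<in>L. \<exists>t\<in>\<int>. \<exists>q\<in>Lb. l = t *\<^sub>R (ufun Lb (real g *\<^sub>R \<alpha>) + comb (bas Lb) n) + q \<and> om q (ufun Lb (real g *\<^sub>R \<alpha>)) = 0))"

text \<open>The values of the generator u on Lb form a functional \<beta> with content g and
  primitive part \<alpha>; they determine u modulo Lb. What remains of the difference from the fixed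
  representative \<open>ufun\<close> is recorded by \<nu>. The number c is nonzero because u has a
  nonzero a-th horizontal coordinate.\<close>

lemma child_encode:
  assumes Lb: "Lb \<in> LL I" and L: "L \<in> children a I Lb" and aI: "a \<notin> I"
  shows "\<exists>g \<alpha> \<nu>. g \<ge> 1 \<and> encodes Lb L g \<alpha> \<nu> \<and> (\<exists>c\<in>\<int> - {0}. \<alpha> \<in> slice a I Lb c)"
proof -
  have lagL: "lag L" and a: "kv a \<notin> L" and red: "red a L = Lb" using L by (auto simp: children_def LL_def)
  have lagb: "lag Lb" using Lb by (simp add: LL_def)
  have kvb: "kv j \<in> Lb" if "j \<notin> I" for j using Lb that by (simp add: LL_def)
  obtain u where u: "u \<in> L" "Re (u $ a) \<noteq> 0" "\<And>l. l \<in> L \<Longrightarrow> \<exists>t\<in>\<int>. Re (l $ a) = t * Re (u $ a)"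
    using child_generator[OF lagL a] by blast
  have ug: "u \<in> glat" using lag_glat[OF lagL u(1)] .
  define \<beta> where "\<beta> = (\<chi> i. om (bas Lb $ i) u)"
  have p: "paired Lb \<beta> u" by (simp add: paired_def \<beta>_def ug)
  have ka: "kap Lb a \<bullet> \<beta> = - Re (u $ a)"
    using paired_comb[OF p, of "kap Lb a"] kap(2)[OF lagb kvb[OF aI]] om_kv_left[of a u] by simp
  have "\<beta> \<in> integer_lattice"
    using om_glat[OF lag_glat[OF lagb bas(2)[OF lagb]] ug] by (simp add: \<beta>_def integer_lattice_def)
  moreover have "\<beta> \<noteq> 0" using ka u by auto
  ultimately obtain g \<alpha> b where g: "g \<ge> 1" "\<alpha> \<in> integer_lattice" "b \<in> integer_lattice" "\<beta> = real g *\<^sub>R \<alpha>" "b \<bullet> \<alpha> = 1"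
    using content_exists by metis
  let ?u = "ufun Lb \<beta>"
  have pu: "paired Lb \<beta> ?u" by (rule ufun[OF p])
  have "u - ?u \<in> Lb"
  proof (rule lag_max[OF lagb])
    show "u - ?u \<in> glat" using ug pu by (auto simp: paired_def)
    fix q assume "q \<in> Lb"
    then obtain t where "q = comb (bas Lb) t" using bas(3)[OF lagb] by blast
    then show "om q (u - ?u) = 0" using paired_comb[OF p, of t] paired_comb[OF pu, of t] by (simp add: om_simps)
  qed
  then obtain n where n: "n \<in> integer_lattice" "u - ?u = comb (bas Lb) n" using bas(3)[OF lagb] by blast
  have uu: "?u + comb (bas Lb) n = u" using n by (metis add_diff_cancel_left' add.commute diff_add_cancel)
  have nL: "comb (bas Lb) n \<in> Lb" using bas(3)[OF lagb] n by blast
  obtain \<nu> where \<nu>: "of_int \<nu> = n \<bullet> \<alpha>" using integer_lattice_inner[OF n(1) g(2)] by (metis Ints_cases)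
  have omq: "om q ?u = om q u" if "q \<in> Lb" for q
    using lag_iso[OF lagb that nL] unfolding uu[symmetric] by (simp add: om_simps)
  have "\<exists>t\<in>\<int>. \<exists>q\<in>Lb. l = t *\<^sub>R u + q \<and> om q ?u = 0" if "l \<in> L" for l
    using child_structure[OF lagL a u that] omq unfolding red by metis
  then have d: "\<forall>l\<in>L. \<exists>t\<in>\<int>. \<exists>q\<in>Lb. l = t *\<^sub>R u + q \<and> om q (ufun Lb (real g *\<^sub>R \<alpha>)) = 0"
    unfolding g(4) by blast
  have U: "ufun Lb (real g *\<^sub>R \<alpha>) + comb (bas Lb) n = u" using uu unfolding g(4) .
  have c: "L = child_of Lb u" using child_of_eq[OF lagL a u] unfolding red .
  have "encodes Lb L g \<alpha> \<nu>"
    unfolding encodes_def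
    apply (rule exI[of _ n])
    apply (rule exI[of _ b])
    using n(1) g(3,5) \<nu> pu[unfolded g(4)] c d unfolding U by (intro conjI)
  moreover have "\<alpha> \<in> slice a I Lb (kap Lb a \<bullet> \<alpha>)"
  proof -
    have "kap Lb j \<bullet> \<alpha> = 0" if j: "j \<notin> I" "j \<noteq> a" for j
    proof -
      have "kv j \<in> L" using L j by (auto simp: children_def LL_def)
      then have "om (kv j) u = 0" using lag_iso[OF lagL] u by blast
      then have "kap Lb j \<bullet> \<beta> = 0"
        using paired_comb[OF p, of "kap Lb j"] kap(2)[OF lagb kvb[OF j(1)]] by simp
      then show ?thesis using g by simp
    qed
    then show ?thesis using g by (simp add: slice_def)
  qed
  moreover have "kap Lb a \<bullet> \<alpha> \<noteq> 0" using ka g u by auto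
  moreover have "kap Lb a \<bullet> \<alpha> \<in> \<int>" using integer_lattice_inner g kap(1)[OF lagb kvb[OF aI]] by blast
  ultimately show ?thesis using g by blast
qed

lemma encodes_inj:
  assumes Lb: "lag Lb" and "encodes Lb L1 g \<alpha> \<nu>" "encodes Lb L2 g \<alpha> \<nu>"
  shows "L1 = L2"
proof -
  let ?u = "ufun Lb (real g *\<^sub>R \<alpha>)"
  obtain n1 where n1: "n1 \<in> integer_lattice" "of_int \<nu> = n1 \<bullet> \<alpha>" "L1 = child_of Lb (?u + comb (bas Lb) n1)"
    and p: "paired Lb (real g *\<^sub>R \<alpha>) ?u" using assms(2) unfolding encodes_def by blast
  obtain n2 where n2: "n2 \<in> integer_lattice" "of_int \<nu> = n2 \<bullet> \<alpha>" "L2 = child_of Lb (?u + comb (bas Lb) n2)"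
    using assms(3) unfolding encodes_def by blast
  have mem: "comb (bas Lb) n1 \<in> Lb" "comb (bas Lb) (n1 - n2) \<in> Lb" using bas(3)[OF Lb] n1 n2 by blast+
  have "om (comb (bas Lb) (n1 - n2)) (?u + comb (bas Lb) n1) = 0"
    using n1(2) n2(2) lag_iso[OF Lb mem(2,1)] paired_comb[OF p, of "n1 - n2"] by (simp add: om_simps inner_diff_left)
  from child_of_shift[OF Lb mem(2) this] show ?thesis unfolding n1(3) n2(3) by (simp add: comb_diff)
qed

text \<open>Real part of the pairing whose modulus bounds the ratio of the covolumes of child and
  parent from below. A change of the generator by an element of the parent adds the integer \<nu> to
  it.\<close>

definition cre :: "('n::finite \<Rightarrow> real) \<Rightarrow> real ^ 'n ^ 'n \<Rightarrow> (complex ^ 'n) set \<Rightarrow> nat \<Rightarrow> real ^ 'n \<Rightarrow> real" where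
  "cre M X Lb g \<alpha> = Re (bdot (rho M X (ufun Lb (real g *\<^sub>R \<alpha>))) (xsol M X (bas Lb) \<alpha>))"

text \<open>Both bounds come from one complex number, the pairing of the generator with x. Its
  imaginary part is g |x|^2 by \<open>Im_bdot_proportional\<close>, its real part is
  \<open>cre\<close> plus \<nu>. A child of small covolume is thus constrained in \<alpha> and,
  separately, in \<nu>.\<close>

lemma encodes_lvol:
  assumes X: "transpose X = X" and M: "\<And>i. M i > 0" and Lb: "lag Lb" and L: "lag L" and g: "g \<ge> 1" and e: "encodes Lb L g \<alpha> \<nu>"
  shows "lvol M X Lb * (real g * (norm (xsol M X (bas Lb) \<alpha>))\<^sup>2) \<le> lvol M X L"
    and "lvol M X Lb * \<bar>cre M X Lb g \<alpha> + of_int \<nu>\<bar> \<le> lvol M X L"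
proof -
  let ?u = "ufun Lb (real g *\<^sub>R \<alpha>)" and ?W = "bas Lb" and ?x = "xsol M X (bas Lb) \<alpha>"
  obtain n b where n: "n \<in> integer_lattice" "b \<in> integer_lattice" "b \<bullet> \<alpha> = 1" "of_int \<nu> = n \<bullet> \<alpha>"
    and p: "paired Lb (real g *\<^sub>R \<alpha>) ?u"
    and s: "\<And>l. l \<in> L \<Longrightarrow> \<exists>t\<in>\<int>. \<exists>q\<in>Lb. l = t *\<^sub>R (?u + comb ?W n) + q \<and> om q ?u = 0"
    using e unfolding encodes_def by blast
  let ?v = "?u + comb ?W n"
  have gW: "gframe ?W" using bas(1)[OF Lb] .
  have x: "rhom M X ?W *v ?x = cvec \<alpha>" by (rule xsol(1)[OF X M gW])
  have "\<forall>i. \<exists>t \<tau>. t \<in> \<int> \<and> \<tau> \<in> integer_lattice \<and> bas L $ i = t *\<^sub>R ?v + comb ?W \<tau> \<and> \<tau> \<bullet> \<alpha> = 0"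
  proof
    fix i
    obtain t q where t: "t \<in> \<int>" "q \<in> Lb" "bas L $ i = t *\<^sub>R ?v + q" "om q ?u = 0" using s[OF bas(2)[OF L]] by metis
    obtain \<tau> where \<tau>: "\<tau> \<in> integer_lattice" "q = comb ?W \<tau>" using bas(3)[OF Lb] t by blast
    have "\<tau> \<bullet> \<alpha> = 0" using paired_comb[OF p, of \<tau>] t \<tau> g by simp
    then show "\<exists>t \<tau>. t \<in> \<int> \<and> \<tau> \<in> integer_lattice \<and> bas L $ i = t *\<^sub>R ?v + comb ?W \<tau> \<and> \<tau> \<bullet> \<alpha> = 0" using t \<tau> by blast
  qed
  then obtain t \<tau> where t\<tau>: "\<And>i. t i \<in> \<int>" "\<And>i. \<tau> i \<in> integer_lattice" "\<And>i. bas L $ i = t i *\<^sub>R ?v + comb ?W (\<tau> i)" "\<And>i. \<tau> i \<bullet> \<alpha> = 0"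
    by metis
  have iso: "isotr ?W" "det ?W \<noteq> 0" using gW by (auto simp: gframe_def)
  have "isotr (bas L)" "det (bas L) \<noteq> 0" using bas(1)[OF L] by (auto simp: gframe_def)
  then have dets: "det (rhom M X ?W) \<noteq> 0" "det (rhom M X (bas L)) \<noteq> 0"
    using det_rhom_nz[where M = M, OF X M] iso by blast+
  have main: "lvol M X Lb * cmod (bdot (rho M X ?v) ?x) \<le> lvol M X L"
    unfolding lvol_def by (rule det_frame_lower[OF t\<tau>(3) t\<tau>(1,2,4) n(2,3) dets x])
  have eq: "bdot (rho M X ?v) ?x = bdot (rho M X ?u) ?x + of_int \<nu>"
    using bdot_comb_sol[OF x, of n] n by (simp add: rho_add bdot_add_left rho_comb) (metis of_real_of_int_eq)
  have "Im (bdot (rho M X ?u) ?x) = real g * (norm ?x)\<^sup>2"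
  proof (rule Im_bdot_proportional[OF isotr_rhom[OF X M iso(1)] dets(1) x])
    show "om (rhom M X ?W $ i) (rho M X ?u) = real g * \<alpha> $ i" for i
      using p by (simp add: rhom_def om_rho[OF X M] paired_def)
  qed
  then have im: "real g * (norm ?x)\<^sup>2 \<le> cmod (bdot (rho M X ?v) ?x)"
    using abs_Im_le_cmod[of "bdot (rho M X ?v) ?x"] by (simp add: eq)
  have re: "\<bar>cre M X Lb g \<alpha> + of_int \<nu>\<bar> \<le> cmod (bdot (rho M X ?v) ?x)"
    using abs_Re_le_cmod[of "bdot (rho M X ?v) ?x"] by (simp add: eq cre_def)
  have "lvol M X Lb \<ge> 0" by (simp add: lvol_def)
  then show "lvol M X Lb * (real g * (norm ?x)\<^sup>2) \<le> lvol M X L" "lvol M X Lb * \<bar>cre M X Lb g \<alpha> + of_int \<nu>\<bar> \<le> lvol M X L"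
    using main im re by (meson mult_left_mono order_trans)+
qed

section \<open>Linear images of Lebesgue measure\<close>

lemma continuous_matrix_mult [continuous_intros]:
  fixes A :: "'a::real_normed_field ^ 'n ^ 'm"
  assumes "continuous_on S f" shows "continuous_on S (\<lambda>y. A *v f y)"
  unfolding matrix_vector_mult_def
  by (intro continuous_on_vec_lambda continuous_intros continuous_on_component assms)

lemma continuous_cvec [continuous_intros]:
  assumes "continuous_on S f" shows "continuous_on S (\<lambda>y. cvec (f y))"
  unfolding cvec_def by (intro continuous_on_vec_lambda continuous_intros continuous_on_component assms)

lemma measurable_matrix_mult [measurable (raw)]:
  fixes A :: "'a::{real_normed_field,second_countable_topology} ^ 'n ^ 'm"
  assumes "f \<in> borel_measurable N" shows "(\<lambda>y. A *v f y) \<in> borel_measurable N"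
  using measurable_compose[OF assms borel_measurable_continuous_onI[of "\<lambda>x. A *v x"]]
  by (simp add: continuous_intros)

lemma measurable_cvec [measurable (raw)]:
  assumes "f \<in> borel_measurable N" shows "(\<lambda>y. cvec (f y)) \<in> borel_measurable N"
  using measurable_compose[OF assms borel_measurable_continuous_onI[of "\<lambda>x. cvec x"]]
  by (simp add: continuous_intros)

lemma cvec_add: "cvec (x + y) = cvec x + cvec y" and cvec_diff: "cvec (x - y) = cvec x - cvec y"
  and cvec_scaleR: "cvec (c *\<^sub>R x) = of_real c *s cvec x"
  by (auto simp: cvec_def vec_eq_iff)

text \<open>For nonsingular A this turns out to be 1 / |det A|. The sign is the one that appears
  when \<open>indicator unit_cube (x - A *v y)\<close> is translated back to x = 0.\<close>

definition scaling :: "real ^ 'n ^ 'n \<Rightarrow> ennreal" where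
  "scaling A = (\<integral>\<^sup>+y. indicator unit_cube (- (A *v y)) \<partial>lborel)"

text \<open>A translation-invariant functional is a multiple of the Lebesgue integral: average it over
  the translates by the unit cube.\<close>

lemma nn_integral_linear_scaling:
  fixes g :: "real ^ 'n \<Rightarrow> ennreal"
  assumes A: "det A \<noteq> 0" and g [measurable]: "g \<in> borel_measurable borel"
  shows "(\<integral>\<^sup>+y. g (A *v y) \<partial>lborel) = scaling A * (\<integral>\<^sup>+y. g y \<partial>lborel)"
proof -
  have inv: "(\<integral>\<^sup>+y. h (A *v y + w) \<partial>lborel) = (\<integral>\<^sup>+y. h (A *v y) \<partial>lborel)"
    if [measurable]: "h \<in> borel_measurable borel" for h :: "real ^ 'n \<Rightarrow> ennreal" and w
  proof -
    obtain z where "A *v z = w" using det_nz_solve[OF A] by blast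
    then show ?thesis
      using nn_integral_translate[of "\<lambda>y. h (A *v y)" z] by (simp add: matrix_vector_right_distrib)
  qed
  have "(\<integral>\<^sup>+y. g (A *v y) \<partial>lborel) = (\<integral>\<^sup>+x. indicator unit_cube (x :: real ^ 'n) * (\<integral>\<^sup>+y. g (A *v y) \<partial>lborel) \<partial>lborel)"
    by (subst nn_integral_multc) (simp_all add: emeasure_unit_cube)
  also have "\<dots> = (\<integral>\<^sup>+x. \<integral>\<^sup>+y. indicator unit_cube x * g (A *v y + x) \<partial>lborel \<partial>lborel)"
    by (intro nn_integral_cong) (simp add: inv nn_integral_cmult)
  also have "\<dots> = (\<integral>\<^sup>+y. \<integral>\<^sup>+x. indicator unit_cube x * g (A *v y + x) \<partial>lborel \<partial>lborel)"
    by (rule lborel_pair.Fubini') measurable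
  also have "\<dots> = (\<integral>\<^sup>+y. \<integral>\<^sup>+x. indicator unit_cube (x - A *v y) * g x \<partial>lborel \<partial>lborel)"
  proof (rule nn_integral_cong)
    fix y
    show "(\<integral>\<^sup>+x. indicator unit_cube x * g (A *v y + x) \<partial>lborel) = (\<integral>\<^sup>+x. indicator unit_cube (x - A *v y) * g x \<partial>lborel)"
      using nn_integral_translate[of "\<lambda>x. indicator unit_cube (x - A *v y) * g x" "A *v y"] by (simp add: add.commute)
  qed
  also have "\<dots> = (\<integral>\<^sup>+x. \<integral>\<^sup>+y. indicator unit_cube (x - A *v y) * g x \<partial>lborel \<partial>lborel)"
    by (rule lborel_pair.Fubini') measurable
  also have "\<dots> = (\<integral>\<^sup>+x. scaling A * g x \<partial>lborel)"
  proof (rule nn_integral_cong)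
    fix x
    have "(\<integral>\<^sup>+y. indicator unit_cube (x - A *v y) \<partial>lborel) = scaling A"
      using inv[of "\<lambda>z. indicator unit_cube (- z)" "- x"] by (simp add: scaling_def)
    then show "(\<integral>\<^sup>+y. indicator unit_cube (x - A *v y) * g x \<partial>lborel) = scaling A * g x"
      by (simp add: nn_integral_multc)
  qed
  finally show ?thesis by (simp add: nn_integral_cmult)
qed

lemma scaling_mult:
  assumes "det A \<noteq> 0" "det B \<noteq> 0"
  shows "scaling (A ** B) = scaling A * scaling B"
proof -
  have "scaling (A ** B) = (\<integral>\<^sup>+y. indicator unit_cube (- (A *v (B *v y))) \<partial>lborel)"
    by (simp add: scaling_def matrix_vector_mul_assoc)
  also have "\<dots> = scaling B * (\<integral>\<^sup>+y. indicator unit_cube (- (A *v y)) \<partial>lborel)"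
    by (rule nn_integral_linear_scaling[OF assms(2)]) measurable
  finally show ?thesis by (simp add: scaling_def mult.commute)
qed

lemma scaling_1: "scaling (mat 1 :: real ^ 'n ^ 'n) = 1"
proof -
  have "(\<integral>\<^sup>+y. indicator unit_cube ((mat 1 :: real ^ 'n ^ 'n) *v y) \<partial>lborel) = scaling (mat 1 :: real ^ 'n ^ 'n) * (\<integral>\<^sup>+y. indicator unit_cube (y :: real ^ 'n) \<partial>lborel)"
    by (rule nn_integral_linear_scaling) auto
  then show ?thesis by (simp add: emeasure_unit_cube)
qed

lemma scaling_finite:
  assumes "det A \<noteq> 0" shows "scaling A \<noteq> 0" "scaling A \<noteq> \<infinity>"
proof -
  obtain R where R: "A ** R = mat 1" using assms invertible_det_nz[of A] unfolding invertible_def by blast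
  then have "det R \<noteq> 0" by (metis det_I det_mul mult_zero_right zero_neq_one)
  from scaling_mult[OF assms this] have "scaling A * scaling R = 1" by (simp add: R scaling_1)
  then show "scaling A \<noteq> 0" "scaling A \<noteq> \<infinity>" by (auto simp: ennreal_top_mult split: if_splits)
qed

lemma ennreal_square_eq_1: assumes "x * x = (1 :: ennreal)" shows "x = 1"
proof (cases x)
  case (real r)
  then have "ennreal (r * r) = ennreal 1" using assms by (simp add: ennreal_mult)
  then have "r * r = 1" using real by (subst (asm) ennreal_inj) auto
  then have "r = 1" using real square_eq_1_iff[of r] by auto
  then show ?thesis using real by simp
qed (use assms in simp)

lemma scaling_idem: assumes "det A \<noteq> 0" "scaling A * scaling A = scaling A" shows "scaling A = 1"
  using scaling_finite[OF assms(1)] assms(2)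
  by (cases "scaling A") (auto simp: ennreal_mult[symmetric] ennreal_1[symmetric] simp del: ennreal_1)

lemma Basis_axis: "(Basis :: (real ^ 'n) set) = (\<lambda>i. axis i 1) ` UNIV"
  by (auto simp: Basis_vec_def)

lemma scaling_diagonal:
  fixes A :: "real ^ 'n ^ 'n"
  assumes A: "\<And>i j. i \<noteq> j \<Longrightarrow> A $ i $ j = 0" and d: "det A \<noteq> 0"
  shows "scaling A * ennreal \<bar>det A\<bar> = 1"
proof -
  have detA: "det A = (\<Prod>i\<in>UNIV. A $ i $ i)" by (rule det_diagonal) (use A in auto)
  then have nz: "A $ i $ i \<noteq> 0" for i using d by auto
  define c where "c j = (A *v j) \<bullet> j" for j
  have cax: "c (axis i 1) = A $ i $ i" for i
    by (simp add: c_def inner_axis matrix_vector_mult_basis column_def)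
  have cnz: "c j \<noteq> 0" if "j \<in> Basis" for j using that nz cax by (auto simp: Basis_axis)
  have T: "0 + (\<Sum>j\<in>Basis. (c j * (x \<bullet> j)) *\<^sub>R j) = A *v x" for x
  proof -
    have "(\<Sum>j\<in>Basis. (c j * (x \<bullet> j)) *\<^sub>R j) = (\<Sum>i\<in>UNIV. (A $ i $ i * x $ i) *\<^sub>R axis i 1)"
      unfolding Basis_axis by (subst sum.reindex) (auto simp: inj_on_def axis_eq_axis cax inner_axis)
    moreover have "(A *v x) $ k = A $ k $ k * x $ k" for k
    proof -
      have "(\<Sum>j\<in>UNIV. A $ k $ j * x $ j) = (\<Sum>j\<in>UNIV. if j = k then A $ k $ k * x $ k else 0)"
        by (intro sum.cong refl) (use A in auto)
      then show ?thesis by (simp add: matrix_vector_mult_def)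
    qed
    ultimately show ?thesis by (simp add: vec_eq_iff axis_def if_distrib cong: if_cong)
  qed
  have p: "(\<Prod>j\<in>Basis. \<bar>c j\<bar>) = \<bar>det A\<bar>"
    unfolding Basis_axis detA by (subst prod.reindex) (auto simp: inj_on_def axis_eq_axis cax abs_prod)
  have "lborel = density (distr lborel borel (\<lambda>x. A *v x)) (\<lambda>_. ennreal \<bar>det A\<bar>)"
    using lborel_affine_euclidean[of c 0, OF cnz] unfolding T p by simp
  then have "(\<integral>\<^sup>+y. indicator unit_cube (y :: real ^ 'n) \<partial>lborel) = (\<integral>\<^sup>+y. indicator unit_cube (y :: real ^ 'n) \<partial>density (distr lborel borel (\<lambda>x. A *v x)) (\<lambda>_. ennreal \<bar>det A\<bar>))"
    by simp
  also have "\<dots> = ennreal \<bar>det A\<bar> * (\<integral>\<^sup>+y. indicator unit_cube (A *v y) \<partial>lborel)"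
    by (subst nn_integral_density, simp, simp, subst nn_integral_distr, simp, simp, subst nn_integral_cmult) simp_all
  also have "(\<integral>\<^sup>+y. indicator unit_cube (A *v y) \<partial>lborel) = scaling A"
    using nn_integral_linear_scaling[OF d, of "indicator unit_cube"] by (simp add: emeasure_unit_cube)
  finally show ?thesis by (simp add: emeasure_unit_cube mult.commute)
qed

text \<open>By multiplicativity only elementary matrices matter. A swap is an involution, so its
  factor squares to 1. A shear is conjugate to its own square by the diagonal matrix that doubles
  one coordinate, so its factor is idempotent and hence 1.\<close>

lemma scaling_det:
  fixes A :: "real ^ 'n ^ 'n"
  shows "det A \<noteq> 0 \<longrightarrow> scaling A * ennreal \<bar>det A\<bar> = 1"
proof (rule induct_matrix_elementary[where P = "\<lambda>A. det A \<noteq> 0 \<longrightarrow> scaling A * ennreal \<bar>det A\<bar> = 1"], goal_cases mult zero_row diagonal swap1 idplus)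
  case (mult A B)
  show ?case
  proof
    assume "det (A ** B) \<noteq> 0"
    then have d: "det A \<noteq> 0" "det B \<noteq> 0" by (auto simp: det_mul)
    then show "scaling (A ** B) * ennreal \<bar>det (A ** B)\<bar> = 1"
      using mult by (simp add: scaling_mult det_mul abs_mult ennreal_mult) (metis mult.left_commute mult.right_neutral mult.assoc)
  qed
next
  case (zero_row A i)
  then show ?case using det_zero_row(2)[of i A] by simp
next
  case (diagonal A)
  then show ?case using scaling_diagonal[of A] by blast
next
  case (swap1 m n)
  let ?S = "\<chi> i j. (mat 1 :: real ^ 'n ^ 'n) $ i $ Transposition.transpose m n j"
  have *: "(\<Sum>j\<in>UNIV. (if i = Transposition.transpose m n j then 1 else 0) * x $ j) = x $ Transposition.transpose m n i" for i and x :: "real ^ 'n"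
  proof -
    have "i = Transposition.transpose m n j \<longleftrightarrow> j = Transposition.transpose m n i" for j
      by (metis transpose_involutory)
    then show ?thesis by (simp add: if_distrib[of "\<lambda>a. a * _"] cong: if_cong)
  qed
  have S: "?S *v x = (\<chi> i. x $ Transposition.transpose m n i)" for x
    unfolding vec_eq_iff by (simp add: matrix_vector_mult_def mat_def *)
  have "?S *v (?S *v x) = x" for x
    unfolding S by (simp add: vec_eq_iff)
  then have "?S ** ?S = mat 1" by (simp add: matrix_eq matrix_vector_mul_assoc)
  then have d: "det ?S * det ?S = 1" and sc: "det ?S \<noteq> 0 \<Longrightarrow> scaling ?S * scaling ?S = 1"
    using scaling_mult[of ?S ?S] scaling_1 by (metis det_I det_mul, metis)
  have "det ?S \<noteq> 0" using d by auto
  then have "scaling ?S = 1" using sc ennreal_square_eq_1 by blast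
  moreover have "\<bar>det ?S\<bar> = 1" using d square_eq_1_iff[of "det ?S"] by auto
  ultimately show ?case by simp
next
  case (idplus m n c)
  let ?E = "(\<chi> i j. if i = m \<and> j = n then c else of_bool (i = j)) :: real ^ 'n ^ 'n"
  let ?D = "\<lambda>d. (\<chi> i j. if i = j then (if i = m then d else 1) else 0) :: real ^ 'n ^ 'n"
  have E: "?E *v x = (\<chi> i. if i = m then x $ m + c * x $ n else x $ i)" for x
  proof -
    have "(\<Sum>j\<in>UNIV. (if i = m \<and> j = n then c else of_bool (i = j)) * x $ j)
       = (\<Sum>j\<in>UNIV. (if j = i then x $ j else 0) + (if j = n then (if i = m then c * x $ n else 0) else 0))" for i
      using idplus by (intro sum.cong) auto
    then show ?thesis by (simp add: matrix_vector_mult_def vec_eq_iff sum.distrib)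
  qed
  have D: "?D d *v x = (\<chi> i. (if i = m then d * x $ i else x $ i))" for d x
    by (simp add: matrix_vector_mult_def vec_eq_iff if_distrib[of "\<lambda>a. a * _"] cong: if_cong)
  have "?D 2 *v (?D (1/2) *v x) = x" for x unfolding D by (simp add: vec_eq_iff)
  then have "(?D 2 ** ?D (1/2)) *v x = mat 1 *v x" for x
    by (simp only: matrix_vector_mul_assoc matrix_vector_mul_lid)
  then have DD: "?D 2 ** ?D (1/2) = mat 1" by (subst matrix_eq) (rule allI)
  have "?E *v (?E *v x) = ?D 2 *v (?E *v (?D (1/2) *v x))" for x
    unfolding D E using idplus by (simp add: vec_eq_iff algebra_simps)
  then have "(?E ** ?E) *v x = (?D 2 ** ?E ** ?D (1/2)) *v x" for x
    by (simp only: matrix_vector_mul_assoc matrix_mul_assoc)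
  then have EE: "?E ** ?E = ?D 2 ** ?E ** ?D (1/2)" by (subst matrix_eq) (rule allI)
  have dd: "det (?D 2) * det (?D (1/2)) = 1" using arg_cong[OF DD, of det] by (simp only: det_mul det_I)
  then have dnz: "det (?D 2) \<noteq> 0" "det (?D (1/2)) \<noteq> 0" by auto
  have cancel: "a * e * b = e" if "a * b = 1" for a b e :: ennreal
    using that by (metis mult.assoc mult.commute mult_1)
  have ss: "scaling (?D 2) * scaling (?D (1/2)) = 1" using scaling_mult[OF dnz] DD by (simp add: scaling_1)
  show ?case
  proof
    assume d: "det ?E \<noteq> 0"
    have "det ?E * det ?E = det ?E * (det (?D 2) * det (?D (1/2)))" using arg_cong[OF EE, of det] by (simp only: det_mul mult_ac)
    then have "det ?E = 1" using d dd by simp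
    have "scaling ?E * scaling ?E = scaling (?E ** ?E)" using scaling_mult[OF d d] by simp
    also have "\<dots> = scaling (?D 2) * scaling ?E * scaling (?D (1/2))"
      unfolding EE using d dnz by (simp only: scaling_mult det_mul mult_eq_0_iff simp_thms)
    also have "\<dots> = scaling ?E" using cancel[OF ss] .
    finally have "scaling ?E = 1" using scaling_idem d by blast
    then show "scaling ?E * ennreal \<bar>det ?E\<bar> = 1" using \<open>det ?E = 1\<close> by simp
  qed
qed

lemma emeasure_real_parallelepiped:
  fixes P :: "real ^ 'n ^ 'n"
  assumes P: "det P \<noteq> 0" and r: "\<And>i. r i \<ge> 0"
  shows "emeasure lborel {\<psi>. \<forall>i. \<bar>(P *v \<psi>) $ i - b $ i\<bar> \<le> r i} = ennreal ((\<Prod>i\<in>UNIV. 2 * r i) / \<bar>det P\<bar>)"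
proof -
  let ?S = "cbox (\<chi> i. b $ i - r i) (\<chi> i. b $ i + r i)"
  let ?T = "{\<psi>. \<forall>i. \<bar>(P *v \<psi>) $ i - b $ i\<bar> \<le> r i}"
  have mem: "P *v \<psi> \<in> ?S \<longleftrightarrow> \<psi> \<in> ?T" for \<psi>
    by (simp add: mem_box_cart abs_diff_le_iff)
  have "closed ?T" by (intro closed_Collect_all closed_Collect_le continuous_intros continuous_on_component)
  then have "emeasure lborel ?T = (\<integral>\<^sup>+\<psi>. indicator ?T \<psi> \<partial>lborel)" by (simp add: borel_closed)
  also have "\<dots> = (\<integral>\<^sup>+\<psi>. indicator ?S (P *v \<psi>) \<partial>lborel)"
    by (intro nn_integral_cong) (simp add: indicator_def mem[symmetric] del: mem_Collect_eq)
  also have "\<dots> = scaling P * emeasure lborel ?S"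
    using nn_integral_linear_scaling[OF P, of "indicator ?S"] by simp
  also have "emeasure lborel ?S = ennreal (\<Prod>i\<in>UNIV. 2 * r i)"
  proof -
    have "emeasure lborel ?S = ennreal (\<Prod>j\<in>Basis. ((\<chi> i. b $ i + r i) - (\<chi> i. b $ i - r i)) \<bullet> j)"
      using r by (intro emeasure_lborel_cbox) (auto simp: Basis_axis inner_axis add_increasing2 intro: order_trans[of _ "b $ _"])
    also have "(\<Prod>j\<in>Basis. ((\<chi> i. b $ i + r i) - (\<chi> i. b $ i - r i)) \<bullet> j) = (\<Prod>i\<in>UNIV. 2 * r i)"
      unfolding Basis_axis by (subst prod.reindex) (auto simp: inj_on_def axis_eq_axis inner_axis)
    finally show ?thesis .
  qed
  also have "scaling P = ennreal (1 / \<bar>det P\<bar>)"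
  proof (cases "scaling P")
    case (real c)
    then have "ennreal (c * \<bar>det P\<bar>) = 1" using scaling_det[of P] P by (simp add: ennreal_mult)
    then have "c * \<bar>det P\<bar> = 1" using real by (simp add: ennreal_1[symmetric] del: ennreal_1)
    then have "c = 1 / \<bar>det P\<bar>" using P by (simp add: field_simps)
    then show ?thesis using real by simp
  qed (use scaling_finite[OF P] in auto)
  finally show ?thesis using r by (simp add: ennreal_mult[symmetric] prod_nonneg)
qed

text \<open>By linearity each row splits the determinant into one with its real part and one with
  its imaginary part; keeping the larger costs a factor 2 per row.\<close>

lemma det_real_choice:
  fixes A :: "complex ^ 'n ^ 'n"
  shows "\<exists>P :: real ^ 'n ^ 'n. (\<forall>i. P $ i = (\<chi> j. Re (A $ i $ j)) \<or> P $ i = (\<chi> j. Im (A $ i $ j))) \<and> cmod (det A) \<le> 2 ^ CARD('n) * \<bar>det P\<bar>"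
proof -
  have ex: "\<exists>P. (\<forall>i\<in>S. P i = (\<chi> j. Re (A $ i $ j)) \<or> P i = (\<chi> j. Im (A $ i $ j)))
     \<and> cmod (det A) \<le> 2 ^ card S * cmod (det (\<chi> i. if i \<in> S then cvec (P i) else A $ i))" if "finite S" for S :: "'n set"
    using that
  proof induction
    case (insert k S)
    then obtain P where P: "\<forall>i\<in>S. P i = (\<chi> j. Re (A $ i $ j)) \<or> P i = (\<chi> j. Im (A $ i $ j))"
      "cmod (det A) \<le> 2 ^ card S * cmod (det (\<chi> i. if i \<in> S then cvec (P i) else A $ i))" by blast
    let ?c = "\<lambda>i. if i \<in> S then cvec (P i) else A $ i"
    let ?re = "(\<chi> j. Re (A $ k $ j)) :: real ^ 'n" and ?im = "(\<chi> j. Im (A $ k $ j)) :: real ^ 'n"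
    have "(\<chi> i. ?c i) = (\<chi> i. if i = k then cvec ?re + \<i> *s cvec ?im else ?c i)"
      using insert by (auto simp: vec_eq_iff cvec_def complex_eq_iff)
    then have "det (\<chi> i. ?c i) = det (\<chi> i. if i = k then cvec ?re else ?c i) + \<i> * det (\<chi> i. if i = k then cvec ?im else ?c i)"
      by (simp only: det_row_add det_row_mul)
    then have *: "cmod (det (\<chi> i. ?c i)) \<le> cmod (det (\<chi> i. if i = k then cvec ?re else ?c i)) + cmod (det (\<chi> i. if i = k then cvec ?im else ?c i))"
      using norm_triangle_ineq[of "det (\<chi> i. if i = k then cvec ?re else ?c i)" "\<i> * det (\<chi> i. if i = k then cvec ?im else ?c i)"]
      by (simp add: norm_mult)
    have "\<exists>w. (w = ?re \<or> w = ?im) \<and> cmod (det (\<chi> i. ?c i)) \<le> 2 * cmod (det (\<chi> i. if i = k then cvec w else ?c i))"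
    proof (cases "cmod (det (\<chi> i. if i = k then cvec ?re else ?c i)) \<ge> cmod (det (\<chi> i. if i = k then cvec ?im else ?c i))")
      case True then show ?thesis using * by (intro exI[of _ ?re]) auto
    next
      case False then show ?thesis using * by (intro exI[of _ ?im]) auto
    qed
    then obtain w where w: "w = ?re \<or> w = ?im" "cmod (det (\<chi> i. ?c i)) \<le> 2 * cmod (det (\<chi> i. if i = k then cvec w else ?c i))" by blast
    define P' where "P' i = (if i = k then w else P i)" for i
    have eq: "(\<chi> i. if i = k then cvec w else ?c i) = (\<chi> i. if i \<in> insert k S then cvec (P' i) else A $ i)"
      by (auto simp: vec_eq_iff P'_def)
    note P(2)
    also have "2 ^ card S * cmod (det (\<chi> i. ?c i)) \<le> 2 ^ card S * (2 * cmod (det (\<chi> i. if i \<in> insert k S then cvec (P' i) else A $ i)))"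
      using w(2) unfolding eq by (rule mult_left_mono) simp
    finally have "cmod (det A) \<le> 2 ^ card S * (2 * cmod (det (\<chi> i. if i \<in> insert k S then cvec (P' i) else A $ i)))" .
    moreover have "2 ^ card (insert k S) = 2 ^ card S * (2 :: real)" using insert by simp
    moreover have "\<forall>i\<in>insert k S. P' i = (\<chi> j. Re (A $ i $ j)) \<or> P' i = (\<chi> j. Im (A $ i $ j))"
    proof
      fix i assume "i \<in> insert k S"
      then show "P' i = (\<chi> j. Re (A $ i $ j)) \<or> P' i = (\<chi> j. Im (A $ i $ j))"
        using P(1) w(1) by (cases "i = k") (simp_all add: P'_def)
    qed
    ultimately show ?case by (intro exI[of _ P']) (simp only: mult.assoc)
  next
    case empty
    show ?case by (simp add: vec_lambda_eta)
  qed
  obtain P where P: "\<forall>i. P i = (\<chi> j. Re (A $ i $ j)) \<or> P i = (\<chi> j. Im (A $ i $ j))"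
     "cmod (det A) \<le> 2 ^ CARD('n) * cmod (det (\<chi> i. cvec (P i)))"
    using ex[of UNIV] by auto
  have "det (\<chi> i. cvec (P i)) = of_real (det (\<chi> i. P i))"
    by (simp add: det_def cvec_def)
  then show ?thesis using P by (intro exI[of _ "\<chi> i. P i"]) auto
qed

text \<open>Each complex inequality implies a real one for whichever part was selected in
  \<open>P\<close>. In 4^n one factor 2^n comes from the lengths of the intervals, the other from
  the choice of \<open>P\<close>.\<close>

lemma emeasure_complex_parallelepiped:
  fixes A :: "complex ^ 'n ^ 'n"
  assumes A: "det A \<noteq> 0" and r: "\<And>i. r i \<ge> 0"
  shows "emeasure lborel {\<psi>. \<forall>i. cmod ((A *v cvec \<psi>) $ i - b $ i) \<le> r i} \<le> ennreal (4 ^ CARD('n) * (\<Prod>i\<in>UNIV. r i) / cmod (det A))"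
proof -
  obtain P :: "real ^ 'n ^ 'n" where P: "\<And>i. P $ i = (\<chi> j. Re (A $ i $ j)) \<or> P $ i = (\<chi> j. Im (A $ i $ j))"
    "cmod (det A) \<le> 2 ^ CARD('n) * \<bar>det P\<bar>" using det_real_choice by blast
  have dP: "\<bar>det P\<bar> > 0" using A P(2) by (metis abs_ge_zero abs_zero le_less_trans mult_zero_right norm_le_zero_iff order_less_le verit_comp_simplify1(3))
  define c where "c = (\<chi> i. if P $ i = (\<chi> j. Re (A $ i $ j)) then Re (b $ i) else Im (b $ i))"
  have "\<bar>(P *v \<psi>) $ i - c $ i\<bar> \<le> cmod ((A *v cvec \<psi>) $ i - b $ i)" for \<psi> i
  proof (cases "P $ i = (\<chi> j. Re (A $ i $ j))")
    case True
    then have "(P *v \<psi>) $ i - c $ i = Re ((A *v cvec \<psi>) $ i - b $ i)"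
      by (simp add: c_def matrix_vector_mult_def cvec_def)
    then show ?thesis using abs_Re_le_cmod by metis
  next
    case False
    then have "P $ i = (\<chi> j. Im (A $ i $ j))" using P(1) by blast
    then have "(P *v \<psi>) $ i - c $ i = Im ((A *v cvec \<psi>) $ i - b $ i)"
      using False by (simp add: c_def matrix_vector_mult_def cvec_def)
    then show ?thesis using abs_Im_le_cmod by metis
  qed
  then have "{\<psi>. \<forall>i. cmod ((A *v cvec \<psi>) $ i - b $ i) \<le> r i} \<subseteq> {\<psi>. \<forall>i. \<bar>(P *v \<psi>) $ i - c $ i\<bar> \<le> r i}"
    by (blast intro: order_trans)
  moreover have "closed {\<psi>. \<forall>i. \<bar>(P *v \<psi>) $ i - c $ i\<bar> \<le> r i}"
    by (intro closed_Collect_all closed_Collect_le continuous_intros continuous_on_component)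
  ultimately have "emeasure lborel {\<psi>. \<forall>i. cmod ((A *v cvec \<psi>) $ i - b $ i) \<le> r i} \<le> emeasure lborel {\<psi>. \<forall>i. \<bar>(P *v \<psi>) $ i - c $ i\<bar> \<le> r i}"
    by (intro emeasure_mono) auto
  also have "\<dots> = ennreal ((\<Prod>i\<in>UNIV. 2 * r i) / \<bar>det P\<bar>)"
    using emeasure_real_parallelepiped[of P r c] dP r by simp
  also have "\<dots> \<le> ennreal (4 ^ CARD('n) * (\<Prod>i\<in>UNIV. r i) / cmod (det A))"
  proof (rule ennreal_leI)
    have "(\<Prod>i\<in>UNIV. 2 * r i) / \<bar>det P\<bar> = (2 ^ CARD('n) * (\<Prod>i\<in>UNIV. r i)) / \<bar>det P\<bar>"
      by (simp add: prod.distrib)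
    also have "\<dots> \<le> (2 ^ CARD('n) * (\<Prod>i\<in>UNIV. r i)) / (cmod (det A) / 2 ^ CARD('n))"
      using P(2) A dP r by (intro divide_left_mono mult_nonneg_nonneg prod_nonneg) (auto simp: field_simps)
    also have "\<dots> = 4 ^ CARD('n) * (\<Prod>i\<in>UNIV. r i) / cmod (det A)"
      using power_mult_distrib[of "2::real" 2 "CARD('n)"] by (simp add: mult_ac)
    finally show "(\<Prod>i\<in>UNIV. 2 * r i) / \<bar>det P\<bar> \<le> 4 ^ CARD('n) * (\<Prod>i\<in>UNIV. r i) / cmod (det A)" .
  qed
  finally show ?thesis .
qed

lemma xsol_matrix:
  assumes "transpose X = X" "\<And>i. M i > 0" "gframe W"
  obtains A where "\<And>\<beta>. xsol M X W \<beta> = A *v cvec \<beta>" "det A * det (rhom M X W) = 1"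
proof -
  have d: "det (rhom M X W) \<noteq> 0" using assms det_rhom_nz[where M=M] by (auto simp: gframe_def)
  then obtain A where A: "rhom M X W ** A = mat 1"
    using invertible_det_nz[of "rhom M X W"] unfolding invertible_def by blast
  have "xsol M X W \<beta> = A *v cvec \<beta>" for \<beta>
    using xsol(2)[where M=M, OF assms, of "A *v cvec \<beta>" \<beta>] by (simp add: matrix_vector_mul_assoc A)
  moreover have "det A * det (rhom M X W) = 1" using A by (metis det_I det_mul mult.commute)
  ultimately show thesis using that by blast
qed

definition cmat :: "complex ^ 'n ^ 'n \<Rightarrow> real ^ 'n ^ 'n" where "cmat W = (\<chi> i j. Re (W $ i $ j))"
definition kmat :: "complex ^ 'n ^ 'n \<Rightarrow> real ^ 'n ^ 'n" where "kmat W = (\<chi> i j. Im (W $ i $ j))"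

lemma rep_inner_cmat: "(\<chi> i. rep (W $ i) \<bullet> y) = cmat W *v y"
  by (simp add: vec_eq_iff cmat_def rep_def inner_vec_def matrix_vector_mult_def)

lemma kap_mats:
  assumes "kv j = comb W \<kappa>"
  shows "\<kappa> \<bullet> (cmat W *v y) = 0" "\<kappa> \<bullet> (kmat W *v y) = y $ j"
proof -
  have "\<kappa> \<bullet> (cmat W *v y) = (\<Sum>k\<in>UNIV. y $ k * Re (comb W \<kappa> $ k))"
    by (simp add: inner_vec_def matrix_vector_mult_def cmat_def comb_nth sum_distrib_left, subst sum.swap) (simp add: mult_ac)
  then show "\<kappa> \<bullet> (cmat W *v y) = 0" by (simp flip: assms)
  have "\<kappa> \<bullet> (kmat W *v y) = (\<Sum>k\<in>UNIV. y $ k * Im (comb W \<kappa> $ k))"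
    by (simp add: inner_vec_def matrix_vector_mult_def kmat_def comb_nth sum_distrib_left, subst sum.swap) (simp add: mult_ac)
  also have "\<dots> = (\<Sum>k\<in>UNIV. y $ k * (if k = j then 1 else 0))"
    by (intro sum.cong refl) (simp flip: assms, simp add: kv_def axis_def)
  also have "\<dots> = (\<Sum>k\<in>UNIV. if k = j then y $ k else 0)" by (intro sum.cong refl) simp
  finally show "\<kappa> \<bullet> (kmat W *v y) = y $ j" by simp
qed

lemma xsol_kv:
  assumes X: "transpose X = X" and M: "\<And>i. M i > 0" and W: "gframe W" and k: "kv j = comb W \<kappa>"
  shows "xsol M X W \<psi> $ j = of_real (\<kappa> \<bullet> \<psi>) / (\<i> * of_real (M j))"
proof -
  have "bdot (rho M X (kv j)) (xsol M X W \<psi>) = of_real (\<kappa> \<bullet> \<psi>)"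
    unfolding k rho_comb by (rule bdot_comb_sol[OF xsol(1)[OF X M W]])
  moreover have "bdot (rho M X (kv j)) (xsol M X W \<psi>) = Complex 0 (M j) * xsol M X W \<psi> $ j"
    unfolding rho_kv by (simp add: bdot_def axis_def if_distrib[of "\<lambda>x. x * _"] cong: if_cong)
  moreover have "Complex 0 (M j) = \<i> * of_real (M j)" by (simp add: complex_eq_iff)
  ultimately show ?thesis using M[of j] by (simp add: field_simps)
qed

lemma xsol_add:
  assumes "transpose X = X" "\<And>i. M i > 0" "gframe W"
  shows "xsol M X W (\<alpha> + \<beta>) = xsol M X W \<alpha> + xsol M X W \<beta>"
proof -
  obtain A where "\<And>\<beta>. xsol M X W \<beta> = A *v cvec \<beta>" using xsol_matrix[where M=M, OF assms] by metis
  then show ?thesis by (simp add: cvec_add matrix_vector_right_distrib)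
qed

text \<open>The components of s outside I produce an explicit solution that is itself supported
  outside I. Those in I enter through the imaginary part of the frame applied to s / M, where
  \<open>norm_solution_Im_le\<close> applies; there the lower bound m for the sides in I is
  used.\<close>

lemma xsol_perturb:
  fixes X :: "real ^ 'n ^ 'n"
  assumes X: "transpose X = X" and M: "\<And>i. M i > 0" and W: "gframe W"
    and re: "\<And>i j. j \<notin> I \<Longrightarrow> Re (W $ i $ j) = 0" and m: "m > 0" "\<And>j. j \<in> I \<Longrightarrow> m \<le> M j"
    and s: "\<And>j. \<bar>s $ j\<bar> \<le> 1" and k: "k \<in> I"
  shows "cmod (xsol M X W (cmat W *v (X *v s) + kmat W *v s) $ k) \<le> real CARD('n) / m"
proof -
  let ?\<eta> = "\<lambda>s. cmat W *v (X *v s) + kmat W *v s"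
  have sym: "X $ i $ j = X $ j $ i" for i j using X by (metis transpose_def vec_lambda_beta)
  have eta: "?\<eta> s $ i = (\<Sum>j\<in>UNIV. ((\<Sum>l\<in>UNIV. Re (W $ i $ l) * X $ l $ j) + Im (W $ i $ j)) * s $ j)" for s i
    by (simp add: matrix_vector_mult_def cmat_def kmat_def distrib_right sum.distrib sum_distrib_left sum_distrib_right,
        subst sum.swap) (simp add: mult.assoc)
  define s1 where "s1 = (\<chi> j. if j \<in> I then s $ j else 0)"
  define s2 where "s2 = (\<chi> j. if j \<in> I then 0 else s $ j)"
  have "s = s1 + s2" by (simp add: vec_eq_iff s1_def s2_def)
  then have "?\<eta> s = ?\<eta> s1 + ?\<eta> s2" by (simp add: matrix_vector_right_distrib)
  then have split: "xsol M X W (?\<eta> s) = xsol M X W (?\<eta> s1) + xsol M X W (?\<eta> s2)"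
    using xsol_add[where M=M, OF X M W] by simp
  define t where "t = (\<chi> j. s1 $ j / M j)"
  have Wi: "isotr W" "det W \<noteq> 0" using W by (auto simp: gframe_def)
  have "norm (xsol M X W (?\<eta> s1)) \<le> norm t"
  proof (rule norm_solution_Im_le[OF isotr_rhom[where M=M, OF X M Wi(1)] det_rhom_nz[where M=M, OF X M Wi]])
    have "?\<eta> s1 = (\<chi> i. \<Sum>j\<in>UNIV. Im (rhom M X W $ i $ j) * t $ j)"
      unfolding vec_eq_iff eta
    proof (intro allI)
      fix i
      have "((\<Sum>l\<in>UNIV. Re (W $ i $ l) * X $ l $ j) + Im (W $ i $ j)) * s1 $ j = Im (rhom M X W $ i $ j) * t $ j" for j
        using M[of j] by (simp add: rhom_def rho_def t_def)
      then show "(\<Sum>j\<in>UNIV. ((\<Sum>l\<in>UNIV. Re (W $ i $ l) * X $ l $ j) + Im (W $ i $ j)) * s1 $ j)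
        = (\<chi> i. \<Sum>j\<in>UNIV. Im (rhom M X W $ i $ j) * t $ j) $ i" by simp
    qed
    then show "rhom M X W *v xsol M X W (?\<eta> s1) = cvec (\<chi> i. \<Sum>j\<in>UNIV. Im (rhom M X W $ i $ j) * t $ j)"
      using xsol(1)[where M=M, OF X M W] by metis
  qed
  moreover have "norm t \<le> (\<Sum>j\<in>UNIV. \<bar>t $ j\<bar>)" by (rule norm_le_l1_cart)
  moreover have "\<dots> \<le> (\<Sum>j\<in>(UNIV::'n set). 1 / m)"
  proof (rule sum_mono)
    fix j
    show "\<bar>t $ j\<bar> \<le> 1 / m"
    proof (cases "j \<in> I")
      case True
      then show ?thesis using m(2)[OF True] s[of j] M[of j] m(1) by (simp add: t_def s1_def frac_le)
    qed (use m in \<open>simp add: t_def s1_def\<close>)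
  qed
  ultimately have 1: "norm (xsol M X W (?\<eta> s1)) \<le> real CARD('n) / m" by simp
  define z where "z = (\<chi> j. if j \<in> I then 0 else of_real (s $ j) / (\<i> * of_real (M j)))"
  have "rhom M X W *v z = cvec (?\<eta> s2)"
  proof -
    have "(rhom M X W *v z) $ i = cvec (?\<eta> s2) $ i" for i
    proof -
      have "rhom M X W $ i $ j * z $ j = of_real (((\<Sum>l\<in>UNIV. Re (W $ i $ l) * X $ l $ j) + Im (W $ i $ j)) * s2 $ j)" for j
      proof (cases "j \<in> I")
        case False
        then have "rhom M X W $ i $ j = \<i> * of_real (M j) * of_real ((\<Sum>l\<in>UNIV. Re (W $ i $ l) * X $ l $ j) + Im (W $ i $ j))"
          using re by (simp add: rhom_def rho_def complex_eq_iff)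
        then show ?thesis using False M[of j] by (simp add: z_def s2_def)
      qed (simp add: z_def s2_def)
      then show ?thesis by (simp add: matrix_vector_mult_def[of "rhom M X W"] cvec_def[of "?\<eta> s2"] eta del: vector_add_component)
    qed
    then show ?thesis by (simp add: vec_eq_iff)
  qed
  then have "xsol M X W (?\<eta> s2) = z" using xsol(2)[where M=M, OF X M W] by metis
  then have "xsol M X W (?\<eta> s) $ k = xsol M X W (?\<eta> s1) $ k" using k by (simp add: split z_def)
  then show ?thesis using order_trans[OF Finite_Cartesian_Product.norm_nth_le[of "xsol M X W (?\<eta> s1)" k] 1] by simp
qed

section \<open>Equidistribution\<close>

lemma nn_integral_count_mono_set:
  assumes "A \<subseteq> B" shows "(\<integral>\<^sup>+x. f x \<partial>count_space A) \<le> (\<integral>\<^sup>+x. f x \<partial>count_space B)"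
proof -
  have "(\<integral>\<^sup>+x. f x \<partial>count_space A) = (\<integral>\<^sup>+x. f x * indicator A x \<partial>count_space UNIV)"
    by (simp add: nn_integral_count_space_indicator)
  also have "\<dots> \<le> (\<integral>\<^sup>+x. f x * indicator B x \<partial>count_space UNIV)"
    by (rule nn_integral_mono) (use assms in \<open>auto simp: indicator_def\<close>)
  finally show ?thesis by (simp add: nn_integral_count_space_indicator)
qed

lemma nn_integral_count_inj:
  assumes "inj_on h A" "h ` A \<subseteq> B"
  shows "(\<integral>\<^sup>+x. f (h x) \<partial>count_space A) \<le> (\<integral>\<^sup>+y. f y \<partial>count_space B)"
proof -
  have "(\<integral>\<^sup>+x. f (h x) \<partial>count_space A) = (\<integral>\<^sup>+y. f y \<partial>count_space (h ` A))"
    by (rule nn_integral_bij_count_space) (use assms in \<open>auto simp: bij_betw_def\<close>)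
  also have "\<dots> \<le> (\<integral>\<^sup>+y. f y \<partial>count_space B)" by (rule nn_integral_count_mono_set[OF assms(2)])
  finally show ?thesis .
qed

lemma nn_integral_lattice_shift:
  assumes z: "z \<in> integer_lattice"
  shows "(\<integral>\<^sup>+\<alpha>. f (\<alpha> + z) \<partial>count_space integer_lattice) = (\<integral>\<^sup>+\<alpha>. f \<alpha> \<partial>count_space integer_lattice)"
proof (rule nn_integral_bij_count_space)
  show "bij_betw (\<lambda>\<alpha>. \<alpha> + z) integer_lattice integer_lattice"
    by (rule bij_betwI[of _ _ _ "\<lambda>\<alpha>. \<alpha> - z"]) (use z in auto)
qed

lemma cmat_lattice: "gframe W \<Longrightarrow> z \<in> integer_lattice \<Longrightarrow> cmat W *v z \<in> integer_lattice"
  and kmat_lattice: "gframe W \<Longrightarrow> z \<in> integer_lattice \<Longrightarrow> kmat W *v z \<in> integer_lattice"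
  by (auto simp: integer_lattice_def cmat_def kmat_def matrix_vector_mult_def gframe_def glat_def gints_def)

text \<open>The real and imaginary parts of a complex solution of W z = v supply y and s, up to
  signs and the factor 1 / c.\<close>

lemma frame_surjective:
  assumes "gframe W" "c \<noteq> 0"
  obtains y s where "kmat W *v s - c *\<^sub>R (cmat W *v y) = v"
proof -
  obtain z where z: "W *v z = cvec v" using det_nz_solve assms(1) unfolding gframe_def by metis
  define y where "y = (- 1 / c) *\<^sub>R (\<chi> i. Re (z $ i))"
  define s where "s = - (\<chi> i. Im (z $ i))"
  have "(kmat W *v s - c *\<^sub>R (cmat W *v y)) $ i = v $ i" for i
  proof -
    have "Re ((W *v z) $ i) = v $ i" by (simp add: z cvec_def)
    then show ?thesis using assms(2)
      by (simp add: y_def s_def matrix_vector_mult_def cmat_def kmat_def sum_distrib_left sum_negf sum_subtractf algebra_simps)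
  qed
  then have "kmat W *v s - c *\<^sub>R (cmat W *v y) = v" by (simp add: vec_eq_iff)
  then show thesis using that by blast
qed

text \<open>Modulo the integer lattice, sending (s, y) to K s - c C y is a homomorphism of tori,
  where C and K are the horizontal and vertical parts of the frame. It is onto by
  \<open>frame_surjective\<close>, so the image measure is Haar measure and the average of the
  periodised sum is the full integral.\<close>

lemma lattice_equidistribution:
  fixes g :: "real ^ 'n \<Rightarrow> ennreal"
  assumes W: "gframe W" and c: "c \<in> \<int>" "c \<noteq> 0" and g [measurable]: "g \<in> borel_measurable borel"
  shows "(\<integral>\<^sup>+s. indicator unit_cube s * (\<integral>\<^sup>+y. indicator unit_cube y *
      (\<integral>\<^sup>+\<alpha>. g (\<alpha> + (kmat W *v s - c *\<^sub>R (cmat W *v y))) \<partial>count_space integer_lattice) \<partial>lborel) \<partial>lborel)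
    = (\<integral>\<^sup>+x. g x \<partial>lborel)"
proof -
  note [simp] = countable_integer_lattice
  define \<Phi> where "\<Phi> w = (\<integral>\<^sup>+\<alpha>. g (\<alpha> + w) \<partial>count_space integer_lattice)" for w
  have [measurable]: "\<Phi> \<in> borel_measurable borel"
    unfolding \<Phi>_def by (rule borel_measurable_count_sum) auto
  have \<Phi>per: "\<Phi> (w + z) = \<Phi> w" if "z \<in> integer_lattice" for w z
    unfolding \<Phi>_def using nn_integral_lattice_shift[OF that, of "\<lambda>\<alpha>. g (\<alpha> + w)"] by (simp add: add_ac)
  define w where "w s y = kmat W *v s - c *\<^sub>R (cmat W *v y)" for s y
  have w_meas [measurable]: "(\<lambda>x. w (f x) (h x)) \<in> borel_measurable N" if [measurable]: "f \<in> borel_measurable N" "h \<in> borel_measurable N" for f h and N :: "'b measure"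
    unfolding w_def by measurable
  have w_add: "w (s + s') (y + y') = w s y + w s' y'" for s s' y y'
    by (simp add: w_def matrix_vector_right_distrib algebra_simps)
  have wy: "w 0 (axis j 1) \<in> integer_lattice" and ws: "w (axis j 1) 0 \<in> integer_lattice" for j
  proof -
    have "0 - c *\<^sub>R (cmat W *v axis j 1) \<in> integer_lattice"
      using cmat_lattice[OF W integer_lattice_axis[of j]] c by blast
    then show "w 0 (axis j 1) \<in> integer_lattice" by (simp add: w_def)
    show "w (axis j 1) 0 \<in> integer_lattice" using kmat_lattice[OF W integer_lattice_axis[of j]] by (simp add: w_def)
  qed
  define H where "H v s = (\<integral>\<^sup>+y. indicator unit_cube y * \<Phi> (w s y + v) \<partial>lborel)" for v s :: "real ^ 'n"
  have H_meas: "(\<lambda>x. H (f x) (h x)) \<in> borel_measurable N" if [measurable]: "f \<in> borel_measurable N" "h \<in> borel_measurable N" for f h and N :: "'b measure"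
    unfolding H_def by measurable
  define \<Xi> where "\<Xi> = (\<integral>\<^sup>+s. indicator unit_cube s * H 0 s \<partial>lborel)"
  have Hshift: "H v (s + s') = (\<integral>\<^sup>+y. indicator unit_cube y * \<Phi> (w (s + s') (y + y') + v) \<partial>lborel)" for v s s' y'
    unfolding H_def
  proof (rule nn_integral_cube_shift[symmetric, where f = "\<lambda>y. \<Phi> (w (s + s') y + v)"])
    show "\<Phi> (w (s + s') (y + axis a 1) + v) = \<Phi> (w (s + s') y + v)" for y a
      using \<Phi>per[OF wy[of a], of "w (s + s') y + v"] w_add[of "s + s'" 0 y "axis a 1"] by (simp add: add_ac)
  qed measurable
  \<comment> \<open>A translation v of the argument is produced by translating s and y, and cube
    averages of periodic functions do not notice that. Averaging over v afterwards unfolds the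
    lattice sum.\<close>
  have Xiv: "\<Xi> = (\<integral>\<^sup>+s. indicator unit_cube s * H v s \<partial>lborel)" for v
  proof -
    obtain y0 s0 where v: "w s0 y0 = v" using frame_surjective[OF W c(2)] unfolding w_def by metis
    have "\<Xi> = (\<integral>\<^sup>+s. indicator unit_cube s * H 0 (s + s0) \<partial>lborel)"
      unfolding \<Xi>_def
    proof (rule nn_integral_cube_shift[symmetric])
      show "H 0 (s + axis a 1) = H 0 s" for s a
      proof -
        have "w (s + axis a 1) y = w s y + w (axis a 1) 0" for y using w_add[of s "axis a 1" y 0] by simp
        then show ?thesis by (simp add: H_def \<Phi>per[OF ws])
      qed
      show "H 0 \<in> borel_measurable borel" unfolding H_def by measurable
    qed
    moreover have "H 0 (s + s0) = H v s" for s
      using Hshift[of 0 s s0 y0] by (simp only: H_def[of v] w_add v add_0_right)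
    ultimately show ?thesis by simp
  qed
  have "\<Xi> = (\<integral>\<^sup>+v. indicator unit_cube (v :: real ^ 'n) * \<Xi> \<partial>lborel)"
    by (subst nn_integral_multc) (simp_all add: emeasure_unit_cube)
  also have "\<dots> = (\<integral>\<^sup>+v. \<integral>\<^sup>+s. indicator unit_cube v * (indicator unit_cube s * H v s) \<partial>lborel \<partial>lborel)"
  proof (rule nn_integral_cong)
    fix v
    have [measurable]: "H v \<in> borel_measurable borel" unfolding H_def by measurable
    show "indicator unit_cube v * \<Xi> = (\<integral>\<^sup>+s. indicator unit_cube v * (indicator unit_cube s * H v s) \<partial>lborel)"
      unfolding Xiv[of v] by (rule nn_integral_cmult[symmetric]) measurable
  qed
  also have "\<dots> = (\<integral>\<^sup>+s. \<integral>\<^sup>+v. indicator unit_cube v * (indicator unit_cube s * H v s) \<partial>lborel \<partial>lborel)"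
  proof (rule lborel_pair.Fubini')
    have [measurable]: "(\<lambda>x. H (snd x) (fst x)) \<in> borel_measurable (lborel \<Otimes>\<^sub>M lborel)"
      by (rule H_meas) measurable
    show "(\<lambda>(s, v). indicator unit_cube v * (indicator unit_cube s * H v s)) \<in> borel_measurable (lborel \<Otimes>\<^sub>M lborel)"
      unfolding case_prod_beta by measurable
  qed
  also have "\<dots> = (\<integral>\<^sup>+s. indicator unit_cube (s :: real ^ 'n) * (\<integral>\<^sup>+x. g x \<partial>lborel) \<partial>lborel)"
  proof (rule nn_integral_cong)
    fix s
    have "(\<integral>\<^sup>+v. indicator unit_cube v * (indicator unit_cube s * H v s) \<partial>lborel)
       = indicator unit_cube s * (\<integral>\<^sup>+v. indicator unit_cube v * H v s \<partial>lborel)"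
    proof -
      have [measurable]: "(\<lambda>v. H v s) \<in> borel_measurable borel" unfolding H_def by measurable
      show ?thesis by (subst nn_integral_cmult[symmetric]) (auto simp: mult_ac)
    qed
    also have "(\<integral>\<^sup>+v. indicator unit_cube v * H v s \<partial>lborel) = (\<integral>\<^sup>+v. \<integral>\<^sup>+y. indicator unit_cube v * (indicator unit_cube y * \<Phi> (w s y + v)) \<partial>lborel \<partial>lborel)"
    proof (rule nn_integral_cong)
      fix v
      show "indicator unit_cube v * H v s = (\<integral>\<^sup>+y. indicator unit_cube v * (indicator unit_cube y * \<Phi> (w s y + v)) \<partial>lborel)"
        unfolding H_def by (rule nn_integral_cmult[symmetric]) measurable
    qed
    also have "\<dots> = (\<integral>\<^sup>+y. \<integral>\<^sup>+v. indicator unit_cube v * (indicator unit_cube y * \<Phi> (w s y + v)) \<partial>lborel \<partial>lborel)"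
      by (rule lborel_pair.Fubini') measurable
    also have "\<dots> = (\<integral>\<^sup>+y. indicator unit_cube (y :: real ^ 'n) * (\<integral>\<^sup>+x. g x \<partial>lborel) \<partial>lborel)"
    proof (rule nn_integral_cong)
      fix y
      have "(\<integral>\<^sup>+v. indicator unit_cube v * (indicator unit_cube y * \<Phi> (w s y + v)) \<partial>lborel)
         = indicator unit_cube y * (\<integral>\<^sup>+v. indicator unit_cube v * \<Phi> (w s y + v) \<partial>lborel)"
        by (subst nn_integral_cmult[symmetric]) (auto simp: mult_ac)
      also have "(\<integral>\<^sup>+v. indicator unit_cube v * \<Phi> (w s y + v) \<partial>lborel)
         = (\<integral>\<^sup>+v. \<integral>\<^sup>+\<alpha>. indicator unit_cube v * g (v + \<alpha> + w s y) \<partial>count_space integer_lattice \<partial>lborel)"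
        unfolding \<Phi>_def by (simp add: nn_integral_cmult add_ac)
      also have "\<dots> = (\<integral>\<^sup>+\<alpha>. \<integral>\<^sup>+v. indicator unit_cube v * g (v + \<alpha> + w s y) \<partial>lborel \<partial>count_space integer_lattice)"
        by (rule nn_integral_count_space_nn_integral) auto
      also have "\<dots> = (\<integral>\<^sup>+x. g (x + w s y) \<partial>lborel)"
        by (rule nn_integral_unfold_cube) measurable
      also have "\<dots> = (\<integral>\<^sup>+x. g x \<partial>lborel)" by (rule nn_integral_translate) measurable
      finally show "(\<integral>\<^sup>+v. indicator unit_cube v * (indicator unit_cube y * \<Phi> (w s y + v)) \<partial>lborel)
         = indicator unit_cube y * (\<integral>\<^sup>+x. g x \<partial>lborel)" .
    qed
    also have "\<dots> = (\<integral>\<^sup>+x. g x \<partial>lborel)"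
      by (subst nn_integral_multc) (simp_all add: emeasure_unit_cube)
    finally show "(\<integral>\<^sup>+v. indicator unit_cube v * (indicator unit_cube s * H v s) \<partial>lborel)
       = indicator unit_cube s * (\<integral>\<^sup>+x. g x \<partial>lborel)" .
  qed
  also have "\<dots> = (\<integral>\<^sup>+x. g x \<partial>lborel)"
    by (subst nn_integral_multc) (simp_all add: emeasure_unit_cube)
  finally show ?thesis unfolding \<Xi>_def H_def \<Phi>_def w_def by simp
qed

text \<open>The slice fixes the values of \<alpha> on the vertical vectors outside I, so it is too
  thin for equidistribution. It is thickened by an auxiliary s in the unit cube, along vectors that
  move those values by \<open>s $ i\<close> and move the components of x in I by O(r). The thickened
  points lie in a parallelepiped \<open>T\<close>; \<open>lattice_equidistribution\<close> and
  \<open>emeasure_complex_parallelepiped\<close> count them.\<close>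

lemma slice_average:
  fixes X :: "real ^ 'n ^ 'n"
  assumes X: "transpose X = X" and M: "\<And>i. M i > 0" and Lb: "Lb \<in> LL I" and aI: "a \<notin> I"
    and Ma: "\<And>j. j \<in> I \<Longrightarrow> M a \<le> M j" and c: "c \<in> \<int>" "c \<noteq> 0" and r: "r > 0"
  shows "(\<integral>\<^sup>+\<alpha>. \<integral>\<^sup>+y. indicator unit_cube y * indicator {y. norm (xsol M X (bas Lb) (\<alpha> - c *\<^sub>R (cmat (bas Lb) *v y))) \<le> r} y
      \<partial>lborel \<partial>count_space (slice a I Lb c))
    \<le> (if \<bar>c\<bar> \<le> r * M a then ennreal (4 ^ CARD('n) * (real CARD('n) + 1) ^ CARD('n) * lvol M X Lb * r ^ card I / (\<Prod>j\<in>-I. M j)) else 0)"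
proof -
  let ?W = "bas Lb"
  have lagb: "lag Lb" and kvb: "\<And>j. j \<notin> I \<Longrightarrow> kv j \<in> Lb" using Lb by (auto simp: LL_def)
  have W: "gframe ?W" using bas(1)[OF lagb] .
  have kapc: "kap Lb j \<bullet> (cmat ?W *v y) = 0" "kap Lb j \<bullet> (kmat ?W *v y) = y $ j" if "j \<notin> I" for j y
    using kap_mats[OF kap(2)[OF lagb kvb[OF that]]] by auto
  have xk: "xsol M X ?W \<psi> $ j = of_real (kap Lb j \<bullet> \<psi>) / (\<i> * of_real (M j))" if "j \<notin> I" for j \<psi>
    by (rule xsol_kv[where M=M, OF X M W kap(2)[OF lagb kvb[OF that]]])
  obtain A where A: "\<And>\<beta>. xsol M X ?W \<beta> = A *v cvec \<beta>" and dA: "det A * det (rhom M X ?W) = 1"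
    using xsol_matrix[where M=M, OF X M W] by metis
  let ?C = "\<lambda>y. cmat ?W *v y" and ?K = "\<lambda>y. kmat ?W *v y"
  let ?LHS = "(\<integral>\<^sup>+\<alpha>. \<integral>\<^sup>+y. indicator unit_cube y * indicator {y. norm (xsol M X ?W (\<alpha> - c *\<^sub>R ?C y)) \<le> r} y
      \<partial>lborel \<partial>count_space (slice a I Lb c))"
  show ?thesis
  proof (cases "\<bar>c\<bar> \<le> r * M a")
    \<comment> \<open>The value c on \<open>kv a\<close> alone gives x a component of modulus |c| /
      M a, which exceeds r.\<close>
    case False
    have "\<not> norm (xsol M X ?W (\<alpha> - c *\<^sub>R ?C y)) \<le> r" if "\<alpha> \<in> slice a I Lb c" for \<alpha> y
    proof -
      have "kap Lb a \<bullet> (\<alpha> - c *\<^sub>R ?C y) = c"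
        using that kapc[OF aI] by (simp add: slice_def inner_diff_right)
      then have "cmod (xsol M X ?W (\<alpha> - c *\<^sub>R ?C y) $ a) = \<bar>c\<bar> / M a"
        using M[of a] by (simp add: xk[OF aI] norm_divide norm_mult)
      moreover have "\<dots> > r" using False M[of a] by (simp add: field_simps)
      ultimately show ?thesis using Finite_Cartesian_Product.norm_nth_le[of "xsol M X ?W (\<alpha> - c *\<^sub>R ?C y)" a] by linarith
    qed
    then have "?LHS = (\<integral>\<^sup>+\<alpha>. 0 \<partial>count_space (slice a I Lb c))"
      by (intro nn_integral_cong) simp
    then show ?thesis by simp
  next
    case True
    have "\<bar>c\<bar> \<ge> 1" using c by (rule Ints_nonzero_abs_ge1)
    then have rM: "1 / M a \<le> r" using True M[of a] by (simp add: field_simps)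
    let ?n = "real CARD('n)"
    \<comment> \<open>In I the radius is r plus the perturbation n / M a, which is at most n r
      because 1 \<le> |c| \<le> r M a. Outside I the components of x are known up to
      \<open>s $ i\<close> / M i.\<close>
    define R where "R i = (if i \<in> I then (?n + 1) * r else 1 / M i)" for i
    define b where "b = (\<chi> i. if i = a then of_real c / (\<i> * of_real (M a)) else 0 :: complex ^ 'n)"
    define T where "T = {\<psi>. \<forall>i. cmod ((A *v cvec \<psi>) $ i - b $ i) \<le> R i}"
    have R0: "R i \<ge> 0" for i using r M[of i] by (simp add: R_def)
    have "closed T" unfolding T_def
      by (intro closed_Collect_all closed_Collect_le continuous_intros continuous_on_component)
    then have Tb [measurable]: "T \<in> sets borel" by (rule borel_closed)
    have inT: "(\<alpha> - c *\<^sub>R ?C y) + (?C (X *v s) + ?K s) \<in> T"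
      if s: "s \<in> unit_cube" and al: "\<alpha> \<in> slice a I Lb c" and le: "norm (xsol M X ?W (\<alpha> - c *\<^sub>R ?C y)) \<le> r" for \<alpha> y s
      unfolding T_def mem_Collect_eq A[symmetric]
    proof
      fix i
      let ?\<psi> = "\<alpha> - c *\<^sub>R ?C y" and ?\<eta> = "?C (X *v s) + ?K s"
      have s1: "0 \<le> s $ j \<and> s $ j < 1" for j using s by (simp add: unit_cube_def)
      show "cmod (xsol M X ?W (?\<psi> + ?\<eta>) $ i - b $ i) \<le> R i"
      proof (cases "i \<in> I")
        case True
        have "cmod (xsol M X ?W ?\<eta> $ i) \<le> ?n / M a"
          by (rule xsol_perturb[where M=M, OF X M W]) (use True Ma M[of a] s1 LL_Re[OF Lb bas(2)[OF lagb]] in \<open>auto simp: abs_le_iff less_imp_le intro: order_trans[of _ 0]\<close>)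
        also have "\<dots> \<le> ?n * r" using mult_left_mono[OF rM, of ?n] by simp
        finally have "cmod (xsol M X ?W ?\<eta> $ i) \<le> ?n * r" .
        moreover have "cmod (xsol M X ?W ?\<psi> $ i) \<le> r" using le Finite_Cartesian_Product.norm_nth_le order_trans by blast
        moreover have "b $ i = 0" using True aI by (auto simp: b_def)
        moreover have eqx: "xsol M X ?W (?\<psi> + ?\<eta>) $ i - b $ i = xsol M X ?W ?\<psi> $ i + xsol M X ?W ?\<eta> $ i"
          unfolding xsol_add[where M=M, OF X M W, of ?\<psi> ?\<eta>] \<open>b $ i = 0\<close> by simp
        moreover have "R i = ?n * r + r" using True by (simp add: R_def algebra_simps)
        ultimately show ?thesis unfolding eqx
          using norm_triangle_ineq[of "xsol M X ?W ?\<psi> $ i" "xsol M X ?W ?\<eta> $ i"] by linarith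
      next
        case False
        have "kap Lb i \<bullet> (?\<psi> + ?\<eta>) = (if i = a then c else 0) + s $ i"
          using al False kapc[OF False] by (auto simp: slice_def inner_diff_right inner_add_right)
        then have "xsol M X ?W (?\<psi> + ?\<eta>) $ i - b $ i = of_real (s $ i) / (\<i> * of_real (M i))"
          by (auto simp: xk[OF False] b_def add_divide_distrib)
        then show ?thesis using False s1[of i] M[of i] by (simp add: R_def norm_divide norm_mult divide_right_mono)
      qed
    qed
    define Q where "Q s = (\<integral>\<^sup>+y. indicator unit_cube y *
      (\<integral>\<^sup>+\<alpha>. indicator T (\<alpha> + (?K s - c *\<^sub>R ?C y)) \<partial>count_space integer_lattice) \<partial>lborel)" for s
    define \<Psi> where "\<Psi> s y = (\<integral>\<^sup>+\<alpha>. indicator T (\<alpha> + (?K s - c *\<^sub>R ?C y)) \<partial>count_space integer_lattice :: ennreal)" for s y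
    have \<Psi>m [measurable]: "\<Psi> s \<in> borel_measurable borel" for s
      unfolding \<Psi>_def by (rule borel_measurable_count_sum[OF countable_integer_lattice]) measurable
    have bound: "?LHS \<le> Q s" if s: "s \<in> unit_cube" for s
    proof -
      have "?LHS \<le> (\<integral>\<^sup>+\<alpha>. \<integral>\<^sup>+y. indicator unit_cube y * indicator T ((\<alpha> - c *\<^sub>R ?C y) + (?C (X *v s) + ?K s)) \<partial>lborel \<partial>count_space (slice a I Lb c))"
        by (intro nn_integral_mono mult_left_mono) (use inT[OF s] in \<open>auto simp: indicator_def\<close>)
      also have "\<dots> \<le> (\<integral>\<^sup>+\<alpha>. \<integral>\<^sup>+y. indicator unit_cube y * indicator T ((\<alpha> - c *\<^sub>R ?C y) + (?C (X *v s) + ?K s)) \<partial>lborel \<partial>count_space integer_lattice)"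
        by (rule nn_integral_count_mono_set) (auto simp: slice_def)
      also have "\<dots> = (\<integral>\<^sup>+y. \<integral>\<^sup>+\<alpha>. indicator unit_cube y * indicator T ((\<alpha> - c *\<^sub>R ?C y) + (?C (X *v s) + ?K s)) \<partial>count_space integer_lattice \<partial>lborel)"
        by (rule nn_integral_count_space_nn_integral[symmetric, OF countable_integer_lattice]) measurable
      \<comment> \<open>The part of the perturbation that involves X is a translation of y by a
        multiple of X s, so it disappears in the average over y. Only K s remains, as required for
        equidistribution.\<close>
      also have "\<dots> = (\<integral>\<^sup>+y. indicator unit_cube y * \<Psi> s (y + (- 1 / c) *\<^sub>R (X *v s)) \<partial>lborel)"
      proof (rule nn_integral_cong)
        fix y
        have eq: "(\<alpha> - c *\<^sub>R ?C y) + (?C (X *v s) + ?K s) = \<alpha> + (?K s - c *\<^sub>R ?C (y + (- 1 / c) *\<^sub>R (X *v s)))" for \<alpha>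
          using c(2) by (simp add: matrix_vector_right_distrib matrix_vector_mult_scaleR algebra_simps)
        show "(\<integral>\<^sup>+\<alpha>. indicator unit_cube y * indicator T ((\<alpha> - c *\<^sub>R ?C y) + (?C (X *v s) + ?K s)) \<partial>count_space integer_lattice)
           = indicator unit_cube y * \<Psi> s (y + (- 1 / c) *\<^sub>R (X *v s))"
          unfolding eq \<Psi>_def by (rule nn_integral_cmult) simp
      qed
      also have "\<dots> = (\<integral>\<^sup>+y. indicator unit_cube y * \<Psi> s y \<partial>lborel)"
      proof (rule nn_integral_cube_shift[OF \<Psi>m])
        fix y j
        have "0 - c *\<^sub>R ?C (axis j 1) \<in> integer_lattice"
          using cmat_lattice[OF W integer_lattice_axis[of j]] c by blast
        from nn_integral_lattice_shift[OF this, of "\<lambda>\<alpha>. indicator T (\<alpha> + (?K s - c *\<^sub>R ?C y))"]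
        show "\<Psi> s (y + axis j 1) = \<Psi> s y"
          unfolding \<Psi>_def by (simp add: matrix_vector_right_distrib algebra_simps)
      qed
      finally show ?thesis by (simp add: Q_def \<Psi>_def)
    qed
    have "?LHS = (\<integral>\<^sup>+s. indicator unit_cube (s :: real ^ 'n) * ?LHS \<partial>lborel)"
      by (subst nn_integral_multc) (simp_all add: emeasure_unit_cube)
    also have "\<dots> \<le> (\<integral>\<^sup>+s. indicator unit_cube s * Q s \<partial>lborel)"
      by (rule nn_integral_mono) (use bound in \<open>auto simp: indicator_def\<close>)
    also have "\<dots> = (\<integral>\<^sup>+x. indicator T x \<partial>lborel)"
      unfolding Q_def by (rule lattice_equidistribution[OF W c]) measurable
    also have "\<dots> = emeasure lborel T" by simp
    also have "\<dots> \<le> ennreal (4 ^ CARD('n) * (\<Prod>i\<in>UNIV. R i) / cmod (det A))"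
      unfolding T_def by (rule emeasure_complex_parallelepiped) (use dA R0 in auto)
    also have "\<dots> \<le> ennreal (4 ^ CARD('n) * (?n + 1) ^ CARD('n) * lvol M X Lb * r ^ card I / (\<Prod>j\<in>-I. M j))"
    proof (rule ennreal_leI)
      have "cmod (det A) * lvol M X Lb = 1" using dA by (simp add: lvol_def flip: norm_mult)
      then have inv: "1 / cmod (det A) = lvol M X Lb"
        by (metis divide_divide_eq_right mult_cancel_right1 mult_zero_left nonzero_eq_divide_eq zero_neq_one mult.commute)
      have "(\<Prod>i\<in>UNIV. R i) = (\<Prod>i\<in>I. R i) * (\<Prod>i\<in>-I. R i)"
        by (metis prod.subset_diff[of I UNIV] finite subset_UNIV Compl_eq_Diff_UNIV mult.commute)
      also have "(\<Prod>i\<in>I. R i) = ((?n + 1) * r) ^ card I" by (simp add: R_def)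
      also have "(\<Prod>i\<in>-I. R i) = 1 / (\<Prod>i\<in>-I. M i)" by (simp add: R_def prod_dividef)
      finally have pR: "(\<Prod>i\<in>UNIV. R i) = (?n + 1) ^ card I * r ^ card I / (\<Prod>i\<in>-I. M i)" by (simp add: power_mult_distrib)
      have "(?n + 1) ^ card I \<le> (?n + 1) ^ CARD('n)" by (rule power_increasing) (auto simp: card_mono)
      then have "(\<Prod>i\<in>UNIV. R i) \<le> (?n + 1) ^ CARD('n) * r ^ card I / (\<Prod>i\<in>-I. M i)"
        unfolding pR using r M by (intro divide_right_mono mult_right_mono prod_nonneg) (auto simp: less_imp_le)
      then have "4 ^ CARD('n) * (\<Prod>i\<in>UNIV. R i) * lvol M X Lb \<le> 4 ^ CARD('n) * ((?n + 1) ^ CARD('n) * r ^ card I / (\<Prod>i\<in>-I. M i)) * lvol M X Lb"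
        by (intro mult_right_mono mult_left_mono) (auto simp: lvol_def)
      then show "4 ^ CARD('n) * (\<Prod>i\<in>UNIV. R i) / cmod (det A) \<le> 4 ^ CARD('n) * (?n + 1) ^ CARD('n) * lvol M X Lb * r ^ card I / (\<Prod>j\<in>-I. M j)"
        unfolding inv[symmetric] by (simp add: mult_ac)
    qed
    finally show ?thesis using True by simp
  qed
qed

section \<open>Averaging over one row\<close>

lemma measurable_rowm [measurable]: "(\<lambda>y. rowm a y $ k $ j) \<in> borel_measurable borel"
  by (cases "k = a"; cases "j = a") (simp_all add: rowm_def)

lemma measurable_cvec_nth [measurable (raw)]:
  fixes f :: "'b \<Rightarrow> complex ^ 'n"
  assumes "f \<in> borel_measurable N" shows "(\<lambda>y. f y $ j) \<in> borel_measurable N"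
  using measurable_compose[OF assms borel_measurable_continuous_onI[of "\<lambda>x. x $ j"]]
  by (simp add: continuous_on_component)

lemma measurable_bdot_rho:
  fixes A :: "complex ^ 'n ^ 'n"
  assumes f [measurable]: "f \<in> borel_measurable borel"
  shows "(\<lambda>y. Re (bdot (rho M (X + rowm a y) u) (A *v cvec (f y)))) \<in> borel_measurable borel"
proof -
  have "Re (bdot (rho M (X + rowm a y) u) x) = (\<Sum>j\<in>UNIV. Re (u $ j) / M j * Re (x $ j)
      - M j * ((\<Sum>k\<in>UNIV. Re (u $ k) * (X $ k $ j + rowm a y $ k $ j)) + Im (u $ j)) * Im (x $ j))" for x :: "complex ^ 'n" and y
    by (simp add: bdot_def rho_def)
  moreover have "(\<lambda>y. Re ((A *v cvec (f y)) $ j)) \<in> borel_measurable borel"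
    "(\<lambda>y. Im ((A *v cvec (f y)) $ j)) \<in> borel_measurable borel" for j
    by measurable
  ultimately show ?thesis by (simp only:) measurable
qed

lemma nn_integral_int_shift:
  "(\<integral>\<^sup>+\<nu>. f (\<nu> + k) \<partial>count_space (UNIV::int set)) = (\<integral>\<^sup>+\<nu>. f \<nu> \<partial>count_space (UNIV::int set))"
proof (rule nn_integral_bij_count_space)
  show "bij_betw (\<lambda>\<nu>. \<nu> + k) UNIV (UNIV::int set)"
    by (rule bij_betwI[of _ _ _ "\<lambda>\<nu>. \<nu> - k"]) auto
qed

text \<open>Moving y along the axis leaves h alone and changes C at a nonzero integral rate, so C
  modulo 1 is uniform given h. The number of integral translates of a uniform variable in an
  interval of length 2 B has mean 2 B.\<close>

lemma average_shift_axis: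
  fixes C :: "real ^ 'n \<Rightarrow> real"
  assumes [measurable]: "C \<in> borel_measurable borel" "h \<in> borel_measurable borel"
    and h: "\<And>y z. h (y + z *\<^sub>R axis a 1) = h y" and C: "\<And>y z. C (y + z *\<^sub>R axis a 1) = C y - z * of_int k"
    and k: "k \<noteq> 0" and B: "B \<ge> 0"
  shows "(\<integral>\<^sup>+y. indicator unit_cube y * (h y * (\<integral>\<^sup>+\<nu>. indicator {-B..B} (C y + of_int \<nu>) \<partial>count_space (UNIV::int set))) \<partial>lborel)
     = ennreal (2 * B) * (\<integral>\<^sup>+y. indicator unit_cube y * h y \<partial>lborel)"
proof -
  define S where "S x = (\<integral>\<^sup>+\<nu>. indicator {-B..B} (x + of_int \<nu>) \<partial>count_space (UNIV::int set) :: ennreal)" for x :: real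
  have [measurable]: "S \<in> borel_measurable borel"
    unfolding S_def by (rule borel_measurable_count_sum) auto
  have Sper: "S (x - of_int k) = S x" for x
    unfolding S_def using nn_integral_int_shift[of "\<lambda>\<nu>. indicator {-B..B} (x - of_int k + of_int \<nu>)" k]
    by (simp add: algebra_simps)
  have Sint: "(\<integral>\<^sup>+v. indicator {0..<1} v * S (x + v) \<partial>lborel) = ennreal (2 * B)" for x
  proof -
    have "(\<integral>\<^sup>+v. indicator {0..<1} v * S (x + v) \<partial>lborel)
      = (\<integral>\<^sup>+v. \<integral>\<^sup>+\<nu>. indicator {0..<1} v * indicator {-B..B} (x + (v + of_int \<nu>)) \<partial>count_space (UNIV::int set) \<partial>lborel)"
      unfolding S_def by (simp add: nn_integral_cmult add_ac)
    also have "\<dots> = (\<integral>\<^sup>+\<nu>. \<integral>\<^sup>+v. indicator {0..<1} v * indicator {-B..B} (x + (v + of_int \<nu>)) \<partial>lborel \<partial>count_space (UNIV::int set))"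
      by (rule nn_integral_count_space_nn_integral) auto
    also have "\<dots> = (\<integral>\<^sup>+v. indicator {-B..B} (x + v) \<partial>lborel)"
      by (rule nn_integral_unfold_interval) measurable
    also have "\<dots> = (\<integral>\<^sup>+v. indicator {-B..B} v \<partial>lborel)"
      using nn_integral_translate[of "indicator {-B..B}" x] by (simp add: add.commute)
    also have "\<dots> = ennreal (2 * B)" using B by simp
    finally show ?thesis .
  qed
  let ?E = "\<integral>\<^sup>+y. indicator unit_cube y * (h y * S (C y)) \<partial>lborel"
  have shift: "?E = (\<integral>\<^sup>+y. indicator unit_cube y * (h y * S (C y + v)) \<partial>lborel)" for v
  proof -
    have "?E = (\<integral>\<^sup>+y. indicator unit_cube y * (h (y + (- v / of_int k) *\<^sub>R axis a 1) * S (C (y + (- v / of_int k) *\<^sub>R axis a 1))) \<partial>lborel)"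
    proof (rule nn_integral_cube_shift_axis[symmetric, where f = "\<lambda>y. h y * S (C y)"])
      show "h (y + axis a 1) * S (C (y + axis a 1)) = h y * S (C y)" for y
        using h[of y 1] C[of y 1] Sper[of "C y"] by simp
    qed measurable
    moreover have "h (y + (- v / of_int k) *\<^sub>R axis a 1) = h y" "C (y + (- v / of_int k) *\<^sub>R axis a 1) = C y + v" for y
      using k by (simp_all only: h C) (simp add: field_simps)
    ultimately show ?thesis by (simp only:)
  qed
  have "?E = (\<integral>\<^sup>+v. indicator {0..<1} (v::real) * ?E \<partial>lborel)"
    by (subst nn_integral_multc) simp_all
  also have "\<dots> = (\<integral>\<^sup>+v. \<integral>\<^sup>+y. indicator {0..<1} v * (indicator unit_cube y * (h y * S (C y + v))) \<partial>lborel \<partial>lborel)"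
  proof (rule nn_integral_cong)
    fix v :: real
    show "indicator {0..<1} v * ?E = (\<integral>\<^sup>+y. indicator {0..<1} v * (indicator unit_cube y * (h y * S (C y + v))) \<partial>lborel)"
      unfolding shift[of v] by (rule nn_integral_cmult[symmetric]) measurable
  qed
  also have "\<dots> = (\<integral>\<^sup>+y. \<integral>\<^sup>+v. indicator {0..<1} v * (indicator unit_cube y * (h y * S (C y + v))) \<partial>lborel \<partial>lborel)"
    by (rule lborel_pair.Fubini') measurable
  also have "\<dots> = (\<integral>\<^sup>+y. (indicator unit_cube y * h y) * ennreal (2 * B) \<partial>lborel)"
  proof (rule nn_integral_cong)
    fix y
    have "(\<integral>\<^sup>+v. indicator {0..<1} v * (indicator unit_cube y * (h y * S (C y + v))) \<partial>lborel)
      = (indicator unit_cube y * h y) * (\<integral>\<^sup>+v. indicator {0..<1} v * S (C y + v) \<partial>lborel)"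
      by (subst nn_integral_cmult[symmetric]) (auto simp: mult_ac)
    then show "(\<integral>\<^sup>+v. indicator {0..<1} v * (indicator unit_cube y * (h y * S (C y + v))) \<partial>lborel) = (indicator unit_cube y * h y) * ennreal (2 * B)"
      by (simp add: Sint)
  qed
  also have "\<dots> = ennreal (2 * B) * (\<integral>\<^sup>+y. indicator unit_cube y * h y \<partial>lborel)"
    by (subst nn_integral_multc) (simp_all add: mult.commute)
  finally show ?thesis unfolding S_def .
qed

lemma nn_integral_int_count:
  assumes t: "t \<ge> 0"
  shows "(\<integral>\<^sup>+c. (if \<bar>c\<bar> \<le> t then K else 0) \<partial>count_space (\<int> - {0::real})) \<le> (if 1 \<le> t then ennreal (2 * t) * K else 0)"
proof -
  define S where "S = real_of_int ` ({- \<lfloor>t\<rfloor>..\<lfloor>t\<rfloor>} - {0})"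
  have S: "{c \<in> \<int> - {0}. \<bar>c\<bar> \<le> t} = S"
    by (auto simp: S_def Ints_def abs_le_iff image_iff le_floor_iff) linarith+
  have "finite S" by (simp add: S_def)
  have "card S = card ({- \<lfloor>t\<rfloor>..\<lfloor>t\<rfloor>} - {0})" unfolding S_def by (rule card_image) (auto simp: inj_on_def)
  also have "\<dots> = nat (2 * \<lfloor>t\<rfloor>)" using t by (subst card_Diff_singleton) (auto simp: nat_diff_distrib)
  finally have cS: "real (card S) \<le> 2 * t" "t < 1 \<Longrightarrow> card S = 0" using t by auto
  have "(\<integral>\<^sup>+c. (if \<bar>c\<bar> \<le> t then K else 0) \<partial>count_space (\<int> - {0::real})) = (\<integral>\<^sup>+c. K * indicator S c \<partial>count_space (\<int> - {0::real}))"
    by (rule nn_integral_cong) (auto simp: S[symmetric] indicator_def)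
  also have "\<dots> = K * emeasure (count_space (\<int> - {0})) S"
    by (rule nn_integral_cmult_indicator) (use S in auto)
  also have "\<dots> = K * of_nat (card S)" using \<open>finite S\<close> S by (subst emeasure_count_space_finite) auto
  also have "\<dots> \<le> (if 1 \<le> t then ennreal (2 * t) * K else 0)"
  proof (cases "1 \<le> t")
    case True
    have "(of_nat (card S) :: ennreal) = ennreal (real (card S))" by (simp add: ennreal_of_nat_eq_real_of_nat)
    also have "\<dots> \<le> ennreal (2 * t)" by (rule ennreal_leI[OF cS(1)])
    finally have le: "(of_nat (card S) :: ennreal) \<le> ennreal (2 * t)" .
    show ?thesis using True mult_left_mono[OF le, of K] by (simp add: mult.commute)
  next
    case False
    then show ?thesis using cS(2) by simp
  qed
  finally show ?thesis .
qed

abbreviation Kn :: "'n::finite itself \<Rightarrow> real" where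
  "Kn TYPE('n) \<equiv> 4 ^ CARD('n) * (real CARD('n) + 1) ^ CARD('n)"

text \<open>A child of covolume at most e has a code (g, \<alpha>, \<nu>) with g |x|^2 \<le> B and
  |C + \<nu>| \<le> B. The diagonal entry of the row changes C at the integral rate g c^2, up to
  sign, without moving x, so the sum over \<nu> contributes 2 B. The other entries spread out
  \<alpha>, and \<open>slice_average\<close> with r = sqrt (B / g) counts each slice; at most 2 r M
  a values of c are possible.\<close>

lemma children_sum:
  fixes X :: "real ^ 'n ^ 'n"
  assumes X: "transpose X = X" and M: "\<And>i. M i > 0" and Lb: "Lb \<in> LL I" and aI: "a \<notin> I"
    and Ma: "\<And>j. j \<in> I \<Longrightarrow> M a \<le> M j" and e: "e > 0"
  defines "B \<equiv> e / lvol M X Lb"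
  shows "(\<integral>\<^sup>+L. \<integral>\<^sup>+y. indicator unit_cube y * indicator {y. lvol M (X + rowm a y) L \<le> e} y \<partial>lborel \<partial>count_space (children a I Lb))
    \<le> (\<integral>\<^sup>+g. (if 1 \<le> g \<and> 1 \<le> sqrt (B / real g) * M a then ennreal (4 * Kn TYPE('n) * e * M a * sqrt (B / real g) ^ (card I + 1) / (\<Prod>j\<in>-I. M j)) else 0) \<partial>count_space (UNIV :: nat set))"
proof -
  let ?W = "bas Lb" and ?V = "lvol M X Lb"
  have lagb: "lag Lb" and kva: "kv a \<in> Lb" using Lb aI by (auto simp: LL_def)
  have W: "gframe ?W" using bas(1)[OF lagb] .
  have V: "?V > 0" by (rule lvol_pos[where M=M, OF X M lagb])
  have B: "B > 0" using e V by (simp add: B_def)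
  have Xy: "transpose (X + rowm a y) = X + rowm a y" for y by (simp add: transpose_add transpose_rowm X)
  have Re0: "Re (?W $ i $ a) = 0" for i using lag_kv_Re[OF lagb kva bas(2)[OF lagb]] .
  have ka: "kv a = comb ?W (kap Lb a)" by (rule kap(2)[OF lagb kva])
  define x where "x \<alpha> y = xsol M (X + rowm a y) ?W \<alpha>" for \<alpha> y
  have x_eq: "x \<alpha> y = xsol M X ?W (\<alpha> - (kap Lb a \<bullet> \<alpha>) *\<^sub>R (cmat ?W *v y))" for \<alpha> y
    unfolding x_def xsol_rowm[where M=M, OF X M W Re0 ka] rep_inner_cmat ..
  obtain A where A: "\<And>\<beta>. xsol M X ?W \<beta> = A *v cvec \<beta>"
    using xsol_matrix[where M=M, OF X M W] by metis
  define h where "h g \<alpha> = (\<lambda>y. indicator {y. real g * (norm (x \<alpha> y))\<^sup>2 \<le> B} y :: ennreal)" for g :: nat and \<alpha>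
  define C where "C g \<alpha> = (\<lambda>y. cre M (X + rowm a y) Lb g \<alpha>)" for g :: nat and \<alpha>
  have x_meas [measurable]: "x \<alpha> \<in> borel_measurable borel" for \<alpha>
    unfolding x_eq[abs_def] A by measurable
  have h_meas [measurable]: "h g \<alpha> \<in> borel_measurable borel" for g \<alpha>
    unfolding h_def by measurable
  have C_meas [measurable]: "C g \<alpha> \<in> borel_measurable borel" for g \<alpha>
    unfolding C_def cre_def x_def[symmetric] x_eq A by (rule measurable_bdot_rho) measurable
  have x_shift: "x \<alpha> (y + z *\<^sub>R axis a 1) = x \<alpha> y" for \<alpha> y z
  proof -
    have "cmat ?W *v axis a 1 = 0"
      by (simp add: vec_eq_iff matrix_vector_mult_basis column_def cmat_def Re0)
    then show ?thesis unfolding x_eq by (simp add: matrix_vector_right_distrib matrix_vector_mult_scaleR)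
  qed
  define U where "U g \<alpha> \<longleftrightarrow> paired Lb (real g *\<^sub>R \<alpha>) (ufun Lb (real g *\<^sub>R \<alpha>))" for g :: nat and \<alpha>
  have C_shift: "C g \<alpha> (y + z *\<^sub>R axis a 1) = C g \<alpha> y - z * (real g * (kap Lb a \<bullet> \<alpha>)\<^sup>2)" if "U g \<alpha>" for g \<alpha> y z
  proof -
    let ?u = "ufun Lb (real g *\<^sub>R \<alpha>)" and ?c = "kap Lb a \<bullet> \<alpha>"
    have "om (kv a) ?u = kap Lb a \<bullet> (real g *\<^sub>R \<alpha>)" unfolding ka by (rule paired_comb) (use that in \<open>simp add: U_def\<close>)
    then have Reu: "Re (?u $ a) = - real g * ?c" by (simp add: om_kv_left)
    have "bdot (rho M X (kv a)) (x \<alpha> y) = of_real (kap Lb a \<bullet> (\<alpha> - ?c *\<^sub>R (cmat ?W *v y)))"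
      unfolding ka rho_comb x_eq by (rule bdot_comb_sol[OF xsol(1)[where M=M, OF X M W]])
    also have "kap Lb a \<bullet> (\<alpha> - ?c *\<^sub>R (cmat ?W *v y)) = ?c" by (simp add: inner_diff_right kap_mats(1)[OF ka])
    finally show ?thesis
      unfolding C_def cre_def x_def[symmetric] x_shift rho_rowm_axis bdot_add_left bdot_scaleR_left
      by (simp add: Reu power2_eq_square)
  qed
  define f where "f = (\<lambda>(g, \<alpha>, \<nu>). \<integral>\<^sup>+y. indicator unit_cube y * (h g \<alpha> y * indicator {-B..B} (C g \<alpha> y + of_int \<nu>)) \<partial>lborel)"
  define w where "w g \<alpha> = (if g \<ge> 1 \<and> (\<exists>c\<in>\<int> - {0}. \<alpha> \<in> slice a I Lb c) \<and> U g \<alpha> then 1 else 0 :: ennreal)" for g :: nat and \<alpha>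
  have step1: "(\<integral>\<^sup>+L. \<integral>\<^sup>+y. indicator unit_cube y * indicator {y. lvol M (X + rowm a y) L \<le> e} y \<partial>lborel \<partial>count_space (children a I Lb))
     \<le> (\<integral>\<^sup>+t. (case t of (g, \<alpha>, \<nu>) \<Rightarrow> w g \<alpha> * f (g, \<alpha>, \<nu>)) \<partial>count_space UNIV)"
  proof -
    define P where "P L t \<longleftrightarrow> (case t of (g, \<alpha>, \<nu>) \<Rightarrow> g \<ge> 1 \<and> encodes Lb L g \<alpha> \<nu> \<and> (\<exists>c\<in>\<int> - {0}. \<alpha> \<in> slice a I Lb c))" for L t
    define J where "J L = (SOME t. P L t)" for L
    have J: "P L (J L)" if "L \<in> children a I Lb" for L
    proof -
      have "\<exists>t. P L t" using child_encode[OF Lb that aI] unfolding P_def by auto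
      then show ?thesis unfolding J_def by (rule someI_ex)
    qed
    have inj: "inj_on J (children a I Lb)"
    proof (rule inj_onI)
      fix L1 L2 assume "L1 \<in> children a I Lb" "L2 \<in> children a I Lb" and eq: "J L1 = J L2"
      then have "P L1 (J L1)" "P L2 (J L1)" using J by metis+
      then show "L1 = L2" using encodes_inj[OF lagb] unfolding P_def by (auto split: prod.splits)
    qed
    have "(\<integral>\<^sup>+y. indicator unit_cube y * indicator {y. lvol M (X + rowm a y) L \<le> e} y \<partial>lborel)
       \<le> (case J L of (g, \<alpha>, \<nu>) \<Rightarrow> w g \<alpha> * f (g, \<alpha>, \<nu>))" if L: "L \<in> children a I Lb" for L
    proof -
      obtain g \<alpha> \<nu> where t: "J L = (g, \<alpha>, \<nu>)" by (metis prod_cases3)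
      have P: "g \<ge> 1" "encodes Lb L g \<alpha> \<nu>" "\<exists>c\<in>\<int> - {0}. \<alpha> \<in> slice a I Lb c" using J[OF L] t by (auto simp: P_def)
      have "U g \<alpha>" using P(2) unfolding encodes_def U_def by blast
      then have w1: "w g \<alpha> = 1" using P by (simp add: w_def)
      have lagL: "lag L" using L by (simp add: children_def LL_def)
      have "indicator unit_cube y * indicator {y. lvol M (X + rowm a y) L \<le> e} y
        \<le> (indicator unit_cube y * (h g \<alpha> y * indicator {-B..B} (C g \<alpha> y + of_int \<nu>)) :: ennreal)" for y
      proof (cases "lvol M (X + rowm a y) L \<le> e")
        case True
        have Vy: "lvol M (X + rowm a y) Lb = ?V" by (rule lvol_rowm[OF lagb kva])
        have "?V * (real g * (norm (x \<alpha> y))\<^sup>2) \<le> e" "?V * \<bar>C g \<alpha> y + of_int \<nu>\<bar> \<le> e"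
          using encodes_lvol[where M=M, OF Xy[of y] M lagb lagL P(1,2)] True unfolding Vy x_def C_def by linarith+
        then have "real g * (norm (x \<alpha> y))\<^sup>2 \<le> B" "\<bar>C g \<alpha> y + of_int \<nu>\<bar> \<le> B"
          using V by (simp_all add: B_def pos_le_divide_eq mult.commute)
        then show ?thesis by (auto simp: h_def abs_le_iff indicator_def)
      qed simp
      then show ?thesis unfolding t by (simp add: w1 f_def nn_integral_mono)
    qed
    then have "(\<integral>\<^sup>+L. \<integral>\<^sup>+y. indicator unit_cube y * indicator {y. lvol M (X + rowm a y) L \<le> e} y \<partial>lborel \<partial>count_space (children a I Lb))
       \<le> (\<integral>\<^sup>+L. (case J L of (g, \<alpha>, \<nu>) \<Rightarrow> w g \<alpha> * f (g, \<alpha>, \<nu>)) \<partial>count_space (children a I Lb))"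
      by (intro nn_integral_mono) simp
    also have "\<dots> \<le> (\<integral>\<^sup>+t. (case t of (g, \<alpha>, \<nu>) \<Rightarrow> w g \<alpha> * f (g, \<alpha>, \<nu>)) \<partial>count_space UNIV)"
      by (rule nn_integral_count_inj[OF inj]) simp
    finally show ?thesis .
  qed
  have "(\<integral>\<^sup>+t. (case t of (g, \<alpha>, \<nu>) \<Rightarrow> w g \<alpha> * f (g, \<alpha>, \<nu>)) \<partial>count_space UNIV)
     = (\<integral>\<^sup>+g. \<integral>\<^sup>+\<alpha>. \<integral>\<^sup>+\<nu>. w g \<alpha> * f (g, \<alpha>, \<nu>) \<partial>count_space UNIV \<partial>count_space UNIV \<partial>count_space UNIV)"
    by (simp add: nn_integral_fst_count_space[symmetric])
  also have "\<dots> \<le> (\<integral>\<^sup>+g. (if 1 \<le> g \<and> 1 \<le> sqrt (B / real g) * M a then ennreal (4 * Kn TYPE('n) * e * M a * sqrt (B / real g) ^ (card I + 1) / (\<Prod>j\<in>-I. M j)) else 0) \<partial>count_space UNIV)"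
  proof (rule nn_integral_mono)
    fix g :: nat
    define r where "r = sqrt (B / real g)"
    let ?K = "Kn TYPE('n) * ?V * r ^ card I / (\<Prod>j\<in>-I. M j)"
    show "(\<integral>\<^sup>+\<alpha>. \<integral>\<^sup>+\<nu>. w g \<alpha> * f (g, \<alpha>, \<nu>) \<partial>count_space UNIV \<partial>count_space UNIV)
      \<le> (if 1 \<le> g \<and> 1 \<le> sqrt (B / real g) * M a then ennreal (4 * Kn TYPE('n) * e * M a * sqrt (B / real g) ^ (card I + 1) / (\<Prod>j\<in>-I. M j)) else 0)"
    proof (cases "g \<ge> 1")
      case False
      then have "w g \<alpha> = 0" for \<alpha> by (simp add: w_def)
      then show ?thesis by simp
    next
      case g: True
      have r: "r > 0" using B g by (simp add: r_def)
      have hr: "h g \<alpha> y = indicator {y. norm (x \<alpha> y) \<le> r} y" for \<alpha> y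
      proof -
        have "real g * (norm (x \<alpha> y))\<^sup>2 \<le> B \<longleftrightarrow> (norm (x \<alpha> y))\<^sup>2 \<le> B / real g"
          using g by (simp add: pos_le_divide_eq mult.commute)
        also have "\<dots> \<longleftrightarrow> norm (x \<alpha> y) \<le> r" using real_sqrt_le_iff[of "(norm (x \<alpha> y))\<^sup>2" "B / real g"] by (simp add: r_def)
        finally show ?thesis by (simp add: h_def indicator_def)
      qed
      have inner: "(\<integral>\<^sup>+\<nu>. w g \<alpha> * f (g, \<alpha>, \<nu>) \<partial>count_space UNIV)
          \<le> (\<integral>\<^sup>+c. ennreal (2 * B) * (indicator (slice a I Lb c) \<alpha> * (\<integral>\<^sup>+y. indicator unit_cube y * h g \<alpha> y \<partial>lborel)) \<partial>count_space (\<int> - {0}))" for \<alpha>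
      proof (cases "w g \<alpha> = 0")
        case False
        then obtain c where c: "c \<in> \<int> - {0}" "\<alpha> \<in> slice a I Lb c" and U: "U g \<alpha>" and w1: "w g \<alpha> = 1" by (auto simp: w_def split: if_splits)
        have cc: "kap Lb a \<bullet> \<alpha> = c" using c by (simp add: slice_def)
        obtain ci where ci: "c = of_int ci" using c by (auto elim: Ints_cases)
        have "(\<integral>\<^sup>+\<nu>. w g \<alpha> * f (g, \<alpha>, \<nu>) \<partial>count_space UNIV) = (\<integral>\<^sup>+\<nu>. \<integral>\<^sup>+y. indicator unit_cube y * (h g \<alpha> y * indicator {-B..B} (C g \<alpha> y + of_int \<nu>)) \<partial>lborel \<partial>count_space UNIV)"
          by (simp add: w1 f_def)
        also have "\<dots> = (\<integral>\<^sup>+y. \<integral>\<^sup>+\<nu>. indicator unit_cube y * (h g \<alpha> y * indicator {-B..B} (C g \<alpha> y + of_int \<nu>)) \<partial>count_space UNIV \<partial>lborel)"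
          by (rule nn_integral_count_space_nn_integral[symmetric]) auto
        also have "\<dots> = (\<integral>\<^sup>+y. indicator unit_cube y * (h g \<alpha> y * (\<integral>\<^sup>+\<nu>. indicator {-B..B} (C g \<alpha> y + of_int \<nu>) \<partial>count_space (UNIV::int set))) \<partial>lborel)"
          by (simp add: nn_integral_cmult)
        also have "\<dots> = ennreal (2 * B) * (\<integral>\<^sup>+y. indicator unit_cube y * h g \<alpha> y \<partial>lborel)"
        proof (rule average_shift_axis[where k = "int g * ci\<^sup>2" and a = a])
          show "h g \<alpha> (y + z *\<^sub>R axis a 1) = h g \<alpha> y" for y z by (simp add: h_def indicator_def x_shift)
          show "C g \<alpha> (y + z *\<^sub>R axis a 1) = C g \<alpha> y - z * of_int (int g * ci\<^sup>2)" for y z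
            using C_shift[OF U, of y z] by (simp add: cc ci)
        qed (use B g c ci in auto)
        also have "\<dots> = (\<integral>\<^sup>+c'. ennreal (2 * B) * (\<integral>\<^sup>+y. indicator unit_cube y * h g \<alpha> y \<partial>lborel) * indicator {c} c' \<partial>count_space (\<int> - {0}))"
          using c by (subst nn_integral_cmult_indicator) auto
        also have "\<dots> \<le> (\<integral>\<^sup>+c. ennreal (2 * B) * (indicator (slice a I Lb c) \<alpha> * (\<integral>\<^sup>+y. indicator unit_cube y * h g \<alpha> y \<partial>lborel)) \<partial>count_space (\<int> - {0}))"
          by (rule nn_integral_mono) (use c in \<open>auto simp: indicator_def\<close>)
        finally show ?thesis .
      qed simp
      have "(\<integral>\<^sup>+\<alpha>. \<integral>\<^sup>+\<nu>. w g \<alpha> * f (g, \<alpha>, \<nu>) \<partial>count_space UNIV \<partial>count_space UNIV)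
        \<le> (\<integral>\<^sup>+\<alpha>. \<integral>\<^sup>+c. ennreal (2 * B) * (indicator (slice a I Lb c) \<alpha> * (\<integral>\<^sup>+y. indicator unit_cube y * h g \<alpha> y \<partial>lborel)) \<partial>count_space (\<int> - {0}) \<partial>count_space UNIV)"
        by (rule nn_integral_mono) (rule inner)
      also have "\<dots> = (\<integral>\<^sup>+c. \<integral>\<^sup>+\<alpha>. ennreal (2 * B) * (indicator (slice a I Lb c) \<alpha> * (\<integral>\<^sup>+y. indicator unit_cube y * h g \<alpha> y \<partial>lborel)) \<partial>count_space UNIV \<partial>count_space (\<int> - {0}))"
        by (rule nn_integral_count_space_nn_integral) (auto simp: Ints_def)
      also have "\<dots> \<le> (\<integral>\<^sup>+c. (if \<bar>c\<bar> \<le> r * M a then ennreal (2 * B) * ennreal ?K else 0) \<partial>count_space (\<int> - {0}))"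
      proof (rule nn_integral_mono)
        fix c :: real assume "c \<in> space (count_space (\<int> - {0}))"
        then have c: "c \<in> \<int>" "c \<noteq> 0" by auto
        have "(\<integral>\<^sup>+\<alpha>. ennreal (2 * B) * (indicator (slice a I Lb c) \<alpha> * (\<integral>\<^sup>+y. indicator unit_cube y * h g \<alpha> y \<partial>lborel)) \<partial>count_space UNIV)
          = ennreal (2 * B) * (\<integral>\<^sup>+\<alpha>. \<integral>\<^sup>+y. indicator unit_cube y * h g \<alpha> y \<partial>lborel \<partial>count_space (slice a I Lb c))"
          by (simp add: nn_integral_cmult nn_integral_count_space_indicator mult.commute)
        also have "(\<integral>\<^sup>+\<alpha>. \<integral>\<^sup>+y. indicator unit_cube y * h g \<alpha> y \<partial>lborel \<partial>count_space (slice a I Lb c))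
          = (\<integral>\<^sup>+\<alpha>. \<integral>\<^sup>+y. indicator unit_cube y * indicator {y. norm (xsol M X ?W (\<alpha> - c *\<^sub>R (cmat ?W *v y))) \<le> r} y \<partial>lborel \<partial>count_space (slice a I Lb c))"
          by (intro nn_integral_cong) (simp add: hr x_eq slice_def)
        also have "\<dots> \<le> (if \<bar>c\<bar> \<le> r * M a then ennreal ?K else 0)"
          by (rule slice_average[where M=M, OF X M Lb aI Ma c r])
        finally show "(\<integral>\<^sup>+\<alpha>. ennreal (2 * B) * (indicator (slice a I Lb c) \<alpha> * (\<integral>\<^sup>+y. indicator unit_cube y * h g \<alpha> y \<partial>lborel)) \<partial>count_space UNIV)
          \<le> (if \<bar>c\<bar> \<le> r * M a then ennreal (2 * B) * ennreal ?K else 0)"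
          by (auto simp: mult_left_mono split: if_splits)
      qed
      also have "\<dots> \<le> (if 1 \<le> r * M a then ennreal (2 * (r * M a)) * (ennreal (2 * B) * ennreal ?K) else 0)"
        by (rule nn_integral_int_count) (use r M[of a] in simp)
      also have "\<dots> \<le> (if 1 \<le> g \<and> 1 \<le> sqrt (B / real g) * M a then ennreal (4 * Kn TYPE('n) * e * M a * sqrt (B / real g) ^ (card I + 1) / (\<Prod>j\<in>-I. M j)) else 0)"
      proof -
        have "?K \<ge> 0" using V r M by (intro divide_nonneg_nonneg mult_nonneg_nonneg prod_nonneg) (auto simp: less_imp_le)
        moreover have "2 * (r * M a) * (2 * B * ?K) = 4 * Kn TYPE('n) * e * M a * r ^ (card I + 1) / (\<Prod>j\<in>-I. M j)"
          using V by (simp add: B_def field_simps)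
        ultimately have "ennreal (2 * (r * M a)) * (ennreal (2 * B) * ennreal ?K) = ennreal (4 * Kn TYPE('n) * e * M a * r ^ (card I + 1) / (\<Prod>j\<in>-I. M j))"
          using r M[of a] B by (metis (no_types, lifting) ennreal_mult less_imp_le mult_nonneg_nonneg zero_le_numeral)
        then show ?thesis using g by (simp add: r_def)
      qed
      finally show ?thesis .
    qed
  qed
  finally show ?thesis using step1 by (rule order_trans[rotated])
qed

section \<open>Covolumes of frames inside a lattice and lower bounds\<close>

lemma det_integer_change:
  assumes B: "\<And>i. B $ i = comb W (\<tau> i)" and \<tau>: "\<And>i. \<tau> i \<in> integer_lattice" and d: "det (rhom M X B) \<noteq> 0"
  shows "cmod (det (rhom M X W)) \<le> cmod (det (rhom M X B))"
proof -
  define T where "T = (\<chi> i j. complex_of_real (\<tau> i $ j))"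
  have "rhom M X B $ i = comb (rhom M X W) (\<tau> i)" for i by (simp add: rhom_def[of M X B] B rho_comb)
  then have "rhom M X B = (\<chi> i. comb (rhom M X W) ((\<chi> i. \<tau> i) $ i))" by (simp add: vec_eq_iff)
  then have eq: "rhom M X B = T ** rhom M X W" unfolding comb_matrix T_def by simp
  have "det T \<in> gints"
    by (rule det_gints) (use \<tau> in \<open>auto simp: T_def glat_def gints_def integer_lattice_def\<close>)
  moreover have "det T \<noteq> 0" using d by (auto simp: eq det_mul)
  ultimately have "1 \<le> cmod (det T)" by (rule gints_norm_ge_1)
  then show ?thesis using mult_right_mono[of 1 "cmod (det T)" "cmod (det (rhom M X W))"] by (simp add: eq det_mul norm_mult)
qed

lemma lvol_le_frame:
  assumes X: "transpose X = X" and M: "\<And>i. M i > 0" and L: "lag L" and B: "\<And>i. B $ i \<in> L" "det (rhom M X B) \<noteq> 0"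
  shows "lvol M X L \<le> cmod (det (rhom M X B))"
proof -
  have "\<forall>i. \<exists>t. t \<in> integer_lattice \<and> B $ i = comb (bas L) t" using B(1) bas(3)[OF L] by blast
  then obtain \<tau> where "\<And>i. \<tau> i \<in> integer_lattice" "\<And>i. B $ i = comb (bas L) (\<tau> i)" by metis
  then show ?thesis unfolding lvol_def by (intro det_integer_change[where \<tau> = \<tau>]) (use B in auto)
qed

text \<open>The division removes the contribution of the vertical coordinates outside \<open>I\<close>, so that \<open>nvol\<close> depends
  only on the part of \<open>L\<close> that lives on \<open>I\<close>.\<close>

definition nvol :: "('n::finite \<Rightarrow> real) \<Rightarrow> real ^ 'n ^ 'n \<Rightarrow> 'n set \<Rightarrow> (complex ^ 'n) set \<Rightarrow> real" where
  "nvol M X I L = lvol M X L / (\<Prod>j\<in>-I. M j)"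

lemma LL_empty:
  fixes L :: "(complex ^ 'n) set"
  assumes "L \<in> LL {}" shows "L = {p \<in> glat. \<forall>j. Re (p $ j) = 0}"
proof -
  have L: "lag L" "\<And>j. kv j \<in> L" using assms by (auto simp: LL_def)
  have "p \<in> L" if p: "p \<in> glat" "\<forall>j. Re (p $ j) = 0" for p
  proof (rule lag_max[OF L(1) p(1)])
    fix q assume "q \<in> L"
    then have "Re (q $ j) = 0" for j using LL_Re[OF assms] by blast
    then show "om q p = 0" using p(2) by (simp add: om_def)
  qed
  then show ?thesis using LL_Re[OF assms] lag_glat[OF L(1)] by blast
qed

lemma nvol_empty_ge_1:
  fixes L :: "(complex ^ 'n) set"
  assumes X: "transpose X = X" and M: "\<And>i. M i > 0" and L: "L \<in> LL {}"
  shows "nvol M X {} L \<ge> 1"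
proof -
  have lagL: "lag L" using L by (simp add: LL_def)
  define W :: "complex ^ 'n ^ 'n" where "W = (\<chi> j. kv j)"
  have "rhom M X W = (\<chi> i j. if i = j then Complex 0 (M i) else 0)"
    by (auto simp: vec_eq_iff rhom_def W_def rho_kv axis_def)
  then have "det (rhom M X W) = (\<Prod>i\<in>UNIV. Complex 0 (M i))"
    by (subst det_diagonal) auto
  then have d: "cmod (det (rhom M X W)) = (\<Prod>i\<in>UNIV. M i)"
  proof -
    have "cmod (Complex 0 (M i)) = M i" for i using M[of i] by (simp add: cmod_def)
    then show ?thesis using \<open>det (rhom M X W) = (\<Prod>i\<in>UNIV. Complex 0 (M i))\<close> by (simp add: prod_norm[symmetric])
  qed
  have "cmod (det (rhom M X W)) \<le> lvol M X L"
    unfolding lvol_def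
  proof (rule det_integer_change[where \<tau> = "\<lambda>i. \<chi> j. Im (bas L $ i $ j)"])
    fix i
    have Re0: "Re (bas L $ i $ j) = 0" for j using LL_Re[OF L bas(2)[OF lagL]] by blast
    have "comb W t $ j = \<i> * of_real (t $ j)" for t j
    proof -
      have "comb W t $ j = (\<Sum>i\<in>UNIV. if i = j then \<i> * of_real (t $ j) else 0)"
        unfolding comb_nth by (intro sum.cong refl) (auto simp: W_def kv_def axis_def)
      then show ?thesis by simp
    qed
    then show "bas L $ i = comb W (\<chi> j. Im (bas L $ i $ j))"
      using Re0 by (simp add: vec_eq_iff complex_eq_iff)
    show "(\<chi> j. Im (bas L $ i $ j)) \<in> integer_lattice"
      using lag_glat[OF lagL bas(2)[OF lagL]] by (auto simp: integer_lattice_def glat_def gints_def)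
  next
    show "det (rhom M X (bas L)) \<noteq> 0" using lvol_pos[where M=M, OF X M lagL] by (simp add: lvol_def)
  qed
  then have "(\<Prod>i\<in>UNIV. M i) \<le> lvol M X L" by (simp add: d)
  moreover have "(\<Prod>i\<in>UNIV. M i) > 0" using M by (simp add: prod_pos)
  ultimately show ?thesis by (simp add: nvol_def pos_le_divide_eq)
qed

lemma prod_insert_compl:
  assumes "a \<notin> (I :: 'n::finite set)"
  shows "(\<Prod>j\<in>-I. M j :: real) = M a * (\<Prod>j\<in>-insert a I. M j)"
proof -
  have "- I = insert a (- insert a I)" using assms by auto
  then have "(\<Prod>j\<in>-I. M j) = (\<Prod>j\<in>insert a (- insert a I). M j)" by simp
  then show ?thesis by simp
qed

lemma nvol_insert: "a \<notin> I \<Longrightarrow> M a \<noteq> 0 \<Longrightarrow> nvol M X (insert a I) L = M a * nvol M X I L"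
  by (simp add: nvol_def prod_insert_compl[of a I M])

text \<open>Induction through the reductions. The a-th component of x has modulus |c| / M a with a
  nonzero integer c, so a child has at least (1 / M a)^2 times the covolume of its parent. The
  normalisation returns one factor M a, and each coordinate costs at most 1 / M a.\<close>

lemma nvol_lower:
  fixes L :: "(complex ^ 'n) set"
  assumes X: "transpose X = X" and M: "\<And>i. M i \<ge> 1" and L: "L \<in> LL I"
  shows "nvol M X I L \<ge> (\<Prod>j\<in>I. 1 / M j)"
proof -
  have M0: "\<And>i. M i > 0" using M by (meson less_le_trans zero_less_one)
  have "finite I" by simp
  then show ?thesis using L
  proof (induction I arbitrary: L)
    case empty
    then show ?case using nvol_empty_ge_1[where M=M, OF X M0] by simp
  next
    case (insert a I)
    have Ma: "M a \<ge> 1" by (rule M)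
    have pI: "(\<Prod>j\<in>I. 1 / M j) \<ge> 0" using M0 by (simp add: prod_nonneg less_imp_le)
    have goal: "(\<Prod>j\<in>insert a I. 1 / M j) = (\<Prod>j\<in>I. 1 / M j) / M a" using insert by simp
    show ?case
    proof (cases "kv a \<in> L")
      case True
      then have "L \<in> LL I" using insert.prems by (auto simp: LL_def)
      from insert.IH[OF this] have "(\<Prod>j\<in>I. 1 / M j) \<le> nvol M X I L" .
      moreover have "(\<Prod>j\<in>I. 1 / M j) / M a \<le> (\<Prod>j\<in>I. 1 / M j)"
        using pI Ma by (simp add: divide_le_eq mult_left_le mult_le_cancel_left1 mult_ge1_I)
      moreover have "nvol M X I L \<le> M a * nvol M X I L"
        using Ma mult_right_mono[of 1 "M a" "nvol M X I L"] calculation pI by linarith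
      ultimately show ?thesis unfolding goal using nvol_insert[of a I M X L] insert Ma by simp
    next
      case False
      let ?Lb = "red a L"
      have Lb: "?Lb \<in> LL I" by (rule red_LL[OF insert.prems False])
      have lagL: "lag L" and lagb: "lag ?Lb" using insert.prems Lb by (auto simp: LL_def)
      have "L \<in> children a I ?Lb" using insert.prems False by (simp add: children_def)
      from child_encode[OF Lb this insert.hyps(2)]
      obtain g \<alpha> \<nu> c where g: "g \<ge> 1" "encodes ?Lb L g \<alpha> \<nu>" "c \<in> \<int>" "c \<noteq> 0" "\<alpha> \<in> slice a I ?Lb c" by blast
      let ?x = "xsol M X (bas ?Lb) \<alpha>"
      have kva: "kv a \<in> ?Lb" by (rule kv_in_red[OF lagL])
      have "?x $ a = of_real (kap ?Lb a \<bullet> \<alpha>) / (\<i> * of_real (M a))"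
        by (rule xsol_kv[where M=M, OF X M0 bas(1)[OF lagb] kap(2)[OF lagb kva]])
      then have "cmod (?x $ a) = \<bar>c\<bar> / M a" using g(5) M0[of a] by (simp add: slice_def norm_divide norm_mult)
      moreover have "1 \<le> \<bar>c\<bar>" using Ints_nonzero_abs_ge1 g(3,4) by blast
      ultimately have "1 / M a \<le> norm ?x"
        using Finite_Cartesian_Product.norm_nth_le[of ?x a] divide_right_mono[of 1 "\<bar>c\<bar>" "M a"] M0[of a] by linarith
      then have "(1 / M a)\<^sup>2 \<le> (norm ?x)\<^sup>2" using M0[of a] by (intro power_mono) auto
      then have "(1 / M a)\<^sup>2 \<le> real g * (norm ?x)\<^sup>2" using g(1) mult_right_mono[of 1 "real g" "(norm ?x)\<^sup>2"] by simp
      moreover have "lvol M X ?Lb \<ge> 0" by (simp add: lvol_def)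
      ultimately have "lvol M X ?Lb * (1 / M a)\<^sup>2 \<le> lvol M X L"
        using encodes_lvol(1)[where M=M, OF X M0 lagb lagL g(1,2)] mult_left_mono by (meson order_trans)
      moreover have "(\<Prod>j\<in>-I. M j) > 0" using M0 by (simp add: prod_pos)
      ultimately have "nvol M X I ?Lb * (1 / M a)\<^sup>2 \<le> nvol M X I L"
        by (simp add: nvol_def divide_right_mono)
      then have "M a * (nvol M X I ?Lb * (1 / M a)\<^sup>2) \<le> M a * nvol M X I L" using M0[of a] by simp
      moreover have "M a * (nvol M X I ?Lb * (1 / M a)\<^sup>2) = nvol M X I ?Lb / M a" using M0[of a] by (simp add: power2_eq_square field_simps)
      moreover have "(\<Prod>j\<in>I. 1 / M j) / M a \<le> nvol M X I ?Lb / M a"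
        using insert.IH[OF Lb] M0[of a] by (simp add: divide_right_mono)
      ultimately show ?thesis unfolding goal using nvol_insert[of a I M X L] insert Ma by simp
    qed
  qed
qed

text \<open>Entries are indexed by all subsets of the index type, so that Lebesgue measure and cube
  averages on a Euclidean space apply directly. The coordinates at sets other than pairs and
  singletons are integrated out in \<open>full_measure_symI\<close>.\<close>

definition symF :: "real ^ ('n set) \<Rightarrow> real ^ 'n ^ 'n" where
  "symF F = (\<chi> i j. F $ {i, j})"

text \<open>The sets {a, j} are distinct for distinct j, so each sum has at most one nonzero
  term.\<close>

definition rowF :: "'n::finite \<Rightarrow> real ^ 'n \<Rightarrow> real ^ ('n set)" where
  "rowF a y = (\<chi> s. \<Sum>j\<in>UNIV. if s = {a, j} then y $ j else 0)"

lemma transpose_symF: "transpose (symF F) = symF F"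
  by (simp add: transpose_def symF_def insert_commute)

lemma symF_add: "symF (F + G) = symF F + symF G"
  by (simp add: symF_def vec_eq_iff)

lemma symF_rowF: "symF (rowF a y) = rowm a y"
proof -
  have "{i, k} = {a, j} \<longleftrightarrow> (if i = a then j = k else k = a \<and> j = i)" for i k j
    by (auto simp: doubleton_eq_iff)
  then show ?thesis by (auto simp: vec_eq_iff symF_def rowF_def rowm_def)
qed

lemma measurable_symF_nth [measurable]: "(\<lambda>F. symF F $ i $ j) \<in> borel_measurable borel"
  by (simp add: symF_def)

lemma measurable_lvol:
  fixes f :: "'x \<Rightarrow> real ^ 'n ^ 'n"
  assumes f: "\<And>i j. (\<lambda>x. f x $ i $ j) \<in> borel_measurable N"
  shows "(\<lambda>x. lvol M (f x) L) \<in> borel_measurable N"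
proof -
  note [measurable] = f
  have "Complex a b = of_real a + \<i> * of_real b" for a b by (simp add: complex_eq_iff)
  then have "(\<lambda>x. rhom M (f x) W $ i $ j) \<in> borel_measurable N" for W :: "complex ^ 'n ^ 'n" and i j
    by (simp only: rhom_def rho_def vec_lambda_beta) measurable
  then show ?thesis unfolding lvol_def det_def by measurable
qed

lemma measurable_lvol_symF [measurable]: "(\<lambda>F. lvol M (symF F) L) \<in> borel_measurable borel"
  by (rule measurable_lvol) measurable

lemma measurable_lvol_symF_rowF [measurable]: "(\<lambda>y. lvol M (X + rowm a y) L) \<in> borel_measurable borel"
  by (rule measurable_lvol) (simp, measurable)

lemma countable_LL: "countable (LL I)"
  by (rule countable_subset[OF _ countable_lag]) (auto simp: LL_def)

text \<open>The unipotent symplectic map taking (h, k) to (h, k + h T). For integral symmetric T it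
  permutes the Lagrangian sublattices, so sums over all of them are periodic in X.\<close>

definition tshift :: "real ^ 'n ^ 'n \<Rightarrow> complex ^ 'n \<Rightarrow> complex ^ 'n" where
  "tshift T p = (\<chi> i. p $ i + \<i> * of_real (\<Sum>j\<in>UNIV. Re (p $ j) * T $ j $ i))"

lemma rho_tshift: "rho M (X + T) p = rho M X (tshift T p)"
  by (simp add: rho_def tshift_def vec_eq_iff complex_eq_iff distrib_left sum.distrib algebra_simps)

lemma tshift_linear: "tshift T (c *\<^sub>R p) = c *\<^sub>R tshift T p" "tshift T (p + q) = tshift T p + tshift T q" "tshift T 0 = 0"
  by (simp_all add: tshift_def vec_eq_iff complex_eq_iff algebra_simps sum.distrib sum_distrib_left)

lemma tshift_sum: "tshift T (sum f A) = (\<Sum>a\<in>A. tshift T (f a))"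
  by (induction A rule: infinite_finite_induct) (auto simp: tshift_linear)

lemma tshift_comb: "tshift T (comb W t) = comb (\<chi> i. tshift T (W $ i)) t"
  by (simp add: comb_def tshift_sum tshift_linear)

lemma tshift_inv: "tshift (- T) (tshift T p) = p" "tshift T (tshift (- T) p) = p"
  by (simp_all add: tshift_def vec_eq_iff complex_eq_iff sum_negf)

lemma tshift_kv: "tshift T (kv j) = kv j"
  by (simp add: tshift_def vec_eq_iff)

lemma om_tshift: assumes "transpose T = T" shows "om (tshift T p) (tshift T q) = om p q"
proof -
  have "rho (\<lambda>_. 1) 0 (tshift T p) = rho (\<lambda>_. 1) T p" for p using rho_tshift[of "\<lambda>_. 1" 0 T p] by simp
  moreover have "transpose (0 :: real ^ 'a ^ 'a) = 0" by (simp add: transpose_def vec_eq_iff)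
  ultimately show ?thesis using om_rho[of T "\<lambda>_. 1" p q, OF assms] om_rho[of 0 "\<lambda>_. 1" "tshift T p" "tshift T q"]
    by simp
qed

lemma tshift_glat: "(\<And>i j. T $ i $ j \<in> \<int>) \<Longrightarrow> p \<in> glat \<Longrightarrow> tshift T p \<in> glat"
  by (auto simp: tshift_def glat_def gints_def)

lemma tshift_lag:
  fixes T :: "real ^ 'n ^ 'n"
  assumes T: "transpose T = T" "\<And>i j. T $ i $ j \<in> \<int>" and L: "lag L"
  shows "lag (tshift T ` L)"
proof -
  let ?W = "\<chi> i. tshift T (bas L $ i)"
  have bW: "gframe (bas L)" by (rule bas(1)[OF L])
  have iso: "isotr ?W" using bW om_tshift[OF T(1)] by (simp add: isotr_def gframe_def)
  have "det ?W \<noteq> 0"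
  proof (rule isotr_indep_det_nz[OF iso])
    fix t assume "comb ?W t = 0"
    then have "tshift T (comb (bas L) t) = 0" by (simp add: tshift_comb)
    then have "comb (bas L) t = 0" using tshift_inv(1)[of T "comb (bas L) t"] by (simp add: tshift_linear)
    then show "t = 0" using comb_inj[of "bas L" t 0] bW by (simp add: comb_0 gframe_def)
  qed
  moreover have "?W $ i \<in> glat" for i using tshift_glat[of T, OF T(2)] bW by (simp add: gframe_def)
  ultimately have gW: "gframe ?W" using iso by (simp add: gframe_def)
  have T': "transpose (- T) = - T" "\<And>i j. (- T) $ i $ j \<in> \<int>" using T by (auto simp: transpose_def vec_eq_iff)
  have "tshift T ` L = lagof ?W"
  proof (intro set_eqI iffI)
    show "p \<in> lagof ?W" if "p \<in> tshift T ` L" for p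
      using that lag_glat[OF L] tshift_glat[of T, OF T(2)] lag_iso[OF L bas(2)[OF L]] by (auto simp: lagof_def om_tshift[OF T(1)])
    fix p assume p: "p \<in> lagof ?W"
    have "tshift (- T) p \<in> L"
    proof (rule lag_max[OF L])
      show "tshift (- T) p \<in> glat" using p tshift_glat[of "- T", OF T'(2)] by (simp add: lagof_def)
      fix q assume "q \<in> L"
      then obtain t where t: "q = comb (bas L) t" using bas(3)[OF L] by blast
      have "om q (tshift (- T) p) = om (tshift T q) p" using om_tshift[OF T(1), of q "tshift (- T) p"] by (simp add: tshift_inv)
      also have "\<dots> = 0" using p by (simp add: t tshift_comb om_comb_left lagof_def)
      finally show "om q (tshift (- T) p) = 0" .
    qed
    then show "p \<in> tshift T ` L" using tshift_inv(2)[of T p] by (metis imageI)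
  qed
  then show ?thesis using gW by (auto simp: lag_def)
qed

lemma lvol_tshift_le:
  fixes T :: "real ^ 'n ^ 'n"
  assumes X: "transpose X = X" and M: "\<And>i. M i > 0" and T: "transpose T = T" "\<And>i j. T $ i $ j \<in> \<int>" and L: "lag L"
  shows "lvol M X (tshift T ` L) \<le> lvol M (X + T) L"
proof -
  let ?B = "\<chi> i. tshift T (bas L $ i)"
  have XT: "transpose (X + T) = X + T" by (simp add: transpose_add X T)
  have eq: "rhom M X ?B = rhom M (X + T) (bas L)" by (simp add: rhom_def vec_eq_iff rho_tshift)
  have "lvol M X (tshift T ` L) \<le> cmod (det (rhom M X ?B))"
    using lvol_pos[where M=M, OF XT M L] bas(2)[OF L]
    by (intro lvol_le_frame[where M=M, OF X M tshift_lag[OF T L]]) (auto simp: eq lvol_def)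
  then show ?thesis by (simp add: eq lvol_def)
qed

text \<open>The image of the chosen basis of L need not be the chosen basis of the image, so only an
  inequality is immediate; the inverse shift gives the reverse one.\<close>

lemma lvol_tshift:
  fixes T :: "real ^ 'n ^ 'n"
  assumes X: "transpose X = X" and M: "\<And>i. M i > 0" and T: "transpose T = T" "\<And>i j. T $ i $ j \<in> \<int>" and L: "lag L"
  shows "lvol M (X + T) L = lvol M X (tshift T ` L)"
proof (rule antisym)
  have T': "transpose (- T) = - T" "\<And>i j. (- T) $ i $ j \<in> \<int>" using T by (auto simp: transpose_def vec_eq_iff)
  have XT: "transpose (X + T) = X + T" by (simp add: transpose_add X T)
  have "tshift (- T) ` tshift T ` L = L" by (simp add: image_image tshift_inv)
  then show "lvol M (X + T) L \<le> lvol M X (tshift T ` L)"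
    using lvol_tshift_le[where M=M, OF XT M T' tshift_lag[OF T L]] by simp
qed (rule lvol_tshift_le[where M=M, OF assms])

section \<open>The mean number of Lagrangian sublattices of small covolume\<close>

lemma sum_inverse_sqrt: "(\<Sum>g=1..N. 1 / sqrt (real g)) \<le> 2 * sqrt (real N)"
proof (induction N)
  case (Suc N)
  let ?s = "sqrt (real (Suc N))" and ?t = "sqrt (real N)"
  have s: "?s > 0" "?t \<ge> 0" "?t \<le> ?s" by auto
  have "(?s - ?t) * (?s + ?t) = 1" by (simp add: algebra_simps)
  then have "1 \<le> (?s - ?t) * (2 * ?s)" using s by (smt (verit) mult_left_mono)
  then have "1 / ?s \<le> ((?s - ?t) * (2 * ?s)) / ?s" using s by (intro divide_right_mono) auto
  also have "\<dots> = 2 * (?s - ?t)" using s by simp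
  finally have "1 / ?s \<le> 2 * (?s - ?t)" .
  then show ?case using Suc by simp
qed simp

lemma nn_integral_inverse_sqrt:
  assumes c: "c \<ge> 0" and q: "q \<ge> 0"
  shows "(\<integral>\<^sup>+g. (if 1 \<le> g \<and> sqrt (real g) \<le> q then ennreal (c / sqrt (real g)) else 0) \<partial>count_space (UNIV::nat set))
    \<le> (if 1 \<le> q then ennreal (2 * c * q) else 0)"
proof -
  define N where "N = nat \<lfloor>q\<^sup>2\<rfloor>"
  have N: "1 \<le> g \<and> sqrt (real g) \<le> q \<longleftrightarrow> g \<in> {1..N}" for g
  proof -
    have "sqrt (real g) \<le> q \<longleftrightarrow> real g \<le> q\<^sup>2" using q real_sqrt_le_iff[of "real g" "q\<^sup>2"] by simp
    also have "\<dots> \<longleftrightarrow> g \<le> N" by (simp add: N_def le_nat_floor le_nat_iff le_floor_iff)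
    finally show ?thesis by auto
  qed
  have "(\<integral>\<^sup>+g. (if 1 \<le> g \<and> sqrt (real g) \<le> q then ennreal (c / sqrt (real g)) else 0) \<partial>count_space (UNIV::nat set))
    = (\<integral>\<^sup>+g. ennreal (c / sqrt (real g)) * indicator {1..N} g \<partial>count_space UNIV)"
    unfolding N by (rule nn_integral_cong) (simp add: indicator_def)
  also have "\<dots> = (\<integral>\<^sup>+g. ennreal (c / sqrt (real g)) \<partial>count_space {1..N})"
    by (simp add: nn_integral_count_space_indicator)
  also have "\<dots> = (\<Sum>g\<in>{1..N}. ennreal (c / sqrt (real g)))" by (simp add: nn_integral_count_space_finite)
  also have "\<dots> = ennreal (\<Sum>g=1..N. c / sqrt (real g))" using c by (intro sum_ennreal) auto
  also have "\<dots> \<le> (if 1 \<le> q then ennreal (2 * c * q) else 0)"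
  proof (cases "1 \<le> q")
    case True
    have "(\<Sum>g=1..N. c / sqrt (real g)) = c * (\<Sum>g=1..N. 1 / sqrt (real g))" by (simp add: sum_distrib_left)
    also have "\<dots> \<le> c * (2 * sqrt (real N))" by (intro mult_left_mono sum_inverse_sqrt c)
    also have "\<dots> \<le> c * (2 * q)" using c q by (intro mult_left_mono) (auto simp: N_def intro!: real_le_lsqrt)
    finally have "(\<Sum>g=1..N. c / sqrt (real g)) \<le> 2 * c * q" by (simp add: mult_ac)
    then show ?thesis using True by (simp add: ennreal_leI)
  next
    case False
    then have "q\<^sup>2 < 1" using q by (simp add: abs_square_less_1)
    then have "N = 0" by (simp add: N_def)
    then show ?thesis by simp
  qed
  finally show ?thesis .
qed

text \<open>Here m is the number of coordinates already treated, v the normalised covolume of the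
  parent and x the bound imposed on the child. The case distinction says that a parent with v > x M
  a contributes nothing.\<close>

definition row_bound :: "('n::finite \<Rightarrow> real) \<Rightarrow> 'n \<Rightarrow> nat \<Rightarrow> real \<Rightarrow> real \<Rightarrow> ennreal" where
  "row_bound M a m x v = (if 1 \<le> sqrt (x * M a / v)
     then ennreal (8 * Kn TYPE('n) * x * (1 / M a) ^ (m + 1) * sqrt (x * M a / v) ^ (m + 2)) else 0)"

lemma children_bound:
  fixes X :: "real ^ 'n ^ 'n"
  assumes X: "transpose X = X" and M: "\<And>i. M i > 0" and Lb: "Lb \<in> LL I" and aI: "a \<notin> I"
    and Ma: "\<And>j. j \<in> I \<Longrightarrow> M a \<le> M j" and x: "x > 0"
  shows "(\<integral>\<^sup>+L. \<integral>\<^sup>+y. indicator unit_cube y * indicator {y. lvol M (X + rowm a y) L \<le> x * (\<Prod>j\<in>-insert a I. M j)} y \<partial>lborel \<partial>count_space (children a I Lb))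
    \<le> row_bound M a (card I) x (nvol M X I Lb)"
proof -
  let ?P = "\<Prod>j\<in>-insert a I. M j" and ?v = "nvol M X I Lb" and ?m = "card I"
  define q where "q = sqrt (x * M a / ?v)"
  have P: "?P > 0" using M by (simp add: prod_pos)
  have PI: "(\<Prod>j\<in>-I. M j) = M a * ?P" by (rule prod_insert_compl[OF aI])
  have "lag Lb" using Lb by (simp add: LL_def)
  then have V: "lvol M X Lb > 0" by (rule lvol_pos[where M=M, OF X M])
  have v: "?v > 0" using V P M[of a] by (simp add: nvol_def PI)
  have "v = v / (m * p) * m * p" if "m > 0" "p > 0" for v m p :: real using that by simp
  from this[OF M[of a] P] have Vv: "lvol M X Lb = ?v * M a * ?P" unfolding nvol_def PI .
  have q0: "q \<ge> 0" using x M[of a] v by (simp add: q_def)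
  have sq: "sqrt (x * ?P / lvol M X Lb / real g) = q / (sqrt (real g) * M a)" for g
  proof -
    have "x * ?P / lvol M X Lb / real g = (x * M a / ?v) / (real g * (M a)\<^sup>2)"
    proof -
      have "x * p / (v * m * p) / r = (x * m / v) / (r * m\<^sup>2)" if "m > 0" "p > 0" "v > 0" for v m p r :: real
        using that by (simp add: field_simps power2_eq_square)
      from this[OF M[of a] P v] show ?thesis unfolding Vv .
    qed
    then show ?thesis using M[of a] by (simp add: q_def real_sqrt_divide real_sqrt_mult)
  qed
  define c where "c = 4 * Kn TYPE('n) * x * (q / M a) ^ (?m + 1)"
  have c0: "c \<ge> 0" using x q0 M[of a] by (simp add: c_def)
  have "(\<integral>\<^sup>+L. \<integral>\<^sup>+y. indicator unit_cube y * indicator {y. lvol M (X + rowm a y) L \<le> x * ?P} y \<partial>lborel \<partial>count_space (children a I Lb))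
    \<le> (\<integral>\<^sup>+g. (if 1 \<le> g \<and> 1 \<le> q / (sqrt (real g) * M a) * M a then ennreal (4 * Kn TYPE('n) * (x * ?P) * M a * (q / (sqrt (real g) * M a)) ^ (?m + 1) / (M a * ?P)) else 0) \<partial>count_space (UNIV :: nat set))"
    using children_sum[where M=M, OF X M Lb aI Ma, of "x * ?P"] x P unfolding sq PI by simp
  also have "\<dots> \<le> (\<integral>\<^sup>+g. (if 1 \<le> g \<and> sqrt (real g) \<le> q then ennreal (c / sqrt (real g)) else 0) \<partial>count_space (UNIV :: nat set))"
  proof (rule nn_integral_mono)
    fix g :: nat
    show "(if 1 \<le> g \<and> 1 \<le> q / (sqrt (real g) * M a) * M a then ennreal (4 * Kn TYPE('n) * (x * ?P) * M a * (q / (sqrt (real g) * M a)) ^ (?m + 1) / (M a * ?P)) else 0)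
      \<le> (if 1 \<le> g \<and> sqrt (real g) \<le> q then ennreal (c / sqrt (real g)) else 0)"
    proof (cases "1 \<le> g")
      case g: True
      have s: "sqrt (real g) \<ge> 1" using g by simp
      have i: "1 \<le> q / (sqrt (real g) * M a) * M a \<longleftrightarrow> sqrt (real g) \<le> q"
        using M[of a] s by (simp add: pos_le_divide_eq)
      have "4 * Kn TYPE('n) * (x * ?P) * M a * (q / (sqrt (real g) * M a)) ^ (?m + 1) / (M a * ?P)
         = 4 * Kn TYPE('n) * x * (q / M a / sqrt (real g)) ^ (?m + 1)"
      proof -
        have "k * (x * p) * m * (q / (r * m)) ^ l / (m * p) = k * x * (q / m / r) ^ l" if "m > 0" "p > 0" for k m p r :: real and l
          using that by (simp add: field_simps)
        from this[OF M[of a] P] show ?thesis .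
      qed
      also have "\<dots> = c / sqrt (real g) ^ (?m + 1)" unfolding c_def power_divide[of "q / M a"] by simp
      \<comment> \<open>Only the first power of 1 / sqrt g is kept; for empty I there is no more. As
        g runs up to q^2 the sum is O(q), which raises the power of q from m + 1 to m + 2.\<close>
      also have "\<dots> \<le> c / sqrt (real g)"
        using s c0 by (intro divide_left_mono) (auto simp: self_le_power)
      finally show ?thesis unfolding i by (auto intro: ennreal_leI)
    qed simp
  qed
  also have "\<dots> \<le> (if 1 \<le> q then ennreal (2 * c * q) else 0)" by (rule nn_integral_inverse_sqrt[OF c0 q0])
  also have "\<dots> = row_bound M a ?m x ?v"
  proof -
    have "2 * c * q = 8 * Kn TYPE('n) * x * (1 / M a) ^ (?m + 1) * q ^ (?m + 2)"
      by (simp add: c_def power_divide field_simps)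
    then show ?thesis unfolding row_bound_def q_def by simp
  qed
  finally show ?thesis .
qed

text \<open>The expected number of \<open>L\<close> in \<open>LL I\<close> with normalised covolume at most \<open>x\<close>, where the entries of the
  symmetric matrix are uniform in the unit cube.\<close>

definition EL :: "('n::finite \<Rightarrow> real) \<Rightarrow> 'n set \<Rightarrow> real \<Rightarrow> ennreal" where
  "EL M I x = (\<integral>\<^sup>+L. (\<integral>\<^sup>+F. indicator unit_cube F * indicator {F. nvol M (symF F) I L \<le> x} F \<partial>lborel) \<partial>count_space (LL I))"

lemma nn_integral_count_Un:
  "(\<integral>\<^sup>+x. f x \<partial>count_space (A \<union> B)) \<le> (\<integral>\<^sup>+x. f x \<partial>count_space A) + (\<integral>\<^sup>+x. f x \<partial>count_space B)"
proof -
  have "(\<integral>\<^sup>+x. f x \<partial>count_space (A \<union> B)) = (\<integral>\<^sup>+x. f x * indicator (A \<union> B) x \<partial>count_space UNIV)"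
    by (simp add: nn_integral_count_space_indicator)
  also have "\<dots> \<le> (\<integral>\<^sup>+x. f x * indicator A x + f x * indicator B x \<partial>count_space UNIV)"
    by (rule nn_integral_mono) (auto simp: indicator_def)
  also have "\<dots> = (\<integral>\<^sup>+x. f x \<partial>count_space A) + (\<integral>\<^sup>+x. f x \<partial>count_space B)"
    by (subst nn_integral_add) (simp_all add: nn_integral_count_space_indicator)
  finally show ?thesis .
qed

lemma measurable_rowF [measurable]: "rowF a \<in> borel_measurable borel"
proof -
  have "continuous_on UNIV (\<lambda>x::real^'a. if s = {a, j} then x $ j else 0)" for s j
    by (cases "s = {a, j}") (auto intro!: continuous_intros)
  then show ?thesis
    unfolding rowF_def by (intro borel_measurable_continuous_onI continuous_on_vec_lambda continuous_on_sum)
qed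

text \<open>The sum over all L is periodic in the entries, because integral shifts permute the L. An
  extra average over row a can therefore be inserted, and for fixed F it is controlled parent by
  parent through \<open>children_bound\<close>.\<close>

lemma children_average:
  fixes M :: "'n::finite \<Rightarrow> real"
  assumes M: "\<And>i. M i > 0" and aI: "a \<notin> I" and Ma: "\<And>j. j \<in> I \<Longrightarrow> M a \<le> M j" and x: "x > 0"
  defines "A \<equiv> {L \<in> LL (insert a I). kv a \<notin> L}" and "e \<equiv> x * (\<Prod>j\<in>-insert a I. M j)"
  shows "(\<integral>\<^sup>+L. (\<integral>\<^sup>+F. indicator unit_cube F * indicator {F. lvol M (symF F) L \<le> e} F \<partial>lborel) \<partial>count_space A)
    \<le> (\<integral>\<^sup>+Lb. (\<integral>\<^sup>+F. indicator unit_cube F * row_bound M a (card I) x (nvol M (symF F) I Lb) \<partial>lborel) \<partial>count_space (LL I))"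
proof -
  have cA: "countable A" unfolding A_def using countable_LL[of "insert a I"] by (rule countable_subset[rotated]) auto
  define G where "G F = (\<integral>\<^sup>+L. indicator {F. lvol M (symF F) L \<le> e} F \<partial>count_space A :: ennreal)" for F
  have [measurable]: "G \<in> borel_measurable borel"
    unfolding G_def by (rule borel_measurable_count_sum[OF cA]) measurable
  have Gper: "G (F + axis s 1) = G F" for F s
  proof -
    let ?T = "symF (axis s 1 :: real ^ ('n set))"
    have T: "transpose ?T = ?T" "\<And>i j. ?T $ i $ j \<in> \<int>" by (auto simp: transpose_symF) (auto simp: symF_def axis_def)
    have T': "transpose (- ?T) = - ?T" "\<And>i j. (- ?T) $ i $ j \<in> \<int>" using T by (auto simp: transpose_def vec_eq_iff)
    have kvim: "kv j \<in> tshift R ` L \<longleftrightarrow> kv j \<in> L" for j R and L :: "(complex ^ 'n) set"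
      by (metis (no_types, lifting) image_iff tshift_inv(1) tshift_kv)
    have mem: "tshift R ` L \<in> A" if "L \<in> A" "transpose R = R" "\<And>i j. R $ i $ j \<in> \<int>" for L and R :: "real ^ 'n ^ 'n"
      using that tshift_lag[of R L] by (simp add: A_def LL_def kvim)
    have bij: "bij_betw (\<lambda>L. tshift ?T ` L) A A"
      by (rule bij_betwI[of _ _ _ "\<lambda>L. tshift (- ?T) ` L"])
         (use mem T T' in \<open>auto simp: image_image tshift_inv\<close>)
    have "G (F + axis s 1) = (\<integral>\<^sup>+L. indicator {F. lvol M (symF F) (tshift ?T ` L) \<le> e} F \<partial>count_space A)"
      unfolding G_def
    proof (rule nn_integral_cong)
      fix L assume "L \<in> space (count_space A)"
      then have "lag L" by (simp add: A_def LL_def)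
      then show "indicator {F. lvol M (symF F) L \<le> e} (F + axis s 1) = (indicator {F. lvol M (symF F) (tshift ?T ` L) \<le> e} F :: ennreal)"
        using lvol_tshift[where M=M, OF transpose_symF M T, of L F] by (simp add: indicator_def symF_add)
    qed
    also have "\<dots> = G F" unfolding G_def by (rule nn_integral_bij_count_space[OF bij])
    finally show ?thesis .
  qed
  have "(\<integral>\<^sup>+L. (\<integral>\<^sup>+F. indicator unit_cube F * indicator {F. lvol M (symF F) L \<le> e} F \<partial>lborel) \<partial>count_space A)
    = (\<integral>\<^sup>+F. (\<integral>\<^sup>+L. indicator unit_cube F * indicator {F. lvol M (symF F) L \<le> e} F \<partial>count_space A) \<partial>lborel)"
    by (rule nn_integral_count_space_nn_integral[symmetric, OF cA]) measurable
  also have "\<dots> = (\<integral>\<^sup>+F. indicator unit_cube F * G F \<partial>lborel)"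
    by (simp add: G_def nn_integral_cmult)
  also have "\<dots> = (\<integral>\<^sup>+y. indicator unit_cube (y :: real ^ 'n) * (\<integral>\<^sup>+F. indicator unit_cube F * G F \<partial>lborel) \<partial>lborel)"
    by (subst nn_integral_multc) (simp_all add: emeasure_unit_cube)
  also have "\<dots> = (\<integral>\<^sup>+y. \<integral>\<^sup>+F. indicator unit_cube (y :: real ^ 'n) * (indicator unit_cube F * G (F + rowF a y)) \<partial>lborel \<partial>lborel)"
  proof (rule nn_integral_cong)
    fix y :: "real ^ 'n"
    have "(\<integral>\<^sup>+F. indicator unit_cube F * G F \<partial>lborel) = (\<integral>\<^sup>+F. indicator unit_cube F * G (F + rowF a y) \<partial>lborel)"
      by (rule nn_integral_cube_shift[symmetric]) (use Gper in auto)
    then show "indicator unit_cube y * (\<integral>\<^sup>+F. indicator unit_cube F * G F \<partial>lborel) = (\<integral>\<^sup>+F. indicator unit_cube y * (indicator unit_cube F * G (F + rowF a y)) \<partial>lborel)"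
      by (simp add: nn_integral_cmult)
  qed
  also have "\<dots> = (\<integral>\<^sup>+F. \<integral>\<^sup>+y. indicator unit_cube (y :: real ^ 'n) * (indicator unit_cube F * G (F + rowF a y)) \<partial>lborel \<partial>lborel)"
    by (rule lborel_pair.Fubini') measurable
  also have "\<dots> \<le> (\<integral>\<^sup>+F. \<integral>\<^sup>+Lb. indicator unit_cube F * row_bound M a (card I) x (nvol M (symF F) I Lb) \<partial>count_space (LL I) \<partial>lborel)"
  proof (rule nn_integral_mono)
    fix F :: "real ^ ('n set)"
    let ?f = "\<lambda>L. \<integral>\<^sup>+y. indicator unit_cube y * indicator {y. lvol M (symF F + rowm a y) L \<le> e} y \<partial>lborel"
    have "(\<integral>\<^sup>+y. indicator unit_cube (y :: real ^ 'n) * (indicator unit_cube F * G (F + rowF a y)) \<partial>lborel)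
      = indicator unit_cube F * (\<integral>\<^sup>+y. indicator unit_cube (y :: real ^ 'n) * G (F + rowF a y) \<partial>lborel)"
      by (subst nn_integral_cmult[symmetric]) (auto simp: mult_ac)
    also have "(\<integral>\<^sup>+y. indicator unit_cube (y :: real ^ 'n) * G (F + rowF a y) \<partial>lborel)
      = (\<integral>\<^sup>+y. \<integral>\<^sup>+L. indicator unit_cube y * indicator {y. lvol M (symF F + rowm a y) L \<le> e} y \<partial>count_space A \<partial>lborel)"
      by (simp add: G_def nn_integral_cmult symF_add symF_rowF indicator_def)
    also have "\<dots> = (\<integral>\<^sup>+L. ?f L \<partial>count_space A)"
      by (rule nn_integral_count_space_nn_integral[OF cA]) measurable
    also have "\<dots> = (\<integral>\<^sup>+L. ?f L * indicator A L \<partial>count_space UNIV)" by (simp add: nn_integral_count_space_indicator)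
    \<comment> \<open>Each L is charged to its reduction, the only parent whose children it belongs
      to.\<close>
    also have "\<dots> \<le> (\<integral>\<^sup>+L. \<integral>\<^sup>+Lb. ?f L * indicator (children a I Lb) L \<partial>count_space (LL I) \<partial>count_space UNIV)"
    proof (rule nn_integral_mono)
      fix L :: "(complex ^ 'n) set"
      show "?f L * indicator A L \<le> (\<integral>\<^sup>+Lb. ?f L * indicator (children a I Lb) L \<partial>count_space (LL I))"
      proof (cases "L \<in> A")
        case True
        then have r: "red a L \<in> LL I" "L \<in> children a I (red a L)" using red_LL by (auto simp: A_def children_def)
        have "?f L * indicator A L = (\<integral>\<^sup>+Lb. ?f L * indicator {red a L} Lb \<partial>count_space (LL I))"
          using True r by (subst nn_integral_cmult_indicator) auto
        also have "\<dots> \<le> (\<integral>\<^sup>+Lb. ?f L * indicator (children a I Lb) L \<partial>count_space (LL I))"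
          by (rule nn_integral_mono) (use r in \<open>auto simp: indicator_def\<close>)
        finally show ?thesis .
      qed simp
    qed
    also have "\<dots> = (\<integral>\<^sup>+Lb. \<integral>\<^sup>+L. ?f L * indicator (children a I Lb) L \<partial>count_space UNIV \<partial>count_space (LL I))"
      by (rule nn_integral_count_space_nn_integral[OF countable_LL]) simp
    also have "\<dots> = (\<integral>\<^sup>+Lb. \<integral>\<^sup>+L. ?f L \<partial>count_space (children a I Lb) \<partial>count_space (LL I))"
      by (simp add: nn_integral_count_space_indicator)
    also have "\<dots> \<le> (\<integral>\<^sup>+Lb. row_bound M a (card I) x (nvol M (symF F) I Lb) \<partial>count_space (LL I))"
      unfolding e_def by (rule nn_integral_mono) (use children_bound[where M=M, OF transpose_symF M _ aI Ma x] in auto)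
    finally show "(\<integral>\<^sup>+y. indicator unit_cube (y :: real ^ 'n) * (indicator unit_cube F * G (F + rowF a y)) \<partial>lborel)
      \<le> (\<integral>\<^sup>+Lb. indicator unit_cube F * row_bound M a (card I) x (nvol M (symF F) I Lb) \<partial>count_space (LL I))"
      by (simp add: nn_integral_cmult mult_left_mono)
  qed
  also have "\<dots> = (\<integral>\<^sup>+Lb. (\<integral>\<^sup>+F. indicator unit_cube F * row_bound M a (card I) x (nvol M (symF F) I Lb) \<partial>lborel) \<partial>count_space (LL I))"
    by (rule nn_integral_count_space_nn_integral[OF countable_LL])
       (simp add: row_bound_def nvol_def, measurable)
  finally show ?thesis .
qed

lemma EL_step:
  fixes M :: "'n::finite \<Rightarrow> real"
  assumes M: "\<And>i. M i > 0" and aI: "a \<notin> I" and Ma: "\<And>j. j \<in> I \<Longrightarrow> M a \<le> M j" and x: "x > 0"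
  shows "EL M (insert a I) x \<le> EL M I (x / M a)
    + (\<integral>\<^sup>+Lb. (\<integral>\<^sup>+F. indicator unit_cube F * row_bound M a (card I) x (nvol M (symF F) I Lb) \<partial>lborel) \<partial>count_space (LL I))"
proof -
  let ?A = "{L \<in> LL (insert a I). kv a \<notin> L}"
  let ?f = "\<lambda>L. (\<integral>\<^sup>+F. indicator unit_cube F * indicator {F. nvol M (symF F) (insert a I) L \<le> x} F \<partial>lborel)"
  have P: "(\<Prod>j\<in>-insert a I. M j) > 0" using M by (simp add: prod_pos)
  have U: "LL (insert a I) = LL I \<union> ?A" by (auto simp: LL_def)
  have "EL M (insert a I) x \<le> (\<integral>\<^sup>+L. ?f L \<partial>count_space (LL I)) + (\<integral>\<^sup>+L. ?f L \<partial>count_space ?A)"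
    unfolding EL_def by (subst U) (rule nn_integral_count_Un)
  also have "(\<integral>\<^sup>+L. ?f L \<partial>count_space (LL I)) = EL M I (x / M a)"
  proof -
    have "nvol M X (insert a I) L \<le> x \<longleftrightarrow> nvol M X I L \<le> x / M a" for X L
      using nvol_insert[of a I M X L] aI M[of a] by (simp add: pos_le_divide_eq mult.commute)
    then show ?thesis by (simp add: EL_def)
  qed
  also have "(\<integral>\<^sup>+L. ?f L \<partial>count_space ?A) \<le> (\<integral>\<^sup>+Lb. (\<integral>\<^sup>+F. indicator unit_cube F * row_bound M a (card I) x (nvol M (symF F) I Lb) \<partial>lborel) \<partial>count_space (LL I))"
  proof -
    have "nvol M X (insert a I) L \<le> x \<longleftrightarrow> lvol M X L \<le> x * (\<Prod>j\<in>-insert a I. M j)" for X L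
      using P by (simp add: nvol_def pos_divide_le_eq)
    then show ?thesis using children_average[where M=M, OF M aI Ma x] by simp
  qed
  finally show ?thesis by (simp add: add_left_mono)
qed

section \<open>The induction on the number of coordinates\<close>

lemma nn_integral_LL_empty_le:
  assumes "\<And>L. L \<in> LL {} \<Longrightarrow> f L \<le> (c :: ennreal)"
  shows "(\<integral>\<^sup>+L. f L \<partial>count_space (LL ({} :: 'n::finite set))) \<le> c"
proof -
  define L0 where "L0 = {p \<in> glat :: (complex ^ 'n) set. \<forall>j. Re (p $ j) = 0}"
  have sub: "LL ({} :: 'n set) \<subseteq> {L0}" using LL_empty by (auto simp: L0_def)
  have "(\<integral>\<^sup>+L. f L \<partial>count_space (LL ({} :: 'n set))) \<le> (\<integral>\<^sup>+L. c \<partial>count_space (LL ({} :: 'n set)))"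
    by (rule nn_integral_mono) (use assms in auto)
  also have "\<dots> \<le> (\<integral>\<^sup>+L. c \<partial>count_space {L0})" by (rule nn_integral_count_mono_set[OF sub])
  also have "\<dots> = c" by simp
  finally show ?thesis .
qed

lemma dyadic_power:
  assumes "(1::real) \<le> q" obtains k where "2 ^ k \<le> q" "q < 2 ^ (k + 1)"
proof -
  obtain n where n: "q < 2 ^ n" using real_arch_pow[of 2 q] by auto
  define k where "k = (LEAST n. q < 2 ^ n)"
  have k: "q < 2 ^ k" unfolding k_def using n by (rule LeastI)
  then have "k \<noteq> 0" using assms by (metis not_le power_0)
  then obtain l where l: "k = Suc l" by (metis not0_implies_Suc)
  have "\<not> q < 2 ^ l" using not_less_Least[of l "\<lambda>n. q < 2 ^ n"] l by (simp add: k_def)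
  then show thesis using that[of l] k l by simp
qed

text \<open>If 2^k is the dyadic size of sqrt (x M a / v), then v is at most x M a / 4^k. Layering
  expresses the sum of powers of v over the parents through their counting function, to which the
  induction hypothesis applies.\<close>

lemma row_bound_layers:
  fixes M :: "'n::finite \<Rightarrow> real"
  assumes x: "x > 0" and Ma: "M a > 0" and v: "v > 0"
  shows "row_bound M a m x v \<le> (\<integral>\<^sup>+k. ennreal (8 * Kn TYPE('n) * x * (1 / M a) ^ (m + 1) * 2 ^ ((k + 1) * (m + 2))) * indicator {v. v \<le> x * M a / 4 ^ k} v \<partial>count_space (UNIV::nat set))"
proof (cases "1 \<le> sqrt (x * M a / v)")
  case True
  let ?q = "sqrt (x * M a / v)"
  obtain k where k: "2 ^ k \<le> ?q" "?q < 2 ^ (k + 1)" using dyadic_power[OF True] by blast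
  have "(2 ^ k)\<^sup>2 \<le> ?q\<^sup>2" using k by (intro power_mono) auto
  then have "4 ^ k \<le> x * M a / v" using x Ma v by (simp add: power_mult[symmetric] mult.commute[of k] power_mult)
  then have vk: "v \<le> x * M a / 4 ^ k" using v by (simp add: field_simps)
  have "?q ^ (m + 2) \<le> (2 ^ (k + 1)) ^ (m + 2)" using k True by (intro power_mono) auto
  then have "row_bound M a m x v \<le> ennreal (8 * Kn TYPE('n) * x * (1 / M a) ^ (m + 1) * 2 ^ ((k + 1) * (m + 2)))"
    unfolding row_bound_def power_mult if_P[OF True] using x Ma by (intro ennreal_leI mult_left_mono) auto
  also have "\<dots> = (\<integral>\<^sup>+k'. ennreal (8 * Kn TYPE('n) * x * (1 / M a) ^ (m + 1) * 2 ^ ((k + 1) * (m + 2))) * indicator {k} k' \<partial>count_space UNIV)"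
    by (subst nn_integral_cmult_indicator) auto
  also have "\<dots> \<le> (\<integral>\<^sup>+k. ennreal (8 * Kn TYPE('n) * x * (1 / M a) ^ (m + 1) * 2 ^ ((k + 1) * (m + 2))) * indicator {v. v \<le> x * M a / 4 ^ k} v \<partial>count_space UNIV)"
    by (rule nn_integral_mono) (use vk in \<open>auto simp: indicator_def\<close>)
  finally show ?thesis .
qed (simp add: row_bound_def)

text \<open>Comparability bounds M j by the power 1 + 1/n of M a, and (1 + 1/n) |I| \<le> |I| + 1
  because |I| \<le> n. This decides how much comparability the induction asks for.\<close>

lemma near_prod_le:
  fixes M :: "'n::finite \<Rightarrow> real"
  assumes M: "\<And>i. 1 \<le> M i" and near: "\<And>i j. M i ^ CARD('n) \<le> M j ^ (CARD('n) + 1)"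
  shows "(\<Prod>j\<in>I. M j) \<le> M a ^ (card I + 1)"
proof -
  let ?n = "CARD('n)"
  have "(\<Prod>j\<in>I. M j) ^ ?n = (\<Prod>j\<in>I. M j ^ ?n)" by (simp add: prod_power_distrib)
  also have "\<dots> \<le> (\<Prod>j\<in>I. M a ^ (?n + 1))"
    by (rule prod_mono) (use near M order_trans[OF zero_le_one M] in auto)
  also have "\<dots> = M a ^ ((?n + 1) * card I)" by (simp only: prod_constant power_mult)
  also have "\<dots> \<le> M a ^ ((card I + 1) * ?n)"
  proof (rule power_increasing)
    have "card I \<le> ?n" by (simp add: card_mono)
    then show "(?n + 1) * card I \<le> (card I + 1) * ?n" by (simp add: algebra_simps)
  qed (rule M)
  finally have "(\<Prod>j\<in>I. M j) ^ ?n \<le> (M a ^ (card I + 1)) ^ ?n" by (simp only: power_mult)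
  then show ?thesis
    by (rule power_le_imp_le_base[of _ "?n - 1", simplified Suc_diff_1[OF zero_less_card_finite]]) 
       (use M[of a] in simp)
qed

text \<open>Induction on the coordinates: a Lagrangian sublattice is either inherited from \<open>I\<close> or a child of its
  reduction. The comparability hypothesis on \<open>M\<close> makes the inherited ones as rare as the children.\<close>

lemma EL_bound:
  "\<exists>C\<ge>0. \<forall>(M :: 'n::finite \<Rightarrow> real) I x. (\<forall>i. 1 \<le> M i) \<longrightarrow> (\<forall>i j. M i ^ CARD('n) \<le> M j ^ (CARD('n) + 1)) \<longrightarrow>
     card I = m \<longrightarrow> (\<forall>a\<in>-I. \<forall>j\<in>I. M a \<le> M j) \<longrightarrow> 0 < x \<longrightarrow> EL M I x \<le> ennreal (C * x ^ (m + 1))"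
proof (induction m)
  case 0
  have "EL M I x \<le> ennreal (1 * x ^ (0 + 1))" if M: "\<forall>i. 1 \<le> M i" and I: "card I = 0" and x: "0 < x" for M :: "'n \<Rightarrow> real" and I x
  proof -
    have I: "I = {}" using I by simp
    have M0: "M i > 0" for i using M by (meson less_le_trans zero_less_one)
    show ?thesis
      unfolding I EL_def
    proof (rule nn_integral_LL_empty_le)
      fix L :: "(complex ^ 'n) set" assume L: "L \<in> LL {}"
      have "(\<integral>\<^sup>+F. indicator unit_cube F * indicator {F. nvol M (symF F) {} L \<le> x} F \<partial>lborel) \<le> (\<integral>\<^sup>+F. indicator unit_cube (F :: real ^ ('n set)) * ennreal x \<partial>lborel)"
      proof (rule nn_integral_mono)
        fix F :: "real ^ ('n set)"
        have "nvol M (symF F) {} L \<ge> 1" by (rule nvol_empty_ge_1[where M=M, OF transpose_symF M0 L])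
        then have "nvol M (symF F) {} L \<le> x \<Longrightarrow> 1 \<le> x" by simp
        then have "indicator {F. nvol M (symF F) {} L \<le> x} F \<le> ennreal x"
          by (simp add: indicator_def)
        then show "indicator unit_cube F * indicator {F. nvol M (symF F) {} L \<le> x} F \<le> indicator unit_cube F * ennreal x"
          by (rule mult_left_mono) simp
      qed
      also have "\<dots> = ennreal x" by (subst nn_integral_multc) (simp_all add: emeasure_unit_cube)
      finally show "(\<integral>\<^sup>+F. indicator unit_cube F * indicator {F. nvol M (symF F) {} L \<le> x} F \<partial>lborel) \<le> ennreal (1 * x ^ (0 + 1))" by simp
    qed
  qed
  then show ?case by (intro exI[of _ 1]) auto
next
  case (Suc m)
  then obtain C where C0: "C \<ge> 0" and C: "\<And>(M :: 'n \<Rightarrow> real) I x. (\<forall>i. 1 \<le> M i) \<Longrightarrow> (\<forall>i j. M i ^ CARD('n) \<le> M j ^ (CARD('n) + 1)) \<Longrightarrow>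
     card I = m \<Longrightarrow> (\<forall>a\<in>-I. \<forall>j\<in>I. M a \<le> M j) \<Longrightarrow> 0 < x \<Longrightarrow> EL M I x \<le> ennreal (C * x ^ (m + 1))" by blast
  define K where "K = 8 * Kn TYPE('n)"
  have K0: "K \<ge> 0" by (simp add: K_def)
  define C' where "C' = C + K * (C * 2 ^ (m + 3) + 1)"
  have "EL M I' x \<le> ennreal (C' * x ^ (Suc m + 1))"
    if M: "\<forall>i. 1 \<le> M i" and near: "\<forall>i j. M i ^ CARD('n) \<le> M j ^ (CARD('n) + 1)" and cI: "card I' = Suc m"
      and up: "\<forall>a\<in>-I'. \<forall>j\<in>I'. M a \<le> M j" and x: "0 < x" for M :: "'n \<Rightarrow> real" and I' x
  proof -
    have M0: "M i > 0" for i using M by (meson less_le_trans zero_less_one)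
    have "I' \<noteq> {}" using cI by auto
    \<comment> \<open>The coordinate split off is one with the smallest side in I', so the remaining
      set again consists of the largest sides.\<close>
    then obtain a where a: "a \<in> I'" "\<And>j. j \<in> I' \<Longrightarrow> M a \<le> M j"
      using ex_min_if_finite[of "M ` I'"] by (metis (no_types, lifting) finite finite_imageI arg_min_if_finite(1) arg_min_least)
    define I where "I = I' - {a}"
    have I': "I' = insert a I" and aI: "a \<notin> I" using a by (auto simp: I_def)
    have cm: "card I = m" using cI a by (simp add: I_def)
    have Ma: "M a \<le> M j" if "j \<in> I" for j using a that by (simp add: I_def)
    have up': "\<forall>b\<in>-I. \<forall>j\<in>I. M b \<le> M j" using up Ma by (auto simp: I_def)
    have EC: "EL M I t \<le> ennreal (C * t ^ (m + 1))" if "t > 0" for t by (rule C[OF M near cm up' that])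
    \<comment> \<open>The inherited lattices. Below the bound of \<open>nvol_lower\<close> there are
      none. Otherwise comparability makes x at least (1 / M a)^(m + 1), and this factor of the
      inductive bound is traded for one more power of x.\<close>
    have partA: "EL M I (x / M a) \<le> ennreal (C * x ^ (m + 2))"
    proof (cases "x / M a < (\<Prod>j\<in>I. 1 / M j)")
      case True
      have "EL M I (x / M a) = (\<integral>\<^sup>+L. 0 \<partial>count_space (LL I))"
        unfolding EL_def
      proof (rule nn_integral_cong)
        fix L assume "L \<in> space (count_space (LL I))"
        then have "nvol M (symF F) I L > x / M a" for F
          using nvol_lower[where M=M, OF transpose_symF, of L I F] M True by fastforce
        then show "(\<integral>\<^sup>+F. indicator unit_cube F * indicator {F. nvol M (symF F) I L \<le> x / M a} F \<partial>lborel) = 0"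
          by (simp add: not_le[symmetric])
      qed
      then show ?thesis by simp
    next
      case False
      have "(\<Prod>j\<in>I. M j) > 0" using M0 by (simp add: prod_pos)
      have "M a / (\<Prod>j\<in>I. M j) \<le> x" using False M0[of a] by (simp add: prod_dividef not_less field_simps)
      moreover have "(\<Prod>j\<in>I. M j) \<le> M a ^ (m + 1)" using near_prod_le[of M I a] M near cm by auto
      ultimately have "M a / M a ^ (m + 1) \<le> x"
        using \<open>(\<Prod>j\<in>I. M j) > 0\<close> M0[of a] by (smt (verit) frac_le)
      moreover have "(1 / M a) ^ (m + 1) \<le> M a / M a ^ (m + 1)"
      proof -
        have "1 / M a ^ (m + 1) \<le> M a / M a ^ (m + 1)" using M0[of a] M by (intro divide_right_mono) auto
        then show ?thesis by (simp add: power_one_over)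
      qed
      ultimately have "(1 / M a) ^ (m + 1) \<le> x" by linarith
      then have "x ^ (m + 1) * (1 / M a) ^ (m + 1) \<le> x ^ (m + 1) * x" using x by (intro mult_left_mono) auto
      then have "C * (x / M a) ^ (m + 1) \<le> C * x ^ (m + 2)"
        using C0 by (intro mult_left_mono) (auto simp: power_divide mult_ac)
      then show ?thesis using EC[of "x / M a"] x M0[of a] by (meson divide_pos_pos ennreal_leI order_trans)
    qed
    have partB: "(\<integral>\<^sup>+Lb. (\<integral>\<^sup>+F. indicator unit_cube F * row_bound M a (card I) x (nvol M (symF F) I Lb) \<partial>lborel) \<partial>count_space (LL I))
       \<le> ennreal (K * (C * 2 ^ (m + 3) + 1) * x ^ (m + 2))"
    \<comment> \<open>The geometric series below has ratio 2^(-m), so m = 0 is treated apart: then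
      the only parent is the vertical lattice, of normalised covolume at least 1, and no layering is
      required.\<close>
    proof (cases "m = 0")
      case True
      then have I0: "I = {}" using cm by simp
      show ?thesis
        unfolding I0
      proof (rule nn_integral_LL_empty_le)
        fix L :: "(complex ^ 'n) set" assume L: "L \<in> LL {}"
        have "row_bound M a 0 x (nvol M (symF F) {} L) \<le> ennreal (K * x ^ 2)" for F
        proof -
          let ?v = "nvol M (symF F) {} L"
          have v: "?v \<ge> 1" by (rule nvol_empty_ge_1[where M=M, OF transpose_symF M0 L])
          have "sqrt (x * M a / ?v) ^ (0 + 2) = x * M a / ?v" using x M0[of a] v by simp
          also have "\<dots> \<le> x * M a / 1" using v x M0[of a] by (intro divide_left_mono) auto
          also have "\<dots> = x * M a" by simp
          finally have "K * x * (1 / M a) ^ (0 + 1) * sqrt (x * M a / ?v) ^ (0 + 2) \<le> K * x * (1 / M a) ^ (0 + 1) * (x * M a)"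
            using K0 x M0[of a] by (intro mult_left_mono) auto
          also have "\<dots> = K * x ^ 2" using M0[of a] by (simp add: power2_eq_square)
          finally show ?thesis by (auto simp: row_bound_def K_def intro!: ennreal_leI)
        qed
        then have "(\<integral>\<^sup>+F. indicator unit_cube F * row_bound M a (card ({}::'n set)) x (nvol M (symF F) {} L) \<partial>lborel) \<le> (\<integral>\<^sup>+F. indicator unit_cube (F :: real ^ ('n set)) * ennreal (K * x ^ 2) \<partial>lborel)"
          by (intro nn_integral_mono mult_left_mono) auto
        also have "\<dots> = ennreal (K * x ^ 2)" by (subst nn_integral_multc) (simp_all add: emeasure_unit_cube)
        also have "\<dots> \<le> ennreal (K * (C * 2 ^ (m + 3) + 1) * x ^ (m + 2))"
          using True K0 C0 x by (intro ennreal_leI) (simp add: algebra_simps power2_eq_square)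
        finally show "(\<integral>\<^sup>+F. indicator unit_cube F * row_bound M a (card ({}::'n set)) x (nvol M (symF F) {} L) \<partial>lborel)
          \<le> ennreal (K * (C * 2 ^ (m + 3) + 1) * x ^ (m + 2))" .
      qed
    next
      case False
      then have m: "m \<ge> 1" by simp
      let ?c = "\<lambda>k. K * x * (1 / M a) ^ (m + 1) * 2 ^ ((k + 1) * (m + 2))"
      have c0: "?c k \<ge> 0" for k using K0 x M0[of a] by simp
      have "(\<integral>\<^sup>+Lb. (\<integral>\<^sup>+F. indicator unit_cube F * row_bound M a (card I) x (nvol M (symF F) I Lb) \<partial>lborel) \<partial>count_space (LL I))
        \<le> (\<integral>\<^sup>+Lb. (\<integral>\<^sup>+F. \<integral>\<^sup>+k. ennreal (?c k) * (indicator unit_cube F * indicator {F. nvol M (symF F) I Lb \<le> x * M a / 4 ^ k} F) \<partial>count_space (UNIV::nat set) \<partial>lborel) \<partial>count_space (LL I))"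
      proof (intro nn_integral_mono)
        fix Lb F assume "Lb \<in> space (count_space (LL I))"
        then have "lag Lb" by (simp add: LL_def)
        then have "nvol M (symF F) I Lb > 0"
          using lvol_pos[where M=M, OF transpose_symF M0] M0 by (simp add: nvol_def prod_pos)
        from row_bound_layers[where M=M, OF x M0 this, of a m]
        have "row_bound M a (card I) x (nvol M (symF F) I Lb) \<le> (\<integral>\<^sup>+k. ennreal (?c k) * indicator {F. nvol M (symF F) I Lb \<le> x * M a / 4 ^ k} F \<partial>count_space UNIV)"
          unfolding cm K_def by (simp add: indicator_def)
        then show "indicator unit_cube F * row_bound M a (card I) x (nvol M (symF F) I Lb) \<le> (\<integral>\<^sup>+k. ennreal (?c k) * (indicator unit_cube F * indicator {F. nvol M (symF F) I Lb \<le> x * M a / 4 ^ k} F) \<partial>count_space UNIV)"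
          by (cases "F \<in> unit_cube") simp_all
      qed
      also have "\<dots> = (\<integral>\<^sup>+Lb. (\<integral>\<^sup>+k. \<integral>\<^sup>+F. ennreal (?c k) * (indicator unit_cube F * indicator {F. nvol M (symF F) I Lb \<le> x * M a / 4 ^ k} F) \<partial>lborel \<partial>count_space (UNIV::nat set)) \<partial>count_space (LL I))"
        by (intro nn_integral_cong nn_integral_count_space_nn_integral) (auto simp: nvol_def)
      also have "\<dots> = (\<integral>\<^sup>+k. (\<integral>\<^sup>+Lb. \<integral>\<^sup>+F. ennreal (?c k) * (indicator unit_cube F * indicator {F. nvol M (symF F) I Lb \<le> x * M a / 4 ^ k} F) \<partial>lborel \<partial>count_space (LL I)) \<partial>count_space (UNIV::nat set))"
        by (rule nn_integral_count_space_nn_integral) auto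
      also have "\<dots> = (\<integral>\<^sup>+k. ennreal (?c k) * EL M I (x * M a / 4 ^ k) \<partial>count_space (UNIV::nat set))"
        unfolding EL_def by (subst nn_integral_cmult, simp add: nvol_def, simp add: nn_integral_cmult)
      \<comment> \<open>The layer weight 2^(k (m + 2)) meets the inductive factor 4^(- k (m + 1)),
        which leaves 2^(- k m); the powers of M a cancel.\<close>
      also have "\<dots> \<le> (\<integral>\<^sup>+k. ennreal (K * C * 2 ^ (m + 2) * x ^ (m + 2) * (1 / 2) ^ k) \<partial>count_space (UNIV::nat set))"
      proof (rule nn_integral_mono)
        fix k :: nat
        have "ennreal (?c k) * EL M I (x * M a / 4 ^ k) \<le> ennreal (?c k) * ennreal (C * (x * M a / 4 ^ k) ^ (m + 1))"
          by (intro mult_left_mono EC) (use x M0[of a] in auto)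
        also have "\<dots> = ennreal (?c k * (C * (x * M a / 4 ^ k) ^ (m + 1)))"
          by (rule ennreal_mult[symmetric]) (use c0 C0 x M0[of a] in auto)
        also have "\<dots> \<le> ennreal (K * C * 2 ^ (m + 2) * x ^ (m + 2) * (1 / 2) ^ k)"
        proof (rule ennreal_leI)
          have "(k + 1) * (m + 2) = (m + 2) + k * (m + 2)" by simp
          then have e1: "(2::real) ^ ((k + 1) * (m + 2)) = 2 ^ (m + 2) * 2 ^ (k * (m + 2))" by (simp only: power_add)
          have "(4::real) = 2 ^ 2" by simp
          then have "((4::real) ^ k) ^ (m + 1) = 2 ^ (2 * k * (m + 1))" by (simp only: power_mult)
          also have "2 * k * (m + 1) = k * (m + 2) + k * m" by (simp add: algebra_simps)
          finally have e2: "((4::real) ^ k) ^ (m + 1) = 2 ^ (k * (m + 2)) * 2 ^ (k * m)" by (simp only: power_add)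
          have "(1 / M a) ^ (m + 1) * (x * M a / 4 ^ k) ^ (m + 1) = (1 / M a * (x * M a / 4 ^ k)) ^ (m + 1)"
            by (simp only: power_mult_distrib)
          also have "1 / M a * (x * M a / 4 ^ k) = x / 4 ^ k" using M0[of a] by simp
          finally have e3: "(1 / M a) ^ (m + 1) * (x * M a / 4 ^ k) ^ (m + 1) = x ^ (m + 1) / (2 ^ (k * (m + 2)) * 2 ^ (k * m))"
            by (simp only: power_divide e2)
          have ar: "K * x * u * (A * B) * (C * y) = K * C * A * (x * z) * (1 / D)" if "u * y = z / (B * D)" "B > 0" "D > 0" for u A B y z D :: real
          proof -
            have "K * x * u * (A * B) * (C * y) = K * C * A * x * B * (u * y)" by (simp only: mult_ac)
            also have "\<dots> = K * C * A * (x * z) * (1 / D)" using that by (simp add: field_simps)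
            finally show ?thesis .
          qed
          have "?c k * (C * (x * M a / 4 ^ k) ^ (m + 1)) = K * C * 2 ^ (m + 2) * (x * x ^ (m + 1)) * (1 / 2 ^ (k * m))"
            unfolding e1 by (rule ar[OF e3]) auto
          also have "x * x ^ (m + 1) = x ^ (m + 2)" by simp
          also have "(1::real) / 2 ^ (k * m) \<le> (1 / 2) ^ k"
            using power_increasing[of k "k * m" "2::real"] m by (simp add: power_divide frac_le)
          finally show "?c k * (C * (x * M a / 4 ^ k) ^ (m + 1)) \<le> K * C * 2 ^ (m + 2) * x ^ (m + 2) * (1 / 2) ^ k"
            using K0 C0 x by (simp add: mult_left_mono)
        qed
        finally show "ennreal (?c k) * EL M I (x * M a / 4 ^ k) \<le> ennreal (K * C * 2 ^ (m + 2) * x ^ (m + 2) * (1 / 2) ^ k)" .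
      qed
      also have "\<dots> = ennreal (K * C * 2 ^ (m + 2) * x ^ (m + 2) * 2)"
      proof -
        have "(\<lambda>k. K * C * 2 ^ (m + 2) * x ^ (m + 2) * (1 / 2) ^ k) sums (K * C * 2 ^ (m + 2) * x ^ (m + 2) * 2)"
          using geometric_sums[of "1/2 :: real"] by (intro sums_mult) simp
        then show ?thesis unfolding nn_integral_count_space_nat
          using K0 C0 x by (intro suminf_ennreal_eq) auto
      qed
      also have "\<dots> \<le> ennreal (K * (C * 2 ^ (m + 3) + 1) * x ^ (m + 2))"
        using K0 x by (intro ennreal_leI) (simp add: algebra_simps power_add)
      finally show ?thesis .
    qed
    have "EL M I' x \<le> ennreal (C * x ^ (m + 2)) + ennreal (K * (C * 2 ^ (m + 3) + 1) * x ^ (m + 2))"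
      unfolding I' using EL_step[where M=M, OF M0 aI Ma x] add_mono[OF partA partB] by (rule order_trans)
    also have "\<dots> = ennreal (C' * x ^ (Suc m + 1))"
      using C0 K0 x by (subst ennreal_plus[symmetric]) (auto simp: C'_def algebra_simps)
    finally show ?thesis .
  qed
  moreover have "C' \<ge> 0" using C0 K0 by (simp add: C'_def)
  ultimately show ?case by (intro exI[of _ C']) blast
qed

section \<open>Reduction of symplectic lattices\<close>

definition hp :: "complex ^ 'n \<Rightarrow> complex ^ 'n \<Rightarrow> complex" where
  "hp v z = Complex (v \<bullet> z) (om v z)"

lemma hp_eq: "hp v z = (\<Sum>i\<in>UNIV. cnj (v $ i) * z $ i)"
  by (simp add: hp_def complex_eq_iff om_def inner_vec_def inner_complex_def)

lemma hp_add: "hp v (y + z) = hp v y + hp v z"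
  and hp_diff: "hp v (y - z) = hp v y - hp v z"
  and hp_scale: "hp v (c *s z) = c * hp v z"
  and hp_zero: "hp v 0 = 0"
  by (simp_all add: hp_eq algebra_simps sum.distrib sum_subtractf sum_distrib_left)

lemma hp_self: "hp v v = of_real (v \<bullet> v)"
  by (simp add: hp_def complex_eq_iff om_self)

lemma hp_zero_iff: "hp v z = 0 \<longleftrightarrow> v \<bullet> z = 0 \<and> om v z = 0"
  by (simp add: hp_def complex_eq_iff)

lemma scaleR_vec_complex: "c *\<^sub>R (z :: complex ^ 'n) = of_real c *s z"
  by (simp add: vec_eq_iff scaleR_conv_of_real[where 'a=complex])

text \<open>\<open>\<Lambda>\<close> is a unimodular symplectic lattice in the complex subspace \<open>S\<close>. Unimodularity is expressed by
  the existence of a dual vector for the primitive vector below any lattice vector, which passes to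
  the projection of the symplectic complement of a shortest vector.\<close>

definition ulat :: "(complex ^ 'n) set \<Rightarrow> (complex ^ 'n) set \<Rightarrow> bool" where
  "ulat S \<Lambda> \<longleftrightarrow> vec.subspace S \<and> \<Lambda> \<subseteq> S \<and> 0 \<in> \<Lambda> \<and> (\<forall>p\<in>\<Lambda>. \<forall>q\<in>\<Lambda>. p - q \<in> \<Lambda>)
    \<and> (\<forall>R. finite (\<Lambda> \<inter> cball 0 R)) \<and> (\<forall>p\<in>\<Lambda>. \<forall>q\<in>\<Lambda>. om p q \<in> \<int>)
    \<and> (\<forall>p\<in>\<Lambda>. p \<noteq> 0 \<longrightarrow> (\<exists>g u w. g \<in> \<int> \<and> u \<in> \<Lambda> \<and> w \<in> \<Lambda> \<and> p = g *\<^sub>R u \<and> om u w = 1))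
    \<and> (\<forall>z\<in>S. (\<forall>p\<in>\<Lambda>. om z p = 0) \<longrightarrow> z = 0)"

lemma ulatD:
  assumes "ulat S \<Lambda>"
  shows "vec.subspace S" "p \<in> \<Lambda> \<Longrightarrow> p \<in> S" "0 \<in> \<Lambda>" "p \<in> \<Lambda> \<Longrightarrow> q \<in> \<Lambda> \<Longrightarrow> p - q \<in> \<Lambda>"
    "finite (\<Lambda> \<inter> cball 0 R)" "p \<in> \<Lambda> \<Longrightarrow> q \<in> \<Lambda> \<Longrightarrow> om p q \<in> \<int>"
    "p \<in> \<Lambda> \<Longrightarrow> p \<noteq> 0 \<Longrightarrow> \<exists>g u w. g \<in> \<int> \<and> u \<in> \<Lambda> \<and> w \<in> \<Lambda> \<and> p = g *\<^sub>R u \<and> om u w = 1"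
    "z \<in> S \<Longrightarrow> (\<And>p. p \<in> \<Lambda> \<Longrightarrow> om z p = 0) \<Longrightarrow> z = 0"
  using assms unfolding ulat_def by (blast, blast, blast, blast, blast, blast, blast, blast)

lemma ulat_add: assumes "ulat S \<Lambda>" "p \<in> \<Lambda>" "q \<in> \<Lambda>" shows "p + q \<in> \<Lambda>"
  using ulatD(4)[OF assms(1,2) ulatD(4)[OF assms(1) ulatD(3)[OF assms(1)] assms(3)]] by simp

lemma ulat_scale: assumes U: "ulat S \<Lambda>" and "k \<in> \<int>" and p: "p \<in> \<Lambda>" shows "k *\<^sub>R p \<in> \<Lambda>"
proof -
  obtain m where m: "k = of_int m" using assms(2) Ints_cases by blast
  have nat: "real n *\<^sub>R p \<in> \<Lambda>" for n
    by (induction n) (use ulatD(3)[OF U] ulat_add[OF U p] in \<open>auto simp: scaleR_left_distrib\<close>)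
  show ?thesis
  proof (cases "m \<ge> 0")
    case True
    then show ?thesis using nat[of "nat m"] m by simp
  next
    case False
    have "0 - real (nat (- m)) *\<^sub>R p \<in> \<Lambda>" by (rule ulatD(4)[OF U ulatD(3)[OF U] nat])
    then show ?thesis using False m by simp
  qed
qed

section \<open>Shortest vectors and descent to their complement\<close>

definition shortest :: "(complex ^ 'n) set \<Rightarrow> complex ^ 'n \<Rightarrow> bool" where
  "shortest \<Lambda> v \<longleftrightarrow> v \<in> \<Lambda> \<and> v \<noteq> 0 \<and> (\<forall>p\<in>\<Lambda>. p \<noteq> 0 \<longrightarrow> norm v \<le> norm p)"

lemma shortest_exists:
  assumes U: "ulat S \<Lambda>" and p: "p \<in> \<Lambda>" "p \<noteq> 0"
  obtains v where "shortest \<Lambda> v"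
proof -
  let ?A = "\<Lambda> \<inter> cball 0 (norm p) - {0}"
  have fin: "finite ?A" using ulatD(5)[OF U] by blast
  have ne: "?A \<noteq> {}" using p by auto
  obtain v where v: "v \<in> ?A" "\<And>q. q \<in> ?A \<Longrightarrow> norm v \<le> norm q"
    using arg_min_if_finite(1)[OF fin ne, of norm] arg_min_least[OF fin ne, of _ norm] by blast
  have "norm v \<le> norm q" if "q \<in> \<Lambda>" "q \<noteq> 0" for q
    using v(2)[of q] v(1) that by (cases "norm q \<le> norm p") auto
  then show thesis using v(1) that[of v] by (auto simp: shortest_def)
qed

text \<open>A shortest vector is primitive, since the primitive vector below it would otherwise be
  shorter.\<close>

lemma shortest_dual:
  assumes U: "ulat S \<Lambda>" and v: "shortest \<Lambda> v"
  obtains w where "w \<in> \<Lambda>" "om v w = 1"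
proof -
  have v': "v \<in> \<Lambda>" "v \<noteq> 0" using v by (auto simp: shortest_def)
  obtain g u w where g: "g \<in> \<int>" "u \<in> \<Lambda>" "w \<in> \<Lambda>" "v = g *\<^sub>R u" "om u w = 1"
    using ulatD(7)[OF U v'] by blast
  have u: "u \<noteq> 0" "g \<noteq> 0" using g v' by auto
  then have "norm v \<le> norm u" using v g by (auto simp: shortest_def)
  then have "\<bar>g\<bar> \<le> 1" using u by (simp add: g(4))
  moreover have "\<bar>g\<bar> \<ge> 1" using g(1) u by (metis Ints_nonzero_abs_ge1)
  ultimately have "\<bar>g\<bar> = 1" by simp
  then have "g * g = 1" by (metis abs_mult_self_eq mult_1)
  then have "om v (g *\<^sub>R w) = 1" using g(4,5) by (simp add: om_simps)
  then show thesis using that ulat_scale[OF U g(1,3)] by blast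
qed

lemma shortest_multiple:
  assumes U: "ulat S \<Lambda>" and v: "shortest \<Lambda> v" and t: "t *\<^sub>R v \<in> \<Lambda>"
  shows "t \<in> \<int>"
proof (rule ccontr)
  assume n: "t \<notin> \<int>"
  have v': "v \<in> \<Lambda>" "v \<noteq> 0" using v by (auto simp: shortest_def)
  have "t *\<^sub>R v - of_int (round t) *\<^sub>R v \<in> \<Lambda>" by (rule ulatD(4)[OF U t ulat_scale[OF U _ v'(1)]]) simp
  then have m: "(t - of_int (round t)) *\<^sub>R v \<in> \<Lambda>" by (simp add: scaleR_left_diff_distrib)
  moreover have "t - of_int (round t) \<noteq> 0" using n by (metis Ints_of_int eq_iff_diff_eq_0)
  ultimately have "norm v \<le> \<bar>t - of_int (round t)\<bar> * norm v" using v v' by (auto simp: shortest_def)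
  moreover have "\<bar>t - of_int (round t)\<bar> \<le> 1/2" using of_int_round_abs_le[of t] by (simp add: abs_minus_commute)
  ultimately show False using v'(2) mult_right_mono[of "\<bar>t - of_int (round t)\<bar>" "1/2" "norm v"] by simp
qed

definition prj :: "complex ^ 'n \<Rightarrow> complex ^ 'n \<Rightarrow> complex ^ 'n" where
  "prj v z = z - ((v \<bullet> z) / (v \<bullet> v)) *\<^sub>R v"

lemma prj_diff: "prj v (p - q) = prj v p - prj v q"
  by (simp add: prj_def algebra_simps diff_divide_distrib)

lemma prj_scale: "prj v (c *\<^sub>R p) = c *\<^sub>R prj v p"
  by (simp add: prj_def algebra_simps)

lemma prj_0: "prj v 0 = 0"
  by (simp add: prj_def)

lemma prj_self: "v \<noteq> 0 \<Longrightarrow> prj v v = 0"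
  by (simp add: prj_def)

lemma om_prj: "om v p = 0 \<Longrightarrow> om v q = 0 \<Longrightarrow> om (prj v p) (prj v q) = om p q"
  by (simp add: prj_def om_simps) (metis mult_zero_right neg_equal_0_iff_equal om_commute)

text \<open>Orthogonality for \<open>om\<close> kills the imaginary part of the Hermitian product
  and the projection kills the real part. Hence projecting along one real line already takes the
  symplectic complement of v into its Hermitian complement.\<close>

lemma hp_prj: "v \<noteq> 0 \<Longrightarrow> om v p = 0 \<Longrightarrow> hp v (prj v p) = 0"
  by (simp add: prj_def hp_zero_iff om_simps inner_diff_right)

lemma norm_prj: 
  assumes "v \<noteq> 0" shows "(norm p)\<^sup>2 = (norm (prj v p))\<^sup>2 + ((v \<bullet> p) / (v \<bullet> v))\<^sup>2 * (norm v)\<^sup>2"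
proof -
  define t where "t = (v \<bullet> p) / (v \<bullet> v)"
  have eq: "p = prj v p + t *\<^sub>R v" by (simp add: prj_def t_def)
  have o: "prj v p \<bullet> v = 0" using assms by (simp add: prj_def inner_diff_left inner_diff_right inner_commute)
  have "(norm (x + t *\<^sub>R v))\<^sup>2 = (norm x)\<^sup>2 + t\<^sup>2 * (norm v)\<^sup>2" if "x \<bullet> v = 0" for x
  proof -
    have "v \<bullet> x = 0" using that by (simp add: inner_commute)
    then show ?thesis using that unfolding power2_norm_eq_inner by (simp add: inner_add_left inner_add_right power2_eq_square)
  qed
  from this[OF o] show ?thesis unfolding eq[symmetric] by (simp add: t_def)
qed

lemma norm_prj_le: "norm (prj v p) \<le> norm p"
proof (cases "v = 0")
  case False
  then have "(norm (prj v p))\<^sup>2 \<le> (norm p)\<^sup>2" using norm_prj[of v p] by simp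
  then show ?thesis by (rule power2_le_imp_le) simp
qed (simp add: prj_def)

definition compl :: "complex ^ 'n \<Rightarrow> (complex ^ 'n) set \<Rightarrow> (complex ^ 'n) set" where
  "compl v S = {z \<in> S. hp v z = 0}"

definition perp :: "complex ^ 'n \<Rightarrow> (complex ^ 'n) set \<Rightarrow> (complex ^ 'n) set" where
  "perp v \<Lambda> = {p \<in> \<Lambda>. om v p = 0}"

lemma compl_split:
  assumes S: "vec.subspace S" and v: "v \<in> S" "v \<noteq> 0" and z: "z \<in> S"
  shows "z - (hp v z / hp v v) *s v \<in> compl v S"
  using assms by (simp add: compl_def hp_diff hp_scale hp_self vec.subspace_diff vec.subspace_scale)

lemma subspace_compl: "vec.subspace S \<Longrightarrow> vec.subspace (compl v S)"
  by (auto simp: vec.subspace_def compl_def hp_add hp_scale hp_zero)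

lemma dim_compl:
  assumes S: "vec.subspace S" and v: "v \<in> S" "v \<noteq> 0"
  shows "vec.dim S = Suc (vec.dim (compl v S))"
proof -
  have sp: "vec.span (compl v S) = compl v S" using subspace_compl[OF S] vec.span_eq_iff by blast
  have nv: "v \<notin> vec.span (compl v S)" unfolding sp using v by (simp add: compl_def hp_self)
  have "vec.span (insert v (compl v S)) = S"
  proof
    show "vec.span (insert v (compl v S)) \<subseteq> S"
      by (rule vec.span_minimal) (use S v in \<open>auto simp: compl_def\<close>)
    show "S \<subseteq> vec.span (insert v (compl v S))"
    proof
      fix z assume "z \<in> S"
      from compl_split[OF S v this] show "z \<in> vec.span (insert v (compl v S))"
        unfolding vec.span_insert sp by blast
    qed
  qed
  then have "vec.dim S = vec.dim (insert v (compl v S))" by (metis vec.dim_span)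
  also have "\<dots> = Suc (vec.dim (compl v S))" using vec.dim_insert[of v "compl v S"] nv by simp
  finally show ?thesis .
qed

text \<open>Discreteness: every class modulo v has a representative of length at most that of its
  projection plus |v|. Duality: a lift is first made orthogonal to both v and its dual w by adding a
  multiple of v; then a multiple of w brings the dual vector into the complement of v without
  changing the pairing. Nondegeneracy: adding a multiple of v to z makes it orthogonal to w as well,
  hence to all of \<Lambda>.\<close>

lemma ulat_child:
  assumes U: "ulat S \<Lambda>" and v: "shortest \<Lambda> v"
  shows "ulat (compl v S) (prj v ` perp v \<Lambda>)"
proof -
  have v': "v \<in> \<Lambda>" "v \<noteq> 0" using v by (auto simp: shortest_def)
  have vS: "v \<in> S" using ulatD(2)[OF U] v' by blast
  note S = ulatD(1)[OF U]
  obtain w where w: "w \<in> \<Lambda>" "om v w = 1" using shortest_dual[OF U v] by blast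
  have wv: "om w v = -1" using w om_commute[of w v] by simp
  have P: "p \<in> \<Lambda>" "om v p = 0" if "p \<in> perp v \<Lambda>" for p using that by (auto simp: perp_def)
  have prS: "prj v p \<in> compl v S" if "p \<in> perp v \<Lambda>" for p
    using hp_prj[OF v'(2) P(2)[OF that]] ulatD(2)[OF U P(1)[OF that]] vS S
    by (simp add: compl_def prj_def scaleR_vec_complex vec.subspace_diff vec.subspace_scale)
  have diff: "p - q \<in> perp v \<Lambda>" if "p \<in> perp v \<Lambda>" "q \<in> perp v \<Lambda>" for p q
    using P[OF that(1)] P[OF that(2)] ulatD(4)[OF U] by (simp add: perp_def om_simps)
  have lift: "\<exists>q\<in>perp v \<Lambda>. prj v q = prj v p \<and> norm q \<le> norm (prj v p) + norm v" if p: "p \<in> perp v \<Lambda>" for p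
  proof -
    define t where "t = (v \<bullet> p) / (v \<bullet> v)"
    define q where "q = p - of_int (round t) *\<^sub>R v"
    have "q \<in> perp v \<Lambda>" unfolding q_def
      by (rule diff[OF p]) (use ulat_scale[OF U _ v'(1)] in \<open>auto simp: perp_def om_simps\<close>)
    moreover have pq: "prj v q = prj v p" using v' by (simp add: q_def prj_diff prj_scale prj_self)
    moreover have "norm q \<le> norm (prj v p) + norm v"
    proof -
      have "q = prj v p + (t - of_int (round t)) *\<^sub>R v" by (simp add: q_def prj_def t_def algebra_simps)
      then have "norm q \<le> norm (prj v p) + \<bar>t - of_int (round t)\<bar> * norm v" by (metis norm_scaleR norm_triangle_ineq)
      also have "\<bar>t - of_int (round t)\<bar> \<le> 1" using of_int_round_abs_le[of t] by (simp add: abs_minus_commute)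
      finally show ?thesis by (simp add: mult_right_mono)
    qed
    ultimately show ?thesis by blast
  qed
  show ?thesis
    unfolding ulat_def
  proof (intro conjI ballI allI impI)
    show "vec.subspace (compl v S)" by (rule subspace_compl[OF S])
    show "prj v ` perp v \<Lambda> \<subseteq> compl v S" using prS by blast
    show "0 \<in> prj v ` perp v \<Lambda>" by (rule image_eqI[of _ _ 0]) (use ulatD(3)[OF U] in \<open>auto simp: prj_0 perp_def om_simps\<close>)
    show "p - q \<in> prj v ` perp v \<Lambda>" if "p \<in> prj v ` perp v \<Lambda>" "q \<in> prj v ` perp v \<Lambda>" for p q
      using that diff by (auto simp flip: prj_diff)
    show "finite (prj v ` perp v \<Lambda> \<inter> cball 0 R)" for R
    proof (rule finite_subset)
      show "prj v ` perp v \<Lambda> \<inter> cball 0 R \<subseteq> prj v ` (\<Lambda> \<inter> cball 0 (R + norm v))"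
      proof
        fix z assume z: "z \<in> prj v ` perp v \<Lambda> \<inter> cball 0 R"
        then obtain p where p: "p \<in> perp v \<Lambda>" "z = prj v p" by blast
        obtain q where "q\<in>perp v \<Lambda>" "prj v q = prj v p" "norm q \<le> norm (prj v p) + norm v" using lift[OF p(1)] by blast
        then show "z \<in> prj v ` (\<Lambda> \<inter> cball 0 (R + norm v))"
          using z p P by (intro image_eqI[of _ _ q]) auto
      qed
    qed (use ulatD(5)[OF U] in blast)
    show "om p q \<in> \<int>" if "p \<in> prj v ` perp v \<Lambda>" "q \<in> prj v ` perp v \<Lambda>" for p q
      using that P ulatD(6)[OF U] by (auto simp: om_prj)
  next
    fix z assume "z \<in> prj v ` perp v \<Lambda>" "z \<noteq> 0"
    then obtain p where p: "p \<in> perp v \<Lambda>" "z = prj v p" by blast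
    have pL: "p \<in> \<Lambda>" "om v p = 0" using P[OF p(1)] by auto
    define c where "c = om p w"
    have c: "c \<in> \<int>" unfolding c_def by (rule ulatD(6)[OF U pL(1) w(1)])
    define p' where "p' = p - c *\<^sub>R v"
    have p': "p' \<in> \<Lambda>" unfolding p'_def by (rule ulatD(4)[OF U pL(1) ulat_scale[OF U c v'(1)]])
    have o1: "om v p' = 0" "om p' w = 0" "om p' v = 0" using pL w om_commute[of p v] by (simp_all add: p'_def om_simps c_def)
    have pr: "prj v p' = z" using v' p by (simp add: p'_def prj_diff prj_scale prj_self)
    have "p' \<noteq> 0" using pr \<open>z \<noteq> 0\<close> by (auto simp: prj_0)
    then obtain g u x where g: "g \<in> \<int>" "u \<in> \<Lambda>" "x \<in> \<Lambda>" "p' = g *\<^sub>R u" "om u x = 1"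
      using ulatD(7)[OF U p'] by blast
    have "g \<noteq> 0" using g \<open>p' \<noteq> 0\<close> by auto
    then have o2: "om v u = 0" "om u w = 0" "om u v = 0" using o1 by (simp_all add: g(4) om_simps)
    define d where "d = om v x"
    have d: "d \<in> \<int>" unfolding d_def by (rule ulatD(6)[OF U v'(1) g(3)])
    define x' where "x' = x - d *\<^sub>R w"
    have x': "x' \<in> \<Lambda>" unfolding x'_def by (rule ulatD(4)[OF U g(3) ulat_scale[OF U d w(1)]])
    have o3: "om v x' = 0" "om u x' = 1" using o2 g(5) w by (simp_all add: x'_def om_simps d_def)
    have "z = g *\<^sub>R prj v u" using pr by (simp add: g(4) prj_scale)
    moreover have "om (prj v u) (prj v x') = 1" using o2 o3 by (simp add: om_prj)
    moreover have "prj v u \<in> prj v ` perp v \<Lambda>" "prj v x' \<in> prj v ` perp v \<Lambda>"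
      using g x' o2 o3 by (auto simp: perp_def)
    ultimately show "\<exists>g u w. g \<in> \<int> \<and> u \<in> prj v ` perp v \<Lambda> \<and> w \<in> prj v ` perp v \<Lambda> \<and> z = g *\<^sub>R u \<and> om u w = 1"
      using g(1) by blast
  next
    fix z assume z: "z \<in> compl v S" and o: "\<forall>p\<in>prj v ` perp v \<Lambda>. om z p = 0"
    have zS: "z \<in> S" and vz: "v \<bullet> z = 0" "om v z = 0" "om z v = 0"
      using z om_commute[of z v] by (auto simp: compl_def hp_zero_iff)
    have op: "om z p = 0" if "p \<in> perp v \<Lambda>" for p
    proof -
      have "om z (prj v p) = 0" using o that by blast
      then show ?thesis using vz by (simp add: prj_def om_simps)
    qed
    define y where "y = z - om z w *\<^sub>R v"
    have yS: "y \<in> S" unfolding y_def scaleR_vec_complex by (intro vec.subspace_diff[OF S zS] vec.subspace_scale[OF S vS])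
    have "om y p = 0" if p: "p \<in> \<Lambda>" for p
    proof -
      define c where "c = om v p"
      have c: "c \<in> \<int>" unfolding c_def by (rule ulatD(6)[OF U v'(1) p])
      have "p - c *\<^sub>R w \<in> perp v \<Lambda>"
        using ulatD(4)[OF U p ulat_scale[OF U c w(1)]] w by (simp add: perp_def om_simps c_def)
      from op[OF this] have "om z p = c * om z w" by (simp add: om_simps)
      then show ?thesis by (simp add: y_def om_simps c_def)
    qed
    then have "y = 0" by (rule ulatD(8)[OF U yS])
    then have "z = om z w *\<^sub>R v" by (simp add: y_def)
    then have "v \<bullet> z = om z w * (v \<bullet> v)" by (metis inner_scaleR_right)
    then have "om z w = 0" using vz v' by simp
    then show "z = 0" using \<open>z = om z w *\<^sub>R v\<close> by simp
  qed
qed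

lemma ulat_nontrivial:
  assumes U: "ulat S \<Lambda>" and d: "vec.dim S \<ge> 1"
  obtains p where "p \<in> \<Lambda>" "p \<noteq> 0"
proof -
  have "\<not> S \<subseteq> {0}"
  proof
    assume "S \<subseteq> {0}"
    then have "vec.dim S = 0" using vec.dim_eq_0[of S] by blast
    then show False using d by linarith
  qed
  then obtain z where "z \<in> S" "z \<noteq> 0" by blast
  then obtain p where "p \<in> \<Lambda>" "om z p \<noteq> 0" using ulatD(8)[OF U, of z] by blast
  moreover from this(2) have "p \<noteq> 0" by (auto simp: om_def)
  ultimately show thesis using that by blast
qed

text \<open>In complex dimension 1 the dual vector is (a + \<i> b) v with b = 1 / |v|^2; once a is
  reduced to at most 1/2 in modulus, minimality of v forces b \<ge> 1/2. In higher dimension a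
  shortest vector u of the projected lattice lifts with a component of at most |v| / 2 along v, so
  |v|^2 \<le> |u|^2 + |v|^2 / 4 and |v| \<le> 2 |u|.\<close>

lemma shortest_bound:
  assumes "ulat S \<Lambda>" "vec.dim S = Suc k" "shortest \<Lambda> v"
  shows "norm v \<le> 2 ^ Suc k"
  using assms
proof (induction k arbitrary: S \<Lambda> v)
  case 0
  note U = 0(1) and v = 0(3)
  have v': "v \<in> \<Lambda>" "v \<noteq> 0" using v by (auto simp: shortest_def)
  have vS: "v \<in> S" using ulatD(2)[OF U] v' by blast
  note S = ulatD(1)[OF U]
  obtain w where w: "w \<in> \<Lambda>" "om v w = 1" using shortest_dual[OF U v] by blast
  have "vec.dim (compl v S) = 0" using dim_compl[OF S vS v'(2)] 0(2) by simp
  then have "compl v S \<subseteq> {0}" using vec.dim_eq_0[of "compl v S"] by simp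
  then have "w - (hp v w / hp v v) *s v = 0" using compl_split[OF S vS v'(2) ulatD(2)[OF U w(1)]] by blast
  then have weq: "w = (hp v w / hp v v) *s v" by simp
  define a where "a = (v \<bullet> w) / (v \<bullet> v)"
  define b where "b = 1 / (v \<bullet> v)"
  have "hp v w / hp v v = Complex a b" unfolding hp_self using w by (simp add: hp_def a_def b_def complex_eq_iff)
  then have weq: "w = Complex a b *s v" using weq by simp
  define w1 where "w1 = w - of_int (round a) *\<^sub>R v"
  define t where "t = a - of_int (round a)"
  have w1L: "w1 \<in> \<Lambda>" unfolding w1_def by (rule ulatD(4)[OF U w(1) ulat_scale[OF U _ v'(1)]]) simp
  have "om v w1 = 1" using w by (simp add: w1_def om_simps)
  then have "w1 \<noteq> 0" by (auto simp: om_simps)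
  then have le: "norm v \<le> norm w1" using v w1L by (auto simp: shortest_def)
  have w1: "w1 = Complex t b *s v"
    unfolding w1_def weq t_def scaleR_vec_complex by (simp add: vec_eq_iff complex_eq_iff algebra_simps)
  have "norm w1 = cmod (Complex t b) * norm v"
    unfolding w1 by (simp add: norm_vec_def norm_mult L2_set_right_distrib)
  then have "1 \<le> cmod (Complex t b)" using le v' by simp
  then have "1 \<le> (cmod (Complex t b))\<^sup>2" by (simp add: one_le_power)
  then have tb: "1 \<le> t\<^sup>2 + b\<^sup>2" by (simp add: cmod_power2)
  have "\<bar>t\<bar> \<le> 1/2" using of_int_round_abs_le[of a] by (simp add: t_def abs_minus_commute)
  then have "t\<^sup>2 \<le> (1/2)\<^sup>2" by (metis abs_le_square_iff abs_of_nonneg abs_numeral divide_nonneg_nonneg le_numeral_extra(1) zero_le_numeral zero_le_one abs_divide abs_one)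
  then have "b\<^sup>2 \<ge> (1/2)\<^sup>2" using tb by (simp add: power2_eq_square)
  then have "b \<ge> 1/2" by (rule power2_le_imp_le) (simp add: b_def)
  then have "v \<bullet> v \<le> 2" using v' by (simp add: b_def field_simps)
  then have "(norm v)\<^sup>2 \<le> 2\<^sup>2" by (simp add: power2_norm_eq_inner)
  then have "norm v \<le> 2" by (rule power2_le_imp_le) simp
  then show ?case by simp
next
  case (Suc k)
  note U = Suc.prems(1) and v = Suc.prems(3)
  have v': "v \<in> \<Lambda>" "v \<noteq> 0" using v by (auto simp: shortest_def)
  have vS: "v \<in> S" using ulatD(2)[OF U] v' by blast
  note S = ulatD(1)[OF U]
  have d: "vec.dim (compl v S) = Suc k" using dim_compl[OF S vS v'(2)] Suc.prems(2) by simp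
  note U' = ulat_child[OF U v]
  obtain p where "p \<in> prj v ` perp v \<Lambda>" "p \<noteq> 0" using ulat_nontrivial[OF U'] d by auto
  then obtain u where u: "shortest (prj v ` perp v \<Lambda>) u" using shortest_exists[OF U'] by blast
  have ub: "norm u \<le> 2 ^ Suc k" by (rule Suc.IH[OF U' d u])
  obtain p where p: "p \<in> perp v \<Lambda>" "u = prj v p" "u \<noteq> 0" using u by (auto simp: shortest_def)
  define t where "t = (v \<bullet> p) / (v \<bullet> v)"
  define q where "q = p - of_int (round t) *\<^sub>R v"
  have qL: "q \<in> \<Lambda>" unfolding q_def
    by (rule ulatD(4)[OF U _ ulat_scale[OF U _ v'(1)]]) (use p in \<open>auto simp: perp_def\<close>)
  have pq: "prj v q = u" using v' p by (simp add: q_def prj_diff prj_scale prj_self)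
  then have "q \<noteq> 0" using p by (auto simp: prj_0)
  then have "norm v \<le> norm q" using v qL by (auto simp: shortest_def)
  then have "(norm v)\<^sup>2 \<le> (norm q)\<^sup>2" by (intro power_mono) auto
  also have "\<dots> = (norm u)\<^sup>2 + (t - of_int (round t))\<^sup>2 * (norm v)\<^sup>2"
    using norm_prj[OF v'(2), of q] v' pq by (simp add: q_def t_def inner_diff_right diff_divide_distrib)
  finally have 1: "(norm v)\<^sup>2 \<le> (norm u)\<^sup>2 + (t - of_int (round t))\<^sup>2 * (norm v)\<^sup>2" .
  have "\<bar>t - of_int (round t)\<bar> \<le> \<bar>1/2\<bar>" using of_int_round_abs_le[of t] by (simp add: abs_minus_commute)
  then have "(t - of_int (round t))\<^sup>2 \<le> (1/2)\<^sup>2" by (simp only: abs_le_square_iff)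
  then have "(t - of_int (round t))\<^sup>2 * (norm v)\<^sup>2 \<le> (1/2)\<^sup>2 * (norm v)\<^sup>2" by (rule mult_right_mono) simp
  then have "(norm v)\<^sup>2 \<le> (norm u)\<^sup>2 + (1/4) * (norm v)\<^sup>2" using 1 by (simp add: power2_eq_square)
  then have "(norm v)\<^sup>2 \<le> 4 * (norm u)\<^sup>2" using zero_le_power2[of "norm u"] by linarith
  also have "\<dots> = (2 * norm u)\<^sup>2" by (simp add: power_mult_distrib)
  finally have "norm v \<le> 2 * norm u" by (rule power2_le_imp_le) simp
  then show ?case using ub by simp
qed

lemma finite_int_interval: "finite {t \<in> \<int>. a \<le> t \<and> t \<le> (b::real)}"
  and card_int_interval: "a \<le> b \<Longrightarrow> real (card {t \<in> \<int>. a \<le> t \<and> t \<le> b}) \<le> b - a + 1"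
proof -
  have eq: "{t \<in> \<int>. a \<le> t \<and> t \<le> b} = real_of_int ` {\<lceil>a\<rceil>..\<lfloor>b\<rfloor>}"
    by (auto elim!: Ints_cases simp: ceiling_le_iff le_floor_iff)
  show "finite {t \<in> \<int>. a \<le> t \<and> t \<le> b}" unfolding eq by simp
  have "card {t \<in> \<int>. a \<le> t \<and> t \<le> b} = nat (\<lfloor>b\<rfloor> + 1 - \<lceil>a\<rceil>)"
    unfolding eq by (subst card_image) (auto simp: inj_on_def)
  then show "a \<le> b \<Longrightarrow> real (card {t \<in> \<int>. a \<le> t \<and> t \<le> b}) \<le> b - a + 1"
    using floor_correct[of b] ceiling_correct[of a] by linarith
qed

lemma card_le_fibres:
  assumes A: "finite A" and K: "\<And>y. y \<in> f ` A \<Longrightarrow> real (card {x \<in> A. f x = y}) \<le> K"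
  shows "real (card A) \<le> K * card (f ` A)"
proof -
  have "card A = (\<Sum>y\<in>f ` A. card {x \<in> A. f x = y})"
    using sum.image_gen[OF A, of "\<lambda>_. 1::nat" f] by simp
  then have "real (card A) = (\<Sum>y\<in>f ` A. real (card {x \<in> A. f x = y}))" by simp
  also have "\<dots> \<le> (\<Sum>y\<in>f ` A. K)" by (rule sum_mono) (rule K)
  finally show ?thesis by (simp add: mult.commute)
qed

text \<open>Points are sorted by the integer \<open>om v p\<close>, which takes at most 2 |v| R + 1
  values; differences within a class lie in the symplectic complement and in the ball of radius 2 R.
  There, points with equal projection differ by integral multiples of v, so at most 4 R / |v| + 1 of
  them share one.\<close>

lemma ulat_count_step:
  assumes U: "ulat S \<Lambda>" and v: "shortest \<Lambda> v" and R: "R > 0"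
  shows "real (card (\<Lambda> \<inter> cball 0 R)) \<le> (2 * norm v * R + 1) * ((4 * R / norm v + 1) * card (prj v ` perp v \<Lambda> \<inter> cball 0 (2 * R)))"
proof -
  have v': "v \<in> \<Lambda>" "v \<noteq> 0" using v by (auto simp: shortest_def)
  have nv: "norm v > 0" using v' by simp
  have inner_count: "real (card (perp v \<Lambda> \<inter> cball 0 r)) \<le> (2 * r / norm v + 1) * card (prj v ` perp v \<Lambda> \<inter> cball 0 r)" if r: "r > 0" for r
  proof -
    have fin: "finite (perp v \<Lambda> \<inter> cball 0 r)"
      using ulatD(5)[OF U, of r] by (rule rev_finite_subset) (auto simp: perp_def)
    have fin': "finite (prj v ` perp v \<Lambda> \<inter> cball 0 r)" by (rule ulatD(5)[OF ulat_child[OF U v]])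
    have "real (card (perp v \<Lambda> \<inter> cball 0 r)) \<le> (2 * r / norm v + 1) * card (prj v ` (perp v \<Lambda> \<inter> cball 0 r))"
    proof (rule card_le_fibres[OF fin])
      fix y assume "y \<in> prj v ` (perp v \<Lambda> \<inter> cball 0 r)"
      then obtain p0 where p0: "p0 \<in> perp v \<Lambda>" "norm p0 \<le> r" "y = prj v p0" by auto
      define c where "c p = (v \<bullet> p) / (v \<bullet> v)" for p
      have pc: "p = prj v p + c p *\<^sub>R v" for p by (simp add: prj_def c_def)
      have cb: "\<bar>c p\<bar> \<le> r / norm v" if "norm p \<le> r" for p
      proof -
        have "\<bar>v \<bullet> p\<bar> \<le> norm v * r" using Cauchy_Schwarz_ineq2[of v p] mult_left_mono[OF that, of "norm v"] by simp
        then have "\<bar>c p\<bar> \<le> (norm v * r) / (v \<bullet> v)" unfolding c_def abs_divide by (simp add: divide_right_mono)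
        also have "\<dots> = r / norm v" using nv by (simp add: dot_square_norm power2_eq_square)
        finally show ?thesis .
      qed
      let ?I = "{t \<in> \<int>. - r / norm v - c p0 \<le> t \<and> t \<le> r / norm v - c p0}"
      have "{p \<in> perp v \<Lambda> \<inter> cball 0 r. prj v p = y} \<subseteq> (\<lambda>t. p0 + t *\<^sub>R v) ` ?I"
      proof
        fix p assume "p \<in> {p \<in> perp v \<Lambda> \<inter> cball 0 r. prj v p = y}"
        then have p: "p \<in> perp v \<Lambda>" "norm p \<le> r" "prj v p = prj v p0" using p0 by auto
        have "p - p0 = (c p - c p0) *\<^sub>R v" using pc[of p] pc[of p0] p(3) by (metis add_diff_cancel_left scaleR_left_diff_distrib)
        moreover from this have "(c p - c p0) *\<^sub>R v \<in> \<Lambda>" using ulatD(4)[OF U, of p p0] p p0 by (auto simp: perp_def)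
        then have "c p - c p0 \<in> \<int>" by (rule shortest_multiple[OF U v])
        moreover have "\<bar>c p\<bar> \<le> r / norm v" by (rule cb[OF p(2)])
        ultimately show "p \<in> (\<lambda>t. p0 + t *\<^sub>R v) ` ?I"
          by (intro image_eqI[of _ _ "c p - c p0"]) (auto simp: algebra_simps)
      qed
      then have "card {p \<in> perp v \<Lambda> \<inter> cball 0 r. prj v p = y} \<le> card ((\<lambda>t. p0 + t *\<^sub>R v) ` ?I)"
        by (rule card_mono[OF finite_imageI[OF finite_int_interval]])
      also have "\<dots> \<le> card ?I" by (rule card_image_le[OF finite_int_interval])
      finally have "real (card {p \<in> perp v \<Lambda> \<inter> cball 0 r. prj v p = y}) \<le> real (card ?I)" by simp
      also have "\<dots> \<le> (r / norm v - c p0) - (- r / norm v - c p0) + 1"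
        by (rule card_int_interval) (use r nv in simp)
      finally show "real (card {p \<in> perp v \<Lambda> \<inter> cball 0 r. prj v p = y}) \<le> 2 * r / norm v + 1" by simp
    qed
    also have "\<dots> \<le> (2 * r / norm v + 1) * card (prj v ` perp v \<Lambda> \<inter> cball 0 r)"
    proof (rule mult_left_mono)
      have "prj v ` (perp v \<Lambda> \<inter> cball 0 r) \<subseteq> prj v ` perp v \<Lambda> \<inter> cball 0 r"
        by (auto intro: order_trans[OF norm_prj_le])
      then show "real (card (prj v ` (perp v \<Lambda> \<inter> cball 0 r))) \<le> card (prj v ` perp v \<Lambda> \<inter> cball 0 r)"
        using card_mono[OF fin'] by simp
    qed (use r nv in simp)
    finally show ?thesis .
  qed
  let ?A = "\<Lambda> \<inter> cball 0 R"
  have fin: "finite ?A" by (rule ulatD(5)[OF U])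
  have "real (card ?A) \<le> real (card (perp v \<Lambda> \<inter> cball 0 (2 * R))) * real (card (om v ` ?A))"
  proof (rule card_le_fibres[OF fin])
    fix y assume "y \<in> om v ` ?A"
    then obtain p0 where p0: "p0 \<in> \<Lambda>" "norm p0 \<le> R" "y = om v p0" by auto
    have "{p \<in> ?A. om v p = y} \<subseteq> (\<lambda>q. p0 + q) ` (perp v \<Lambda> \<inter> cball 0 (2 * R))"
    proof
      fix p assume "p \<in> {p \<in> ?A. om v p = y}"
      then have p: "p \<in> \<Lambda>" "norm p \<le> R" "om v p = om v p0" using p0 by auto
      have "norm (p - p0) \<le> 2 * R" using norm_triangle_ineq4[of p p0] p p0 by linarith
      then show "p \<in> (\<lambda>q. p0 + q) ` (perp v \<Lambda> \<inter> cball 0 (2 * R))"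
        using ulatD(4)[OF U p(1) p0(1)] p by (intro image_eqI[of _ _ "p - p0"]) (auto simp: perp_def om_simps)
    qed
    moreover have f2: "finite (perp v \<Lambda> \<inter> cball 0 (2 * R))"
      using ulatD(5)[OF U, of "2 * R"] by (rule rev_finite_subset) (auto simp: perp_def)
    ultimately have "card {p \<in> ?A. om v p = y} \<le> card ((\<lambda>q. p0 + q) ` (perp v \<Lambda> \<inter> cball 0 (2 * R)))"
      by (intro card_mono finite_imageI)
    also have "\<dots> \<le> card (perp v \<Lambda> \<inter> cball 0 (2 * R))" by (rule card_image_le[OF f2])
    finally show "real (card {p \<in> ?A. om v p = y}) \<le> real (card (perp v \<Lambda> \<inter> cball 0 (2 * R)))" by simp
  qed
  also have "\<dots> \<le> real (card (perp v \<Lambda> \<inter> cball 0 (2 * R))) * (2 * norm v * R + 1)"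
  proof (rule mult_left_mono)
    let ?I = "{t \<in> \<int>. - (norm v * R) \<le> t \<and> t \<le> norm v * R}"
    have "om v ` ?A \<subseteq> ?I"
    proof
      fix t assume "t \<in> om v ` ?A"
      then obtain p where p: "p \<in> \<Lambda>" "norm p \<le> R" "t = om v p" by auto
      have "\<bar>t\<bar> \<le> norm v * R" using abs_om_le[of v p] mult_left_mono[OF p(2), of "norm v"] p(3) by simp
      then show "t \<in> ?I" using ulatD(6)[OF U v'(1) p(1)] p(3) by auto
    qed
    then have "real (card (om v ` ?A)) \<le> real (card ?I)" using card_mono[OF finite_int_interval] by simp
    also have "\<dots> \<le> norm v * R - (- (norm v * R)) + 1" by (rule card_int_interval) (use R in simp)
    finally show "real (card (om v ` ?A)) \<le> 2 * norm v * R + 1" by (simp add: mult_ac)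
  qed simp
  also have "\<dots> \<le> ((2 * (2 * R) / norm v + 1) * card (prj v ` perp v \<Lambda> \<inter> cball 0 (2 * R))) * (2 * norm v * R + 1)"
    by (rule mult_right_mono[OF inner_count]) (use R in auto)
  finally show ?thesis by (simp add: mult.commute)
qed

section \<open>Reduced Lagrangian frames\<close>

lemma det_add_rows:
  fixes A :: "'a::field ^ 'n ^ 'n"
  assumes "finite J" "a \<notin> J"
  shows "det (\<chi> i. if i \<in> J then A $ i + t i *s A $ a else A $ i) = det A"
  using assms
proof (induction J)
  case empty
  then show ?case by (simp add: vec_nth_inverse)
next
  case (insert j J)
  let ?B = "\<chi> i. if i \<in> J then A $ i + t i *s A $ a else A $ i"
  have "(\<chi> i. if i \<in> insert j J then A $ i + t i *s A $ a else A $ i) = (\<chi> k. if k = j then row j ?B + t j *s row a ?B else row k ?B)"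
    using insert by (auto simp: vec_eq_iff row_def)
  then show ?case using det_row_operation[of j a ?B "t j"] insert by auto
qed

definition replace_rows :: "'n set \<Rightarrow> ('n \<Rightarrow> 'a ^ 'n) \<Rightarrow> 'a ^ 'n ^ 'n \<Rightarrow> 'a ^ 'n ^ 'n" where
  "replace_rows J f W = (\<chi> i. if i \<in> J then f i else W $ i)"

text \<open>The vectors f are isotropic lattice vectors and e is an orthogonalised form of them. The
  determinant condition is stated for every completion W by other rows, so that the induction can
  add a row. The last clause is the aim: covolume times number of lattice points stays
  bounded.\<close>

definition reduced_frame :: "'n set \<Rightarrow> (complex ^ 'n) set \<Rightarrow> (complex ^ 'n) set \<Rightarrow> real \<Rightarrow> real \<Rightarrow> ('n \<Rightarrow> complex ^ 'n) \<Rightarrow> ('n \<Rightarrow> complex ^ 'n) \<Rightarrow> bool" where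
  "reduced_frame J S \<Lambda> R C f e \<longleftrightarrow> (\<forall>i\<in>J. f i \<in> \<Lambda> \<and> e i \<in> S \<and> e i \<noteq> 0)
     \<and> (\<forall>i\<in>J. \<forall>j\<in>J. om (f i) (f j) = 0) \<and> (\<forall>i\<in>J. \<forall>j\<in>J. i \<noteq> j \<longrightarrow> hp (e i) (e j) = 0)
     \<and> (\<forall>W. det (replace_rows J f W) = det (replace_rows J e W :: complex ^ 'n ^ 'n))
     \<and> (\<Prod>i\<in>J. norm (e i)) * card (\<Lambda> \<inter> cball 0 R) \<le> C"

text \<open>Adding a shortest v multiplies the product of the norms by |v| and the count by at most
  (2 |v| R + 1) (4 R / |v| + 1). Together this is (2 |v| R + 1) (4 R + |v|), bounded because |v| is.
  The radius doubles on the way down, so the statement concerns all R at once.\<close>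

lemma ulat_reduction:
  fixes J :: "'n::finite set"
  assumes "finite J"
  shows "\<forall>R>0. \<exists>C>0. \<forall>S \<Lambda>. ulat S \<Lambda> \<longrightarrow> vec.dim S = card J \<longrightarrow> (\<exists>f e. reduced_frame J S \<Lambda> R C f e)"
  using assms
proof (induction J)
  case empty
  have "(\<Prod>i\<in>{}. norm (e i)) * card (\<Lambda> \<inter> cball 0 R) \<le> (1::real)" if "ulat S \<Lambda>" "vec.dim S = 0" for S \<Lambda> R and e :: "'n \<Rightarrow> complex ^ 'n"
  proof -
    have "\<Lambda> \<inter> cball 0 R \<subseteq> {0}" using that vec.dim_eq_0[of S] ulatD(2)[OF that(1)] by blast
    from card_mono[OF _ this] show ?thesis by simp
  qed
  then show ?case by (intro allI impI exI[of _ 1]) (auto simp: replace_rows_def reduced_frame_def)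
next
  case (insert a J)
  show ?case
  proof (intro allI impI)
    fix R :: real assume R: "R > 0"
    then obtain C where C0: "C > 0" and C: "\<And>S \<Lambda>. ulat S \<Lambda> \<Longrightarrow> vec.dim S = card J \<Longrightarrow> \<exists>f e. reduced_frame J S \<Lambda> (2 * R) C f e"
      using insert.IH[rule_format, of "2 * R"] by auto
    define h where "h = (2::real) ^ Suc (card J)"
    have h0: "h > 0" by (simp add: h_def)
    define C' where "C' = (2 * h * R + 1) * (4 * R + h) * C"
    have C'0: "C' > 0" unfolding C'_def using h0 R C0 by (intro mult_pos_pos add_pos_pos) auto
    have "\<exists>f e. reduced_frame (insert a J) S \<Lambda> R C' f e"
      if U: "ulat S \<Lambda>" and d: "vec.dim S = card (insert a J)" for S \<Lambda>
    proof -
      have d: "vec.dim S = Suc (card J)" using d insert by simp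
      obtain p where "p \<in> \<Lambda>" "p \<noteq> 0" using ulat_nontrivial[OF U] d by auto
      then obtain v where v: "shortest \<Lambda> v" using shortest_exists[OF U] by blast
      have v': "v \<in> \<Lambda>" "v \<noteq> 0" using v by (auto simp: shortest_def)
      have vS: "v \<in> S" using ulatD(2)[OF U] v' by blast
      note S = ulatD(1)[OF U]
      have vh: "norm v \<le> h" unfolding h_def by (rule shortest_bound[OF U d v])
      have d': "vec.dim (compl v S) = card J" using dim_compl[OF S vS v'(2)] d by simp
      from C[OF ulat_child[OF U v] d'] obtain f' e' where "reduced_frame J (compl v S) (prj v ` perp v \<Lambda>) (2 * R) C f' e'"
        by blast
      note fe = this[unfolded reduced_frame_def]
      have f'1: "f' i \<in> prj v ` perp v \<Lambda>" and e': "e' i \<in> compl v S" "e' i \<noteq> 0" if "i \<in> J" for i using conjunct1[OF fe] that by blast+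
      note fe = conjunct2[OF fe]
      have f'2: "om (f' i) (f' j) = 0" if "i \<in> J" "j \<in> J" for i j using conjunct1[OF fe] that by blast
      note fe = conjunct2[OF fe]
      have e'2: "hp (e' i) (e' j) = 0" if "i \<in> J" "j \<in> J" "i \<noteq> j" for i j using conjunct1[OF fe] that by blast
      note fe = conjunct2[OF fe]
      have D: "det (replace_rows J f' W) = det (replace_rows J e' W)" for W using conjunct1[OF fe] by blast
      note B = conjunct2[OF fe]
      have "\<forall>i\<in>J. \<exists>p. p \<in> perp v \<Lambda> \<and> f' i = prj v p" using f'1 by blast
      then obtain p where p: "\<And>i. i \<in> J \<Longrightarrow> p i \<in> perp v \<Lambda>" "\<And>i. i \<in> J \<Longrightarrow> f' i = prj v (p i)" by metis
      have p': "p i \<in> \<Lambda>" "om v (p i) = 0" "om (p i) v = 0" if "i \<in> J" for i using p(1)[OF that] om_commute[of "p i" v] by (auto simp: perp_def)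
      define f where "f i = (if i = a then v else p i)" for i
      define e where "e i = (if i = a then v else e' i)" for i
      have aJ: "a \<notin> J" by fact
      have ea: "e a = v" "f a = v" "\<And>i. i \<in> J \<Longrightarrow> e i = e' i" "\<And>i. i \<in> J \<Longrightarrow> f i = p i" using aJ by (auto simp: e_def f_def)
      have 1: "f i \<in> \<Lambda> \<and> e i \<in> S \<and> e i \<noteq> 0" if "i \<in> insert a J" for i
        using that p' e' v' vS by (auto simp: ea compl_def)
      have 2: "om (f i) (f j) = 0" if "i \<in> insert a J" "j \<in> insert a J" for i j
        using that p' f'2 om_prj[of v "p i" "p j"] by (auto simp: ea om_self p(2))
      have hc: "hp x y = 0 \<Longrightarrow> hp y x = 0" for x y :: "complex ^ 'n"
        using om_commute[of x y] by (simp add: hp_zero_iff inner_commute)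
      have 3: "hp (e i) (e j) = 0" if "i \<in> insert a J" "j \<in> insert a J" "i \<noteq> j" for i j
        using that e'2 e'(1) hc by (auto simp: ea compl_def)
      have 4: "det (replace_rows (insert a J) f W) = det (replace_rows (insert a J) e W)" for W
      proof -
        define W' where "W' = replace_rows {a} (\<lambda>_. v) W"
        define t where "t i = complex_of_real ((v \<bullet> p i) / (v \<bullet> v))" for i
        have Wa: "replace_rows J f' W' $ a = v" using aJ by (simp add: replace_rows_def W'_def)
        \<comment> \<open>The lifts p i differ from their projections by multiples of v, which is
          row a; these row operations preserve the determinant.\<close>
        have "replace_rows (insert a J) f W = (\<chi> i. if i \<in> J then replace_rows J f' W' $ i + t i *s replace_rows J f' W' $ a else replace_rows J f' W' $ i)"
          unfolding Wa using aJ
          by (auto simp: vec_eq_iff replace_rows_def f_def W'_def t_def p(2) prj_def scaleR_conv_of_real[where 'a=complex])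
        then have "det (replace_rows (insert a J) f W) = det (replace_rows J f' W')"
          using det_add_rows[OF \<open>finite J\<close> aJ, of "replace_rows J f' W'" t] by simp
        also have "\<dots> = det (replace_rows J e' W')" by (rule D)
        also have "replace_rows J e' W' = replace_rows (insert a J) e W"
          using aJ by (auto simp: vec_eq_iff replace_rows_def e_def W'_def)
        finally show ?thesis .
      qed
      have 5: "(\<Prod>i\<in>insert a J. norm (e i)) * card (\<Lambda> \<inter> cball 0 R) \<le> C'"
      proof -
        let ?P = "\<Prod>i\<in>J. norm (e' i)" and ?N = "real (card (prj v ` perp v \<Lambda> \<inter> cball 0 (2 * R)))"
        have "(\<Prod>i\<in>insert a J. norm (e i)) = norm v * ?P" using insert ea by (simp cong: prod.cong)
        then have "(\<Prod>i\<in>insert a J. norm (e i)) * card (\<Lambda> \<inter> cball 0 R) \<le> norm v * ?P * ((2 * norm v * R + 1) * ((4 * R / norm v + 1) * ?N))"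
          using ulat_count_step[OF U v R] by (simp add: mult_left_mono prod_nonneg)
        also have "\<dots> = (2 * norm v * R + 1) * (4 * R + norm v) * (?P * ?N)"
          using v' by (simp add: field_simps)
        also have "\<dots> \<le> (2 * h * R + 1) * (4 * R + h) * C"
          by (intro mult_mono add_mono mult_right_mono B vh) (use R h0 in \<open>auto simp: prod_nonneg\<close>)
        finally show ?thesis by (simp add: C'_def)
      qed
      show ?thesis
        by (rule exI[of _ f], rule exI[of _ e]) (use 1 2 3 4 5 in \<open>simp add: reduced_frame_def\<close>)
    qed
    then show "\<exists>C>0. \<forall>S \<Lambda>. ulat S \<Lambda> \<longrightarrow> vec.dim S = card (insert a J) \<longrightarrow> (\<exists>f e. reduced_frame (insert a J) S \<Lambda> R C f e)"
      using C'0 by blast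
  qed
qed

lemma det_orthogonal_rows:
  fixes E :: "complex ^ 'n ^ 'n"
  assumes "\<And>i j. i \<noteq> j \<Longrightarrow> hp (E $ i) (E $ j) = 0"
  shows "cmod (det E) = (\<Prod>i\<in>UNIV. norm (E $ i))"
proof -
  have nth: "(E ** herm E) $ i $ j = hp (E $ j) (E $ i)" for i j
    by (simp add: matrix_matrix_mult_def herm_def hp_eq mult.commute)
  have "det (E ** herm E) = (\<Prod>i\<in>UNIV. (E ** herm E) $ i $ i)"
    by (rule det_diagonal) (use assms in \<open>auto simp: nth\<close>)
  also have "\<dots> = of_real ((\<Prod>i\<in>UNIV. norm (E $ i))\<^sup>2)"
    by (simp add: nth hp_self dot_square_norm prod_power_distrib)
  finally have "cmod (det E * cnj (det E)) = (\<Prod>i\<in>UNIV. norm (E $ i))\<^sup>2"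
    by (simp add: det_mul det_herm norm_power prod_nonneg abs_of_nonneg del: of_real_power of_real_prod)
  then have "(cmod (det E))\<^sup>2 = (\<Prod>i\<in>UNIV. norm (E $ i))\<^sup>2" by (simp add: norm_mult power2_eq_square)
  then show ?thesis by (simp add: power2_eq_iff_nonneg prod_nonneg)
qed

lemma finite_vec_components:
  assumes "\<And>i. finite (A i)" shows "finite {v :: 'a ^ 'n. \<forall>i. v $ i \<in> A i}"
proof (rule finite_imageD)
  show "finite (vec_nth ` {v. \<forall>i. v $ i \<in> A i})"
    by (rule finite_subset[of _ "PiE UNIV A"]) (auto intro!: finite_PiE assms)
  show "inj_on vec_nth {v. \<forall>i. v $ i \<in> A i}" by (simp add: inj_on_def vec_nth_inject)
qed

lemma finite_glat_bounded: "finite {p \<in> glat. \<forall>i. \<bar>Re (p $ i)\<bar> \<le> A i \<and> \<bar>Im (p $ i)\<bar> \<le> B i}"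
proof (rule finite_subset)
  let ?I = "\<lambda>c. {t \<in> \<int>. - c \<le> t \<and> t \<le> (c::real)}"
  show "{p \<in> glat. \<forall>i. \<bar>Re (p $ i)\<bar> \<le> A i \<and> \<bar>Im (p $ i)\<bar> \<le> B i} \<subseteq> {p. \<forall>i. p $ i \<in> (\<lambda>(a, b). Complex a b) ` (?I (A i) \<times> ?I (B i))}"
  proof (clarify)
    fix p i assume p: "p \<in> glat" "\<forall>i. \<bar>Re (p $ i)\<bar> \<le> A i \<and> \<bar>Im (p $ i)\<bar> \<le> B i"
    then have "Re (p $ i) \<in> ?I (A i)" "Im (p $ i) \<in> ?I (B i)"
      by (auto simp: glat_def gints_def abs_le_iff) (meson minus_le_iff)+
    then show "p $ i \<in> (\<lambda>(a, b). Complex a b) ` (?I (A i) \<times> ?I (B i))"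
      by (intro image_eqI[of _ _ "(Re (p $ i), Im (p $ i))"]) auto
  qed
  show "finite {p :: complex ^ 'a. \<forall>i. p $ i \<in> (\<lambda>(a, b). Complex a b) ` (?I (A i) \<times> ?I (B i))}"
    by (intro finite_vec_components finite_imageI finite_cartesian_product finite_int_interval)
qed

lemma finite_rho_ball:
  assumes M: "\<And>i. M i > 0"
  shows "finite {p \<in> glat. norm (rho M X p) \<le> R}"
proof (rule finite_subset[OF _ finite_glat_bounded])
  let ?A = "\<lambda>i. M i * R"
  let ?B = "\<lambda>i. R / M i + (\<Sum>j\<in>UNIV. M j * R * \<bar>X $ j $ i\<bar>)"
  show "{p \<in> glat. norm (rho M X p) \<le> R} \<subseteq> {p \<in> glat. \<forall>i. \<bar>Re (p $ i)\<bar> \<le> ?A i \<and> \<bar>Im (p $ i)\<bar> \<le> ?B i}"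
  proof (clarify, intro conjI)
    fix p i assume p: "norm (rho M X p) \<le> R"
    have n: "cmod (rho M X p $ j) \<le> R" for j using Finite_Cartesian_Product.norm_nth_le[of "rho M X p" j] p by linarith
    have re: "\<bar>Re (p $ j)\<bar> \<le> M j * R" for j
      using order_trans[OF abs_Re_le_cmod n, of j] M[of j] by (simp add: rho_def abs_divide divide_le_eq mult.commute abs_of_pos)
    show "\<bar>Re (p $ i)\<bar> \<le> M i * R" by (rule re)
    let ?s = "\<Sum>j\<in>UNIV. Re (p $ j) * X $ j $ i"
    have "\<bar>M i * (?s + Im (p $ i))\<bar> \<le> R" using order_trans[OF abs_Im_le_cmod n, of i] by (simp add: rho_def)
    then have "\<bar>?s + Im (p $ i)\<bar> \<le> R / M i" using M[of i] by (simp add: abs_mult le_divide_eq mult.commute abs_of_pos)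
    moreover have "\<bar>?s\<bar> \<le> (\<Sum>j\<in>UNIV. M j * R * \<bar>X $ j $ i\<bar>)"
      by (rule order_trans[OF sum_abs sum_mono]) (simp add: abs_mult mult_right_mono re)
    ultimately show "\<bar>Im (p $ i)\<bar> \<le> ?B i" by linarith
  qed
qed

lemma ulat_rho:
  fixes X :: "real ^ 'n ^ 'n"
  assumes X: "transpose X = X" and M: "\<And>i. M i > 0"
  shows "ulat UNIV (rho M X ` glat)"
  unfolding ulat_def
proof (intro conjI ballI allI impI)
  show "0 \<in> rho M X ` glat" by (rule image_eqI[of _ _ 0]) (auto simp: rho_0)
  show "p - q \<in> rho M X ` glat" if "p \<in> rho M X ` glat" "q \<in> rho M X ` glat" for p q
  proof -
    obtain p' q' where "p = rho M X p'" "q = rho M X q'" "p' \<in> glat" "q' \<in> glat" using \<open>p \<in> _\<close> \<open>q \<in> _\<close> by blast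
    moreover from this have "p' - q' \<in> glat" by (auto simp: glat_def)
    ultimately show ?thesis by (auto simp: rho_diff[symmetric])
  qed
  have "rho M X ` glat \<inter> cball 0 R = rho M X ` {p \<in> glat. norm (rho M X p) \<le> R}" for R by auto
  then show "finite (rho M X ` glat \<inter> cball 0 R)" for R using finite_rho_ball[where M=M and X=X, OF M] by simp
  show "om p q \<in> \<int>" if "p \<in> rho M X ` glat" "q \<in> rho M X ` glat" for p q
    using \<open>p \<in> _\<close> \<open>q \<in> _\<close> by (auto simp: om_rho[where M=M, OF X M] om_glat)
next
  fix z assume "z \<in> rho M X ` glat" "z \<noteq> 0"
  then obtain p where p: "p \<in> glat" "z = rho M X p" by blast
  then have p0: "p \<noteq> 0" using \<open>z \<noteq> 0\<close> by (auto simp: rho_0)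
  show "\<exists>g u w. g \<in> \<int> \<and> u \<in> rho M X ` glat \<and> w \<in> rho M X ` glat \<and> z = g *\<^sub>R u \<and> om u w = 1"
  proof -
    define \<beta> :: "real ^ ('n + 'n)" where "\<beta> = (\<chi> s. case s of Inl i \<Rightarrow> Re (p $ i) | Inr i \<Rightarrow> Im (p $ i))"
    have b1: "\<beta> \<in> integer_lattice" using p(1) by (auto simp: \<beta>_def integer_lattice_def glat_def gints_def split: sum.split)
    have b2: "\<beta> \<noteq> 0"
    proof
      assume b0: "\<beta> = 0"
      have "Re (p $ i) = \<beta> $ Inl i" "Im (p $ i) = \<beta> $ Inr i" for i by (simp_all add: \<beta>_def)
      then have "p = 0" using b0 by (simp add: vec_eq_iff complex_eq_iff)
      then show False using p0 by simp
    qed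
    obtain g :: nat and \<alpha> b where g: "\<alpha> \<in> integer_lattice" "b \<in> integer_lattice" "\<beta> = real g *\<^sub>R \<alpha>" "b \<bullet> \<alpha> = 1"
      using content_exists[OF b1 b2] by metis
    define u :: "complex ^ 'n" where "u = (\<chi> i. Complex (\<alpha> $ Inl i) (\<alpha> $ Inr i))"
    \<comment> \<open>The Bezout vector rotated by the standard symplectic matrix, which turns the
      Bezout identity into \<open>om u w = 1\<close>.\<close>
    define w :: "complex ^ 'n" where "w = (\<chi> i. Complex (- b $ Inr i) (b $ Inl i))"
    have uw: "u \<in> glat" "w \<in> glat" using g by (auto simp: u_def w_def glat_def gints_def integer_lattice_def)
    have "p = real g *\<^sub>R u"
    proof -
      have "Re (p $ i) = \<beta> $ Inl i" "Im (p $ i) = \<beta> $ Inr i" for i by (simp_all add: \<beta>_def)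
      then show ?thesis by (simp add: g(3) u_def vec_eq_iff complex_eq_iff)
    qed
    moreover have "om u w = 1"
    proof -
      have "om u w = (\<Sum>i\<in>UNIV. b $ Inl i * \<alpha> $ Inl i) + (\<Sum>i\<in>UNIV. b $ Inr i * \<alpha> $ Inr i)"
        by (simp add: om_def u_def w_def sum.distrib[symmetric] algebra_simps)
      also have "\<dots> = b \<bullet> \<alpha>"
        unfolding inner_vec_def UNIV_Plus_UNIV[symmetric] by (subst sum.Plus) auto
      finally show ?thesis using g by simp
    qed
    ultimately show ?thesis
      using uw p by (intro exI[of _ "real g"] exI[of _ "rho M X u"] exI[of _ "rho M X w"])
        (auto simp: rho_scaleR om_rho[where M=M, OF X M])
  qed
next
  fix z assume "\<forall>p\<in>rho M X ` glat. om z p = 0"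
  then have o: "\<And>p. p \<in> glat \<Longrightarrow> om z (rho M X p) = 0" by blast
  have re: "Re (z $ i) = 0" for i
  proof -
    have "rho M X (axis i \<i>) = axis i (\<i> * of_real (M i))"
    proof -
      have "Re ((axis i \<i> :: complex ^ 'n) $ j) = 0" for j by (simp add: axis_def)
      then show ?thesis by (simp add: rho_def vec_eq_iff complex_eq_iff) (simp add: axis_def)
    qed
    moreover have "(axis i \<i> :: complex ^ 'n) \<in> glat" by (auto simp: glat_def gints_def axis_def)
    ultimately have "om z (axis i (\<i> * of_real (M i))) = 0" using o by metis
    then show ?thesis using M[of i] by (simp add: om_def axis_def if_distrib cong: if_cong)
  qed
  have im: "Im (z $ i) = 0" for i
  proof -
    have "(axis i 1 :: complex ^ 'n) \<in> glat" by (auto simp: glat_def gints_def axis_def)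
    then have "om z (rho M X (axis i 1)) = 0" by (rule o)
    moreover have "Im (cnj (z $ j) * rho M X (axis i 1) $ j) = (if j = i then - Im (z $ i) / M i else 0)" for j
      using re[of j] by (auto simp: rho_def axis_def)
    ultimately show ?thesis using M[of i] by (simp add: om_def) 
  qed
  show "z = 0" using re im by (simp add: vec_eq_iff complex_eq_iff)
qed auto

text \<open>By orthogonality of e the reduced frame has covolume equal to the product of the norms.
  The primitive lattice \<open>lagof W\<close> contains the frame, so its covolume is no
  larger.\<close>

lemma count_lagrangian:
  assumes R: "R > 0"
  shows "\<exists>C>0. \<forall>(M :: 'n::finite \<Rightarrow> real) X. transpose X = X \<longrightarrow> (\<forall>i. M i > 0) \<longrightarrow>
     (\<exists>L. lag L \<and> lvol M X L * card {p \<in> glat. norm (rho M X p) \<le> R} \<le> C)"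
proof -
  obtain C where C0: "C > 0" and C: "\<And>S \<Lambda>. ulat S \<Lambda> \<Longrightarrow> vec.dim S = CARD('n) \<Longrightarrow> \<exists>f e. reduced_frame (UNIV :: 'n set) S \<Lambda> R C f e"
    using ulat_reduction[of "UNIV :: 'n set", rule_format, OF _ R] by auto
  have "\<exists>L. lag L \<and> lvol M X L * card {p \<in> glat. norm (rho M X p) \<le> R} \<le> C"
    if X: "transpose X = X" and M: "\<forall>i. M i > 0" for M :: "'n \<Rightarrow> real" and X
  proof -
    have M: "M i > 0" for i using M by blast
    have "vec.dim (UNIV :: (complex ^ 'n) set) = CARD('n)" by (simp add: card_cart_basis)
    from C[OF ulat_rho[where M=M, OF X M] this] obtain f e where "reduced_frame UNIV UNIV (rho M X ` glat) R C f e" by blast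
    note fe = this[unfolded reduced_frame_def]
    have f1: "f i \<in> rho M X ` glat" and e1: "e i \<noteq> 0" for i using conjunct1[OF fe] by blast+
    note fe = conjunct2[OF fe]
    have f2: "om (f i) (f j) = 0" for i j using conjunct1[OF fe] by blast
    note fe = conjunct2[OF fe]
    have e2: "hp (e i) (e j) = 0" if "i \<noteq> j" for i j using conjunct1[OF fe] that by blast
    note fe = conjunct2[OF fe]
    have D: "det (replace_rows UNIV f W) = det (replace_rows UNIV e W)" for W using conjunct1[OF fe] by blast
    note B = conjunct2[OF fe]
    have "\<forall>i. \<exists>p. p \<in> glat \<and> f i = rho M X p" using f1 by blast
    then obtain q where q: "\<And>i. q i \<in> glat" "\<And>i. f i = rho M X (q i)" by metis
    define W :: "complex ^ 'n ^ 'n" where "W = (\<chi> i. q i)"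
    have rW: "rhom M X W = replace_rows UNIV f 0" by (simp add: W_def rhom_def replace_rows_def q(2))
    have dW: "cmod (det (rhom M X W)) = (\<Prod>i\<in>UNIV. norm (e i))"
      unfolding rW D using det_orthogonal_rows[of "replace_rows UNIV e 0"] e2 by (simp add: replace_rows_def)
    have dnz: "det (rhom M X W) \<noteq> 0" using dW e1 by auto
    have iso: "isotr W" using f2 by (simp add: isotr_def W_def q(2) om_rho[where M=M, OF X M])
    have "det W \<noteq> 0"
    proof (rule isotr_indep_det_nz[OF iso])
      fix t assume "comb W t = 0"
      then have "comb (rhom M X W) t = 0" by (simp add: rho_comb[symmetric] rho_0)
      then show "t = 0" using comb_inj[OF dnz, of t 0] by (simp add: comb_0)
    qed
    then have gf: "gframe W" using iso q by (simp add: gframe_def W_def)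
    have L: "lag (lagof W)" using gf by (auto simp: lag_def)
    have "lvol M X (lagof W) \<le> (\<Prod>i\<in>UNIV. norm (e i))"
      unfolding dW[symmetric] using gf
      by (intro lvol_le_frame[where M=M, OF X M L _ dnz]) (auto simp: lagof_def gframe_def isotr_def)
    moreover have "card (rho M X ` glat \<inter> cball 0 R) = card {p \<in> glat. norm (rho M X p) \<le> R}"
    proof -
      have "rho M X ` glat \<inter> cball 0 R = rho M X ` {p \<in> glat. norm (rho M X p) \<le> R}" by auto
      moreover have "inj_on (rho M X) A" for A
      proof (rule inj_onI)
        fix x y assume "rho M X x = rho M X y"
        then show "x = y" using rho_inj[where M=M, OF M, of X "x - y"] by (simp add: rho_diff)
      qed
      ultimately show ?thesis by (simp add: card_image)
    qed
    ultimately have "lvol M X (lagof W) * card {p \<in> glat. norm (rho M X p) \<le> R} \<le> C"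
      using B by (smt (verit) mult_right_mono of_nat_0_le_iff)
    then show ?thesis using L by blast
  qed
  then show ?thesis using C0 by blast
qed

section \<open>Smooth dyadic decomposition of an interval\<close>

definition ee :: "real \<Rightarrow> complex" where "ee t = cis (2 * pi * t)"

lemma ee_add: "ee (s + t) = ee s * ee t"
  by (simp add: ee_def cis_mult distrib_left)

lemma norm_ee [simp]: "cmod (ee t) = 1"
  by (simp add: ee_def)

lemma ee_0 [simp]: "ee 0 = 1"
  by (simp add: ee_def)

lemma ee_int: "t \<in> \<int> \<Longrightarrow> ee t = 1"
  unfolding ee_def by (metis cis_multiple_2pi)

lemma cnj_ee: "cnj (ee t) = ee (- t)"
  by (simp add: ee_def cis_cnj)

lemma ee_sum: "finite A \<Longrightarrow> ee (\<Sum>a\<in>A. f a) = (\<Prod>a\<in>A. ee (f a))"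
  by (induction A rule: finite_induct) (auto simp: ee_add)

text \<open>The modulus is 2 |sin (pi s)|. Taylor's formula gives |sin x| \<ge> |x| / 2 up to 1.6 >
  pi / 2, and the constant 3 comes from pi > 3.\<close>

lemma norm_one_minus_ee:
  assumes "\<bar>s\<bar> \<le> 1/2" shows "cmod (1 - ee s) \<ge> 3 * \<bar>s\<bar>"
proof -
  define x where "x = pi * s"
  have xs: "\<bar>x\<bar> = pi * \<bar>s\<bar>" by (simp add: x_def abs_mult)
  have "\<bar>x\<bar> \<le> pi * (1/2)" unfolding xs by (intro mult_left_mono assms) simp
  also have "\<dots> \<le> 1.6" using pi_approx by simp
  finally have x: "\<bar>x\<bar> \<le> 1.6" .
  have "\<bar>sin x - (\<Sum>m<3. sin_coeff m * x ^ m)\<bar> \<le> inverse (fact 3) * \<bar>x\<bar> ^ 3" by (rule Maclaurin_sin_bound)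
  moreover have "(\<Sum>m<3. sin_coeff m * x ^ m) = x" by (simp add: sin_coeff_def numeral_eq_Suc)
  ultimately have "\<bar>sin x - x\<bar> \<le> \<bar>x\<bar> ^ 3 / 6" by (simp add: fact_numeral)
  also have "\<dots> = \<bar>x\<bar> * (\<bar>x\<bar>\<^sup>2 / 6)" by (simp add: power3_eq_cube power2_eq_square)
  also have "\<dots> \<le> \<bar>x\<bar> * (1/2)"
  proof (rule mult_left_mono)
    have "\<bar>x\<bar>\<^sup>2 \<le> 1.6\<^sup>2" using x by (intro power_mono) auto
    then show "\<bar>x\<bar>\<^sup>2 / 6 \<le> 1/2" by (simp add: power2_eq_square)
  qed simp
  finally have sx: "\<bar>sin x\<bar> \<ge> \<bar>x\<bar> / 2" by linarith
  have "cmod (1 - ee s) = 2 * \<bar>sin x\<bar>"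
  proof -
    have e: "ee s = cis (2 * x)" by (simp add: ee_def x_def algebra_simps)
    have "(cmod (1 - ee s))\<^sup>2 = (1 - cos (2 * x))\<^sup>2 + (sin (2 * x))\<^sup>2" unfolding e cmod_power2 by simp
    also have "\<dots> = (2 * (sin x)\<^sup>2)\<^sup>2 + (2 * sin x * cos x)\<^sup>2" by (simp add: cos_double_sin sin_double)
    also have "\<dots> = 4 * (sin x)\<^sup>2 * ((sin x)\<^sup>2 + (cos x)\<^sup>2)"
    proof -
      have "(2 * a\<^sup>2)\<^sup>2 + (2 * a * b)\<^sup>2 = 4 * a\<^sup>2 * (a\<^sup>2 + b\<^sup>2)" for a b :: real
        by (simp add: power2_eq_square algebra_simps)
      then show ?thesis .
    qed
    also have "\<dots> = (2 * \<bar>sin x\<bar>)\<^sup>2" by (simp add: power_mult_distrib)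
    finally have "(cmod (1 - ee s))\<^sup>2 = (2 * \<bar>sin x\<bar>)\<^sup>2" .
    then show ?thesis by (rule power2_eq_imp_eq) simp_all
  qed
  moreover have "3 * \<bar>s\<bar> \<le> \<bar>x\<bar>" unfolding xs using pi_gt3 by (intro mult_right_mono) auto
  ultimately show ?thesis using sx by linarith
qed

text \<open>The bound on the second differences is what makes the correlation sums decay like an inverse square;
  sharp cutoffs would cost a logarithm.\<close>

definition weight :: "nat \<Rightarrow> (int \<Rightarrow> real) \<Rightarrow> bool" where
  "weight a w \<longleftrightarrow> (\<forall>m. \<bar>w m\<bar> \<le> 1) \<and> (\<exists>p. \<forall>m. w m \<noteq> 0 \<longrightarrow> p \<le> m \<and> m < p + 4 * 2 ^ a)
    \<and> (\<forall>m. \<bar>w (m + 1) - w m\<bar> \<le> 2 / 2 ^ a)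
    \<and> (\<forall>S. finite S \<longrightarrow> (\<Sum>m\<in>S. \<bar>w (m + 2) - 2 * w (m + 1) + w m\<bar>) \<le> 8 / 2 ^ a)"

lemma sum_shift_int:
  fixes g :: "int \<Rightarrow> 'a::comm_monoid_add"
  assumes "\<And>m. g m \<noteq> 0 \<Longrightarrow> p \<le> m \<and> m < q" "a + j \<le> p" "q \<le> b + j"
  shows "(\<Sum>m\<in>{a..<b}. g (m + j)) = sum g {p..<q}"
proof -
  have "(\<Sum>m\<in>{a..<b}. g (m + j)) = sum g {a + j..<b + j}"
    by (rule sum.reindex_bij_witness[of _ "\<lambda>m. m - j" "\<lambda>m. m + j"]) auto
  also have "\<dots> = sum g {p..<q}"
  proof (rule sum.mono_neutral_right)
    show "\<forall>m\<in>{a + j..<b + j} - {p..<q}. g m = 0" using assms(1) by (metis DiffD2 atLeastLessThan_iff)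
  qed (use assms in auto)
  finally show ?thesis .
qed

text \<open>Two summations by parts: (1 - ee s)^2 F is a sum against the second differences of a
  product of two weights, whose total is at most 80 / 2^a, while F is trivially at most 4 * 2^a. The
  bound involves the floor of 2^a s because the shifts are later grouped by this integer.\<close>

lemma weight_correlation:
  assumes w: "weight a w" and sup: "\<And>m. w m \<noteq> 0 \<Longrightarrow> p \<le> m \<and> m < p + 4 * 2 ^ a" and s: "\<bar>s\<bar> \<le> 1/2"
  shows "cmod (\<Sum>m\<in>{p..<p + 4 * 2 ^ a}. of_real (w (m + h) * w m) * ee (of_int m * s)) \<le> 33 * 2 ^ a / (1 + (of_int \<lfloor>2 ^ a * s\<rfloor>)\<^sup>2)"
proof -
  define b where "b = (2::real) ^ a"
  have b: "b \<ge> 1" by (simp add: b_def)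
  define q where "q = p + 4 * 2 ^ a"
  have qp: "real_of_int (q - p) = 4 * b" "q \<ge> p" by (simp_all add: q_def b_def)
  define u where "u m = w (m + h) * w m" for m
  define F where "F = (\<Sum>m\<in>{p..<q}. of_real (u m) * ee (of_int m * s))"
  have w1: "\<bar>w m\<bar> \<le> 1" and w2: "\<bar>w (m + 1) - w m\<bar> \<le> 2 / b"
    and w3: "finite S \<Longrightarrow> (\<Sum>m\<in>S. \<bar>w (m + 2) - 2 * w (m + 1) + w m\<bar>) \<le> 8 / b" for m S
    using w by (auto simp: weight_def b_def)
  have usup: "u m \<noteq> 0 \<Longrightarrow> p \<le> m \<and> m < q" for m using sup[of m] by (auto simp: u_def q_def)
  have u1: "\<bar>u m\<bar> \<le> 1" for m using w1[of m] w1[of "m + h"] mult_mono[of "\<bar>w (m + h)\<bar>" 1 "\<bar>w m\<bar>" 1] by (simp add: u_def abs_mult)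
  have triv: "cmod F \<le> 4 * b"
  proof -
    have "cmod F \<le> (\<Sum>m\<in>{p..<q}. 1)" unfolding F_def
      by (rule sum_norm_le) (use u1 in \<open>simp add: norm_mult\<close>)
    also have "\<dots> = 4 * b" using qp by simp
    finally show ?thesis .
  qed
  let ?D = "\<lambda>m. u (m + 2) - 2 * u (m + 1) + u m"
  have eq: "(\<Sum>m\<in>{p - 2..<q}. of_real (?D m) * ee (of_int (m + 2) * s)) = (1 - ee s)\<^sup>2 * F"
  proof -
    have gs: "of_real (u m) * ee (of_int m * s) \<noteq> 0 \<Longrightarrow> p \<le> m \<and> m < q" for m using usup[of m] by auto
    have "(\<Sum>m\<in>{p - 2..<q}. of_real (?D m) * ee (of_int (m + 2) * s))
      = (\<Sum>m\<in>{p - 2..<q}. of_real (u (m + 2)) * ee (of_int (m + 2) * s)) - 2 * ee s * (\<Sum>m\<in>{p - 2..<q}. of_real (u (m + 1)) * ee (of_int (m + 1) * s))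
        + (ee s)\<^sup>2 * (\<Sum>m\<in>{p - 2..<q}. of_real (u (m + 0)) * ee (of_int (m + 0) * s))"
      by (simp add: sum_distrib_left sum_subtractf[symmetric] sum.distrib[symmetric] distrib_right ee_add power2_eq_square)
        (intro sum.cong refl, simp add: algebra_simps ee_add flip: ee_add)
    also have "(\<Sum>m\<in>{p - 2..<q}. of_real (u (m + 2)) * ee (of_int (m + 2) * s)) = F"
      unfolding F_def by (rule sum_shift_int[where g = "\<lambda>m. of_real (u m) * ee (of_int m * s)", OF gs]) auto
    also have "(\<Sum>m\<in>{p - 2..<q}. of_real (u (m + 1)) * ee (of_int (m + 1) * s)) = F"
      unfolding F_def by (rule sum_shift_int[where g = "\<lambda>m. of_real (u m) * ee (of_int m * s)", OF gs]) auto
    also have "(\<Sum>m\<in>{p - 2..<q}. of_real (u (m + 0)) * ee (of_int (m + 0) * s)) = F"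
      unfolding F_def by (rule sum_shift_int[where g = "\<lambda>m. of_real (u m) * ee (of_int m * s)", OF gs]) auto
    finally show ?thesis by (simp add: power2_eq_square algebra_simps)
  qed
  have D: "(\<Sum>m\<in>{p - 2..<q}. \<bar>?D m\<bar>) \<le> 80 / b"
  proof -
    let ?d = "\<lambda>m. w (m + 1) - w m" and ?dd = "\<lambda>m. w (m + 2) - 2 * w (m + 1) + w m"
    \<comment> \<open>Discrete Leibniz rule. The product of first differences costs 8 / b^2 at each
      of 4 b + 2 places, which accounts for 64 of the 80.\<close>
    have "\<bar>?D m\<bar> \<le> \<bar>?dd (m + h)\<bar> + \<bar>?dd m\<bar> + 8 / b\<^sup>2" for m
    proof -
      have "?D m = w (m + 2) * ?dd (m + h) + w (m + h) * ?dd m + 2 * (?d (m + h) * ?d (m + 1))"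
        by (simp add: u_def algebra_simps)
      moreover have "\<bar>w (m + 2) * ?dd (m + h)\<bar> \<le> \<bar>?dd (m + h)\<bar>" "\<bar>w (m + h) * ?dd m\<bar> \<le> \<bar>?dd m\<bar>"
        using w1 by (simp_all add: abs_mult mult_left_le_one_le)
      moreover have "\<bar>?d (m + h) * ?d (m + 1)\<bar> \<le> 4 / b\<^sup>2"
        unfolding abs_mult using mult_mono[OF w2[of "m + h"] w2[of "m + 1"]] b by (simp add: power2_eq_square)
      ultimately show ?thesis by linarith
    qed
    then have "(\<Sum>m\<in>{p - 2..<q}. \<bar>?D m\<bar>) \<le> (\<Sum>m\<in>{p - 2..<q}. \<bar>?dd (m + h)\<bar> + \<bar>?dd m\<bar> + 8 / b\<^sup>2)" by (rule sum_mono)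
    also have "\<dots> = (\<Sum>m\<in>{p - 2..<q}. \<bar>?dd (m + h)\<bar>) + (\<Sum>m\<in>{p - 2..<q}. \<bar>?dd m\<bar>) + (4 * b + 2) * (8 / b\<^sup>2)"
      using qp by (simp add: sum.distrib)
    also have "(\<Sum>m\<in>{p - 2..<q}. \<bar>?dd (m + h)\<bar>) = (\<Sum>m\<in>{p - 2 + h..<q + h}. \<bar>?dd m\<bar>)"
      by (rule sum.reindex_bij_witness[of _ "\<lambda>m. m - h" "\<lambda>m. m + h"]) auto
    also have "\<dots> \<le> 8 / b" by (rule w3) simp
    also have "(\<Sum>m\<in>{p - 2..<q}. \<bar>?dd m\<bar>) \<le> 8 / b" by (rule w3) simp
    also have "(4 * b + 2) * (8 / b\<^sup>2) \<le> (8 * b) * (8 / b\<^sup>2)" using b by (intro mult_right_mono) auto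
    also have "\<dots> = 64 / b" using b by (simp add: power2_eq_square)
    finally show ?thesis by simp
  qed
  have "cmod ((1 - ee s)\<^sup>2 * F) \<le> (\<Sum>m\<in>{p - 2..<q}. \<bar>?D m\<bar>)"
    unfolding eq[symmetric] by (rule sum_norm_le) (simp add: norm_mult del: of_real_add of_real_diff of_real_mult)
  also note D
  finally have "(cmod (1 - ee s))\<^sup>2 * cmod F \<le> 80 / b" by (simp add: norm_mult norm_power)
  moreover have "(3 * \<bar>s\<bar>)\<^sup>2 * cmod F \<le> (cmod (1 - ee s))\<^sup>2 * cmod F"
    using norm_one_minus_ee[OF s] by (intro mult_right_mono power_mono) auto
  ultimately have "9 * s\<^sup>2 * cmod F \<le> 80 / b" by (simp add: power_mult_distrib)
  then have "b\<^sup>2 * (9 * s\<^sup>2 * cmod F) \<le> b\<^sup>2 * (80 / b)" by (rule mult_left_mono) simp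
  also have "b\<^sup>2 * (80 / b) = 80 * b" using b by (simp add: power2_eq_square)
  finally have 1: "9 * ((b * s)\<^sup>2 * cmod F) \<le> 80 * b" by (simp add: power_mult_distrib mult_ac)
  define k where "k = real_of_int \<lfloor>b * s\<rfloor>"
  have k: "\<bar>k\<bar> \<le> \<bar>b * s\<bar> + 1" unfolding k_def by linarith
  \<comment> \<open>The constants 3/2 and 3 make the difference in the next estimate half of a
    square. Then 4 * 4 b + 3/2 * 80 b / 9 is below 33 b.\<close>
  have "k\<^sup>2 \<le> (\<bar>b * s\<bar> + 1)\<^sup>2" using power_mono[OF k, of 2] by simp
  also have "\<dots> \<le> 3/2 * (b * s)\<^sup>2 + 3"
    using zero_le_power2[of "\<bar>b * s\<bar> - 2"] by (simp add: power2_eq_square algebra_simps)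
  finally have "(1 + k\<^sup>2) * cmod F \<le> (4 + 3/2 * (b * s)\<^sup>2) * cmod F" by (intro mult_right_mono) auto
  also have "\<dots> = 4 * cmod F + 3/2 * ((b * s)\<^sup>2 * cmod F)" by (simp add: algebra_simps)
  also have "\<dots> \<le> 4 * (4 * b) + 3/2 * (80 * b / 9)" using triv 1 by linarith
  also have "\<dots> \<le> 33 * b" using b by simp
  finally have "cmod F \<le> 33 * b / (1 + k\<^sup>2)"
    by (subst pos_le_divide_eq) (auto simp: mult.commute add_pos_nonneg)
  then show ?thesis unfolding F_def q_def b_def k_def u_def .
qed

text \<open>The offset 1 makes \<open>ramp 0\<close> the indicator of m \<ge> 0, the sharp cutoff
  from which the telescoping over scales starts.\<close>

definition ramp :: "nat \<Rightarrow> int \<Rightarrow> real" where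
  "ramp j m = max 0 (min 1 ((of_int m + 1) / 2 ^ j))"

lemma ramp_bounds: "0 \<le> ramp j m" "ramp j m \<le> 1"
  by (auto simp: ramp_def)

lemma ramp_eq_0: "m < 0 \<Longrightarrow> ramp j m = 0"
proof -
  assume "m < 0"
  then have "(of_int m + 1) / (2::real) ^ j \<le> 0" by (intro divide_nonpos_pos) auto
  then show ?thesis by (simp add: ramp_def)
qed

lemma ramp_eq_1: "2 ^ j \<le> m + 1 \<Longrightarrow> ramp j m = 1"
proof -
  assume "2 ^ j \<le> m + 1"
  then have "real_of_int (2 ^ j) \<le> of_int (m + 1)" by (simp only: of_int_le_iff)
  then have "(2::real) ^ j \<le> of_int m + 1" by simp
  then show ?thesis by (simp add: ramp_def min_def le_divide_eq)
qed

lemma ramp_mid: "-1 \<le> m \<Longrightarrow> m + 1 \<le> 2 ^ j \<Longrightarrow> ramp j m = (of_int m + 1) / 2 ^ j"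
proof -
  assume m: "-1 \<le> m" "m + 1 \<le> 2 ^ j"
  then have "real_of_int (m + 1) \<le> of_int (2 ^ j)" by (simp only: of_int_le_iff)
  then have "of_int m + 1 \<le> (2::real) ^ j" by simp
  then show ?thesis using m by (simp add: ramp_def min_def max_def divide_le_eq zero_le_divide_iff)
qed

lemma ramp_0: "ramp 0 m = (if m \<ge> 0 then 1 else 0)"
  using ramp_eq_0[of m 0] ramp_eq_1[of 0 m] by simp

lemma ramp_diff: "\<bar>ramp j (m + 1) - ramp j m\<bar> \<le> 1 / 2 ^ j"
proof -
  have "(of_int (m + 1) + 1) / 2 ^ j = (of_int m + 1) / 2 ^ j + 1 / (2::real) ^ j" by (simp add: add_divide_distrib)
  moreover have "1 / (2::real) ^ j \<ge> 0" by simp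
  ultimately show ?thesis unfolding ramp_def by linarith
qed

lemma ramp_second_diff:
  assumes "m \<noteq> - 2" "m \<noteq> 2 ^ j - 2"
  shows "ramp j (m + 2) - 2 * ramp j (m + 1) + ramp j m = 0"
proof -
  consider "m < -2" | "m \<ge> -1" "m + 3 \<le> 2 ^ j" | "2 ^ j \<le> m + 1" using assms by linarith
  then show ?thesis
  proof cases
    case 1 then show ?thesis by (simp add: ramp_eq_0)
  next
    case 2 then show ?thesis by (simp add: ramp_mid field_simps)
  next
    case 3 then show ?thesis by (simp add: ramp_eq_1)
  qed
qed

text \<open>A ramp is piecewise linear, so its second differences live at its two kinks, each of
  size at most 2 / 2^j.\<close>

lemma sum_ramp_second_diff:
  assumes S: "finite S"
  shows "(\<Sum>m\<in>S. \<bar>ramp j (m + 2) - 2 * ramp j (m + 1) + ramp j m\<bar>) \<le> 4 / 2 ^ j"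
proof -
  let ?f = "\<lambda>m. \<bar>ramp j (m + 2) - 2 * ramp j (m + 1) + ramp j m\<bar>"
  have b: "?f m \<le> 2 / 2 ^ j" for m
    using ramp_diff[of j m] ramp_diff[of j "m + 1"] by (simp add: add.assoc)
  have "sum ?f S = sum ?f (S \<inter> {-2, 2 ^ j - 2})"
    by (rule sum.mono_neutral_right) (use S ramp_second_diff in auto)
  also have "\<dots> \<le> (\<Sum>m\<in>S \<inter> {-2, 2 ^ j - 2}. 2 / 2 ^ j)" by (rule sum_mono) (rule b)
  also have "\<dots> = card (S \<inter> {-2, 2 ^ j - 2}) * (2 / 2 ^ j)" by simp
  also have "\<dots> \<le> 2 * (2 / 2 ^ j)"
  proof (rule mult_right_mono)
    have "card (S \<inter> {-2, 2 ^ j - 2}) \<le> card {-2, 2 ^ j - 2 :: int}" by (rule card_mono) auto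
    also have "\<dots> \<le> 2" by (simp add: card_insert_if)
    finally show "real (card (S \<inter> {-2, 2 ^ j - 2})) \<le> 2" by simp
  qed simp
  finally show ?thesis by simp
qed

lemma sum_ramp_second_diff_shift:
  assumes S: "finite S"
  shows "(\<Sum>m\<in>S. \<bar>ramp j (m + 2 - u) - 2 * ramp j (m + 1 - u) + ramp j (m - u)\<bar>) \<le> 4 / 2 ^ j"
    and "(\<Sum>m\<in>S. \<bar>ramp j (v - (m + 2)) - 2 * ramp j (v - (m + 1)) + ramp j (v - m)\<bar>) \<le> 4 / 2 ^ j"
proof -
  let ?f = "\<lambda>m. \<bar>ramp j (m + 2) - 2 * ramp j (m + 1) + ramp j m\<bar>"
  have "(\<Sum>m\<in>S. \<bar>ramp j (m + 2 - u) - 2 * ramp j (m + 1 - u) + ramp j (m - u)\<bar>) = sum ?f ((\<lambda>m. m - u) ` S)"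
    by (subst sum.reindex) (auto simp: inj_on_def algebra_simps intro!: sum.cong)
  also have "\<dots> \<le> 4 / 2 ^ j" by (rule sum_ramp_second_diff) (use S in simp)
  finally show "(\<Sum>m\<in>S. \<bar>ramp j (m + 2 - u) - 2 * ramp j (m + 1 - u) + ramp j (m - u)\<bar>) \<le> 4 / 2 ^ j" .
  have "(\<Sum>m\<in>S. \<bar>ramp j (v - (m + 2)) - 2 * ramp j (v - (m + 1)) + ramp j (v - m)\<bar>) = sum ?f ((\<lambda>m. v - 2 - m) ` S)"
    by (subst sum.reindex) (auto simp: inj_on_def algebra_simps intro!: sum.cong)
  also have "\<dots> \<le> 4 / 2 ^ j" by (rule sum_ramp_second_diff) (use S in simp)
  finally show "(\<Sum>m\<in>S. \<bar>ramp j (v - (m + 2)) - 2 * ramp j (v - (m + 1)) + ramp j (v - m)\<bar>) \<le> 4 / 2 ^ j" .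
qed

lemma ramp_diff_shift:
  "\<bar>ramp j (m + 1 - u) - ramp j (m - u)\<bar> \<le> 1 / 2 ^ j" "\<bar>ramp j (v - (m + 1)) - ramp j (v - m)\<bar> \<le> 1 / 2 ^ j"
  using ramp_diff[of j "m - u"] ramp_diff[of j "v - (m + 1)"] by (simp_all add: algebra_simps abs_minus_commute)

lemma ramp_step_nonzero:
  assumes "ramp j m - ramp (Suc j) m \<noteq> 0" shows "0 \<le> m \<and> m < 4 * 2 ^ j"
proof (rule ccontr)
  assume n: "\<not> (0 \<le> m \<and> m < 4 * 2 ^ j)"
  show False
  proof (cases "m < 0")
    case True
    then show False using assms by (simp add: ramp_eq_0)
  next
    case False
    have "(0::int) < 2 ^ j" by simp
    then show False using n False assms ramp_eq_1[of j m] ramp_eq_1[of "Suc j" m] by simp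
  qed
qed

lemma abs_le_split: "z = x + y \<or> z = x - y \<Longrightarrow> \<bar>z\<bar> \<le> \<bar>x\<bar> + \<bar>y :: real\<bar>"
  using abs_triangle_ineq[of x y] abs_triangle_ineq4[of x y] by auto

lemma weight_left: "weight j (\<lambda>m. ramp j (m - u) - ramp (Suc j) (m - u))"
  and weight_right: "weight j (\<lambda>m. ramp j (v - m) - ramp (Suc j) (v - m))"
proof -
  have ineq: "1 / 2 ^ j + 1 / (2::real) ^ Suc j \<le> 2 / 2 ^ j" "4 / 2 ^ j + 4 / (2::real) ^ Suc j \<le> 8 / 2 ^ j"
    by (simp_all add: field_simps)
  have b1: "\<bar>ramp j m - ramp (Suc j) m\<bar> \<le> 1" for m
    using ramp_bounds[of j m] ramp_bounds[of "Suc j" m] by linarith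
  show "weight j (\<lambda>m. ramp j (m - u) - ramp (Suc j) (m - u))"
    unfolding weight_def
  proof (intro conjI allI impI)
    show "\<exists>p. \<forall>m. ramp j (m - u) - ramp (Suc j) (m - u) \<noteq> 0 \<longrightarrow> p \<le> m \<and> m < p + 4 * 2 ^ j"
      using ramp_step_nonzero by (intro exI[of _ u]) (smt (verit))
    show "\<bar>ramp j (m + 1 - u) - ramp (Suc j) (m + 1 - u) - (ramp j (m - u) - ramp (Suc j) (m - u))\<bar> \<le> 2 / 2 ^ j" for m
      using ramp_diff_shift(1)[of j m u] ramp_diff_shift(1)[of "Suc j" m u] ineq(1) by linarith
    fix S :: "int set" assume S: "finite S"
    have "(\<Sum>m\<in>S. \<bar>ramp j (m + 2 - u) - ramp (Suc j) (m + 2 - u) - 2 * (ramp j (m + 1 - u) - ramp (Suc j) (m + 1 - u)) + (ramp j (m - u) - ramp (Suc j) (m - u))\<bar>)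
      \<le> (\<Sum>m\<in>S. \<bar>ramp j (m + 2 - u) - 2 * ramp j (m + 1 - u) + ramp j (m - u)\<bar> + \<bar>ramp (Suc j) (m + 2 - u) - 2 * ramp (Suc j) (m + 1 - u) + ramp (Suc j) (m - u)\<bar>)"
      by (rule sum_mono, rule abs_le_split) simp
    also have "\<dots> \<le> 8 / 2 ^ j"
      unfolding sum.distrib using sum_ramp_second_diff_shift(1)[OF S, of j u] sum_ramp_second_diff_shift(1)[OF S, of "Suc j" u] ineq(2) by linarith
    finally show "(\<Sum>m\<in>S. \<bar>ramp j (m + 2 - u) - ramp (Suc j) (m + 2 - u) - 2 * (ramp j (m + 1 - u) - ramp (Suc j) (m + 1 - u)) + (ramp j (m - u) - ramp (Suc j) (m - u))\<bar>) \<le> 8 / 2 ^ j" .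
  qed (rule b1)
  show "weight j (\<lambda>m. ramp j (v - m) - ramp (Suc j) (v - m))"
    unfolding weight_def
  proof (intro conjI allI impI)
    show "\<exists>p. \<forall>m. ramp j (v - m) - ramp (Suc j) (v - m) \<noteq> 0 \<longrightarrow> p \<le> m \<and> m < p + 4 * 2 ^ j"
      using ramp_step_nonzero by (intro exI[of _ "v - 4 * 2 ^ j + 1"]) (smt (verit))
    show "\<bar>ramp j (v - (m + 1)) - ramp (Suc j) (v - (m + 1)) - (ramp j (v - m) - ramp (Suc j) (v - m))\<bar> \<le> 2 / 2 ^ j" for m
      using ramp_diff_shift(2)[of j v m] ramp_diff_shift(2)[of "Suc j" v m] ineq(1) by linarith
    fix S :: "int set" assume S: "finite S"
    have "(\<Sum>m\<in>S. \<bar>ramp j (v - (m + 2)) - ramp (Suc j) (v - (m + 2)) - 2 * (ramp j (v - (m + 1)) - ramp (Suc j) (v - (m + 1))) + (ramp j (v - m) - ramp (Suc j) (v - m))\<bar>)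
      \<le> (\<Sum>m\<in>S. \<bar>ramp j (v - (m + 2)) - 2 * ramp j (v - (m + 1)) + ramp j (v - m)\<bar> + \<bar>ramp (Suc j) (v - (m + 2)) - 2 * ramp (Suc j) (v - (m + 1)) + ramp (Suc j) (v - m)\<bar>)"
      by (rule sum_mono, rule abs_le_split) simp
    also have "\<dots> \<le> 8 / 2 ^ j"
      unfolding sum.distrib using sum_ramp_second_diff_shift(2)[OF S, of j v] sum_ramp_second_diff_shift(2)[OF S, of "Suc j" v] ineq(2) by linarith
    finally show "(\<Sum>m\<in>S. \<bar>ramp j (v - (m + 2)) - ramp (Suc j) (v - (m + 2)) - 2 * (ramp j (v - (m + 1)) - ramp (Suc j) (v - (m + 1))) + (ramp j (v - m) - ramp (Suc j) (v - m))\<bar>) \<le> 8 / 2 ^ j" .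
  qed (rule b1)
qed

text \<open>The first hypothesis lets each ramp reach 1 by the time the opposite end is passed, so
  outside [u, v] one term is 1, the other 0, and -1 cancels them. The second keeps the support
  within the length allowed at scale A.\<close>

lemma weight_mid:
  assumes A: "2 ^ A \<le> v - u + 2" and B: "v - u + 1 \<le> 4 * 2 ^ A"
  shows "weight A (\<lambda>m. ramp A (m - u) + ramp A (v - m) - 1)"
  unfolding weight_def
proof (intro conjI allI impI)
  show "\<bar>ramp A (m - u) + ramp A (v - m) - 1\<bar> \<le> 1" for m
    using ramp_bounds[of A "m - u"] ramp_bounds[of A "v - m"] by linarith
  have "u \<le> m \<and> m \<le> v" if "ramp A (m - u) + ramp A (v - m) - 1 \<noteq> 0" for m
  proof (rule ccontr)
    assume "\<not> (u \<le> m \<and> m \<le> v)"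
    then consider "m < u" | "m > v" by linarith
    then show False
    proof cases
      case 1 then show False using that A by (simp add: ramp_eq_0 ramp_eq_1)
    next
      case 2 then show False using that A by (simp add: ramp_eq_0 ramp_eq_1)
    qed
  qed
  then show "\<exists>p. \<forall>m. ramp A (m - u) + ramp A (v - m) - 1 \<noteq> 0 \<longrightarrow> p \<le> m \<and> m < p + 4 * 2 ^ A"
    using B by (intro exI[of _ u]) fastforce
  show "\<bar>ramp A (m + 1 - u) + ramp A (v - (m + 1)) - 1 - (ramp A (m - u) + ramp A (v - m) - 1)\<bar> \<le> 2 / 2 ^ A" for m
    using ramp_diff_shift(1)[of A m u] ramp_diff_shift(2)[of A v m] by simp
  fix S :: "int set" assume S: "finite S"
  have "(\<Sum>m\<in>S. \<bar>ramp A (m + 2 - u) + ramp A (v - (m + 2)) - 1 - 2 * (ramp A (m + 1 - u) + ramp A (v - (m + 1)) - 1) + (ramp A (m - u) + ramp A (v - m) - 1)\<bar>)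
    \<le> (\<Sum>m\<in>S. \<bar>ramp A (m + 2 - u) - 2 * ramp A (m + 1 - u) + ramp A (m - u)\<bar> + \<bar>ramp A (v - (m + 2)) - 2 * ramp A (v - (m + 1)) + ramp A (v - m)\<bar>)"
    by (rule sum_mono, rule abs_le_split) simp
  also have "\<dots> \<le> 8 / 2 ^ A"
    unfolding sum.distrib using sum_ramp_second_diff_shift(1)[OF S, of A u] sum_ramp_second_diff_shift(2)[OF S, of A v] by simp
  finally show "(\<Sum>m\<in>S. \<bar>ramp A (m + 2 - u) + ramp A (v - (m + 2)) - 1 - 2 * (ramp A (m + 1 - u) + ramp A (v - (m + 1)) - 1) + (ramp A (m - u) + ramp A (v - m) - 1)\<bar>) \<le> 8 / 2 ^ A" .
qed

lemma weight_zero: "weight a (\<lambda>_. 0)"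
  by (simp add: weight_def)

text \<open>The indicator is \<open>ramp 0 (m - u) + ramp 0 (v - m) - 1\<close>. At each end the
  ramp telescopes from scale 0 to A, and the bool selects the end. A is the first scale at which a
  single weight covers what is left; that middle piece is stored at (A, True). The lower bound -1
  for v - u admits the empty interval.\<close>

lemma interval_decomposition:
  assumes n: "v - u + 1 \<ge> 0" "v - u + 1 \<le> 2 ^ t"
  obtains w :: "nat \<times> bool \<Rightarrow> int \<Rightarrow> real" where "\<And>j c. weight j (w (j, c))"
    "\<And>m. (if u \<le> m \<and> m \<le> v then 1 else 0) = (\<Sum>jc\<in>{..t} \<times> UNIV. w jc m)"
proof -
  define A where "A = (LEAST k. v - u + 1 \<le> 4 * 2 ^ k)"
  have ex: "v - u + 1 \<le> 4 * 2 ^ t" using n(2) by (smt (verit) zero_less_power)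
  have A1: "v - u + 1 \<le> 4 * 2 ^ A" unfolding A_def by (rule LeastI[of _ t]) (rule ex)
  have At: "A \<le> t" unfolding A_def by (rule Least_le) (rule ex)
  have A2: "2 ^ A \<le> v - u + 2"
  proof (cases A)
    case 0
    then show ?thesis using n by simp
  next
    case (Suc k)
    then have "\<not> v - u + 1 \<le> 4 * 2 ^ k" using not_less_Least[of k "\<lambda>k. v - u + 1 \<le> 4 * 2 ^ k"] by (simp add: A_def)
    moreover have "(0::int) < 2 ^ k" by simp
    ultimately show ?thesis unfolding Suc power_Suc by linarith
  qed
  define w where "w = (\<lambda>(j, c) m. if j < A then (if c then ramp j (m - u) - ramp (Suc j) (m - u) else ramp j (v - m) - ramp (Suc j) (v - m))
    else if j = A \<and> c then ramp A (m - u) + ramp A (v - m) - 1 else 0)"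
  have "weight j (w (j, c))" for j c
  proof -
    consider "j < A" "c" | "j < A" "\<not> c" | "j = A" "c" | "j = A" "\<not> c" | "j > A" by linarith
    then show ?thesis
      by cases (simp_all only: w_def prod.case if_True if_False simp_thms less_irrefl not_less_iff_gr_or_eq, 
        use weight_left[of j u] weight_right[of j v] weight_mid[OF A2 A1] weight_zero in auto)
  qed
  moreover have "(if u \<le> m \<and> m \<le> v then 1 else 0) = (\<Sum>jc\<in>{..t} \<times> UNIV. w jc m)" for m
  proof -
    have "(\<Sum>jc\<in>{..t} \<times> UNIV. w jc m) = (\<Sum>j\<le>t. \<Sum>c\<in>UNIV. w (j, c) m)" by (simp add: sum.cartesian_product)
    also have "\<dots> = (\<Sum>j\<le>t. w (j, True) m + w (j, False) m)" by (simp add: UNIV_bool add.commute)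
    also have "\<dots> = (\<Sum>j\<le>A. w (j, True) m + w (j, False) m)"
      by (rule sum.mono_neutral_right) (use At in \<open>auto simp: w_def\<close>)
    also have "\<dots> = (\<Sum>j<A. w (j, True) m + w (j, False) m) + (w (A, True) m + w (A, False) m)"
      by (simp add: lessThan_Suc_atMost[symmetric])
    also have "(\<Sum>j<A. w (j, True) m + w (j, False) m) = (\<Sum>j<A. (ramp j (m - u) + ramp j (v - m)) - (ramp (Suc j) (m - u) + ramp (Suc j) (v - m)))"
      by (rule sum.cong) (auto simp: w_def)
    also have "\<dots> = (ramp 0 (m - u) + ramp 0 (v - m)) - (ramp A (m - u) + ramp A (v - m))"
      by (rule sum_lessThan_telescope')
    finally have "(\<Sum>jc\<in>{..t} \<times> UNIV. w jc m) = ramp 0 (m - u) + ramp 0 (v - m) - 1" by (simp add: w_def)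
    then show ?thesis using n(1) by (auto simp: ramp_0)
  qed
  ultimately show thesis by (rule that)
qed

section \<open>Weyl differencing\<close>

definition lform :: "real ^ 'n ^ 'n \<Rightarrow> ('n \<Rightarrow> int) \<Rightarrow> 'n \<Rightarrow> real" where
  "lform X h i = (\<Sum>j\<in>UNIV. of_int (h j) * X $ j $ i)"

definition phase :: "real ^ 'n ^ 'n \<Rightarrow> real ^ 'n \<Rightarrow> ('n \<Rightarrow> int) \<Rightarrow> real" where
  "phase X y m = 1/2 * (\<Sum>i\<in>UNIV. of_int (m i) * lform X m i) + (\<Sum>i\<in>UNIV. of_int (m i) * y $ i)"

lemma phase_add:
  fixes X :: "real ^ 'n ^ 'n"
  assumes X: "transpose X = X"
  shows "phase X y (\<lambda>i. m i + h i) = phase X y m + phase X y h + (\<Sum>i\<in>UNIV. of_int (m i) * lform X h i)"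
proof -
  have sym: "X $ i $ j = X $ j $ i" for i j using X by (metis transpose_def vec_lambda_beta)
  have comm: "(\<Sum>i\<in>UNIV. of_int (h i) * lform X m i) = (\<Sum>i\<in>UNIV. of_int (m i) * lform X h i)"
    unfolding lform_def sum_distrib_left
    by (subst sum.swap) (simp add: sym mult_ac)
  have add: "lform X (\<lambda>i. m i + h i) i = lform X m i + lform X h i" for i
    by (simp add: lform_def sum.distrib distrib_right)
  have "(\<Sum>i\<in>UNIV. of_int (m i + h i) * lform X (\<lambda>i. m i + h i) i)
      = (\<Sum>i\<in>UNIV. of_int (m i) * lform X m i) + (\<Sum>i\<in>UNIV. of_int (m i) * lform X h i)
        + ((\<Sum>i\<in>UNIV. of_int (h i) * lform X m i) + (\<Sum>i\<in>UNIV. of_int (h i) * lform X h i))"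
    by (simp add: add distrib_left distrib_right sum.distrib)
  then show ?thesis unfolding comm phase_def by (simp add: distrib_left distrib_right sum.distrib)
qed

text \<open>Opening the square with m' = m + h turns the quadratic phase into one that is linear in
  m, so the inner sum factors over the coordinates. The term in y depends on h alone and has modulus
  1, which gives uniformity in y.\<close>

lemma weyl_differencing:
  fixes X :: "real ^ 'n::finite ^ 'n" and w :: "'n \<Rightarrow> int \<Rightarrow> real"
  assumes X: "transpose X = X" and sup: "\<And>i m. w i m \<noteq> 0 \<Longrightarrow> p i \<le> m \<and> m < p i + l i"
  defines "S \<equiv> PiE UNIV (\<lambda>i. {p i..<p i + l i})" and "H \<equiv> PiE UNIV (\<lambda>i. {- l i..l i})"
  shows "(cmod (\<Sum>m\<in>S. of_real (\<Prod>i\<in>UNIV. w i (m i)) * ee (phase X y m)))\<^sup>2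
    \<le> (\<Sum>h\<in>H. \<Prod>i\<in>UNIV. cmod (\<Sum>m\<in>{p i..<p i + l i}. of_real (w i (m + h i) * w i m) * ee (of_int m * lform X h i)))"
proof -
  define g where "g m = of_real (\<Prod>i\<in>UNIV. w i (m i)) * ee (phase X y m)" for m
  have finS: "finite S" and finH: "finite H" by (simp_all add: S_def H_def finite_PiE)
  have memS: "m \<in> S \<longleftrightarrow> (\<forall>i. p i \<le> m i \<and> m i < p i + l i)" and memH: "m \<in> H \<longleftrightarrow> (\<forall>i. - l i \<le> m i \<and> m i \<le> l i)" for m
    by (auto simp: S_def H_def PiE_iff)
  have g0: "g m = 0" if mS: "m \<notin> S" for m
  proof -
    obtain i where "\<not> (p i \<le> m i \<and> m i < p i + l i)" using mS memS by blast
    then have "w i (m i) = 0" using sup by blast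
    then show ?thesis by (auto simp: g_def intro!: prod_zero)
  qed
  have sh: "(\<Sum>m'\<in>S. g m') = (\<Sum>h\<in>H. g (\<lambda>i. m i + h i))" if m: "m \<in> S" for m
  proof -
    have "(\<Sum>h\<in>H. g (\<lambda>i. m i + h i)) = sum g ((\<lambda>h i. m i + h i) ` H)"
      by (subst sum.reindex) (auto simp: inj_on_def fun_eq_iff)
    also have "\<dots> = sum g S"
    proof (rule sum.mono_neutral_right)
      show "S \<subseteq> (\<lambda>h i. m i + h i) ` H"
      proof
        fix m' assume m': "m' \<in> S"
        have "- l i \<le> m' i - m i \<and> m' i - m i \<le> l i" for i using m m' unfolding memS by (smt (verit))
        then show "m' \<in> (\<lambda>h i. m i + h i) ` H" by (intro image_eqI[of _ _ "\<lambda>i. m' i - m i"]) (auto simp: memH)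
      qed
    qed (use finH g0 in auto)
    finally show ?thesis ..
  qed
  have tm: "g (\<lambda>i. m i + h i) * cnj (g m) = ee (phase X y h) * (\<Prod>i\<in>UNIV. of_real (w i (m i + h i) * w i (m i)) * ee (of_int (m i) * lform X h i))" for m h
  proof -
    have "g (\<lambda>i. m i + h i) * cnj (g m) = of_real (\<Prod>i\<in>UNIV. w i (m i + h i) * w i (m i)) * (ee (phase X y (\<lambda>i. m i + h i)) * ee (- phase X y m))"
      by (simp add: g_def cnj_ee prod.distrib mult_ac)
    also have "ee (phase X y (\<lambda>i. m i + h i)) * ee (- phase X y m) = ee (phase X y h) * ee (\<Sum>i\<in>UNIV. of_int (m i) * lform X h i)"
      unfolding phase_add[OF X] ee_add[symmetric] by (simp add: algebra_simps)
    finally show ?thesis by (simp add: ee_sum prod.distrib mult_ac)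
  qed
  have "of_real ((cmod (sum g S))\<^sup>2) = (\<Sum>m\<in>S. sum g S * cnj (g m))"
    by (simp only: complex_norm_square cnj_sum sum_distrib_left)
  also have "\<dots> = (\<Sum>m\<in>S. \<Sum>h\<in>H. g (\<lambda>i. m i + h i) * cnj (g m))"
    by (rule sum.cong[OF refl]) (simp only: sh sum_distrib_right)
  also have "\<dots> = (\<Sum>h\<in>H. ee (phase X y h) * (\<Sum>m\<in>S. \<Prod>i\<in>UNIV. of_real (w i (m i + h i) * w i (m i)) * ee (of_int (m i) * lform X h i)))"
    unfolding tm sum_distrib_left by (rule sum.swap)
  also have "\<dots> = (\<Sum>h\<in>H. ee (phase X y h) * (\<Prod>i\<in>UNIV. \<Sum>m\<in>{p i..<p i + l i}. of_real (w i (m + h i) * w i m) * ee (of_int m * lform X h i)))"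
    unfolding S_def by (subst prod_sum_PiE) auto
  finally have eq: "of_real ((cmod (sum g S))\<^sup>2) = (\<Sum>h\<in>H. ee (phase X y h) * (\<Prod>i\<in>UNIV. \<Sum>m\<in>{p i..<p i + l i}. of_real (w i (m + h i) * w i m) * ee (of_int m * lform X h i)))" .
  have "(cmod (sum g S))\<^sup>2 = cmod (of_real ((cmod (sum g S))\<^sup>2))" by (simp only: norm_of_real abs_of_nonneg[OF zero_le_power2])
  also have "\<dots> \<le> (\<Sum>h\<in>H. \<Prod>i\<in>UNIV. cmod (\<Sum>m\<in>{p i..<p i + l i}. of_real (w i (m + h i) * w i m) * ee (of_int m * lform X h i)))"
    unfolding eq by (rule sum_norm_le) (simp only: norm_mult norm_ee prod_norm mult_1 order_refl)
  finally show ?thesis by (simp only: g_def[abs_def])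
qed

text \<open>The bound 8 is for the difference of two shifts of size at most 4 * 2^(a i), divided by
  2^(a i); the bound 1 is for the difference of two numbers with the same floor.\<close>

definition boxset :: "('n::finite \<Rightarrow> real) \<Rightarrow> real ^ 'n ^ 'n \<Rightarrow> (complex ^ 'n) set" where
  "boxset M X = {p \<in> glat. \<forall>i. \<bar>Re (rho M X p $ i)\<bar> \<le> 8 \<and> \<bar>Im (rho M X p $ i)\<bar> \<le> 1}"

lemma boxset_ball: "boxset M X \<subseteq> {p \<in> glat. norm (rho M (X :: real ^ 'n::finite ^ 'n) p) \<le> 9 * CARD('n)}"
proof
  fix p assume "p \<in> boxset M X"
  then have pg: "p \<in> glat" and p: "\<And>i. \<bar>Re (rho M X p $ i)\<bar> \<le> 8 \<and> \<bar>Im (rho M X p $ i)\<bar> \<le> 1" by (auto simp: boxset_def)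
  have "norm (rho M X p) \<le> (\<Sum>i\<in>UNIV. cmod (rho M X p $ i))" unfolding norm_vec_def by (rule L2_set_le_sum) simp
  also have "\<dots> \<le> (\<Sum>i\<in>(UNIV :: 'n set). 9)"
  proof (rule sum_mono)
    fix i
    show "cmod (rho M X p $ i) \<le> 9" using cmod_le[of "rho M X p $ i"] p[of i] by linarith
  qed
  finally show "p \<in> {p \<in> glat. norm (rho M X p) \<le> 9 * CARD('n)}" using pg by simp
qed

lemma finite_boxset: "(\<And>i. M i > 0) \<Longrightarrow> finite (boxset M X)"
  using finite_subset[OF boxset_ball finite_rho_ball] by blast

lemma sum_inverse_square_nat: "(\<Sum>k\<le>N. 1 / (1 + (real k)\<^sup>2)) \<le> 3 - 2 / (real N + 1)"
proof (induction N)
  case (Suc N)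
  define x where "x = real N + 1"
  have x: "x \<ge> 1" by (simp add: x_def)
  have "1 / (1 + x\<^sup>2) \<le> 2 / (x * (x + 1))"
  proof -
    have "x * 1 \<le> x * x" using x by (intro mult_left_mono) auto
    then have "1 * (x * (x + 1)) \<le> 2 * (1 + x\<^sup>2)" by (simp add: power2_eq_square algebra_simps)
    moreover have "x * (x + 1) > 0" using x by simp
    moreover have "1 + x\<^sup>2 > 0" by (simp add: add_pos_nonneg)
    moreover have "1 / A \<le> 2 / B" if "1 * B \<le> 2 * A" "B > 0" "A > 0" for A B :: real using that by (simp add: field_simps)
    ultimately show ?thesis by blast
  qed
  also have "\<dots> = 2 / x - 2 / (x + 1)" using x by (simp add: field_simps)
  finally show ?case using Suc by (simp add: x_def add_ac)
qed simp

lemma sum_inverse_square_int: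
  assumes "finite (Z :: int set)" shows "(\<Sum>k\<in>Z. 1 / (1 + (real_of_int k)\<^sup>2)) \<le> 6"
proof -
  obtain N where N: "Z \<subseteq> {- int N..int N}"
  proof
    show "Z \<subseteq> {- int (nat (\<Sum>z\<in>Z. \<bar>z\<bar>))..int (nat (\<Sum>z\<in>Z. \<bar>z\<bar>))}"
    proof
      fix z assume "z \<in> Z"
      then have "\<bar>z\<bar> \<le> (\<Sum>z\<in>Z. \<bar>z\<bar>)" using member_le_sum[of z Z abs] assms by simp
      then show "z \<in> {- int (nat (\<Sum>z\<in>Z. \<bar>z\<bar>))..int (nat (\<Sum>z\<in>Z. \<bar>z\<bar>))}" by auto
    qed
  qed
  let ?f = "\<lambda>k::int. 1 / (1 + (real_of_int k)\<^sup>2)"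
  have f: "?f k \<ge> 0" for k by (simp add: add_nonneg_nonneg)
  have n: "(\<Sum>k\<le>N. 1 / (1 + (real k)\<^sup>2)) \<le> 3" using sum_inverse_square_nat[of N] by (smt (verit) divide_nonneg_nonneg of_nat_0_le_iff)
  have "sum ?f Z \<le> sum ?f (int ` {..N} \<union> (\<lambda>k. - int k) ` {..N})"
  proof (rule sum_mono2)
    show "Z \<subseteq> int ` {..N} \<union> (\<lambda>k. - int k) ` {..N}"
    proof
      fix z assume "z \<in> Z"
      then have "z \<in> {- int N..int N}" using N by blast
      then have z: "\<bar>z\<bar> \<le> int N" by auto
      show "z \<in> int ` {..N} \<union> (\<lambda>k. - int k) ` {..N}"
      proof (cases "z \<ge> 0")
        case True then show ?thesis using z by (intro UnI1 image_eqI[of _ _ "nat z"]) auto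
      next
        case False then show ?thesis using z by (intro UnI2 image_eqI[of _ _ "nat (- z)"]) auto
      qed
    qed
  qed (use f in auto)
  also have "\<dots> \<le> sum ?f (int ` {..N}) + sum ?f ((\<lambda>k. - int k) ` {..N})"
    using sum.union_inter[of "int ` {..N}" "(\<lambda>k. - int k) ` {..N}" ?f] sum_nonneg[of "int ` {..N} \<inter> (\<lambda>k. - int k) ` {..N}" ?f] f by simp
  also have "sum ?f (int ` {..N}) = (\<Sum>k\<le>N. 1 / (1 + (real k)\<^sup>2))" by (subst sum.reindex) auto
  also have "sum ?f ((\<lambda>k. - int k) ` {..N}) = (\<Sum>k\<le>N. 1 / (1 + (real k)\<^sup>2))" by (subst sum.reindex) (auto simp: inj_on_def)
  finally show ?thesis using n by simp
qed

text \<open>The shifts h are grouped by the cell \<open>\<kappa> h\<close> of their linear forms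
  reduced to [-1/2, 1/2]. Two shifts in one cell differ by an element of \<open>boxset\<close>,
  which bounds the size of every cell, and the correlation bounds over the cells form a product of
  convergent sums: 198 = 33 * 6.\<close>

lemma smooth_sum_bound:
  fixes X :: "real ^ 'n::finite ^ 'n" and w :: "'n \<Rightarrow> int \<Rightarrow> real"
  assumes X: "transpose X = X" and w: "\<And>i. weight (a i) (w i)"
    and sup: "\<And>i m. w i m \<noteq> 0 \<Longrightarrow> p i \<le> m \<and> m < p i + 4 * 2 ^ a i"
  shows "(cmod (\<Sum>m\<in>PiE UNIV (\<lambda>i. {p i..<p i + 4 * 2 ^ a i}). of_real (\<Prod>i\<in>UNIV. w i (m i)) * ee (phase X y m)))\<^sup>2
    \<le> (\<Prod>i\<in>UNIV. 198 * 2 ^ a i) * card (boxset (\<lambda>i. 2 ^ a i) X)"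
proof -
  define H where "H = PiE (UNIV :: 'n set) (\<lambda>i. {- (4 * 2 ^ a i)..4 * 2 ^ a i :: int})"
  have memH: "m \<in> H \<longleftrightarrow> (\<forall>i. - (4 * 2 ^ a i) \<le> m i \<and> m i \<le> 4 * 2 ^ a i)" for m by (auto simp: H_def PiE_iff)
  have finH: "finite H" by (simp add: H_def finite_PiE)
  define s where "s h i = lform X h i - of_int (round (lform X h i))" for h i
  have s: "\<bar>s h i\<bar> \<le> 1/2" for h i using of_int_round_abs_le[of "lform X h i"] by (simp add: s_def abs_minus_commute)
  define \<kappa> where "\<kappa> h = (\<lambda>i. \<lfloor>2 ^ a i * s h i\<rfloor>)" for h
  define B where "B k = (\<Prod>i\<in>UNIV. 33 * 2 ^ a i / (1 + (real_of_int (k i))\<^sup>2))" for k :: "'n \<Rightarrow> int"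
  have B0: "B k \<ge> 0" for k unfolding B_def by (intro prod_nonneg divide_nonneg_nonneg) (auto simp: add_nonneg_nonneg)
  let ?N = "real (card (boxset (\<lambda>i. 2 ^ a i) X))"
  have fac: "cmod (\<Sum>m\<in>{p i..<p i + 4 * 2 ^ a i}. of_real (w i (m + h i) * w i m) * ee (of_int m * lform X h i))
     \<le> 33 * 2 ^ a i / (1 + (real_of_int (\<kappa> h i))\<^sup>2)" for h i
  proof -
    have "ee (of_int m * lform X h i) = ee (of_int m * s h i)" for m
    proof -
      have "of_int m * lform X h i = of_int m * s h i + of_int (m * round (lform X h i))" by (simp add: s_def algebra_simps)
      then show ?thesis by (simp only: ee_add ee_int[OF Ints_of_int] mult_1_right)
    qed
    then show ?thesis using weight_correlation[OF w sup s, of i "h i" h i] by (simp add: \<kappa>_def)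
  qed
  have fibre: "real (card {h \<in> H. \<kappa> h = k}) \<le> ?N" for k
  proof (cases "{h \<in> H. \<kappa> h = k} = {}")
    case False
    then obtain h0 where h0: "h0 \<in> H" "\<kappa> h0 = k" by blast
    define \<phi> where "\<phi> h = (\<chi> i. Complex (of_int (h i - h0 i)) (of_int (round (lform X h0 i) - round (lform X h i))))" for h
    have "\<phi> h \<in> boxset (\<lambda>i. 2 ^ a i) X" if h: "h \<in> H" "\<kappa> h = k" for h
    proof -
      have "\<bar>Re (rho (\<lambda>i. 2 ^ a i) X (\<phi> h) $ i)\<bar> \<le> 8" for i
      proof -
        have "- (8 * 2 ^ a i) \<le> h i - h0 i" "h i - h0 i \<le> 8 * 2 ^ a i" using h(1) h0(1) unfolding memH by (smt (verit))+
        then have "real_of_int (- (8 * 2 ^ a i)) \<le> of_int (h i - h0 i)" "of_int (h i - h0 i) \<le> real_of_int (8 * 2 ^ a i)" by (simp_all only: of_int_le_iff)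
        then show ?thesis by (simp add: rho_def \<phi>_def abs_le_iff divide_le_eq le_divide_eq)
      qed
      moreover have "\<bar>Im (rho (\<lambda>i. 2 ^ a i) X (\<phi> h) $ i)\<bar> \<le> 1" for i
      proof -
        have "(\<Sum>j\<in>UNIV. real_of_int (h j - h0 j) * X $ j $ i) = lform X h i - lform X h0 i"
          by (simp add: lform_def left_diff_distrib sum_subtractf)
        then have "Im (rho (\<lambda>i. 2 ^ a i) X (\<phi> h) $ i) = 2 ^ a i * s h i - 2 ^ a i * s h0 i"
          unfolding rho_def \<phi>_def s_def by (simp only: vec_lambda_beta complex.sel) (simp add: algebra_simps)
        moreover have "\<lfloor>2 ^ a i * s h i\<rfloor> = \<lfloor>2 ^ a i * s h0 i\<rfloor>" using h(2) h0(2) by (metis \<kappa>_def)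
        ultimately show ?thesis by linarith
      qed
      moreover have "\<phi> h \<in> glat" by (auto simp: glat_def gints_def \<phi>_def)
      ultimately show ?thesis by (simp add: boxset_def)
    qed
    moreover have "inj_on \<phi> {h \<in> H. \<kappa> h = k}"
      by (auto simp: inj_on_def \<phi>_def vec_eq_iff fun_eq_iff)
    ultimately have "card {h \<in> H. \<kappa> h = k} \<le> card (boxset (\<lambda>i. 2 ^ a i) X)"
      by (intro card_inj_on_le[of \<phi>]) (auto simp: finite_boxset)
    then show ?thesis by simp
  next
    case True
    show ?thesis unfolding True by simp
  qed
  define Z where "Z i = (\<lambda>h. \<kappa> h i) ` H" for i
  have finZ: "finite (Z i)" for i using finH by (simp add: Z_def)
  have "(cmod (\<Sum>m\<in>PiE UNIV (\<lambda>i. {p i..<p i + 4 * 2 ^ a i}). of_real (\<Prod>i\<in>UNIV. w i (m i)) * ee (phase X y m)))\<^sup>2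
    \<le> (\<Sum>h\<in>H. \<Prod>i\<in>UNIV. cmod (\<Sum>m\<in>{p i..<p i + 4 * 2 ^ a i}. of_real (w i (m + h i) * w i m) * ee (of_int m * lform X h i)))"
    unfolding H_def by (rule weyl_differencing[OF X sup])
  also have "\<dots> \<le> (\<Sum>h\<in>H. B (\<kappa> h))"
    unfolding B_def by (intro sum_mono prod_mono conjI norm_ge_zero fac)
  also have "\<dots> = (\<Sum>k\<in>\<kappa> ` H. \<Sum>h\<in>{h \<in> H. \<kappa> h = k}. B (\<kappa> h))"
    by (rule sum.image_gen[OF finH])
  also have "\<dots> = (\<Sum>k\<in>\<kappa> ` H. real (card {h \<in> H. \<kappa> h = k}) * B k)"
    by (rule sum.cong) auto
  also have "\<dots> \<le> (\<Sum>k\<in>\<kappa> ` H. ?N * B k)"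
    by (intro sum_mono mult_right_mono fibre B0)
  also have "\<dots> \<le> (\<Sum>k\<in>PiE UNIV Z. ?N * B k)"
  proof (rule sum_mono2)
    show "finite (PiE UNIV Z)" using finZ by (intro finite_PiE) auto
  qed (auto simp: Z_def B0)
  also have "\<dots> = ?N * (\<Prod>i\<in>UNIV. \<Sum>k\<in>Z i. 33 * 2 ^ a i / (1 + (real_of_int k)\<^sup>2))"
    unfolding B_def sum_distrib_left[symmetric] by (subst prod_sum_PiE) (auto simp: finZ)
  also have "\<dots> \<le> ?N * (\<Prod>i\<in>UNIV. 198 * 2 ^ a i)"
  proof (intro mult_left_mono prod_mono conjI)
    fix i
    show "0 \<le> (\<Sum>k\<in>Z i. 33 * 2 ^ a i / (1 + (real_of_int k)\<^sup>2))" by (intro sum_nonneg divide_nonneg_nonneg) (auto simp: add_nonneg_nonneg)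
    have "(\<Sum>k\<in>Z i. 33 * 2 ^ a i / (1 + (real_of_int k)\<^sup>2)) = 33 * 2 ^ a i * (\<Sum>k\<in>Z i. 1 / (1 + (real_of_int k)\<^sup>2))"
      by (simp add: sum_distrib_left)
    also have "\<dots> \<le> 33 * 2 ^ a i * 6" by (intro mult_left_mono sum_inverse_square_int finZ) simp
    finally show "(\<Sum>k\<in>Z i. 33 * 2 ^ a i / (1 + (real_of_int k)\<^sup>2)) \<le> 198 * 2 ^ a i" by simp
  qed simp
  finally show ?thesis by (simp add: mult.commute)
qed

lemma e_char_ee: "e_char (of_real t) = ee t"
  by (simp add: e_char_def ee_def cis_conv_exp mult_ac)

text \<open>The box is open, hence the strict inequalities and the endpoints floor + 1 and ceiling -
  1.\<close>

lemma theta_sum_eq: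
  fixes X :: "real ^ 'n::finite ^ 'n"
  assumes M: "M > 0"
  shows "theta_sum (box 0 b) M X x y
    = (\<Sum>m\<in>PiE UNIV (\<lambda>i. {\<lfloor>- x $ i\<rfloor> + 1..\<lceil>M * b $ i - x $ i\<rceil> - 1}). ee (phase X y m))"
proof -
  let ?D = "PiE (UNIV :: 'n set) (\<lambda>i. {\<lfloor>- x $ i\<rfloor> + 1..\<lceil>M * b $ i - x $ i\<rceil> - 1})"
  define f :: "('n \<Rightarrow> int) \<Rightarrow> real ^ 'n" where "f m = (\<chi> i. of_int (m i))" for m
  have inj: "inj_on f ?D" by (auto simp: inj_on_def f_def vec_eq_iff fun_eq_iff)
  have cond: "m \<in> (\<lambda>v. M *\<^sub>R v - x) ` box 0 b \<longleftrightarrow> (\<forall>i. - x $ i < m $ i \<and> m $ i < M * b $ i - x $ i)" for m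
  proof
    assume "m \<in> (\<lambda>v. M *\<^sub>R v - x) ` box 0 b"
    then obtain v where v: "v \<in> box 0 b" "m = M *\<^sub>R v - x" by blast
    have "0 < v $ i \<and> v $ i < b $ i" for i using v(1) by (simp add: mem_box_cart)
    then show "\<forall>i. - x $ i < m $ i \<and> m $ i < M * b $ i - x $ i" using M v(2) by simp
  next
    assume a: "\<forall>i. - x $ i < m $ i \<and> m $ i < M * b $ i - x $ i"
    have "m = M *\<^sub>R ((1 / M) *\<^sub>R (m + x)) - x" using M by simp
    moreover have "(1 / M) *\<^sub>R (m + x) \<in> box 0 b"
      unfolding mem_box_cart
    proof
      fix i
      have "- x $ i < m $ i \<and> m $ i < M * b $ i - x $ i" using a by blast
      then show "0 $ i < ((1 / M) *\<^sub>R (m + x)) $ i \<and> ((1 / M) *\<^sub>R (m + x)) $ i < b $ i"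
        using M by (simp add: pos_divide_less_eq mult.commute)
    qed
    ultimately show "m \<in> (\<lambda>v. M *\<^sub>R v - x) ` box 0 b" by blast
  qed
  have set: "integer_lattice \<inter> (\<lambda>v. M *\<^sub>R v - x) ` box 0 b = f ` ?D"
  proof
    show "f ` ?D \<subseteq> integer_lattice \<inter> (\<lambda>v. M *\<^sub>R v - x) ` box 0 b"
    proof
      fix z assume "z \<in> f ` ?D"
      then obtain m where m: "m \<in> ?D" "z = f m" by blast
      have "- x $ i < of_int (m i) \<and> of_int (m i) < M * b $ i - x $ i" for i
      proof -
        have "\<lfloor>- x $ i\<rfloor> + 1 \<le> m i" "m i \<le> \<lceil>M * b $ i - x $ i\<rceil> - 1" using m(1) by (auto simp: PiE_iff)
        then show ?thesis by linarith
      qed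
      then show "z \<in> integer_lattice \<inter> (\<lambda>v. M *\<^sub>R v - x) ` box 0 b"
        unfolding Int_iff cond using m(2) by (auto simp: f_def integer_lattice_def)
    qed
    show "integer_lattice \<inter> (\<lambda>v. M *\<^sub>R v - x) ` box 0 b \<subseteq> f ` ?D"
    proof
      fix z assume z: "z \<in> integer_lattice \<inter> (\<lambda>v. M *\<^sub>R v - x) ` box 0 b"
      define m where "m i = \<lfloor>z $ i\<rfloor>" for i
      have zm: "z $ i = of_int (m i)" for i using z by (auto simp: m_def integer_lattice_def)
      have "m i \<in> {\<lfloor>- x $ i\<rfloor> + 1..\<lceil>M * b $ i - x $ i\<rceil> - 1}" for i
      proof -
        have "- x $ i < z $ i \<and> z $ i < M * b $ i - x $ i" using z cond by blast
        then show ?thesis unfolding zm by (simp add: floor_less_iff less_ceiling_iff) linarith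
      qed
      then show "z \<in> f ` ?D" by (intro image_eqI[of _ _ m]) (auto simp: f_def vec_eq_iff zm)
    qed
  qed
  have "e_char (of_real (1/2 * ((f m v* X) \<bullet> f m) + f m \<bullet> y)) = ee (phase X y m)" for m
  proof -
    have "(f m v* X) \<bullet> f m = (\<Sum>i\<in>UNIV. of_int (m i) * lform X m i)"
      by (simp add: inner_vec_def vector_matrix_mult_def f_def lform_def mult_ac)
    moreover have "f m \<bullet> y = (\<Sum>i\<in>UNIV. of_int (m i) * y $ i)" by (simp add: inner_vec_def f_def)
    ultimately show ?thesis unfolding e_char_ee phase_def by simp
  qed
  then show ?thesis unfolding theta_sum_def set by (subst sum.reindex[OF inj]) (simp add: o_def)
qed

lemma theta_sum_bound:
  fixes X :: "real ^ 'n::finite ^ 'n"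
  assumes X: "transpose X = X" and M: "M > 0" and b: "\<And>i. b $ i > 0" and t: "\<And>i. M * b $ i + 1 \<le> 2 ^ t"
  shows "cmod (theta_sum (box 0 b) M X x y)
    \<le> (\<Sum>g\<in>PiE UNIV (\<lambda>_. {..t} \<times> (UNIV :: bool set)). sqrt ((\<Prod>i\<in>UNIV. 198 * 2 ^ fst (g i)) * card (boxset (\<lambda>i. 2 ^ fst (g i)) X)))"
proof -
  define u where "u i = \<lfloor>- x $ i\<rfloor> + 1" for i
  define v where "v i = \<lceil>M * b $ i - x $ i\<rceil> - 1" for i
  have "\<exists>w :: nat \<times> bool \<Rightarrow> int \<Rightarrow> real. (\<forall>j c. weight j (w (j, c))) \<and> (\<forall>m. (if u i \<le> m \<and> m \<le> v i then 1 else 0) = (\<Sum>jc\<in>{..t} \<times> UNIV. w jc m))" for i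
  proof -
    have Mb: "M * b $ i > 0" using M b by simp
    have "- x $ i < M * b $ i - x $ i" using Mb by simp
    then have 1: "v i - u i + 1 \<ge> 0" unfolding u_def v_def by linarith
    have "real_of_int (v i - u i + 1) \<le> M * b $ i + 1" unfolding u_def v_def by linarith
    also have "\<dots> \<le> 2 ^ t" by (rule t)
    finally have "real_of_int (v i - u i + 1) \<le> of_int (2 ^ t)" by simp
    then have 2: "v i - u i + 1 \<le> 2 ^ t" by (simp only: of_int_le_iff)
    show ?thesis using interval_decomposition[OF 1 2] by metis
  qed
  then obtain w :: "'n \<Rightarrow> nat \<times> bool \<Rightarrow> int \<Rightarrow> real" where w: "\<And>i j c. weight j (w i (j, c))"
    and wsum: "\<And>i m. (if u i \<le> m \<and> m \<le> v i then 1 else 0) = (\<Sum>jc\<in>{..t} \<times> UNIV. w i jc m)" by metis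
  have "\<exists>p. \<forall>m. w i jc m \<noteq> 0 \<longrightarrow> p \<le> m \<and> m < p + 4 * 2 ^ fst jc" for i jc
    using w[of "fst jc" i "snd jc"] by (simp add: weight_def)
  then obtain p where p: "\<And>i jc m. w i jc m \<noteq> 0 \<Longrightarrow> p i jc \<le> m \<and> m < p i jc + 4 * 2 ^ fst jc" by metis
  \<comment> \<open>A common finite range for the interval and the supports of all its pieces, so
    that the sums over m and over the pieces can be interchanged.\<close>
  define B where "B i = {u i..v i} \<union> (\<Union>jc\<in>{..t} \<times> UNIV. {p i jc..<p i jc + 4 * 2 ^ fst jc})" for i
  have finB: "finite (B i)" for i by (simp add: B_def)
  let ?G = "PiE (UNIV :: 'n set) (\<lambda>_. {..t} \<times> (UNIV :: bool set))"
  have T: "cmod (\<Sum>m\<in>PiE UNIV B. of_real (\<Prod>i\<in>UNIV. w i (g i) (m i)) * ee (phase X y m))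
     \<le> sqrt ((\<Prod>i\<in>UNIV. 198 * 2 ^ fst (g i)) * card (boxset (\<lambda>i. 2 ^ fst (g i)) X))" if g: "g \<in> ?G" for g
  proof -
    have sub: "{p i (g i)..<p i (g i) + 4 * 2 ^ fst (g i)} \<subseteq> B i" for i using g unfolding B_def by (auto simp: PiE_iff)
    have "(\<Sum>m\<in>PiE UNIV B. of_real (\<Prod>i\<in>UNIV. w i (g i) (m i)) * ee (phase X y m))
      = (\<Sum>m\<in>PiE UNIV (\<lambda>i. {p i (g i)..<p i (g i) + 4 * 2 ^ fst (g i)}). of_real (\<Prod>i\<in>UNIV. w i (g i) (m i)) * ee (phase X y m))"
    proof (rule sum.mono_neutral_right)
      show "finite (PiE UNIV B)" by (simp add: finite_PiE finB)
      show "PiE UNIV (\<lambda>i. {p i (g i)..<p i (g i) + 4 * 2 ^ fst (g i)}) \<subseteq> PiE UNIV B" using sub by (intro PiE_mono) auto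
      show "\<forall>m\<in>PiE UNIV B - PiE UNIV (\<lambda>i. {p i (g i)..<p i (g i) + 4 * 2 ^ fst (g i)}). of_real (\<Prod>i\<in>UNIV. w i (g i) (m i)) * ee (phase X y m) = 0"
      proof
        fix m assume "m \<in> PiE UNIV B - PiE UNIV (\<lambda>i. {p i (g i)..<p i (g i) + 4 * 2 ^ fst (g i)})"
        then obtain i where "m i \<notin> {p i (g i)..<p i (g i) + 4 * 2 ^ fst (g i)}" by (auto simp: PiE_iff)
        then have "w i (g i) (m i) = 0" using p[of i "g i" "m i"] by fastforce
        then have "(\<Prod>i\<in>UNIV. w i (g i) (m i)) = 0" by (intro prod_zero) auto
        then show "of_real (\<Prod>i\<in>UNIV. w i (g i) (m i)) * ee (phase X y m) = 0" by simp
      qed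
    qed
    moreover have "weight (fst (g i)) (w i (g i))" for i using w[of "fst (g i)" i "snd (g i)"] by simp
    ultimately show ?thesis
      using smooth_sum_bound[OF X, of "\<lambda>i. fst (g i)" "\<lambda>i. w i (g i)" "\<lambda>i. p i (g i)" y] p by (intro real_le_rsqrt) simp
  qed
  have "theta_sum (box 0 b) M X x y = (\<Sum>m\<in>PiE UNIV (\<lambda>i. {u i..v i}). ee (phase X y m))"
    unfolding u_def v_def by (rule theta_sum_eq[OF M])
  also have "\<dots> = (\<Sum>m\<in>PiE UNIV B. of_real (\<Prod>i\<in>UNIV. if u i \<le> m i \<and> m i \<le> v i then 1 else 0) * ee (phase X y m))"
  proof (rule sum.mono_neutral_cong_left)
    show "finite (PiE UNIV B)" by (simp add: finite_PiE finB)
    show "PiE UNIV (\<lambda>i. {u i..v i}) \<subseteq> PiE UNIV B" by (intro PiE_mono) (auto simp: B_def)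
    show "\<forall>m\<in>PiE UNIV B - PiE UNIV (\<lambda>i. {u i..v i}). of_real (\<Prod>i\<in>UNIV. if u i \<le> m i \<and> m i \<le> v i then 1 else 0) * ee (phase X y m) = 0"
    proof
      fix m assume "m \<in> PiE UNIV B - PiE UNIV (\<lambda>i. {u i..v i})"
      then obtain i where "\<not> (u i \<le> m i \<and> m i \<le> v i)" by (auto simp: PiE_iff)
      then have "(\<Prod>i\<in>UNIV. if u i \<le> m i \<and> m i \<le> v i then 1 else 0 :: real) = 0" by (intro prod_zero) auto
      then show "of_real (\<Prod>i\<in>UNIV. if u i \<le> m i \<and> m i \<le> v i then 1 else 0) * ee (phase X y m) = 0" by simp
    qed
    fix m assume "m \<in> PiE UNIV (\<lambda>i. {u i..v i})"
    then have "(\<Prod>i\<in>UNIV. if u i \<le> m i \<and> m i \<le> v i then 1 else 0 :: real) = 1" by (intro prod.neutral) (auto simp: PiE_iff)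
    then show "ee (phase X y m) = of_real (\<Prod>i\<in>UNIV. if u i \<le> m i \<and> m i \<le> v i then 1 else 0) * ee (phase X y m)" by simp
  qed
  also have "\<dots> = (\<Sum>m\<in>PiE UNIV B. \<Sum>g\<in>?G. of_real (\<Prod>i\<in>UNIV. w i (g i) (m i)) * ee (phase X y m))"
    unfolding wsum by (subst prod_sum_PiE) (auto simp: sum_distrib_right)
  also have "\<dots> = (\<Sum>g\<in>?G. \<Sum>m\<in>PiE UNIV B. of_real (\<Prod>i\<in>UNIV. w i (g i) (m i)) * ee (phase X y m))"
    by (rule sum.swap)
  finally show ?thesis using sum_norm_le[of ?G, OF T] by simp
qed

section \<open>The mean and the tail of the lattice point count\<close>

definition wrapped :: "real \<Rightarrow> real \<Rightarrow> ennreal" where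
  "wrapped B x = (\<integral>\<^sup>+\<nu>. indicator {-B..B} (x + of_int \<nu>) \<partial>count_space (UNIV::int set))"

lemma measurable_wrapped [measurable]: "wrapped B \<in> borel_measurable borel"
  unfolding wrapped_def by (rule borel_measurable_count_sum) auto

lemma wrapped_card: "wrapped B x = of_nat (card {\<nu>::int. - B \<le> x + of_int \<nu> \<and> x + of_int \<nu> \<le> B})"
  and finite_wrapped: "finite {\<nu>::int. - B \<le> x + of_int \<nu> \<and> x + of_int \<nu> \<le> B}"
proof -
  let ?A = "{\<nu>::int. - B \<le> x + of_int \<nu> \<and> x + of_int \<nu> \<le> B}"
  have "?A \<subseteq> {\<lfloor>- B - x\<rfloor>..\<lceil>B - x\<rceil>}" by (auto simp: floor_le_iff le_ceiling_iff)
  then show fin: "finite ?A" using finite_subset by blast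
  have "wrapped B x = (\<integral>\<^sup>+\<nu>. indicator ?A \<nu> \<partial>count_space UNIV)"
    unfolding wrapped_def by (rule nn_integral_cong) (simp add: indicator_def)
  also have "\<dots> = of_nat (card ?A)" using fin by (simp add: emeasure_count_space_finite)
  finally show "wrapped B x = of_nat (card ?A)" .
qed

lemma lform_symF: "lform (symF F) h i = (\<Sum>l\<in>UNIV. of_int (h l) * F $ {l, i})"
  by (simp add: lform_def symF_def)

lemma measurable_lform_symF [measurable]: "(\<lambda>F. lform (symF F) h i) \<in> borel_measurable borel"
  unfolding lform_symF by measurable

lemma lform_symF_shift:
  fixes F :: "real ^ ('n::finite set)"
  shows "lform (symF (F + z *\<^sub>R axis s 1)) h i = lform (symF F) h i + z * (\<Sum>l\<in>UNIV. if {l, i} = s then of_int (h l) else 0)"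
proof -
  have "of_int (h l) * (F + z *\<^sub>R axis s 1) $ {l, i} = of_int (h l) * F $ {l, i} + z * (if {l, i} = s then of_int (h l) else 0)" for l
    by (simp add: axis_def distrib_left)
  then show ?thesis unfolding lform_symF by (simp only: sum.distrib sum_distrib_left)
qed

lemma lform_symF_shift_own:
  "lform (symF (F + z *\<^sub>R axis {j, i} 1)) h i = lform (symF F) h i + z * of_int (h j)"
proof -
  have "{l, i} = {j, i} \<longleftrightarrow> l = j" for l by (auto simp: doubleton_eq_iff)
  then show ?thesis by (simp add: lform_symF_shift)
qed

lemma lform_symF_shift_other:
  assumes "i \<noteq> k" "i \<noteq> j" shows "lform (symF (F + z *\<^sub>R axis {j, k} 1)) h i = lform (symF F) h i"
proof -
  have "{l, i} \<noteq> {j, k}" for l using assms by (auto simp: doubleton_eq_iff)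
  then show ?thesis by (simp add: lform_symF_shift)
qed

text \<open>With h j \<noteq> 0 the entry {j, k} changes the k-th form at the nonzero rate h j, so
  the k-th factor averages out. This entry also changes the j-th form; therefore the factor at j is
  removed first, through the diagonal entry, which affects no other form.\<close>

lemma average_wrapped:
  fixes h :: "'n::finite \<Rightarrow> int" and B :: "'n \<Rightarrow> real"
  assumes hj: "h j \<noteq> 0" and B: "\<And>i. B i \<ge> 0"
  shows "(\<integral>\<^sup>+F. indicator unit_cube F * (\<Prod>i\<in>UNIV. wrapped (B i) (lform (symF F) h i)) \<partial>lborel) = (\<Prod>i\<in>UNIV. ennreal (2 * B i))"
proof -
  have step: "(\<integral>\<^sup>+F. indicator unit_cube F * (\<Prod>i\<in>insert k A. wrapped (B i) (lform (symF F) h i)) \<partial>lborel)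
    = ennreal (2 * B k) * (\<integral>\<^sup>+F. indicator unit_cube F * (\<Prod>i\<in>A. wrapped (B i) (lform (symF F) h i)) \<partial>lborel)"
    if k: "k \<notin> A" "j \<notin> A" for k A
  proof -
    have "(\<Prod>i\<in>A. wrapped (B i) (lform (symF (F + z *\<^sub>R axis {j, k} 1)) h i)) = (\<Prod>i\<in>A. wrapped (B i) (lform (symF F) h i))" for F z
    proof (rule prod.cong[OF refl])
      fix i assume "i \<in> A"
      then have "i \<noteq> k" "i \<noteq> j" using k by auto
      then show "wrapped (B i) (lform (symF (F + z *\<^sub>R axis {j, k} 1)) h i) = wrapped (B i) (lform (symF F) h i)"
        unfolding lform_symF_shift_other[OF \<open>i \<noteq> k\<close> \<open>i \<noteq> j\<close>] by simp
    qed
    moreover have "lform (symF (F + z *\<^sub>R axis {j, k} 1)) h k = lform (symF F) h k - z * of_int (- h j)" for F z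
      by (simp add: lform_symF_shift_own)
    ultimately have "(\<integral>\<^sup>+F. indicator unit_cube F * ((\<Prod>i\<in>A. wrapped (B i) (lform (symF F) h i)) * wrapped (B k) (lform (symF F) h k)) \<partial>lborel)
      = ennreal (2 * B k) * (\<integral>\<^sup>+F. indicator unit_cube F * (\<Prod>i\<in>A. wrapped (B i) (lform (symF F) h i)) \<partial>lborel)"
      unfolding wrapped_def[of "B k"]
      by (intro average_shift_axis[where a = "{j, k}" and k = "- h j" and h = "\<lambda>F. \<Prod>i\<in>A. wrapped (B i) (lform (symF F) h i)" and C = "\<lambda>F. lform (symF F) h k"])
        (use hj B in \<open>simp_all del: scaleR_one\<close>)
    then show ?thesis using k by (simp add: mult.commute)
  qed
  have noj: "(\<integral>\<^sup>+F. indicator unit_cube F * (\<Prod>i\<in>A. wrapped (B i) (lform (symF F) h i)) \<partial>lborel) = (\<Prod>i\<in>A. ennreal (2 * B i))"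
    if "finite A" "j \<notin> A" for A
    using that
  proof (induction A)
    case empty
    then show ?case by (simp add: emeasure_unit_cube)
  next
    case (insert k A)
    then show ?case using step[of k A] by simp
  qed
  have "(\<integral>\<^sup>+F. indicator unit_cube F * (\<Prod>i\<in>insert j (UNIV - {j}). wrapped (B i) (lform (symF F) h i)) \<partial>lborel) = ennreal (2 * B j) * (\<Prod>i\<in>UNIV - {j}. ennreal (2 * B i))"
    by (subst step) (auto simp: noj)
  moreover have "insert j (UNIV - {j}) = UNIV" by auto
  ultimately show ?thesis by (simp only: prod.remove[OF finite UNIV_I, of _ j])
qed

section \<open>First moment and tails of the lattice point count\<close>

definition hbox :: "('n::finite \<Rightarrow> nat) \<Rightarrow> ('n \<Rightarrow> int) set" where
  "hbox a = PiE UNIV (\<lambda>i. {- (8 * 2 ^ a i)..8 * 2 ^ a i})"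

definition ncount :: "('n::finite \<Rightarrow> nat) \<Rightarrow> real ^ ('n set) \<Rightarrow> ennreal" where
  "ncount a F = (\<Sum>h\<in>hbox a. \<Prod>i\<in>UNIV. wrapped (1 / 2 ^ a i) (lform (symF F) h i))"

lemma finite_hbox: "finite (hbox a)"
  by (simp add: hbox_def finite_PiE)

lemma card_boxset_le_ncount:
  fixes a :: "'n::finite \<Rightarrow> nat"
  shows "of_nat (card (boxset (\<lambda>i. 2 ^ a i) (symF F))) \<le> ncount a F"
proof -
  define K where "K h i = {\<nu>::int. - (1 / 2 ^ a i) \<le> lform (symF F) h i + of_int \<nu> \<and> lform (symF F) h i + of_int \<nu> \<le> 1 / 2 ^ a i}" for h i
  have finK: "finite (K h i)" for h i unfolding K_def by (rule finite_wrapped)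
  define \<phi> :: "('n \<Rightarrow> int) \<times> ('n \<Rightarrow> int) \<Rightarrow> complex ^ 'n" where "\<phi> = (\<lambda>(h, k). \<chi> i. Complex (of_int (h i)) (of_int (k i)))"
  have "boxset (\<lambda>i. 2 ^ a i) (symF F) \<subseteq> \<phi> ` (SIGMA h:hbox a. PiE UNIV (K h))"
  proof
    fix p assume p: "p \<in> boxset (\<lambda>i. 2 ^ a i) (symF F)"
    define h where "h i = \<lfloor>Re (p $ i)\<rfloor>" for i
    define k where "k i = \<lfloor>Im (p $ i)\<rfloor>" for i
    have hk: "Re (p $ i) = of_int (h i)" "Im (p $ i) = of_int (k i)" for i
      using p by (auto simp: boxset_def glat_def gints_def h_def k_def)
    have "h i \<in> {- (8 * 2 ^ a i)..8 * 2 ^ a i}" for i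
    proof -
      have "\<bar>of_int (h i) / 2 ^ a i\<bar> \<le> (8::real)" using p by (simp add: boxset_def rho_def hk)
      then have "\<bar>real_of_int (h i)\<bar> \<le> 8 * 2 ^ a i" by (simp add: abs_divide divide_le_eq)
      then have "real_of_int \<bar>h i\<bar> \<le> real_of_int (8 * 2 ^ a i)" by simp
      then have "\<bar>h i\<bar> \<le> 8 * 2 ^ a i" by (simp only: of_int_le_iff)
      then show ?thesis by auto
    qed
    moreover have "k i \<in> K h i" for i
    proof -
      have "\<bar>2 ^ a i * (lform (symF F) h i + of_int (k i))\<bar> \<le> 1" using p by (simp add: boxset_def rho_def hk lform_def)
      then have "2 ^ a i * \<bar>lform (symF F) h i + of_int (k i)\<bar> \<le> 1" by (simp add: abs_mult)
      then have "\<bar>lform (symF F) h i + of_int (k i)\<bar> \<le> 1 / 2 ^ a i" by (simp add: le_divide_eq mult.commute)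
      then show ?thesis unfolding K_def by (auto simp: abs_le_iff)
    qed
    moreover have "p = \<phi> (h, k)" by (simp add: \<phi>_def vec_eq_iff complex_eq_iff hk)
    ultimately show "p \<in> \<phi> ` (SIGMA h:hbox a. PiE UNIV (K h))" by (auto simp: hbox_def)
  qed
  then have "card (boxset (\<lambda>i. 2 ^ a i) (symF F)) \<le> card (SIGMA h:hbox a. PiE UNIV (K h))"
    by (rule surj_card_le[rotated]) (simp add: finite_hbox finite_PiE finK)
  also have "\<dots> = (\<Sum>h\<in>hbox a. \<Prod>i\<in>UNIV. card (K h i))"
    by (simp add: finite_hbox finite_PiE finK card_PiE)
  finally have "(of_nat (card (boxset (\<lambda>i. 2 ^ a i) (symF F))) :: ennreal) \<le> of_nat (\<Sum>h\<in>hbox a. \<Prod>i\<in>UNIV. card (K h i))"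
    by (rule of_nat_mono)
  then show ?thesis by (simp add: ncount_def wrapped_card K_def)
qed

lemma measurable_ncount [measurable]: "ncount a \<in> borel_measurable borel"
  unfolding ncount_def by measurable

lemma prod_mono_ennreal: "(\<And>i. i \<in> A \<Longrightarrow> f i \<le> g i) \<Longrightarrow> prod f A \<le> (prod g A :: ennreal)"
  by (induction A rule: infinite_finite_induct) (auto intro!: mult_mono)

text \<open>For h \<noteq> 0 the mean is the product of the 2 / 2^(a i), and the number of such h is
  at most the product of the 17 * 2^(a i): together 34^n. For h = 0 each coordinate counts the
  integers of modulus at most 1 / 2^(a i), at most three.\<close>

lemma ncount_average:
  "(\<integral>\<^sup>+F. indicator unit_cube F * ncount a F \<partial>lborel) \<le> ennreal (34 ^ CARD('n) + 3 ^ CARD('n))"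
  for a :: "'n::finite \<Rightarrow> nat"
proof -
  let ?I = "\<lambda>h. (\<integral>\<^sup>+F. indicator unit_cube F * (\<Prod>i\<in>UNIV. wrapped (1 / 2 ^ a i) (lform (symF F) h i)) \<partial>lborel)"
  have z: "(\<lambda>_. 0) \<in> hbox a" by (auto simp: hbox_def)
  have I: "?I h = ennreal (\<Prod>i\<in>UNIV. 2 / 2 ^ a i)" if "h \<noteq> (\<lambda>_. 0)" for h
  proof -
    obtain j where "h j \<noteq> 0" using \<open>h \<noteq> _\<close> by auto
    then show ?thesis using average_wrapped[of h j "\<lambda>i. 1 / 2 ^ a i"] by (simp add: prod_ennreal)
  qed
  have I0: "?I (\<lambda>_. 0) \<le> ennreal (3 ^ CARD('n))"
  proof -
    have w: "wrapped (1 / 2 ^ a i) (lform (symF F) (\<lambda>_. 0) i) \<le> 3" for F i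
    proof -
      have "{\<nu>::int. - (1 / 2 ^ a i) \<le> 0 + real_of_int \<nu> \<and> 0 + real_of_int \<nu> \<le> 1 / 2 ^ a i} \<subseteq> {-1..1}"
      proof
        fix \<nu> :: int assume "\<nu> \<in> {\<nu>. - (1 / 2 ^ a i) \<le> 0 + real_of_int \<nu> \<and> 0 + real_of_int \<nu> \<le> 1 / 2 ^ a i}"
        then have "- (1 / 2 ^ a i) \<le> real_of_int \<nu>" "real_of_int \<nu> \<le> 1 / 2 ^ a i" by simp_all
        moreover have "1 / 2 ^ a i \<le> (1::real)" by simp
        ultimately have "-1 \<le> real_of_int \<nu>" "real_of_int \<nu> \<le> 1" by linarith+
        then show "\<nu> \<in> {-1..1}" by simp
      qed
      from card_mono[OF _ this] have "card {\<nu>::int. - (1 / 2 ^ a i) \<le> 0 + real_of_int \<nu> \<and> 0 + real_of_int \<nu> \<le> 1 / 2 ^ a i} \<le> 3" by simp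
      then have "of_nat (card {\<nu>::int. - (1 / 2 ^ a i) \<le> 0 + real_of_int \<nu> \<and> 0 + real_of_int \<nu> \<le> 1 / 2 ^ a i}) \<le> (of_nat 3 :: ennreal)"
        by (rule of_nat_mono)
      moreover have "lform (symF F) (\<lambda>_. 0) i = 0" by (simp add: lform_def)
      ultimately show ?thesis unfolding wrapped_card by simp
    qed
    have "?I (\<lambda>_. 0) \<le> (\<integral>\<^sup>+F. indicator unit_cube (F :: real ^ ('n set)) * 3 ^ CARD('n) \<partial>lborel)"
    proof (intro nn_integral_mono mult_left_mono)
      fix F :: "real ^ ('n set)"
      have "(\<Prod>i\<in>UNIV. wrapped (1 / 2 ^ a i) (lform (symF F) (\<lambda>_. 0) i)) \<le> (\<Prod>i\<in>(UNIV :: 'n set). 3)"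
        by (rule prod_mono_ennreal) (rule w)
      then show "(\<Prod>i\<in>UNIV. wrapped (1 / 2 ^ a i) (lform (symF F) (\<lambda>_. 0) i)) \<le> 3 ^ CARD('n)" by simp
    qed simp
    also have "\<dots> = 3 ^ CARD('n)" by (subst nn_integral_multc) (simp_all add: emeasure_unit_cube)
    finally show ?thesis by (simp add: ennreal_power[symmetric])
  qed
  have "(\<integral>\<^sup>+F. indicator unit_cube F * ncount a F \<partial>lborel) = (\<Sum>h\<in>hbox a. ?I h)"
    unfolding ncount_def sum_distrib_left by (rule nn_integral_sum) measurable
  also have "\<dots> = ?I (\<lambda>_. 0) + (\<Sum>h\<in>hbox a - {\<lambda>_. 0}. ?I h)"
    by (rule sum.remove[OF finite_hbox z])
  also have "(\<Sum>h\<in>hbox a - {\<lambda>_. 0}. ?I h) = (\<Sum>h\<in>hbox a - {\<lambda>_. 0}. ennreal (\<Prod>i\<in>UNIV. 2 / 2 ^ a i))"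
    by (rule sum.cong[OF refl I]) simp
  also have "\<dots> = ennreal (real (card (hbox a - {\<lambda>_. 0})) * (\<Prod>i\<in>UNIV. 2 / 2 ^ a i))"
    by (simp add: ennreal_mult prod_nonneg ennreal_of_nat_eq_real_of_nat)
  also have "\<dots> \<le> ennreal (34 ^ CARD('n))"
  proof (rule ennreal_leI)
    have "real (card (hbox a - {\<lambda>_. 0})) \<le> real (card (hbox a))" using card_mono[OF finite_hbox, of "hbox a - {\<lambda>_. 0}" a] by auto
    also have "\<dots> = (\<Prod>i\<in>UNIV. 16 * 2 ^ a i + 1)"
    proof -
      have "card {- (8 * 2 ^ a i)..8 * 2 ^ a i :: int} = 16 * 2 ^ a i + 1" for i
      proof -
        have "8 * 2 ^ a i + 1 - (- (8 * 2 ^ a i)) = int (16 * 2 ^ a i + 1)" by simp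
        then show ?thesis by (simp only: card_atLeastAtMost_int nat_int)
      qed
      then have "card (hbox a) = (\<Prod>i\<in>UNIV. 16 * 2 ^ a i + 1)" unfolding hbox_def by (subst card_PiE) auto
      then show ?thesis by (simp add: add.commute)
    qed
    also have "\<dots> \<le> (\<Prod>i\<in>UNIV. 17 * 2 ^ a i)" by (rule prod_mono) auto
    finally have "real (card (hbox a - {\<lambda>_. 0})) * (\<Prod>i\<in>UNIV. 2 / 2 ^ a i) \<le> (\<Prod>i\<in>UNIV. 17 * 2 ^ a i) * (\<Prod>i\<in>UNIV. 2 / 2 ^ a i)"
      by (rule mult_right_mono) (simp add: prod_nonneg)
    also have "\<dots> = 34 ^ CARD('n)" by (simp add: prod.distrib[symmetric])
    finally show "real (card (hbox a - {\<lambda>_. 0})) * (\<Prod>i\<in>UNIV. 2 / 2 ^ a i) \<le> 34 ^ CARD('n)" .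
  qed
  finally show ?thesis using I0 by (simp add: add.commute add_mono order_trans)
qed

text \<open>Markov's inequality. The tail is expressed by a measurable majorant W of the event, the
  form shared with \<open>near_bound\<close>, where W counts lattices.\<close>

lemma far_bound:
  fixes a :: "'n::finite \<Rightarrow> nat"
  assumes x: "x > 0"
  shows "\<exists>W. W \<in> borel_measurable borel \<and> (\<forall>F. x \<le> real (card (boxset (\<lambda>i. 2 ^ a i) (symF F))) \<longrightarrow> 1 \<le> W F)
    \<and> (\<integral>\<^sup>+F. indicator unit_cube F * W F \<partial>lborel) \<le> ennreal ((34 ^ CARD('n) + 3 ^ CARD('n)) / x)"
proof (intro exI conjI allI impI)
  let ?W = "\<lambda>F. ennreal (1 / x) * ncount a F"
  show "?W \<in> borel_measurable borel" by measurable
  fix F :: "real ^ ('n set)" assume "x \<le> real (card (boxset (\<lambda>i. 2 ^ a i) (symF F)))"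
  then have "ennreal x \<le> of_nat (card (boxset (\<lambda>i. 2 ^ a i) (symF F)))" by (simp add: ennreal_of_nat_eq_real_of_nat ennreal_leI)
  also have "\<dots> \<le> ncount a F" by (rule card_boxset_le_ncount)
  finally have "ennreal (1 / x) * ennreal x \<le> ?W F" by (rule mult_left_mono) simp
  then show "1 \<le> ?W F" using x by (simp add: ennreal_mult[symmetric])
next
  have "(\<integral>\<^sup>+F. indicator unit_cube F * (ennreal (1 / x) * ncount a F) \<partial>lborel) = ennreal (1 / x) * (\<integral>\<^sup>+F. indicator unit_cube F * ncount a F \<partial>lborel)"
    by (subst nn_integral_cmult[symmetric]) (simp_all add: mult_ac)
  also have "\<dots> \<le> ennreal (1 / x) * ennreal (34 ^ CARD('n) + 3 ^ CARD('n))" by (intro mult_left_mono ncount_average) simp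
  also have "\<dots> = ennreal (1 / x * (34 ^ CARD('n) + 3 ^ CARD('n)))" using x by (intro ennreal_mult[symmetric]) auto
  also have "1 / x * (34 ^ CARD('n) + 3 ^ CARD('n)) = (34 ^ CARD('n) + 3 ^ CARD('n)) / x" by simp
  finally show "(\<integral>\<^sup>+F. indicator unit_cube F * (ennreal (1 / x) * ncount a F) \<partial>lborel) \<le> ennreal ((34 ^ CARD('n) + 3 ^ CARD('n)) / x)" .
qed

text \<open>A count of at least x forces, by \<open>count_lagrangian\<close>, a Lagrangian
  sublattice of covolume at most C1 / x. The number of these is the majorant, and its mean is
  bounded by \<open>EL_bound\<close> with I the full set of coordinates.\<close>

lemma near_bound:
  "\<exists>C>0. \<forall>(a :: 'n::finite \<Rightarrow> nat) x. (\<forall>i j. CARD('n) * a i \<le> (CARD('n) + 1) * a j) \<longrightarrow> x > 0 \<longrightarrow>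
    (\<exists>W. W \<in> borel_measurable borel \<and> (\<forall>F. x \<le> real (card (boxset (\<lambda>i. 2 ^ a i) (symF F))) \<longrightarrow> 1 \<le> W F)
    \<and> (\<integral>\<^sup>+F. indicator unit_cube F * W F \<partial>lborel) \<le> ennreal (C / x ^ (CARD('n) + 1)))"
proof -
  let ?n = "CARD('n)"
  have R: "9 * real ?n > 0" by simp
  obtain C1 where C1: "C1 > 0" and L: "\<And>(M :: 'n \<Rightarrow> real) X. transpose X = X \<Longrightarrow> (\<forall>i. M i > 0) \<Longrightarrow>
     \<exists>L. lag L \<and> lvol M X L * card {p \<in> glat. norm (rho M X p) \<le> 9 * real ?n} \<le> C1"
    using count_lagrangian[OF R, where ?'n = 'n] by blast
  obtain C2 where C2: "C2 \<ge> 0" and E: "\<And>(M :: 'n \<Rightarrow> real) I x. (\<forall>i. 1 \<le> M i) \<Longrightarrow> (\<forall>i j. M i ^ ?n \<le> M j ^ (?n + 1)) \<Longrightarrow>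
     card I = ?n \<Longrightarrow> (\<forall>a\<in>-I. \<forall>j\<in>I. M a \<le> M j) \<Longrightarrow> 0 < x \<Longrightarrow> EL M I x \<le> ennreal (C2 * x ^ (?n + 1))"
    using EL_bound[of ?n, where ?'n = 'n] by blast
  define C where "C = C2 * C1 ^ (?n + 1) + 1"
  have C0: "C > 0" using C1 C2 by (simp add: C_def add_nonneg_pos)
  have "\<exists>W. W \<in> borel_measurable borel \<and> (\<forall>F. x \<le> real (card (boxset (\<lambda>i. 2 ^ a i) (symF F))) \<longrightarrow> 1 \<le> W F)
    \<and> (\<integral>\<^sup>+F. indicator unit_cube F * W F \<partial>lborel) \<le> ennreal (C / x ^ (?n + 1))"
    if near: "\<forall>i j. ?n * a i \<le> (?n + 1) * a j" and x: "x > 0" for a :: "'n \<Rightarrow> nat" and x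
  proof -
    define M where "M i = (2::real) ^ a i" for i
    have M1: "\<forall>i. 1 \<le> M i" and M0: "M i > 0" for i by (simp_all add: M_def)
    have nearM: "\<forall>i j. M i ^ ?n \<le> M j ^ (?n + 1)"
    proof (intro allI)
      fix i j
      have "(2::real) ^ (a i * ?n) \<le> 2 ^ (a j * (?n + 1))" using near by (intro power_increasing) (auto simp: mult.commute)
      then show "M i ^ ?n \<le> M j ^ (?n + 1)" unfolding M_def by (simp only: power_mult)
    qed
    define W where "W F = (\<integral>\<^sup>+L. indicator {F. lvol M (symF F) L \<le> C1 / x} F \<partial>count_space (LL UNIV) :: ennreal)" for F
    have Wm: "W \<in> borel_measurable borel" unfolding W_def by (rule borel_measurable_count_sum[OF countable_LL]) measurable
    have "1 \<le> W F" if big: "x \<le> real (card (boxset (\<lambda>i. 2 ^ a i) (symF F)))" for F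
    proof -
      obtain L0 where L0: "lag L0" "lvol M (symF F) L0 * card {p \<in> glat. norm (rho M (symF F) p) \<le> 9 * real ?n} \<le> C1"
        using L[OF transpose_symF, of M F] M0 by blast
      have "card (boxset M (symF F)) \<le> card {p \<in> glat. norm (rho M (symF F) p) \<le> 9 * real ?n}"
        using boxset_ball[of M "symF F"] by (intro card_mono finite_rho_ball[where M=M, OF M0]) simp
      then have "x \<le> real (card {p \<in> glat. norm (rho M (symF F) p) \<le> 9 * real ?n})" using big by (simp add: M_def[abs_def])
      then have "lvol M (symF F) L0 * x \<le> C1"
        using L0(2) lvol_pos[where M=M, OF transpose_symF M0 L0(1), of F] by (smt (verit) mult_left_mono)
      then have small: "lvol M (symF F) L0 \<le> C1 / x" using x by (simp add: le_divide_eq)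
      have LL0: "L0 \<in> LL UNIV" using L0 by (simp add: LL_def)
      have "1 = (\<integral>\<^sup>+L. indicator {L0} L \<partial>count_space (LL UNIV) :: ennreal)" using LL0 by simp
      also have "\<dots> \<le> W F" unfolding W_def by (rule nn_integral_mono) (use small in \<open>auto simp: indicator_def\<close>)
      finally show ?thesis .
    qed
    moreover have "(\<integral>\<^sup>+F. indicator unit_cube F * W F \<partial>lborel) \<le> ennreal (C / x ^ (?n + 1))"
    proof -
      have nv: "nvol M X UNIV L = lvol M X L" for X L by (simp add: nvol_def)
      have "(\<integral>\<^sup>+F. indicator unit_cube F * W F \<partial>lborel) = (\<integral>\<^sup>+F. (\<integral>\<^sup>+L. indicator unit_cube F * indicator {F. lvol M (symF F) L \<le> C1 / x} F \<partial>count_space (LL UNIV)) \<partial>lborel)"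
        unfolding W_def by (simp add: nn_integral_cmult)
      also have "\<dots> = EL M UNIV (C1 / x)"
        unfolding EL_def nv by (rule nn_integral_count_space_nn_integral[OF countable_LL]) measurable
      also have "\<dots> \<le> ennreal (C2 * (C1 / x) ^ (?n + 1))" by (rule E[OF M1 nearM]) (use x C1 in auto)
      also have "\<dots> \<le> ennreal (C / x ^ (?n + 1))"
        unfolding C_def power_divide times_divide_eq_right using x by (intro ennreal_leI divide_right_mono) auto
      finally show ?thesis .
    qed
    ultimately show ?thesis using Wm by blast
  qed
  then show ?thesis using C0 by blast
qed

section \<open>Almost every symmetric matrix\<close>

definition cnt :: "('n::finite \<Rightarrow> nat) \<Rightarrow> real ^ 'n ^ 'n \<Rightarrow> nat" where
  "cnt a X = card (boxset (\<lambda>i. 2 ^ a i) X)"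

text \<open>Integral shifts of X permute the lattice points, so the count is periodic; this carries
  almost sure statements from the unit cube to all symmetric matrices.\<close>

lemma cnt_shift:
  assumes T: "\<And>i j. T $ i $ j \<in> \<int>" shows "cnt a (X + T) = cnt a X"
proof -
  let ?M = "\<lambda>i. 2 ^ a i :: real"
  have T': "(- T) $ i $ j \<in> \<int>" for i j using T by simp
  have "bij_betw (tshift T) (boxset ?M (X + T)) (boxset ?M X)"
    by (rule bij_betwI[of _ _ _ "tshift (- T)"])
       (auto simp: boxset_def rho_tshift tshift_inv tshift_glat[OF T] tshift_glat[OF T'])
  then show ?thesis unfolding cnt_def by (rule bij_betw_same_card)
qed

lemma measurable_cnt [measurable]: "(\<lambda>X. real (cnt a X)) \<in> borel_measurable borel"
proof -
  let ?M = "\<lambda>i. 2 ^ a i :: real"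
  define f where "f X = (\<integral>\<^sup>+p. indicator {X. \<forall>i. \<bar>Re (rho ?M X p $ i)\<bar> \<le> 8 \<and> \<bar>Im (rho ?M X p $ i)\<bar> \<le> 1} X \<partial>count_space glat :: ennreal)" for X
  have comp: "(\<lambda>X :: real ^ 'a ^ 'a. X $ i $ j) \<in> borel_measurable borel" for i j
    by (intro borel_measurable_continuous_onI continuous_intros)
  have "f \<in> borel_measurable borel"
    unfolding f_def
  proof (rule borel_measurable_count_sum[OF countable_glat])
    fix p :: "complex ^ 'a"
    note comp [measurable]
    show "(\<lambda>X. indicator {X. \<forall>i. \<bar>Re (rho ?M X p $ i)\<bar> \<le> 8 \<and> \<bar>Im (rho ?M X p $ i)\<bar> \<le> 1} X :: ennreal) \<in> borel_measurable borel"
      unfolding rho_def by (simp only: vec_lambda_beta complex.sel) measurable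
  qed
  moreover have "f X = ennreal (real (cnt a X))" for X
  proof -
    have "f X = (\<integral>\<^sup>+p. indicator (boxset ?M X) p \<partial>count_space glat)"
      unfolding f_def by (rule nn_integral_cong) (auto simp: boxset_def indicator_def)
    also have "\<dots> = emeasure (count_space glat) (boxset ?M X)" by (rule nn_integral_indicator) (auto simp: boxset_def)
    also have "\<dots> = of_nat (card (boxset ?M X))"
      by (rule emeasure_count_space_finite) (auto simp: boxset_def finite_boxset[unfolded boxset_def])
    finally show ?thesis by (simp add: cnt_def ennreal_of_nat_eq_real_of_nat)
  qed
  ultimately have "(\<lambda>X. enn2real (ennreal (real (cnt a X)))) \<in> borel_measurable borel" by (metis (no_types, lifting) ext borel_measurable_enn2real)
  then show ?thesis by simp
qed

lemma unit_cube_AE_extend: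
  fixes P :: "real ^ 'm::finite \<Rightarrow> bool"
  assumes ae: "AE F in lborel. F \<in> unit_cube \<longrightarrow> P F" and per: "\<And>F \<alpha>. \<alpha> \<in> integer_lattice \<Longrightarrow> P (F + \<alpha>) = P F"
  shows "AE F in lborel. P F"
proof -
  obtain N where N: "N \<in> null_sets lborel" "{F. \<not> (F \<in> unit_cube \<longrightarrow> P F)} \<subseteq> N"
    using ae unfolding eventually_ae_filter by auto
  have "(\<Union>\<alpha>\<in>integer_lattice. {F. F - \<alpha> \<in> N}) \<in> null_sets lborel"
    by (rule null_sets_UN'[OF countable_integer_lattice]) (rule null_sets_translation[OF N(1)])
  moreover have "{F. \<not> P F} \<subseteq> (\<Union>\<alpha>\<in>integer_lattice. {F. F - \<alpha> \<in> N})"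
  proof
    fix F assume F: "F \<in> {F. \<not> P F}"
    obtain \<alpha> where a: "\<alpha> \<in> integer_lattice" "F - \<alpha> \<in> unit_cube" using tile_unit_cube[of F] by blast
    have "\<not> P (F - \<alpha>)" using per[OF a(1), of "F - \<alpha>"] F by simp
    then show "F \<in> (\<Union>\<alpha>\<in>integer_lattice. {F. F - \<alpha> \<in> N})" using N(2) a by blast
  qed
  ultimately show ?thesis unfolding eventually_ae_filter by auto
qed

lemma sum_power_rev_le:
  assumes "0 \<le> q" "q < (1::real)" shows "(\<Sum>j\<le>t. q ^ (t - j)) \<le> 1 / (1 - q)"
proof -
  have "(\<Sum>j\<le>t. q ^ (t - j)) = (\<Sum>j\<le>t. q ^ j)"
    by (rule sum.reindex_bij_witness[of _ "\<lambda>j. t - j" "\<lambda>j. t - j"]) auto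
  also have "\<dots> \<le> (\<Sum>j. q ^ j)" by (rule sum_le_suminf) (use assms in auto)
  also have "\<dots> = 1 / (1 - q)" using assms by (intro suminf_geometric) auto
  finally show ?thesis .
qed

text \<open>With \<open>q ^ 4 = 1/2\<close> this measures how far the box with sides \<open>2 ^ a i\<close> is from the cube with side
  \<open>2 ^ t\<close>, and makes the sum over all boxes converge.\<close>

definition defect :: "real \<Rightarrow> nat \<Rightarrow> ('n::finite \<Rightarrow> nat) \<Rightarrow> real" where
  "defect q t a = (\<Prod>i\<in>UNIV. q ^ (t - a i))"

lemma sum_defect_le:
  assumes "0 \<le> q" "q < 1"
  shows "(\<Sum>a\<in>PiE (UNIV :: 'n::finite set) (\<lambda>_. {..t}). defect q t a) \<le> (1 / (1 - q)) ^ CARD('n)"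
proof -
  have "(\<Sum>a\<in>PiE (UNIV :: 'n set) (\<lambda>_. {..t}). defect q t a) = (\<Prod>i\<in>(UNIV :: 'n set). \<Sum>j\<le>t. q ^ (t - j))"
    unfolding defect_def by (subst prod_sum_PiE) auto
  also have "\<dots> \<le> (\<Prod>i\<in>(UNIV :: 'n set). 1 / (1 - q))"
    by (intro prod_mono conjI sum_power_rev_le assms sum_nonneg) (use assms in auto)
  finally show ?thesis by simp
qed

text \<open>Let Q be the defect. For comparable sides the tail at (P / Q)^2 is (Q / P)^(2 n + 2), of
  which one factor Q is kept for the sum over boxes. Otherwise (n + 1) a j < n t for some j, so Q
  \<le> q^(t - a j) \<le> z^t; the first moment gives Q^2 / P^2, and one of the two factors Q
  becomes summable in t.\<close>

lemma scale_bound: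
  assumes z: "0 < z" "z < (1::real)"
  shows "\<exists>K\<ge>0. \<forall>t (a :: 'n::finite \<Rightarrow> nat) P. (\<forall>i. a i \<le> t) \<longrightarrow> 1 \<le> P \<longrightarrow>
    (\<exists>W. W \<in> borel_measurable borel \<and> (\<forall>F. (P / defect (z ^ (CARD('n) + 1)) t a)\<^sup>2 \<le> real (cnt a (symF F)) \<longrightarrow> 1 \<le> W F)
    \<and> (\<integral>\<^sup>+F. indicator unit_cube F * W F \<partial>lborel) \<le> ennreal (K * defect (z ^ (CARD('n) + 1)) t a * (1 / P ^ (2 * CARD('n) + 2) + z ^ t)))"
proof -
  let ?n = "CARD('n)"
  define q where "q = z ^ (?n + 1)"
  have q: "0 < q" "q < 1" unfolding q_def using z by (auto intro: power_Suc_less_one simp del: power_Suc)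
  obtain C where C: "C > 0" and near: "\<And>(a :: 'n \<Rightarrow> nat) x. (\<forall>i j. ?n * a i \<le> (?n + 1) * a j) \<Longrightarrow> x > 0 \<Longrightarrow>
    (\<exists>W. W \<in> borel_measurable borel \<and> (\<forall>F. x \<le> real (card (boxset (\<lambda>i. 2 ^ a i) (symF F))) \<longrightarrow> 1 \<le> W F)
    \<and> (\<integral>\<^sup>+F. indicator unit_cube F * W F \<partial>lborel) \<le> ennreal (C / x ^ (?n + 1)))"
    using near_bound by blast
  define D where "D = (34 :: real) ^ ?n + 3 ^ ?n"
  define K where "K = C + D"
  have D: "D > 0" by (simp add: D_def add_pos_pos)
  have "\<exists>W. W \<in> borel_measurable borel \<and> (\<forall>F. (P / defect q t a)\<^sup>2 \<le> real (cnt a (symF F)) \<longrightarrow> 1 \<le> W F)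
    \<and> (\<integral>\<^sup>+F. indicator unit_cube F * W F \<partial>lborel) \<le> ennreal (K * defect q t a * (1 / P ^ (2 * ?n + 2) + z ^ t))"
    if at: "\<forall>i. a i \<le> t" and P: "1 \<le> P" for t and a :: "'n \<Rightarrow> nat" and P
  proof -
    define Q where "Q = defect q t a"
    have Q: "0 < Q" "Q \<le> 1" using q by (auto simp: Q_def defect_def intro!: prod_pos prod_le_1 power_le_one)
    define x where "x = (P / Q)\<^sup>2"
    have x: "x > 0" using P Q by (simp add: x_def)
    show ?thesis
    proof (cases "\<forall>i j. ?n * a i \<le> (?n + 1) * a j")
      case True
      have "C / x ^ (?n + 1) = C * (Q ^ (2 * ?n + 2) / P ^ (2 * ?n + 2))"
      proof -
        have "2 * (?n + 1) = 2 * ?n + 2" by simp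
        then have "x ^ (?n + 1) = (P / Q) ^ (2 * ?n + 2)" unfolding x_def by (metis power_mult)
        then show ?thesis by (simp only: power_divide) simp
      qed
      also have "\<dots> \<le> C * (Q / P ^ (2 * ?n + 2))"
        using C P Q power_decreasing[of 1 "2 * ?n + 2" Q] by (intro mult_left_mono divide_right_mono) auto
      also have "\<dots> \<le> K * Q * (1 / P ^ (2 * ?n + 2) + z ^ t)"
      proof -
        have "C * Q * (1 / P ^ (2 * ?n + 2)) \<le> K * Q * (1 / P ^ (2 * ?n + 2) + z ^ t)"
          using C D Q P z by (intro mult_mono) (auto simp: K_def)
        then show ?thesis by simp
      qed
      finally have le: "ennreal (C / x ^ (?n + 1)) \<le> ennreal (K * Q * (1 / P ^ (2 * ?n + 2) + z ^ t))" by (rule ennreal_leI)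
      from near[OF True x] show ?thesis unfolding cnt_def Q_def[symmetric] x_def[symmetric] using le by (meson order_trans)
    next
      case False
      then obtain i j where ij: "(?n + 1) * a j < ?n * a i" by (meson not_le)
      have "?n * a i \<le> ?n * t" using at by simp
      then have "(?n + 1) * a j < ?n * t" using ij by linarith
      moreover have "(?n + 1) * (t - a j) = (?n + 1) * t - (?n + 1) * a j" by (rule diff_mult_distrib2)
      ultimately have tt: "t \<le> (?n + 1) * (t - a j)" by simp
      have "Q = q ^ (t - a j) * (\<Prod>i\<in>UNIV - {j}. q ^ (t - a i))" unfolding Q_def defect_def by (rule prod.remove) auto
      also have "\<dots> \<le> q ^ (t - a j) * 1"
        using q by (intro mult_left_mono prod_le_1) (auto intro: power_le_one)
      also have "\<dots> = z ^ ((?n + 1) * (t - a j))" by (simp only: q_def power_mult mult_1_right)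
      also have "\<dots> \<le> z ^ t" using z tt by (intro power_decreasing) auto
      finally have Qz: "Q \<le> z ^ t" .
      have "D / x = D * Q * (Q / P\<^sup>2)" using Q by (simp add: x_def power_divide power2_eq_square)
      also have "\<dots> \<le> D * Q * (z ^ t / 1)" using D Q P Qz z by (intro mult_left_mono frac_le) (auto simp: one_le_power)
      also have "\<dots> \<le> K * Q * (1 / P ^ (2 * ?n + 2) + z ^ t)"
        using C D Q P z by (intro mult_mono) (auto simp: K_def)
      finally have le: "ennreal (D / x) \<le> ennreal (K * Q * (1 / P ^ (2 * ?n + 2) + z ^ t))" by (rule ennreal_leI)
      from far_bound[OF x, of a] show ?thesis unfolding cnt_def Q_def[symmetric] x_def[symmetric] D_def[symmetric] using le by (meson order_trans)
    qed
  qed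
  moreover have "K \<ge> 0" using C D by (simp add: K_def)
  ultimately show ?thesis unfolding q_def by blast
qed

text \<open>Boxes of all shapes at scale t are included. Finitely many exceptional scales are
  allowed, with t0 depending on X; they end up in the constant c.\<close>

definition good :: "real \<Rightarrow> (nat \<Rightarrow> real) \<Rightarrow> real ^ 'n::finite ^ 'n \<Rightarrow> bool" where
  "good q \<Psi> X \<longleftrightarrow> (\<exists>t0. \<forall>t\<ge>t0. \<forall>a\<in>PiE UNIV (\<lambda>_. {..t}). real (cnt a X) < (\<Psi> t / defect q t a)\<^sup>2)"

lemma good_AE:
  assumes z: "0 < z" "z < 1" and \<Psi>: "\<And>t. 1 \<le> \<Psi> t" and sm: "summable (\<lambda>t. 1 / \<Psi> t ^ (2 * CARD('n) + 2))"
  shows "AE F in lborel. good (z ^ (CARD('n) + 1)) \<Psi> (symF F :: real ^ 'n::finite ^ 'n)"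
proof (rule unit_cube_AE_extend)
  let ?n = "CARD('n)"
  define q where "q = z ^ (?n + 1)"
  have q: "0 < q" "q < 1" unfolding q_def using z by (auto intro: power_Suc_less_one simp del: power_Suc)
  obtain K where K: "K \<ge> 0" and KW: "\<And>t (a :: 'n \<Rightarrow> nat) P. (\<forall>i. a i \<le> t) \<Longrightarrow> 1 \<le> P \<Longrightarrow>
    (\<exists>W. W \<in> borel_measurable borel \<and> (\<forall>F. (P / defect q t a)\<^sup>2 \<le> real (cnt a (symF F)) \<longrightarrow> 1 \<le> W F)
    \<and> (\<integral>\<^sup>+F. indicator unit_cube F * W F \<partial>lborel) \<le> ennreal (K * defect q t a * (1 / P ^ (2 * ?n + 2) + z ^ t)))"
    using scale_bound[OF z, where ?'n = 'n] unfolding q_def by blast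
  let ?A = "\<lambda>t::nat. PiE (UNIV :: 'n set) (\<lambda>_. {..t})"
  have "\<forall>t. \<forall>a\<in>?A t. \<exists>W. W \<in> borel_measurable borel \<and> (\<forall>F. (\<Psi> t / defect q t a)\<^sup>2 \<le> real (cnt a (symF F)) \<longrightarrow> 1 \<le> W F)
    \<and> (\<integral>\<^sup>+F. indicator unit_cube F * W F \<partial>lborel) \<le> ennreal (K * defect q t a * (1 / \<Psi> t ^ (2 * ?n + 2) + z ^ t))"
    using KW \<Psi> by (auto simp: PiE_iff)
  then obtain W where "\<forall>t. \<forall>a\<in>?A t. W t a \<in> borel_measurable borel \<and> (\<forall>F. (\<Psi> t / defect q t a)\<^sup>2 \<le> real (cnt a (symF F)) \<longrightarrow> 1 \<le> W t a F)
    \<and> (\<integral>\<^sup>+F. indicator unit_cube F * W t a F \<partial>lborel) \<le> ennreal (K * defect q t a * (1 / \<Psi> t ^ (2 * ?n + 2) + z ^ t))"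
    unfolding bchoice_iff choice_iff by blast
  then have W: "a \<in> ?A t \<Longrightarrow> W t a \<in> borel_measurable borel"
    and W1: "a \<in> ?A t \<Longrightarrow> (\<Psi> t / defect q t a)\<^sup>2 \<le> real (cnt a (symF F)) \<Longrightarrow> 1 \<le> W t a F"
    and W2: "a \<in> ?A t \<Longrightarrow> (\<integral>\<^sup>+F. indicator unit_cube F * W t a F \<partial>lborel) \<le> ennreal (K * defect q t a * (1 / \<Psi> t ^ (2 * ?n + 2) + z ^ t))" for t a F
    by blast+
  have finA: "finite (?A t)" for t by (intro finite_PiE) auto
  define V where "V t F = (\<Sum>a\<in>?A t. W t a F)" for t F
  have Vm [measurable]: "V t \<in> borel_measurable borel" for t
    unfolding V_def by (rule borel_measurable_sum) (rule W)
  \<comment> \<open>One exceptional set per scale: the majorants of all boxes are added, and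
    \<open>sum_defect_le\<close> keeps the total independent of the number of boxes.\<close>
  define B where "B t = {F \<in> unit_cube. 1 \<le> V t F}" for t
  have Bm: "B t \<in> sets lborel" for t unfolding B_def by measurable
  define w where "w t = K * (1 / (1 - q)) ^ ?n * (1 / \<Psi> t ^ (2 * ?n + 2) + z ^ t)" for t
  have Bw: "emeasure lborel (B t) \<le> ennreal (w t)" for t
  proof -
    have p0: "1 / \<Psi> t ^ (2 * ?n + 2) + z ^ t \<ge> 0" using \<Psi>[of t] z by (intro add_nonneg_nonneg) auto
    have d0: "defect q t a \<ge> 0" for a :: "'n \<Rightarrow> nat" using q by (simp add: defect_def prod_nonneg)
    have "emeasure lborel (B t) = (\<integral>\<^sup>+F. indicator (B t) F \<partial>lborel)" using Bm by simp
    also have "\<dots> \<le> (\<integral>\<^sup>+F. indicator unit_cube F * V t F \<partial>lborel)"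
      by (rule nn_integral_mono) (auto simp: B_def indicator_def)
    also have "\<dots> = (\<Sum>a\<in>?A t. \<integral>\<^sup>+F. indicator unit_cube F * W t a F \<partial>lborel)"
      unfolding V_def sum_distrib_left by (rule nn_integral_sum) (use W in measurable)
    also have "\<dots> \<le> (\<Sum>a\<in>?A t. ennreal (K * defect q t a * (1 / \<Psi> t ^ (2 * ?n + 2) + z ^ t)))" by (rule sum_mono) (rule W2)
    also have "\<dots> = ennreal (\<Sum>a\<in>?A t. K * defect q t a * (1 / \<Psi> t ^ (2 * ?n + 2) + z ^ t))"
      by (rule sum_ennreal) (use K d0 p0 in \<open>auto intro!: mult_nonneg_nonneg\<close>)
    also have "(\<Sum>a\<in>?A t. K * defect q t a * (1 / \<Psi> t ^ (2 * ?n + 2) + z ^ t)) = K * (\<Sum>a\<in>?A t. defect q t a) * (1 / \<Psi> t ^ (2 * ?n + 2) + z ^ t)"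
      by (simp only: sum_distrib_left sum_distrib_right)
    also have "ennreal \<dots> \<le> ennreal (w t)" unfolding w_def
      by (intro ennreal_leI mult_right_mono mult_left_mono sum_defect_le K p0) (use q in auto)
    finally show ?thesis .
  qed
  have w0: "w t \<ge> 0" for t unfolding w_def using K q \<Psi>[of t] z by (intro mult_nonneg_nonneg add_nonneg_nonneg) auto
  have "AE F in lborel. eventually (\<lambda>t. F \<in> space lborel - B t) sequentially"
  proof (rule borel_cantelli_AE1)
    show "emeasure lborel (B t) < \<infinity>" for t using Bw[of t] by (metis ennreal_less_top infinity_ennreal_def le_less_trans)
    show "summable (\<lambda>t. measure lborel (B t))"
    proof (rule summable_comparison_test')
      show "summable w" unfolding w_def using z sm by (intro summable_mult summable_add summable_geometric) auto
      show "norm (measure lborel (B t)) \<le> w t" if "t \<ge> 0" for t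
        using Bw[of t] w0[of t] by (simp add: measure_def enn2real_leI)
    qed
  qed (rule Bm)
  then show "AE F in lborel. F \<in> unit_cube \<longrightarrow> good (z ^ (?n + 1)) \<Psi> (symF F :: real ^ 'n ^ 'n)"
  proof (rule AE_mp, intro AE_I2 impI)
    fix F :: "real ^ ('n set)" assume ev: "eventually (\<lambda>t. F \<in> space lborel - B t) sequentially" and F: "F \<in> unit_cube"
    then obtain t0 where t0: "\<And>t. t \<ge> t0 \<Longrightarrow> F \<notin> B t" unfolding eventually_sequentially by auto
    have "real (cnt a (symF F)) < (\<Psi> t / defect q t a)\<^sup>2" if t: "t \<ge> t0" and a: "a \<in> ?A t" for t a
    proof (rule ccontr)
      assume "\<not> ?thesis"
      then have "1 \<le> W t a F" using W1[OF a] by simp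
      also have "\<dots> \<le> V t F" unfolding V_def by (rule member_le_sum[OF a]) (auto simp: finA)
      finally show False using t0[OF t] F by (simp add: B_def)
    qed
    then show "good (z ^ (?n + 1)) \<Psi> (symF F :: real ^ 'n ^ 'n)" unfolding good_def q_def by blast
  qed
next
  fix F \<alpha> :: "real ^ ('n set)" assume "\<alpha> \<in> integer_lattice"
  then have "symF \<alpha> $ i $ j \<in> \<int>" for i j :: 'n by (simp add: symF_def integer_lattice_def)
  then show "good (z ^ (CARD('n) + 1)) \<Psi> (symF (F + \<alpha>) :: real ^ 'n ^ 'n) = good (z ^ (CARD('n) + 1)) \<Psi> (symF F :: real ^ 'n ^ 'n)"
    by (simp add: good_def symF_add cnt_shift)
qed

lemma measurable_good: "{X :: real ^ 'n::finite ^ 'n. good q \<Psi> X} \<in> sets borel"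
proof -
  let ?S = "\<lambda>t0 t. if t0 \<le> t then (\<Inter>a\<in>PiE UNIV (\<lambda>_. {..t}). {X :: real ^ 'n ^ 'n. real (cnt a X) < (\<Psi> t / defect q t a)\<^sup>2}) else UNIV"
  have S: "?S t0 t \<in> sets borel" for t0 t
  proof -
    have "(\<lambda>_. t) \<in> PiE (UNIV :: 'n set) (\<lambda>_. {..t})" by (auto simp: PiE_iff)
    then have "PiE (UNIV :: 'n set) (\<lambda>_. {..t}) \<noteq> {}" by blast
    then have "(\<Inter>a\<in>PiE UNIV (\<lambda>_. {..t}). {X :: real ^ 'n ^ 'n. real (cnt a X) < (\<Psi> t / defect q t a)\<^sup>2}) \<in> sets borel"
      by (intro sets.finite_INT finite_PiE) (simp_all, measurable)
    then show ?thesis by simp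
  qed
  have "{X :: real ^ 'n ^ 'n. good q \<Psi> X} = (\<Union>t0. \<Inter>t. ?S t0 t)"
    by (auto simp: good_def)
  also have "\<dots> \<in> sets borel"
    by (intro sets.countable_UN sets.countable_INT image_subsetI) (use S in auto)
  finally show ?thesis .
qed

section \<open>Transfer to the space of symmetric matrices\<close>

lemma measurable_vec_lambda_PiM [measurable]:
  "(vec_lambda :: ('m::finite \<Rightarrow> real) \<Rightarrow> real ^ 'm) \<in> borel_measurable (Pi\<^sub>M UNIV (\<lambda>_. lborel))"
proof (subst borel_measurable_euclidean_space, intro ballI)
  fix b :: "real ^ 'm" assume "b \<in> Basis"
  then obtain i where "b = axis i 1" by (auto simp: Basis_vec_def)
  then have "(\<lambda>f. vec_lambda f \<bullet> b) = (\<lambda>f. f i)" by (simp add: inner_axis)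
  moreover have "(\<lambda>f. f i) \<in> borel_measurable (Pi\<^sub>M UNIV (\<lambda>_. lborel :: real measure))"
    using measurable_component_singleton[of i UNIV "\<lambda>_. lborel :: real measure"] by simp
  ultimately show "(\<lambda>f. vec_lambda f \<bullet> b) \<in> borel_measurable (Pi\<^sub>M UNIV (\<lambda>_. lborel))" by simp
qed

lemma lborel_vec_eq: "(lborel :: (real ^ 'm::finite) measure) = distr (Pi\<^sub>M UNIV (\<lambda>_. lborel)) borel vec_lambda"
proof (rule lborel_eqI)
  interpret product_sigma_finite "\<lambda>_::'m. lborel :: real measure" by standard
  fix l u :: "real ^ 'm" assume lu: "\<And>b. b \<in> Basis \<Longrightarrow> l \<bullet> b \<le> u \<bullet> b"
  have lu': "l $ i \<le> u $ i" for i using lu[of "axis i 1"] by (simp add: inner_axis)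
  have "emeasure (distr (Pi\<^sub>M UNIV (\<lambda>_. lborel)) borel vec_lambda) (box l u) = emeasure (Pi\<^sub>M UNIV (\<lambda>_. lborel)) (vec_lambda -` box l u \<inter> space (Pi\<^sub>M UNIV (\<lambda>_. lborel)))"
    by (rule emeasure_distr) simp_all
  also have "vec_lambda -` box l u \<inter> space (Pi\<^sub>M UNIV (\<lambda>_. lborel)) = PiE UNIV (\<lambda>i. {l $ i<..<u $ i})"
    by (auto simp: space_PiM mem_box_cart PiE_iff)
  also have "emeasure (Pi\<^sub>M UNIV (\<lambda>_. lborel)) \<dots> = (\<Prod>i\<in>UNIV. emeasure lborel {l $ i<..<u $ i})"
    by (rule emeasure_PiM) auto
  also have "\<dots> = ennreal (\<Prod>i\<in>UNIV. u $ i - l $ i)" using lu' by (simp add: prod_ennreal)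
  also have "(\<Prod>i\<in>UNIV. u $ i - l $ i) = (\<Prod>b\<in>Basis. (u - l) \<bullet> b)"
    by (simp add: Basis_vec_def cart_eq_inner_axis axis_eq_axis prod.UNION_disjoint inner_diff_left)
  finally show "emeasure (distr (Pi\<^sub>M UNIV (\<lambda>_. lborel)) borel vec_lambda) (box l u) = (\<Prod>b\<in>Basis. (u - l) \<bullet> b)" .
qed simp

text \<open>The product over all subsets splits into \<open>sym_index\<close> and its complement,
  and the event depends on the first part only. Fubini shows that its measure there times the
  measure of the whole complementary space is zero; the second factor is not zero, though it may be
  infinite.\<close>

lemma full_measure_symI:
  fixes P :: "real ^ 'n::finite ^ 'n \<Rightarrow> bool"
  assumes P: "{X. P X} \<in> sets borel" and ae: "AE F in lborel. P (symF F)"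
  shows "full_measure_sym {X \<in> sym_matrices. P X}"
proof -
  interpret product_sigma_finite "\<lambda>_::'n set. lborel :: real measure" by standard
  let ?I = "sym_index :: 'n set set" and ?J = "- sym_index :: 'n set set"
  let ?MI = "Pi\<^sub>M ?I (\<lambda>_. lborel :: real measure)" and ?MJ = "Pi\<^sub>M ?J (\<lambda>_. lborel :: real measure)"
    and ?MU = "Pi\<^sub>M (UNIV :: 'n set set) (\<lambda>_. lborel :: real measure)"
  have symm: "sym_of_entries \<in> borel_measurable ?MI"
    using sym_of_entries_measurable[where 'n='n] by (simp add: measurable_restrict_space2_iff)
  have Psym: "{f \<in> space ?MI. \<not> P (sym_of_entries f)} \<in> sets ?MI"
  proof -
    have "{f \<in> space ?MI. \<not> P (sym_of_entries f)} = sym_of_entries -` (- {X. P X}) \<inter> space ?MI" by auto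
    also have "\<dots> \<in> sets ?MI" using P by (intro measurable_sets[OF symm]) auto
    finally show ?thesis .
  qed
  have inI: "{i, j} \<in> ?I" for i j by (auto simp: sym_index_def)
  have fa: "(\<lambda>f. symF (vec_lambda f) :: real ^ 'n ^ 'n) = sym_of_entries" by (simp add: fun_eq_iff symF_def sym_of_entries_def)
  have symU: "(sym_of_entries :: ('n set \<Rightarrow> real) \<Rightarrow> real ^ 'n ^ 'n) \<in> borel_measurable ?MU"
  proof -
    have "(\<lambda>f. restrict f ?I) \<in> measurable ?MU ?MI" by (rule measurable_restrict_subset) simp
    from measurable_comp[OF this symm] show ?thesis
      by (simp add: o_def sym_of_entries_def[abs_def] inI)
  qed
  have "AE f in ?MU. P (sym_of_entries f)"
  proof -
    have "symF \<in> borel_measurable (borel :: (real ^ ('n set)) measure)"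
      unfolding symF_def by (intro borel_measurable_continuous_onI continuous_on_vec_lambda continuous_intros)
    then have "{F \<in> space borel. P (symF F)} \<in> sets borel"
      using measurable_sets[of symF borel borel "{X. P X}"] P by (simp add: vimage_def)
    then have "AE f in ?MU. P (symF (vec_lambda f))"
      using ae unfolding lborel_vec_eq by (subst (asm) AE_distr_iff) auto
    then show ?thesis using fun_cong[OF fa] by simp
  qed
  then have "emeasure ?MU {f \<in> space ?MU. \<not> P (sym_of_entries f)} = 0"
  proof (subst (asm) AE_iff_measurable[OF _ refl])
    have "{f \<in> space ?MU. \<not> P (sym_of_entries f)} = sym_of_entries -` (- {X. P X}) \<inter> space ?MU" by auto
    also have "\<dots> \<in> sets ?MU" using P by (intro measurable_sets[OF symU]) auto
    finally show "{f \<in> space ?MU. \<not> P (sym_of_entries f)} \<in> sets ?MU" .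
  qed
  moreover have "{f \<in> space ?MU. \<not> P (sym_of_entries f)} \<in> sets ?MU"
  proof -
    have "{f \<in> space ?MU. \<not> P (sym_of_entries f)} = sym_of_entries -` (- {X. P X}) \<inter> space ?MU" by auto
    also have "\<dots> \<in> sets ?MU" using P by (intro measurable_sets[OF symU]) auto
    finally show ?thesis .
  qed
  ultimately have "0 = (\<integral>\<^sup>+f. indicator {f \<in> space ?MU. \<not> P (sym_of_entries f)} f \<partial>?MU)" "(\<lambda>f. indicator {f \<in> space ?MU. \<not> P (sym_of_entries f)} f :: ennreal) \<in> borel_measurable ?MU"
    by simp_all
  note zero = this
  have IJ: "?I \<union> ?J = UNIV" "?I \<inter> ?J = {}" by auto
  have "0 = (\<integral>\<^sup>+x. (\<integral>\<^sup>+y. indicator {f \<in> space ?MU. \<not> P (sym_of_entries f)} (merge ?I ?J (x, y)) \<partial>?MJ) \<partial>?MI)"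
    using product_nn_integral_fold[of ?I ?J "indicator {f \<in> space ?MU. \<not> P (sym_of_entries f)}"] zero IJ by simp
  also have "\<dots> = (\<integral>\<^sup>+x. indicator {f \<in> space ?MI. \<not> P (sym_of_entries f)} x * emeasure ?MJ (space ?MJ) \<partial>?MI)"
  proof (rule nn_integral_cong)
    fix x assume x: "x \<in> space ?MI"
    have "sym_of_entries (merge ?I ?J (x, y)) = (sym_of_entries x :: real ^ 'n ^ 'n)" for y
      by (simp add: sym_of_entries_def merge_def inI)
    then have "(\<integral>\<^sup>+y. indicator {f \<in> space ?MU. \<not> P (sym_of_entries f)} (merge ?I ?J (x, y)) \<partial>?MJ)
      = (\<integral>\<^sup>+y. indicator {f \<in> space ?MI. \<not> P (sym_of_entries f)} x \<partial>?MJ)"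
      using x by (intro nn_integral_cong) (simp add: indicator_def space_PiM)
    then show "(\<integral>\<^sup>+y. indicator {f \<in> space ?MU. \<not> P (sym_of_entries f)} (merge ?I ?J (x, y)) \<partial>?MJ)
      = indicator {f \<in> space ?MI. \<not> P (sym_of_entries f)} x * emeasure ?MJ (space ?MJ)" by simp
  qed
  also have "\<dots> = emeasure ?MI {f \<in> space ?MI. \<not> P (sym_of_entries f)} * emeasure ?MJ (space ?MJ)"
    using Psym by (subst nn_integral_multc) auto
  finally have "emeasure ?MI {f \<in> space ?MI. \<not> P (sym_of_entries f)} = 0 \<or> emeasure ?MJ (space ?MJ) = 0" by simp
  moreover have "emeasure ?MJ (space ?MJ) \<noteq> 0"
  proof -
    have "emeasure ?MJ (space ?MJ) = (\<Prod>i\<in>?J. emeasure lborel (UNIV :: real set))"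
      using emeasure_PiM[of ?J "\<lambda>_. UNIV"] by (simp add: space_PiM)
    then show ?thesis by simp
  qed
  ultimately have nullI: "emeasure ?MI {f \<in> space ?MI. \<not> P (sym_of_entries f)} = 0" by blast
  have eq: "sym_matrices - {X \<in> sym_matrices. P X} = sym_matrices \<inter> (- {X. P X})" by auto
  have sets: "sym_matrices \<inter> (- {X. P X}) \<in> sets (restrict_space borel (sym_matrices :: (real ^ 'n ^ 'n) set))"
    unfolding sets_restrict_space using P by (intro image_eqI[of _ _ "- {X. P X}"]) auto
  have "sym_matrices \<inter> (- {X. P X}) \<in> null_sets lborel_sym"
  proof (rule null_setsI)
    show "sym_matrices \<inter> (- {X. P X}) \<in> sets lborel_sym" using sets by (simp add: lborel_sym_def)
    have "emeasure lborel_sym (sym_matrices \<inter> (- {X. P X})) = emeasure ?MI (sym_of_entries -` (sym_matrices \<inter> (- {X. P X})) \<inter> space ?MI)"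
      unfolding lborel_sym_def by (rule emeasure_distr[OF sym_of_entries_measurable sets])
    also have "sym_of_entries -` (sym_matrices \<inter> (- {X. P X})) \<inter> space ?MI = {f \<in> space ?MI. \<not> P (sym_of_entries f)}"
      using measurable_space[OF sym_of_entries_measurable[where 'n='n]] by (auto simp: space_restrict_space)
    finally show "emeasure lborel_sym (sym_matrices \<inter> (- {X. P X})) = 0" using nullI by simp
  qed
  then show ?thesis unfolding full_measure_sym_def eq lebesgue_sym_def by (auto intro: null_sets_completionI)
qed

text \<open>The step ln 2 exceeds 1/2, so the t-th sample is at most f at t div 2, and every k
  occurs twice as t div 2.\<close>

lemma summable_sampled:
  fixes f :: "real \<Rightarrow> real"
  assumes f0: "\<And>x. x \<ge> 0 \<Longrightarrow> f x \<ge> 0" and anti: "\<And>x y. 0 \<le> x \<Longrightarrow> x \<le> y \<Longrightarrow> f y \<le> f x"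
    and sm: "summable (\<lambda>k::nat. f (real k))"
  shows "summable (\<lambda>t::nat. f (real t * ln 2))"
proof (rule summable_comparison_test')
  show "summable (\<lambda>t::nat. f (real (t div 2)))"
  proof (rule summableI_nonneg_bounded)
    show "f (real (t div 2)) \<ge> 0" for t by (rule f0) simp
    fix N
    have "(\<Sum>t<N. f (real (t div 2))) \<le> (\<Sum>t<2 * N. f (real (t div 2)))" by (rule sum_mono2) (auto intro: f0)
    also have "\<dots> = 2 * (\<Sum>k<N. f (real k))" by (induction N) auto
    also have "\<dots> \<le> 2 * (\<Sum>k. f (real k))" by (intro mult_left_mono sum_le_suminf sm) (auto intro: f0)
    finally show "(\<Sum>t<N. f (real (t div 2))) \<le> 2 * (\<Sum>k. f (real k))" .
  qed
  fix t :: nat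
  have "2 * (t div 2) \<le> t" by simp
  then have "real (2 * (t div 2)) \<le> real t" by (simp only: of_nat_le_iff)
  then have "real (t div 2) \<le> real t * (1/2)" by simp
  also have "\<dots> \<le> real t * ln 2" using ln2_ge_two_thirds by (intro mult_left_mono) auto
  finally have "f (real t * ln 2) \<le> f (real (t div 2))" by (intro anti) auto
  then show "norm (f (real t * ln 2)) \<le> f (real (t div 2))" using f0[of "real t * ln 2"] by simp
qed

text \<open>As q^4 = 1/2, the volume factor is 2^(n t) Q^4; together with the count bound (\<Psi> t
  / Q)^2 the square root is 2^(n t / 2) \<Psi> t Q. The remaining Q is a product of geometric
  factors, so the sum over all boxes is a constant.\<close>

lemma good_theta_bound:
  fixes X :: "real ^ 'n::finite ^ 'n"
  assumes X: "transpose X = X" and good: "good q \<Psi> X" and q: "0 < q" "q < 1" "q ^ 4 = 1/2" and \<Psi>: "\<And>t. 1 \<le> \<Psi> t"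
  shows "\<exists>c\<ge>0. \<forall>t M b x y. M > 0 \<longrightarrow> (\<forall>i. b $ i > 0) \<longrightarrow> (\<forall>i. M * b $ i + 1 \<le> 2 ^ t) \<longrightarrow>
     cmod (theta_sum (box 0 b) M X x y) \<le> c * (2 ^ t) powr (real CARD('n) / 2) * \<Psi> t"
proof -
  let ?n = "CARD('n)"
  let ?G = "\<lambda>t::nat. PiE (UNIV :: 'n set) (\<lambda>_. {..t} \<times> (UNIV :: bool set))"
  obtain t0 where t0: "\<And>t a. t \<ge> t0 \<Longrightarrow> a \<in> PiE UNIV (\<lambda>_. {..t}) \<Longrightarrow> real (cnt a X) < (\<Psi> t / defect q t a)\<^sup>2"
    using good unfolding good_def by blast
  define D where "D t = (\<Sum>g\<in>?G t. sqrt ((\<Prod>i\<in>(UNIV :: 'n set). 198 * (2::real) ^ fst (g i)) * real (cnt (\<lambda>i. fst (g i)) X)))" for t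
  have D0: "D t \<ge> 0" for t by (simp add: D_def sum_nonneg prod_nonneg)
  have finG: "finite (?G t)" for t by (intro finite_PiE) auto
  define A where "A = sqrt (198 ^ ?n) * (2 / (1 - q)) ^ ?n"
  have A0: "A \<ge> 0" using q by (simp add: A_def)
  have big: "D t \<le> A * (2 ^ t) powr (real ?n / 2) * \<Psi> t" if t: "t \<ge> t0" for t
  proof -
    have "D t \<le> (\<Sum>g\<in>?G t. sqrt (198 ^ ?n) * (2 ^ t) powr (real ?n / 2) * \<Psi> t * (\<Prod>i\<in>UNIV. q ^ (t - fst (g i))))"
      unfolding D_def
    proof (rule sum_mono)
      fix g assume g: "g \<in> ?G t"
      define a where "a i = fst (g i)" for i
      have a: "a i \<le> t" for i using g by (auto simp: PiE_iff a_def mem_Times_iff)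
      define Q where "Q = defect q t a"
      have Q: "Q > 0" using q by (simp add: Q_def defect_def prod_pos)
      have "a \<in> PiE UNIV (\<lambda>_. {..t})" using a by (auto simp: PiE_iff)
      from t0[OF t this] have N: "real (cnt a X) \<le> (\<Psi> t / Q)\<^sup>2" by (simp add: Q_def)
      have pr: "(\<Prod>i\<in>UNIV. 198 * 2 ^ a i) = 198 ^ ?n * (2 ^ t) ^ ?n * Q ^ 4"
      proof -
        have "(2::real) ^ a i = 2 ^ t * (q ^ (t - a i)) ^ 4" for i
        proof -
          have "(q ^ (t - a i)) ^ 4 = (1/2) ^ (t - a i)" using q(3) by (metis power_mult mult.commute)
          moreover have "(2::real) ^ t = 2 ^ a i * 2 ^ (t - a i)" using a[of i] by (simp add: power_add[symmetric])
          ultimately show ?thesis by (simp add: power_one_over)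
        qed
        then have "(\<Prod>i\<in>UNIV. 198 * 2 ^ a i) = (\<Prod>i\<in>(UNIV :: 'n set). (198 * 2 ^ t) * (q ^ (t - a i)) ^ 4)" by (simp add: mult.assoc)
        also have "\<dots> = (198 * 2 ^ t) ^ ?n * Q ^ 4" by (simp add: prod.distrib Q_def defect_def prod_power_distrib)
        finally show ?thesis by (simp add: power_mult_distrib)
      qed
      have "sqrt ((\<Prod>i\<in>(UNIV :: 'n set). 198 * (2::real) ^ a i) * real (cnt a X)) \<le> sqrt (198 ^ ?n * (2 ^ t) ^ ?n * Q ^ 4 * (\<Psi> t / Q)\<^sup>2)"
      proof (rule real_sqrt_le_mono)
        have "(\<Prod>i\<in>(UNIV :: 'n set). 198 * (2::real) ^ a i) * cnt a X \<le> (\<Prod>i\<in>(UNIV :: 'n set). 198 * 2 ^ a i) * (\<Psi> t / Q)\<^sup>2"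
          by (rule mult_left_mono[OF N]) (simp add: prod_nonneg)
        then show "(\<Prod>i\<in>(UNIV :: 'n set). 198 * (2::real) ^ a i) * cnt a X \<le> 198 ^ ?n * (2 ^ t) ^ ?n * Q ^ 4 * (\<Psi> t / Q)\<^sup>2"
          by (simp only: pr)
      qed
      also have "Q ^ 4 * (\<Psi> t / Q)\<^sup>2 = (\<Psi> t * Q)\<^sup>2" using Q by (simp add: field_simps power2_eq_square power4_eq_xxxx)
      then have "sqrt (198 ^ ?n * (2 ^ t) ^ ?n * Q ^ 4 * (\<Psi> t / Q)\<^sup>2) = sqrt (198 ^ ?n) * sqrt ((2 ^ t) ^ ?n) * (\<Psi> t * Q)"
        using Q \<Psi>[of t] by (simp add: real_sqrt_mult mult.assoc)
      also have "sqrt ((2 ^ t) ^ ?n) = ((2::real) ^ t) powr (real ?n / 2)"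
        by (simp add: powr_half_sqrt[symmetric] powr_realpow[symmetric] powr_powr del: powr_realpow)
      finally show "sqrt ((\<Prod>i\<in>(UNIV :: 'n set). 198 * (2::real) ^ fst (g i)) * real (cnt (\<lambda>i. fst (g i)) X))
        \<le> sqrt (198 ^ ?n) * (2 ^ t) powr (real ?n / 2) * \<Psi> t * (\<Prod>i\<in>UNIV. q ^ (t - fst (g i)))"
        by (simp add: a_def[abs_def] Q_def defect_def mult_ac)
    qed
    also have "\<dots> = sqrt (198 ^ ?n) * (2 ^ t) powr (real ?n / 2) * \<Psi> t * (\<Prod>i\<in>(UNIV :: 'n set). \<Sum>jc\<in>{..t} \<times> (UNIV :: bool set). q ^ (t - fst jc))"
      unfolding sum_distrib_left[symmetric] by (subst prod_sum_PiE) auto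
    also have "\<dots> \<le> sqrt (198 ^ ?n) * (2 ^ t) powr (real ?n / 2) * \<Psi> t * (\<Prod>i\<in>(UNIV :: 'n set). 2 / (1 - q))"
    proof (intro mult_left_mono prod_mono conjI)
      show "0 \<le> (\<Sum>jc\<in>{..t} \<times> (UNIV :: bool set). q ^ (t - fst jc))" using q by (intro sum_nonneg) auto
      have "(\<Sum>jc\<in>{..t} \<times> (UNIV :: bool set). q ^ (t - fst jc)) = (\<Sum>j\<le>t. \<Sum>c\<in>(UNIV :: bool set). q ^ (t - j))"
        by (simp only: sum.cartesian_product split_def)
      also have "\<dots> = 2 * (\<Sum>j\<le>t. q ^ (t - j))" by (simp add: sum_distrib_left)
      also have "\<dots> \<le> 2 * (1 / (1 - q))" using q by (intro mult_left_mono sum_power_rev_le) auto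
      finally show "(\<Sum>jc\<in>{..t} \<times> (UNIV :: bool set). q ^ (t - fst jc)) \<le> 2 / (1 - q)" by simp
    qed (use \<Psi>[of t] in simp)
    finally show ?thesis by (simp add: A_def mult_ac)
  qed
  \<comment> \<open>The finitely many scales below t0 have bounds \<open>D t\<close> that involve
    only X and t, so they are simply added to the constant.\<close>
  define c where "c = A + (\<Sum>t<t0. D t)"
  have c0: "c \<ge> 0" using A0 D0 by (simp add: c_def sum_nonneg)
  have Dc: "D t \<le> c * (2 ^ t) powr (real ?n / 2) * \<Psi> t" for t
  proof (cases "t \<ge> t0")
    case True
    have "A * ((2 ^ t) powr (real ?n / 2) * \<Psi> t) \<le> c * ((2 ^ t) powr (real ?n / 2) * \<Psi> t)"
      using D0 \<Psi>[of t] by (intro mult_right_mono) (auto simp: c_def sum_nonneg)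
    then show ?thesis using big[OF True] unfolding mult.assoc by (rule order_trans[rotated])
  next
    case False
    have "D t \<le> (\<Sum>t<t0. D t)" using False D0 by (intro member_le_sum) auto
    then have "D t \<le> c" using A0 by (simp add: c_def)
    also have "c \<le> c * ((2 ^ t) powr (real ?n / 2) * \<Psi> t)"
    proof -
      have "(1::real) \<le> (2 ^ t) powr (real ?n / 2)" by (rule ge_one_powr_ge_zero) auto
      then have "1 * 1 \<le> (2 ^ t) powr (real ?n / 2) * \<Psi> t" using \<Psi>[of t] by (intro mult_mono) auto
      then show ?thesis using mult_left_mono[OF _ c0] by fastforce
    qed
    finally show ?thesis by (simp add: mult.assoc)
  qed
  have "cmod (theta_sum (box 0 b) M X x y) \<le> c * (2 ^ t) powr (real ?n / 2) * \<Psi> t"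
    if "M > 0" "\<forall>i. b $ i > 0" "\<forall>i. M * b $ i + 1 \<le> 2 ^ t" for t M b x y
    proof -
    have "cmod (theta_sum (box 0 b) M X x y) \<le> D t"
      using theta_sum_bound[OF X \<open>M > 0\<close>, of b t x y] that by (simp add: D_def cnt_def)
    then show ?thesis using Dc[of t] by linarith
  qed
  then show ?thesis using c0 by blast
qed

theorem theorem1p2:
  fixes K :: "(real ^ 'n) set" and \<psi> :: "real \<Rightarrow> real"
  assumes "compact K"
    and "K \<subseteq> {b. \<forall>i. 0 < b $ i}"
    and "\<And>t. 0 \<le> t \<Longrightarrow> 1 \<le> \<psi> t"
    and "mono_on {0..} \<psi>"
    and "summable (\<lambda>k::nat. 1 / \<psi> (real k) ^ (2 * CARD('n) + 2))"
  shows "\<exists>\<X> :: (real ^ 'n ^ 'n) set. full_measure_sym \<X> \<and>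
           (\<forall>X\<in>\<X>. \<exists>c. \<forall>M\<ge>1. \<forall>b\<in>K. \<forall>x y.
              cmod (theta_sum (box 0 b) M X x y) \<le> c * M powr (real CARD('n) / 2) * \<psi> (ln M))"
proof -
  let ?n = "CARD('n)"
  obtain \<beta> where \<beta>: "\<And>b. b \<in> K \<Longrightarrow> norm b \<le> \<beta>" "\<beta> > 0"
    using compact_imp_bounded[OF assms(1)] unfolding bounded_pos by blast
  \<comment> \<open>The scale t is tied to the sides of the box, so 2^t can exceed M by a factor up
    to 2 (\<beta> + 1). Delaying \<psi> by k0 scales compensates for this. Truncated subtraction
    gives the first scales the value \<psi> 0, and summability is unaffected.\<close>
  obtain k0 where k0: "2 * (\<beta> + 1) < 2 ^ k0" using real_arch_pow[of 2 "2 * (\<beta> + 1)"] by auto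
  define \<Psi> where "\<Psi> t = \<psi> (real (t - k0) * ln 2)" for t
  have \<Psi>1: "1 \<le> \<Psi> t" for t unfolding \<Psi>_def by (rule assms(3)) simp
  have mono: "0 \<le> x \<Longrightarrow> x \<le> y \<Longrightarrow> \<psi> x \<le> \<psi> y" for x y using assms(4) by (auto simp: mono_on_def)
  have sm: "summable (\<lambda>t. 1 / \<Psi> t ^ (2 * ?n + 2))"
  proof -
    have "summable (\<lambda>t::nat. 1 / \<psi> (real t * ln 2) ^ (2 * ?n + 2))"
    proof (rule summable_sampled)
      show "0 \<le> 1 / \<psi> x ^ (2 * ?n + 2)" if "x \<ge> 0" for x using assms(3)[OF that] by simp
      show "1 / \<psi> y ^ (2 * ?n + 2) \<le> 1 / \<psi> x ^ (2 * ?n + 2)" if "0 \<le> x" "x \<le> y" for x y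
        using assms(3)[OF that(1)] mono[OF that] by (intro divide_left_mono power_mono mult_pos_pos zero_less_power) auto
    qed (rule assms(5))
    then have "summable (\<lambda>t. 1 / \<Psi> (t + k0) ^ (2 * ?n + 2))" by (simp add: \<Psi>_def)
    then show ?thesis by (subst (asm) summable_iff_shift)
  qed
  \<comment> \<open>Chosen so that q = z^(n + 1) satisfies q^4 = 1/2.\<close>
  define z where "z = root (4 * (?n + 1)) (1/2)"
  have z: "0 < z" "z < 1" using real_root_lt_1_iff[of "4 * (?n + 1)" "1/2"] by (simp_all add: z_def)
  define q where "q = z ^ (?n + 1)"
  have "q ^ 4 = z ^ (4 * (?n + 1))" by (simp only: q_def power_mult[symmetric] mult.commute)
  also have "\<dots> = 1/2" unfolding z_def by (rule real_root_pow_pos2) auto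
  finally have q4: "q ^ 4 = 1/2" .
  have q: "0 < q" "q < 1" unfolding q_def using z by (auto intro: power_Suc_less_one simp del: power_Suc)
  define \<X> :: "(real ^ 'n ^ 'n) set" where "\<X> = {X \<in> sym_matrices. good q \<Psi> X}"
  have ae: "AE F in lborel. good q \<Psi> (symF F :: real ^ 'n ^ 'n)" unfolding q_def by (rule good_AE[OF z \<Psi>1 sm])
  have "full_measure_sym \<X>"
    unfolding \<X>_def using full_measure_symI[where P = "good q \<Psi> :: real ^ 'n ^ 'n \<Rightarrow> bool", OF measurable_good ae] by simp
  moreover have "\<exists>c. \<forall>M\<ge>1. \<forall>b\<in>K. \<forall>x y. cmod (theta_sum (box 0 b) M X x y) \<le> c * M powr (real ?n / 2) * \<psi> (ln M)"
    if XX: "X \<in> \<X>" for X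
  proof -
    have X: "transpose X = X" "good q \<Psi> X" using XX by (auto simp: \<X>_def sym_matrices_def)
    obtain c where c: "c \<ge> 0" and bound: "\<And>t M b x y. M > 0 \<Longrightarrow> (\<forall>i. b $ i > 0) \<Longrightarrow> (\<forall>i. M * b $ i + 1 \<le> 2 ^ t) \<Longrightarrow>
      cmod (theta_sum (box 0 b) M X x y) \<le> c * (2 ^ t) powr (real ?n / 2) * \<Psi> t"
      using good_theta_bound[OF X q q4 \<Psi>1] by blast
    define E where "E = (2 * (\<beta> + 1)) powr (real ?n / 2)"
    have "cmod (theta_sum (box 0 b) M X x y) \<le> (c * E) * M powr (real ?n / 2) * \<psi> (ln M)"
      if M: "M \<ge> 1" and b: "b \<in> K" for M b x y
    proof -
      have b0: "\<forall>i. b $ i > 0" using assms(2) b by blast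
      have "1 * 1 \<le> M * (\<beta> + 1)" using M \<beta>(2) by (intro mult_mono) auto
      then have "1 \<le> M * (\<beta> + 1)" by simp
      then obtain k where k: "2 ^ k \<le> M * (\<beta> + 1)" "M * (\<beta> + 1) < 2 ^ (k + 1)" using dyadic_power by blast
      define t where "t = k + 1"
      have t2: "(2::real) ^ t \<le> 2 * (\<beta> + 1) * M" using k(1) by (simp add: t_def algebra_simps)
      have "M * b $ i + 1 \<le> 2 ^ t" for i
      proof -
        have "b $ i \<le> \<beta>" using component_le_norm_cart[of b i] \<beta>(1)[OF b] by linarith
        then have "M * b $ i \<le> M * \<beta>" using M by (intro mult_left_mono) auto
        then have "M * b $ i + 1 \<le> M * \<beta> + M" using M by linarith
        then have "M * b $ i + 1 \<le> M * (\<beta> + 1)" by (simp only: distrib_left mult_1_right)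
        then show ?thesis using k(2) by (simp add: t_def)
      qed
      then have 1: "cmod (theta_sum (box 0 b) M X x y) \<le> c * (2 ^ t) powr (real ?n / 2) * \<Psi> t"
        using bound[of M b t x y] M b0 by auto
      have 2: "(2 ^ t) powr (real ?n / 2) \<le> E * M powr (real ?n / 2)"
      proof -
        have "(2 ^ t) powr (real ?n / 2) \<le> (2 * (\<beta> + 1) * M) powr (real ?n / 2)" using t2 by (intro powr_mono2) auto
        also have "\<dots> = E * M powr (real ?n / 2)" unfolding E_def using M \<beta>(2) by (simp add: powr_mult)
        finally show ?thesis .
      qed
      have 3: "\<Psi> t \<le> \<psi> (ln M)"
        unfolding \<Psi>_def
      proof (rule mono)
        have "(2::real) ^ (t - k0) \<le> M"
        proof (cases "t \<ge> k0")
          case True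
          have "(2::real) ^ t \<le> 2 ^ k0 * M" using t2 mult_right_mono[of "2 * (\<beta> + 1)" "2 ^ k0" M] k0 M by linarith
          moreover have "(2::real) ^ t = 2 ^ k0 * 2 ^ (t - k0)" using True by (simp add: power_add[symmetric])
          ultimately show ?thesis by simp
        qed (use M in simp)
        then have "ln ((2::real) ^ (t - k0)) \<le> ln M" using M by (subst ln_le_cancel_iff) auto
        then show "real (t - k0) * ln 2 \<le> ln M" by (simp add: ln_realpow)
      qed simp
      have "c * (2 ^ t) powr (real ?n / 2) * \<Psi> t \<le> c * (E * M powr (real ?n / 2)) * \<psi> (ln M)"
        using c \<Psi>1[of t] by (intro mult_mono mult_left_mono 2 3) (auto simp: E_def)
      then show ?thesis using 1 by (simp add: mult.assoc)
    qed
    then show ?thesis by blast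
  qed
  ultimately show ?thesis by blast
qed

end
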